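(* Let $\mathcal M$ be a von Neumann algebra acting on the Hilbert space $H$ and let $\{P_t\}_{t\ge0}$ be a semigroup of normal, unital, completely positive maps on $\mathcal M$ such that $P_0$ is the identity mapping on $\mathcal M$. Let $\{E(t)\}_{t\ge0}$ be the product system of $\mathcal M'$-correspondences associated with $\{P_t\}_{t\ge0}$, let $\{T_t\}_{t\ge0}$ be the identity representation of $\{E(t)\}_{t\ge0}$ on $H$ and let $(\{V_t\}_{t\ge0},u_0,K)$ be the minimal isometric dilation of $\{T_t\}_{t\ge0}$. Write $\rho$ for $V_0$, a normal $*$-homomorphism of $\mathcal M'$ into $B(K)$, and set $\mathcal R=\rho(\mathcal M')'$. Then $u_0^*\mathcal R u_0=\mathcal M$, and if $\{\alpha_t\}_{t\ge0}$ is defined by $$\alpha_t(S)=\widetilde V_t(I_{E(t)}\otimes S)\widetilde V_t^*,\qquad S\in\mathcal R,\ t\ge0,$$ then $\{\alpha_t\}_{t\ge0}$ is a semigroup of unital, normal $*$-endomorphisms of $\mathcal R$ such that for all $t\ge0$, $S\in\mathcal R$ and $T\in\mathcal M$, $$P_t(u_0^*Su_0)=u_0^*\alpha_t(S)u_0\quad\text{and}\quad P_t(T)=u_0^*\alpha_t(u_0Tu_0^* )u_0 .$$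
   Context: **Correspondences.** Inner products are linear in the second variable. A $W^*$-correspondence over a von Neumann algebra $\mathcal N$ is a self-dual right Hilbert $C^*$-module $\mathcal X$ over $\mathcal N$ (every bounded module map $\mathcal X\to\mathcal N$ is $\langle\xi_0,\cdot\rangle$ for some $\xi_0\in\mathcal X$) with a left action given by a normal $*$-homomorphism $\varphi:\mathcal N\to\mathcal L(\mathcal X)$ into the adjointable maps; write $a\xi=\varphi(a)\xi$. Isomorphisms are bijective, inner-product preserving bimodule maps. The $\sigma$-topology on $\mathcal X$ is defined by the functionals $\sum_n w_n(\langle\eta_n,\cdot\rangle)$, $\eta_n\in\mathcal X$, $w_n\in\mathcal N_*$, $\sum\|w_n\|\|\eta_n\|<\infty$. The tensor product $\mathcal X\otimes_{\mathcal N}\mathcal Y$ is the balanced tensor product with $\langle\xi_1\otimes\eta_1,\xi_2\otimes\eta_2\rangle=\langle\eta_1,\langle\xi_1,\xi_2\rangle\eta_2\rangle$, Hausdorff completed and then self-dually completed. **Covariant representations.** A completely contractive covariant representation of $\mathcal E$ (over $\mathcal N$) on a Hilbert space $G$ is a pair $(T,\sigma)$: $\sigma$ a normal $*$-representation of $\mathcal N$ on $G$, $T:\mathcal E\to B(G)$ linear, completely contractive, continuous from the $\sigma$-topology to the $\sigma$-weak topology, with $T(a\xi b)=\sigma(a)T(\xi)\sigma(b)$. It is isometric if $T(\xi)^*T(\eta)=\sigma(\langle\xi,\eta\rangle)$. $\mathcal E\otimes_\sigma G$ is the Hausdorff completion of $\mathcal E\otimes G$ for $\langle\xi\otimes h,\eta\otimes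 k\rangle=\langle h,\sigma(\langle\xi,\eta\rangle)k\rangle$, $\widetilde T:\mathcal E\otimes_\sigma G\to G$ is the contraction $\widetilde T(\xi\otimes h)=T(\xi)h$, and $(T,\sigma)$ is fully coisometric if $\widetilde T\widetilde T^*=I$. A discrete product system over $\mathcal N$ is a family $\{E(t)\}_{t\ge0}$ of $W^*$-correspondences over $\mathcal N$ with $E(0)=\mathcal N$ and isomorphisms $E(t)\otimes_{\mathcal N} E(s)\simeq E(t+s)$, associative, and given by the module actions if $t=0$ or $s=0$. A covariant representation of it on $G$ is a family $T_t:E(t)\to B(G)$ of completely contractive linear maps, continuous from the $\sigma$-topology to the $\sigma$-weak topology, with $T_0$ a normal $*$-representation and $T_{t+s}(\xi\otimes\eta)=T_t(\xi)T_s(\eta)$ under the identifications; it is isometric (fully coisometric) if every $(T_t,T_0)$ is. **The product system of $\{P_t\}$.** For a partition $\mathfrak p=\{0=t_0<t_1<\dots<t_n=t\}$ of $[0,t]$, let $H_{\mathfrak p,t}=\mathcal M\otimes_{P_{t_1}}\mathcal M\otimes_{P_{t_2-t_1}}\cdots\mathcal M\otimes_{P_{t-t_{n-1}}}H$ be the Hausdorff completion of the algebraic tensor product of $n$ copies of $\mathcal M$ with $H$ for $$\langle T_1\otimes\cdots\otimes T_n\otimes h,\,S_1\otimes\cdots\otimes S_n\otimes k\rangle=\langle h,P_{t-t_{n-1}}(T_n^*\cdots P_{t_2-t_1}(T_2^*P_{t_1}(T_1^*S_1)S_2)\cdots S_n)k\rangle .$$ $\mathcal M$ acts by left multiplication on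 the first factor, and $R\in\mathcal M'$ acts by $I\otimes R$, i.e. on the factor $H$. If $\mathfrak p'$ refines $\mathfrak p$, inserting identity operators in the positions corresponding to the new points gives an isometry $H_{\mathfrak p,t}\to H_{\mathfrak p',t}$. Let $H_t=\varinjlim H_{\mathfrak p,t}$ with canonical isometries $v_{\mathfrak p}:H_{\mathfrak p,t}\to H_t$; it inherits the actions of $\mathcal M$ and $\mathcal M'$. Put $E(0)=\mathcal M'$ and, for $t>0$, let $E(t)=\mathcal L_{\mathcal M}(H,H_t)$ be the space of bounded $X:H\to H_t$ intertwining the $\mathcal M$-actions, a $W^*$-correspondence over $\mathcal M'$ with $\langle X,Y\rangle=X^*Y$, $(XR)h=X(Rh)$, $(RX)h=(I\otimes R)Xh$. The isomorphism $E(t)\otimes E(s)\simeq E(t+s)$ is determined by $v_{\mathfrak p_1}X\otimes v_{\mathfrak p_2}Y\mapsto v_{\mathfrak p}(I_s\otimes X)Y$ for $X\in\mathcal L_{\mathcal M}(H,H_{\mathfrak p_1,t})$, $Y\in\mathcal L_{\mathcal M}(H,H_{\mathfrak p_2,s})$, where $\mathfrak p=\mathfrak p_2\cup(\mathfrak p_1+s)$ and $(I_s\otimes X)(S_1\otimes\cdots\otimes S_m\otimes h)=S_1\otimes\cdots\otimes S_m\otimes Xh$. The identity representation of $\{E(t)\}$ on $H$ is $T_0(a)=a$ and $T_t(X)=\iota_t^*X$, where $\iota_t:H\to H_t$ is the isometry $\iota_t h=v_{\mathfrak p}(I\otimes\cdots\otimes I\otimes h)$ (independent of $\mathfrak p$);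 it is a fully coisometric covariant representation. **Minimal isometric dilation.** $(\{V_t\}_{t\ge0},u_0,K)$ is the triple, existing and unique up to unitary equivalence, such that $u_0:H\to K$ is an isometry into a Hilbert space, $\{V_t\}$ is a fully coisometric, isometric covariant representation of $\{E(t)\}$ on $K$, $u_0^*V_t(\xi)u_0=T_t(\xi)$, $V_t(\xi)^*$ leaves $u_0(H)$ invariant for all $\xi\in E(t)$, $t\ge 0$, and the smallest subspace containing $u_0(H)$ and reducing all $V_t(\xi)$ is $K$. No continuity in $t$ is assumed. *)

theory Defs
  imports "HOL-Analysis.Analysis"
begin

section \<open>Hilbert spaces with explicit carriers\<close>

text \<open>The Hilbert spaces attached to a product system depend on the time parameter, so they are
  treated as records with a carrier set. The record type is also used for spaces whose inner
  product is only positive semidefinite. Inner products are linear in the second variable.\<close>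

record 'a hspace =
  hcar :: "'a set"
  hadd :: "'a \<Rightarrow> 'a \<Rightarrow> 'a"
  hscale :: "complex \<Rightarrow> 'a \<Rightarrow> 'a"
  hzero :: 'a
  hinner :: "'a \<Rightarrow> 'a \<Rightarrow> complex"

definition hnorm :: "'a hspace \<Rightarrow> 'a \<Rightarrow> real" where
  "hnorm G x = sqrt (Re (hinner G x x))"

definition hdist :: "'a hspace \<Rightarrow> 'a \<Rightarrow> 'a \<Rightarrow> real" where
  "hdist G x y = hnorm G (hadd G x (hscale G (-1) y))"

definition hcauchy :: "'a hspace \<Rightarrow> (nat \<Rightarrow> 'a) \<Rightarrow> bool" where
  "hcauchy G u \<longleftrightarrow> (\<forall>n. u n \<in> hcar G) \<and>
     (\<forall>e>0. \<exists>N. \<forall>m\<ge>N. \<forall>n\<ge>N. hdist G (u m) (u n) < e)"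

definition semi_inner_space :: "'a hspace \<Rightarrow> bool" where
  "semi_inner_space G \<longleftrightarrow>
     hzero G \<in> hcar G \<and>
     (\<forall>x\<in>hcar G. \<forall>y\<in>hcar G. hadd G x y \<in> hcar G) \<and>
     (\<forall>c. \<forall>x\<in>hcar G. hscale G c x \<in> hcar G) \<and>
     (\<forall>x\<in>hcar G. \<forall>y\<in>hcar G. \<forall>z\<in>hcar G. hadd G (hadd G x y) z = hadd G x (hadd G y z)) \<and>
     (\<forall>x\<in>hcar G. \<forall>y\<in>hcar G. hadd G x y = hadd G y x) \<and>
     (\<forall>x\<in>hcar G. hadd G (hzero G) x = x) \<and>
     (\<forall>x\<in>hcar G. hadd G x (hscale G (-1) x) = hzero G) \<and>
     (\<forall>c. \<forall>x\<in>hcar G. \<forall>y\<in>hcar G. hscale G c (hadd G x y) = hadd G (hscale G c x) (hscale G c y)) \<and>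
     (\<forall>c d. \<forall>x\<in>hcar G. hscale G (c + d) x = hadd G (hscale G c x) (hscale G d x)) \<and>
     (\<forall>c d. \<forall>x\<in>hcar G. hscale G (c * d) x = hscale G c (hscale G d x)) \<and>
     (\<forall>x\<in>hcar G. hscale G 1 x = x) \<and>
     (\<forall>x\<in>hcar G. \<forall>y\<in>hcar G. \<forall>z\<in>hcar G.
        hinner G x (hadd G y z) = hinner G x y + hinner G x z) \<and>
     (\<forall>c. \<forall>x\<in>hcar G. \<forall>y\<in>hcar G. hinner G x (hscale G c y) = c * hinner G x y) \<and>
     (\<forall>x\<in>hcar G. \<forall>y\<in>hcar G. hinner G y x = cnj (hinner G x y)) \<and>
     (\<forall>x\<in>hcar G. 0 \<le> Re (hinner G x x))"

definition hilbert_space :: "'a hspace \<Rightarrow> bool" where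
  "hilbert_space G \<longleftrightarrow>
     semi_inner_space G \<and>
     (\<forall>x\<in>hcar G. hinner G x x = 0 \<longrightarrow> x = hzero G) \<and>
     (\<forall>u. hcauchy G u \<longrightarrow> (\<exists>x\<in>hcar G. (\<lambda>n. hdist G (u n) x) \<longlonglongrightarrow> 0))"

primrec hsum :: "'a hspace \<Rightarrow> (nat \<Rightarrow> 'a) \<Rightarrow> nat \<Rightarrow> 'a" where
  "hsum G f 0 = hzero G"
| "hsum G f (Suc n) = hadd G (hsum G f n) (f n)"

definition closed_subspace :: "'a hspace \<Rightarrow> 'a set \<Rightarrow> bool" where
  "closed_subspace G L \<longleftrightarrow>
     L \<subseteq> hcar G \<and> hzero G \<in> L \<and>
     (\<forall>x\<in>L. \<forall>y\<in>L. hadd G x y \<in> L) \<and> (\<forall>c. \<forall>x\<in>L. hscale G c x \<in> L) \<and>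
     (\<forall>u. \<forall>x\<in>hcar G. (\<forall>n. u n \<in> L) \<and> (\<lambda>n. hdist G (u n) x) \<longlonglongrightarrow> 0 \<longrightarrow> x \<in> L)"

subsection \<open>Hausdorff completions\<close>

text \<open>Elements of the completion are classes of Cauchy sequences modulo sequences whose
  seminorm tends to zero; the quotient by null vectors is part of this.\<close>

definition hcauchy_rel :: "'a hspace \<Rightarrow> ((nat \<Rightarrow> 'a) \<times> (nat \<Rightarrow> 'a)) set" where
  "hcauchy_rel G = {(u, v). hcauchy G u \<and> hcauchy G v \<and> (\<lambda>n. hdist G (u n) (v n)) \<longlonglongrightarrow> 0}"

definition hcompletion :: "'a hspace \<Rightarrow> (nat \<Rightarrow> 'a) set hspace" where
  "hcompletion G =
    \<lparr>hcar = Collect (hcauchy G) // hcauchy_rel G,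
     hadd = (\<lambda>C D. hcauchy_rel G `` {\<lambda>n. hadd G ((SOME u. u \<in> C) n) ((SOME v. v \<in> D) n)}),
     hscale = (\<lambda>c C. hcauchy_rel G `` {\<lambda>n. hscale G c ((SOME u. u \<in> C) n)}),
     hzero = hcauchy_rel G `` {\<lambda>n. hzero G},
     hinner = (\<lambda>C D. lim (\<lambda>n. hinner G ((SOME u. u \<in> C) n) ((SOME v. v \<in> D) n)))\<rparr>"

text \<open>The free complex vector space on a set \<open>X\<close> (finitely supported coefficient functions) with
  the sesquilinear form extending a kernel \<open>k\<close> on \<open>X\<close>. All Hausdorff completions of algebraic
  tensor products below are obtained from the free space on the elementary tensors: the
  multilinearity relations are null vectors for the form, hence the Hausdorff completion of
  the free space is that of the algebraic tensor product.\<close>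

definition free_space :: "'x set \<Rightarrow> ('x \<Rightarrow> 'x \<Rightarrow> complex) \<Rightarrow> ('x \<Rightarrow> complex) hspace" where
  "free_space X k =
    \<lparr>hcar = {c. finite {x. c x \<noteq> 0} \<and> {x. c x \<noteq> 0} \<subseteq> X},
     hadd = (\<lambda>c d x. c x + d x),
     hscale = (\<lambda>z c x. z * c x),
     hzero = (\<lambda>x. 0),
     hinner = (\<lambda>c d. \<Sum>x\<in>{x. c x \<noteq> 0}. \<Sum>y\<in>{y. d y \<noteq> 0}. cnj (c x) * d y * k x y)\<rparr>"

type_synonym 'x kpoint = "(nat \<Rightarrow> 'x \<Rightarrow> complex) set"

definition kspace :: "'x set \<Rightarrow> ('x \<Rightarrow> 'x \<Rightarrow> complex) \<Rightarrow> 'x kpoint hspace" where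
  "kspace X k = hcompletion (free_space X k)"

text \<open>The image in the completion of the free generator \<open>x\<close>.\<close>

definition kgen :: "'x set \<Rightarrow> ('x \<Rightarrow> 'x \<Rightarrow> complex) \<Rightarrow> 'x \<Rightarrow> 'x kpoint" where
  "kgen X k x = hcauchy_rel (free_space X k) `` {\<lambda>n y. if y = x then 1 else 0}"

section \<open>Bounded operators\<close>

text \<open>Operators are extensional functions, so that equality of operators is equality in HOL.\<close>

definition bop :: "'a hspace \<Rightarrow> 'b hspace \<Rightarrow> ('a \<Rightarrow> 'b) set" where
  "bop G1 G2 = {A. A \<in> extensional (hcar G1) \<and> A \<in> hcar G1 \<rightarrow> hcar G2 \<and>
     (\<forall>x\<in>hcar G1. \<forall>y\<in>hcar G1. A (hadd G1 x y) = hadd G2 (A x) (A y)) \<and>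
     (\<forall>c. \<forall>x\<in>hcar G1. A (hscale G1 c x) = hscale G2 c (A x)) \<and>
     (\<exists>C. \<forall>x\<in>hcar G1. hnorm G2 (A x) \<le> C * hnorm G1 x)}"

definition oid :: "'a hspace \<Rightarrow> 'a \<Rightarrow> 'a" where
  "oid G = (\<lambda>x\<in>hcar G. x)"

definition oadd :: "'a hspace \<Rightarrow> 'b hspace \<Rightarrow> ('a \<Rightarrow> 'b) \<Rightarrow> ('a \<Rightarrow> 'b) \<Rightarrow> 'a \<Rightarrow> 'b" where
  "oadd G1 G2 A B = (\<lambda>x\<in>hcar G1. hadd G2 (A x) (B x))"

definition oscale :: "'a hspace \<Rightarrow> 'b hspace \<Rightarrow> complex \<Rightarrow> ('a \<Rightarrow> 'b) \<Rightarrow> 'a \<Rightarrow> 'b" where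
  "oscale G1 G2 c A = (\<lambda>x\<in>hcar G1. hscale G2 c (A x))"

text \<open>Composition; the first argument is the domain of the right-hand factor.\<close>

definition ocomp :: "'a hspace \<Rightarrow> ('b \<Rightarrow> 'c) \<Rightarrow> ('a \<Rightarrow> 'b) \<Rightarrow> 'a \<Rightarrow> 'c" where
  "ocomp G A B = compose (hcar G) A B"

definition hadj :: "'a hspace \<Rightarrow> 'b hspace \<Rightarrow> ('a \<Rightarrow> 'b) \<Rightarrow> 'b \<Rightarrow> 'a" where
  "hadj G1 G2 A = (THE B. B \<in> bop G2 G1 \<and>
     (\<forall>x\<in>hcar G1. \<forall>y\<in>hcar G2. hinner G1 (B y) x = hinner G2 y (A x)))"

definition opnorm :: "'a hspace \<Rightarrow> 'b hspace \<Rightarrow> ('a \<Rightarrow> 'b) \<Rightarrow> real" where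
  "opnorm G1 G2 A = Sup {hnorm G2 (A x) | x. x \<in> hcar G1 \<and> hnorm G1 x \<le> 1}"

text \<open>The norm of an \<open>n \<times> n\<close> operator matrix acting on the direct sum of \<open>n\<close> copies of \<open>G\<close>.\<close>

definition matnorm :: "'a hspace \<Rightarrow> nat \<Rightarrow> (nat \<Rightarrow> nat \<Rightarrow> 'a \<Rightarrow> 'a) \<Rightarrow> real" where
  "matnorm G n A = Sup {sqrt (\<Sum>i<n. (hnorm G (hsum G (\<lambda>j. A i j (x j)) n))\<^sup>2) | x.
     (\<forall>j<n. x j \<in> hcar G) \<and> (\<Sum>j<n. (hnorm G (x j))\<^sup>2) \<le> 1}"

definition matpos :: "'a hspace \<Rightarrow> nat \<Rightarrow> (nat \<Rightarrow> nat \<Rightarrow> 'a \<Rightarrow> 'a) \<Rightarrow> bool" where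
  "matpos G n A \<longleftrightarrow> (\<forall>x. (\<forall>j<n. x j \<in> hcar G) \<longrightarrow>
     (\<Sum>i<n. \<Sum>j<n. hinner G (x i) (A i j (x j))) \<in> \<real> \<and>
     0 \<le> Re (\<Sum>i<n. \<Sum>j<n. hinner G (x i) (A i j (x j))))"

text \<open>The bounded operator from \<open>kspace X k\<close> to \<open>G\<close> with prescribed values on the generators
  (the generators have dense span, so there is at most one).\<close>

definition kext :: "'x set \<Rightarrow> ('x \<Rightarrow> 'x \<Rightarrow> complex) \<Rightarrow> 'b hspace \<Rightarrow> ('x \<Rightarrow> 'b) \<Rightarrow> 'x kpoint \<Rightarrow> 'b" where
  "kext X k G f = (THE A. A \<in> bop (kspace X k) G \<and> (\<forall>x\<in>X. A (kgen X k x) = f x))"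

section \<open>Von Neumann algebras and normal maps\<close>

definition commutant :: "'a hspace \<Rightarrow> ('a \<Rightarrow> 'a) set \<Rightarrow> ('a \<Rightarrow> 'a) set" where
  "commutant G S = {A \<in> bop G G. \<forall>B\<in>S. ocomp G A B = ocomp G B A}"

definition von_neumann_algebra :: "'a hspace \<Rightarrow> ('a \<Rightarrow> 'a) set \<Rightarrow> bool" where
  "von_neumann_algebra G N \<longleftrightarrow>
     N \<subseteq> bop G G \<and> (\<forall>A\<in>N. hadj G G A \<in> N) \<and> commutant G (commutant G N) = N"

text \<open>The coarsest topology on \<open>S\<close> for which all functionals in \<open>\<Phi>\<close> are continuous.\<close>

definition initial_topology :: "'a set \<Rightarrow> ('a \<Rightarrow> complex) set \<Rightarrow> 'a topology" where
  "initial_topology S \<Phi> = topology_generated_by {{x \<in> S. \<phi> x \<in> U} | \<phi> U. \<phi> \<in> \<Phi> \<and> open U}"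

text \<open>The functionals representing the elements of the predual of \<open>N\<close>; only the values on \<open>N\<close>
  matter.\<close>

definition predual :: "'a hspace \<Rightarrow> ('a \<Rightarrow> 'a) set \<Rightarrow> (('a \<Rightarrow> 'a) \<Rightarrow> complex) set" where
  "predual G N = {w. \<exists>x y. (\<forall>n. x n \<in> hcar G) \<and> (\<forall>n. y n \<in> hcar G) \<and>
     summable (\<lambda>n. (hnorm G (x n))\<^sup>2) \<and> summable (\<lambda>n. (hnorm G (y n))\<^sup>2) \<and>
     (\<forall>A\<in>N. w A = (\<Sum>n. hinner G (x n) (A (y n))))}"

definition predual_norm :: "'a hspace \<Rightarrow> ('a \<Rightarrow> 'a) set \<Rightarrow> (('a \<Rightarrow> 'a) \<Rightarrow> complex) \<Rightarrow> real" where
  "predual_norm G N w = Sup {cmod (w A) | A. A \<in> N \<and> opnorm G G A \<le> 1}"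

definition sigma_weak :: "'a hspace \<Rightarrow> ('a \<Rightarrow> 'a) topology" where
  "sigma_weak G = initial_topology (bop G G) (predual G (bop G G))"

definition normal_map ::
  "'a hspace \<Rightarrow> ('a \<Rightarrow> 'a) set \<Rightarrow> 'b hspace \<Rightarrow> (('a \<Rightarrow> 'a) \<Rightarrow> 'b \<Rightarrow> 'b) \<Rightarrow> bool" where
  "normal_map G N K \<Phi> \<longleftrightarrow> continuous_map (subtopology (sigma_weak G) N) (sigma_weak K) \<Phi>"

definition op_linear ::
  "'a hspace \<Rightarrow> ('a \<Rightarrow> 'a) set \<Rightarrow> 'b hspace \<Rightarrow> (('a \<Rightarrow> 'a) \<Rightarrow> 'b \<Rightarrow> 'b) \<Rightarrow> bool" where
  "op_linear G N K \<Phi> \<longleftrightarrow>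
     (\<forall>A\<in>N. \<forall>B\<in>N. \<Phi> (oadd G G A B) = oadd K K (\<Phi> A) (\<Phi> B)) \<and>
     (\<forall>c. \<forall>A\<in>N. \<Phi> (oscale G G c A) = oscale K K c (\<Phi> A))"

definition star_hom ::
  "'a hspace \<Rightarrow> ('a \<Rightarrow> 'a) set \<Rightarrow> 'b hspace \<Rightarrow> (('a \<Rightarrow> 'a) \<Rightarrow> 'b \<Rightarrow> 'b) \<Rightarrow> bool" where
  "star_hom G N K \<Phi> \<longleftrightarrow>
     (\<forall>A\<in>N. \<Phi> A \<in> bop K K) \<and> op_linear G N K \<Phi> \<and>
     (\<forall>A\<in>N. \<forall>B\<in>N. \<Phi> (ocomp G A B) = ocomp K (\<Phi> A) (\<Phi> B)) \<and>
     (\<forall>A\<in>N. \<Phi> (hadj G G A) = hadj K K (\<Phi> A))"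

definition unital_normal_endomorphism ::
  "'a hspace \<Rightarrow> ('a \<Rightarrow> 'a) set \<Rightarrow> (('a \<Rightarrow> 'a) \<Rightarrow> 'a \<Rightarrow> 'a) \<Rightarrow> bool" where
  "unital_normal_endomorphism G N \<Phi> \<longleftrightarrow>
     (\<forall>A\<in>N. \<Phi> A \<in> N) \<and> star_hom G N G \<Phi> \<and> \<Phi> (oid G) = oid G \<and> normal_map G N G \<Phi>"

definition completely_positive ::
  "'a hspace \<Rightarrow> ('a \<Rightarrow> 'a) set \<Rightarrow> (('a \<Rightarrow> 'a) \<Rightarrow> 'a \<Rightarrow> 'a) \<Rightarrow> bool" where
  "completely_positive G N \<Phi> \<longleftrightarrow>
     (\<forall>n A. (\<forall>i<n. \<forall>j<n. A i j \<in> N) \<and> matpos G n A \<longrightarrow> matpos G n (\<lambda>i j. \<Phi> (A i j)))"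

definition cp_semigroup ::
  "'a hspace \<Rightarrow> ('a \<Rightarrow> 'a) set \<Rightarrow> (real \<Rightarrow> ('a \<Rightarrow> 'a) \<Rightarrow> 'a \<Rightarrow> 'a) \<Rightarrow> bool" where
  "cp_semigroup G N P \<longleftrightarrow>
     (\<forall>t\<ge>0. (\<forall>A\<in>N. P t A \<in> N) \<and> op_linear G N G (P t) \<and> completely_positive G N (P t) \<and>
        normal_map G N G (P t) \<and> P t (oid G) = oid G) \<and>
     (\<forall>A\<in>N. P 0 A = A) \<and>
     (\<forall>s\<ge>0. \<forall>t\<ge>0. \<forall>A\<in>N. P (s + t) A = P s (P t A))"

section \<open>Correspondences, product systems and covariant representations\<close>

text \<open>The data of a correspondence over an algebra of operators on a space with elements of
  type \<open>'a\<close>.\<close>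

record ('a, 'e) corr =
  ecar :: "'e set"
  eadd :: "'e \<Rightarrow> 'e \<Rightarrow> 'e"
  escale :: "complex \<Rightarrow> 'e \<Rightarrow> 'e"
  einner :: "'e \<Rightarrow> 'e \<Rightarrow> 'a \<Rightarrow> 'a"
  elact :: "('a \<Rightarrow> 'a) \<Rightarrow> 'e \<Rightarrow> 'e"
  eract :: "'e \<Rightarrow> ('a \<Rightarrow> 'a) \<Rightarrow> 'e"

definition trivial_corr :: "'a hspace \<Rightarrow> ('a \<Rightarrow> 'a) set \<Rightarrow> ('a, 'a \<Rightarrow> 'a) corr" where
  "trivial_corr G N =
    \<lparr>ecar = N, eadd = oadd G G, escale = oscale G G,
     einner = (\<lambda>a b. ocomp G (hadj G G a) b),
     elact = (\<lambda>a b. ocomp G a b), eract = (\<lambda>a b. ocomp G a b)\<rparr>"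

text \<open>Transport of a correspondence along an injection \<open>f\<close> with left inverse \<open>g\<close>.\<close>

definition corr_transport :: "('e \<Rightarrow> 'f) \<Rightarrow> ('f \<Rightarrow> 'e) \<Rightarrow> ('a, 'e) corr \<Rightarrow> ('a, 'f) corr" where
  "corr_transport f g E =
    \<lparr>ecar = f ` ecar E, eadd = (\<lambda>x y. f (eadd E (g x) (g y))), escale = (\<lambda>c x. f (escale E c (g x))),
     einner = (\<lambda>x y. einner E (g x) (g y)),
     elact = (\<lambda>a x. f (elact E a (g x))), eract = (\<lambda>x a. f (eract E (g x) a))\<rparr>"

definition enorm :: "'a hspace \<Rightarrow> ('a, 'e) corr \<Rightarrow> 'e \<Rightarrow> real" where
  "enorm G E \<xi> = sqrt (opnorm G G (einner E \<xi> \<xi>))"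

definition sigma_functionals ::
  "'a hspace \<Rightarrow> ('a \<Rightarrow> 'a) set \<Rightarrow> ('a, 'e) corr \<Rightarrow> ('e \<Rightarrow> complex) set" where
  "sigma_functionals G N E = {\<phi>. \<exists>\<eta> w. (\<forall>n. \<eta> n \<in> ecar E) \<and> (\<forall>n. w n \<in> predual G N) \<and>
     summable (\<lambda>n. predual_norm G N (w n) * enorm G E (\<eta> n)) \<and>
     (\<forall>\<xi>\<in>ecar E. \<phi> \<xi> = (\<Sum>n. w n (einner E (\<eta> n) \<xi>)))}"

definition sigma_topology :: "'a hspace \<Rightarrow> ('a \<Rightarrow> 'a) set \<Rightarrow> ('a, 'e) corr \<Rightarrow> 'e topology" where
  "sigma_topology G N E = initial_topology (ecar E) (sigma_functionals G N E)"

text \<open>An \<open>n \<times> n\<close> matrix \<open>\<xi>\<close> over \<open>E\<close> is an element of a correspondence over the \<open>n \<times> n\<close> matrices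
  over the coefficient algebra, with inner product \<open>(\<Sum>k. \<langle>\<xi> k i, \<eta> k j\<rangle>)\<close>; this gives the
  matrix norms on \<open>E\<close>.\<close>

definition corr_matnorm :: "'a hspace \<Rightarrow> ('a, 'e) corr \<Rightarrow> nat \<Rightarrow> (nat \<Rightarrow> nat \<Rightarrow> 'e) \<Rightarrow> real" where
  "corr_matnorm G E n \<xi> =
     sqrt (matnorm G n (\<lambda>i j. \<lambda>h\<in>hcar G. hsum G (\<lambda>k. einner E (\<xi> k i) (\<xi> k j) h) n))"

definition completely_contractive ::
  "'a hspace \<Rightarrow> ('a, 'e) corr \<Rightarrow> 'g hspace \<Rightarrow> ('e \<Rightarrow> 'g \<Rightarrow> 'g) \<Rightarrow> bool" where
  "completely_contractive H E G T \<longleftrightarrow>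
     (\<forall>n \<xi>. (\<forall>i<n. \<forall>j<n. \<xi> i j \<in> ecar E) \<longrightarrow>
        matnorm G n (\<lambda>i j. T (\<xi> i j)) \<le> corr_matnorm H E n \<xi>)"

text \<open>\<open>E \<otimes>\<^sub>\<sigma> G\<close>, its elementary tensors, \<open>I \<otimes> S\<close>, and the operator \<open>\<xi> \<otimes> h \<mapsto> T \<xi> h\<close>.\<close>

definition tensor_gens :: "('a, 'e) corr \<Rightarrow> 'g hspace \<Rightarrow> ('e \<times> 'g) set" where
  "tensor_gens E G = ecar E \<times> hcar G"

definition tensor_kernel ::
  "('a, 'e) corr \<Rightarrow> (('a \<Rightarrow> 'a) \<Rightarrow> 'g \<Rightarrow> 'g) \<Rightarrow> 'g hspace \<Rightarrow> 'e \<times> 'g \<Rightarrow> 'e \<times> 'g \<Rightarrow> complex" where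
  "tensor_kernel E \<sigma> G = (\<lambda>(\<xi>, h) (\<eta>, k). hinner G h (\<sigma> (einner E \<xi> \<eta>) k))"

definition tensor_space ::
  "('a, 'e) corr \<Rightarrow> (('a \<Rightarrow> 'a) \<Rightarrow> 'g \<Rightarrow> 'g) \<Rightarrow> 'g hspace \<Rightarrow> ('e \<times> 'g) kpoint hspace" where
  "tensor_space E \<sigma> G = kspace (tensor_gens E G) (tensor_kernel E \<sigma> G)"

definition elem_tensor ::
  "('a, 'e) corr \<Rightarrow> (('a \<Rightarrow> 'a) \<Rightarrow> 'g \<Rightarrow> 'g) \<Rightarrow> 'g hspace \<Rightarrow> 'e \<Rightarrow> 'g \<Rightarrow> ('e \<times> 'g) kpoint" where
  "elem_tensor E \<sigma> G \<xi> h = kgen (tensor_gens E G) (tensor_kernel E \<sigma> G) (\<xi>, h)"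

definition id_tensor ::
  "('a, 'e) corr \<Rightarrow> (('a \<Rightarrow> 'a) \<Rightarrow> 'g \<Rightarrow> 'g) \<Rightarrow> 'g hspace \<Rightarrow> ('g \<Rightarrow> 'g)
     \<Rightarrow> ('e \<times> 'g) kpoint \<Rightarrow> ('e \<times> 'g) kpoint" where
  "id_tensor E \<sigma> G S = kext (tensor_gens E G) (tensor_kernel E \<sigma> G) (tensor_space E \<sigma> G)
     (\<lambda>(\<xi>, h). elem_tensor E \<sigma> G \<xi> (S h))"

definition tilde ::
  "('a, 'e) corr \<Rightarrow> (('a \<Rightarrow> 'a) \<Rightarrow> 'g \<Rightarrow> 'g) \<Rightarrow> 'g hspace \<Rightarrow> ('e \<Rightarrow> 'g \<Rightarrow> 'g)
     \<Rightarrow> ('e \<times> 'g) kpoint \<Rightarrow> 'g" where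
  "tilde E \<sigma> G T = kext (tensor_gens E G) (tensor_kernel E \<sigma> G) G (\<lambda>(\<xi>, h). T \<xi> h)"

text \<open>The data of a discrete product system: the fibres, the image \<open>pmul t s \<xi> \<eta>\<close> of
  \<open>\<xi> \<otimes> \<eta>\<close> in the fibre over \<open>t + s\<close>, and the identification of the coefficient algebra with the
  fibre over \<open>0\<close> (all fibres are subsets of one type).\<close>

record ('a, 'e) prodsys =
  pfib :: "real \<Rightarrow> ('a, 'e) corr"
  pmul :: "real \<Rightarrow> real \<Rightarrow> 'e \<Rightarrow> 'e \<Rightarrow> 'e"
  pzero :: "('a \<Rightarrow> 'a) \<Rightarrow> 'e"

definition covariant_rep ::
  "'a hspace \<Rightarrow> ('a \<Rightarrow> 'a) set \<Rightarrow> ('a, 'e) prodsys \<Rightarrow> 'g hspace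
     \<Rightarrow> (real \<Rightarrow> 'e \<Rightarrow> 'g \<Rightarrow> 'g) \<Rightarrow> bool" where
  "covariant_rep H N E G T \<longleftrightarrow>
     (\<forall>t\<ge>0.
        (\<forall>\<xi>\<in>ecar (pfib E t). T t \<xi> \<in> bop G G) \<and>
        (\<forall>\<xi>\<in>ecar (pfib E t). \<forall>\<eta>\<in>ecar (pfib E t).
           T t (eadd (pfib E t) \<xi> \<eta>) = oadd G G (T t \<xi>) (T t \<eta>)) \<and>
        (\<forall>c. \<forall>\<xi>\<in>ecar (pfib E t). T t (escale (pfib E t) c \<xi>) = oscale G G c (T t \<xi>)) \<and>
        completely_contractive H (pfib E t) G (T t) \<and>
        continuous_map (sigma_topology H N (pfib E t)) (sigma_weak G) (T t)) \<and>
     star_hom H N G (\<lambda>a. T 0 (pzero E a)) \<and> normal_map H N G (\<lambda>a. T 0 (pzero E a)) \<and>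
     (\<forall>t\<ge>0. \<forall>s\<ge>0. \<forall>\<xi>\<in>ecar (pfib E t). \<forall>\<eta>\<in>ecar (pfib E s).
        T (t + s) (pmul E t s \<xi> \<eta>) = ocomp G (T t \<xi>) (T s \<eta>))"

definition isometric_rep ::
  "('a, 'e) prodsys \<Rightarrow> 'g hspace \<Rightarrow> (real \<Rightarrow> 'e \<Rightarrow> 'g \<Rightarrow> 'g) \<Rightarrow> bool" where
  "isometric_rep E G T \<longleftrightarrow>
     (\<forall>t\<ge>0. \<forall>\<xi>\<in>ecar (pfib E t). \<forall>\<eta>\<in>ecar (pfib E t).
        ocomp G (hadj G G (T t \<xi>)) (T t \<eta>) = T 0 (pzero E (einner (pfib E t) \<xi> \<eta>)))"

definition rep_space ::
  "('a, 'e) prodsys \<Rightarrow> 'g hspace \<Rightarrow> (real \<Rightarrow> 'e \<Rightarrow> 'g \<Rightarrow> 'g) \<Rightarrow> real \<Rightarrow> ('e \<times> 'g) kpoint hspace" where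
  "rep_space E G T t = tensor_space (pfib E t) (\<lambda>a. T 0 (pzero E a)) G"

definition rep_tilde ::
  "('a, 'e) prodsys \<Rightarrow> 'g hspace \<Rightarrow> (real \<Rightarrow> 'e \<Rightarrow> 'g \<Rightarrow> 'g) \<Rightarrow> real \<Rightarrow> ('e \<times> 'g) kpoint \<Rightarrow> 'g" where
  "rep_tilde E G T t = tilde (pfib E t) (\<lambda>a. T 0 (pzero E a)) G (T t)"

definition rep_id_tensor ::
  "('a, 'e) prodsys \<Rightarrow> 'g hspace \<Rightarrow> (real \<Rightarrow> 'e \<Rightarrow> 'g \<Rightarrow> 'g) \<Rightarrow> real \<Rightarrow> ('g \<Rightarrow> 'g)
     \<Rightarrow> ('e \<times> 'g) kpoint \<Rightarrow> ('e \<times> 'g) kpoint" where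
  "rep_id_tensor E G T t S = id_tensor (pfib E t) (\<lambda>a. T 0 (pzero E a)) G S"

definition fully_coisometric_rep ::
  "('a, 'e) prodsys \<Rightarrow> 'g hspace \<Rightarrow> (real \<Rightarrow> 'e \<Rightarrow> 'g \<Rightarrow> 'g) \<Rightarrow> bool" where
  "fully_coisometric_rep E G T \<longleftrightarrow>
     (\<forall>t\<ge>0. ocomp G (rep_tilde E G T t) (hadj (rep_space E G T t) G (rep_tilde E G T t)) = oid G)"

definition minimal_isometric_dilation ::
  "'a hspace \<Rightarrow> ('a \<Rightarrow> 'a) set \<Rightarrow> ('a, 'e) prodsys \<Rightarrow> 'g hspace \<Rightarrow> (real \<Rightarrow> 'e \<Rightarrow> 'g \<Rightarrow> 'g)
     \<Rightarrow> (real \<Rightarrow> 'e \<Rightarrow> 'k \<Rightarrow> 'k) \<Rightarrow> ('g \<Rightarrow> 'k) \<Rightarrow> 'k hspace \<Rightarrow> bool" where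
  "minimal_isometric_dilation H N E G T V u K \<longleftrightarrow>
     hilbert_space K \<and>
     u \<in> bop G K \<and> (\<forall>x\<in>hcar G. \<forall>y\<in>hcar G. hinner K (u x) (u y) = hinner G x y) \<and>
     covariant_rep H N E K V \<and> isometric_rep E K V \<and> fully_coisometric_rep E K V \<and>
     (\<forall>t\<ge>0. \<forall>\<xi>\<in>ecar (pfib E t).
        ocomp G (hadj G K u) (ocomp G (V t \<xi>) u) = T t \<xi> \<and>
        hadj K K (V t \<xi>) ` (u ` hcar G) \<subseteq> u ` hcar G) \<and>
     (\<forall>L. closed_subspace K L \<and> u ` hcar G \<subseteq> L \<and>
        (\<forall>t\<ge>0. \<forall>\<xi>\<in>ecar (pfib E t). V t \<xi> ` L \<subseteq> L \<and> hadj K K (V t \<xi>) ` L \<subseteq> L) \<longrightarrow>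
        L = hcar K)"

section \<open>The product system of a semigroup of completely positive maps\<close>

definition partitions :: "real \<Rightarrow> real set set" where
  "partitions t = {p. finite p \<and> p \<subseteq> {0..t} \<and> 0 \<in> p \<and> t \<in> p}"

text \<open>For \<open>p = {0 = t\<^sub>0 < \<dots> < t\<^sub>n = t}\<close> the elementary tensor \<open>T\<^sub>1 \<otimes> \<dots> \<otimes> T\<^sub>n \<otimes> h\<close> is encoded as
  \<open>(f, h)\<close>, where \<open>f t\<^sub>i = T\<^sub>(\<^sub>i\<^sub>+\<^sub>1\<^sub>)\<close> for \<open>i < n\<close> and \<open>f\<close> is the identity operator elsewhere. Inserting
  identity operators at the new points of a refinement does not change the code.\<close>

type_synonym 'h ptuple = "(real \<Rightarrow> 'h \<Rightarrow> 'h) \<times> 'h"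
type_synonym 'h ppoint = "'h ptuple kpoint"
type_synonym 'h tpoint = "(real set \<times> 'h ppoint) kpoint"

definition part_gens :: "'h hspace \<Rightarrow> ('h \<Rightarrow> 'h) set \<Rightarrow> real \<Rightarrow> real set \<Rightarrow> 'h ptuple set" where
  "part_gens H M t p =
     {f. (\<forall>r\<in>p - {t}. f r \<in> M) \<and> (\<forall>r. r \<notin> p - {t} \<longrightarrow> f r = oid H)} \<times> hcar H"

text \<open>On the increasing list of the points of a partition and \<open>A\<close> the identity this is
  \<open>P\<^bsub>t - t\<^sub>(\<^sub>n\<^sub>-\<^sub>1\<^sub>)\<^esub> (T\<^sub>n\<^sup>* \<cdots> P\<^bsub>t\<^sub>2 - t\<^sub>1\<^esub> (T\<^sub>2\<^sup>* P\<^bsub>t\<^sub>1\<^esub> (T\<^sub>1\<^sup>* S\<^sub>1) S\<^sub>2) \<cdots> S\<^sub>n)\<close>.\<close>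

fun part_chain ::
  "'h hspace \<Rightarrow> (real \<Rightarrow> ('h \<Rightarrow> 'h) \<Rightarrow> 'h \<Rightarrow> 'h) \<Rightarrow> (real \<Rightarrow> 'h \<Rightarrow> 'h) \<Rightarrow> (real \<Rightarrow> 'h \<Rightarrow> 'h)
     \<Rightarrow> ('h \<Rightarrow> 'h) \<Rightarrow> real list \<Rightarrow> 'h \<Rightarrow> 'h" where
  "part_chain H P f g A (r # r' # rs) =
     part_chain H P f g (P (r' - r) (ocomp H (hadj H H (f r)) (ocomp H A (g r)))) (r' # rs)"
| "part_chain H P f g A [r] = A"
| "part_chain H P f g A [] = A"

definition part_kernel ::
  "'h hspace \<Rightarrow> (real \<Rightarrow> ('h \<Rightarrow> 'h) \<Rightarrow> 'h \<Rightarrow> 'h) \<Rightarrow> real set \<Rightarrow> 'h ptuple \<Rightarrow> 'h ptuple \<Rightarrow> complex" where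
  "part_kernel H P p = (\<lambda>(f, h) (g, k).
     hinner H h (part_chain H P f g (oid H) (sorted_list_of_set p) k))"

definition part_space ::
  "'h hspace \<Rightarrow> ('h \<Rightarrow> 'h) set \<Rightarrow> (real \<Rightarrow> ('h \<Rightarrow> 'h) \<Rightarrow> 'h \<Rightarrow> 'h) \<Rightarrow> real \<Rightarrow> real set
     \<Rightarrow> 'h ppoint hspace" where
  "part_space H M P t p = kspace (part_gens H M t p) (part_kernel H P p)"

definition part_gen ::
  "'h hspace \<Rightarrow> ('h \<Rightarrow> 'h) set \<Rightarrow> (real \<Rightarrow> ('h \<Rightarrow> 'h) \<Rightarrow> 'h \<Rightarrow> 'h) \<Rightarrow> real \<Rightarrow> real set
     \<Rightarrow> 'h ptuple \<Rightarrow> 'h ppoint" where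
  "part_gen H M P t p = kgen (part_gens H M t p) (part_kernel H P p)"

definition part_ext ::
  "'h hspace \<Rightarrow> ('h \<Rightarrow> 'h) set \<Rightarrow> (real \<Rightarrow> ('h \<Rightarrow> 'h) \<Rightarrow> 'h \<Rightarrow> 'h) \<Rightarrow> real \<Rightarrow> real set
     \<Rightarrow> 'b hspace \<Rightarrow> ('h ptuple \<Rightarrow> 'b) \<Rightarrow> 'h ppoint \<Rightarrow> 'b" where
  "part_ext H M P t p = kext (part_gens H M t p) (part_kernel H P p)"

definition part_lact ::
  "'h hspace \<Rightarrow> ('h \<Rightarrow> 'h) set \<Rightarrow> (real \<Rightarrow> ('h \<Rightarrow> 'h) \<Rightarrow> 'h \<Rightarrow> 'h) \<Rightarrow> real \<Rightarrow> real set
     \<Rightarrow> ('h \<Rightarrow> 'h) \<Rightarrow> 'h ppoint \<Rightarrow> 'h ppoint" where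
  "part_lact H M P t p S = part_ext H M P t p (part_space H M P t p)
     (\<lambda>(f, h). part_gen H M P t p (f(0 := ocomp H S (f 0)), h))"

definition part_comm_act ::
  "'h hspace \<Rightarrow> ('h \<Rightarrow> 'h) set \<Rightarrow> (real \<Rightarrow> ('h \<Rightarrow> 'h) \<Rightarrow> 'h \<Rightarrow> 'h) \<Rightarrow> real \<Rightarrow> real set
     \<Rightarrow> ('h \<Rightarrow> 'h) \<Rightarrow> 'h ppoint \<Rightarrow> 'h ppoint" where
  "part_comm_act H M P t p R = part_ext H M P t p (part_space H M P t p)
     (\<lambda>(f, h). part_gen H M P t p (f, R h))"

text \<open>The isometry given by the insertion of identity operators, for \<open>p \<subseteq> p'\<close>.\<close>

definition part_incl ::
  "'h hspace \<Rightarrow> ('h \<Rightarrow> 'h) set \<Rightarrow> (real \<Rightarrow> ('h \<Rightarrow> 'h) \<Rightarrow> 'h \<Rightarrow> 'h) \<Rightarrow> real \<Rightarrow> real set \<Rightarrow> real set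
     \<Rightarrow> 'h ppoint \<Rightarrow> 'h ppoint" where
  "part_incl H M P t p p' = part_ext H M P t p (part_space H M P t p')
     (\<lambda>(f, h). part_gen H M P t p' (f, h))"

text \<open>The Hilbert space direct limit \<open>H\<^sub>t\<close> is generated by the pairs \<open>(p, x)\<close> with \<open>x\<close> in the space
  of \<open>p\<close>; inner products of generators are computed in the space of the common refinement.\<close>

definition lim_gens ::
  "'h hspace \<Rightarrow> ('h \<Rightarrow> 'h) set \<Rightarrow> (real \<Rightarrow> ('h \<Rightarrow> 'h) \<Rightarrow> 'h \<Rightarrow> 'h) \<Rightarrow> real
     \<Rightarrow> (real set \<times> 'h ppoint) set" where
  "lim_gens H M P t = Sigma (partitions t) (\<lambda>p. hcar (part_space H M P t p))"

definition lim_kernel ::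
  "'h hspace \<Rightarrow> ('h \<Rightarrow> 'h) set \<Rightarrow> (real \<Rightarrow> ('h \<Rightarrow> 'h) \<Rightarrow> 'h \<Rightarrow> 'h) \<Rightarrow> real
     \<Rightarrow> real set \<times> 'h ppoint \<Rightarrow> real set \<times> 'h ppoint \<Rightarrow> complex" where
  "lim_kernel H M P t = (\<lambda>(p, x) (q, y). hinner (part_space H M P t (p \<union> q))
     (part_incl H M P t p (p \<union> q) x) (part_incl H M P t q (p \<union> q) y))"

definition lim_space ::
  "'h hspace \<Rightarrow> ('h \<Rightarrow> 'h) set \<Rightarrow> (real \<Rightarrow> ('h \<Rightarrow> 'h) \<Rightarrow> 'h \<Rightarrow> 'h) \<Rightarrow> real \<Rightarrow> 'h tpoint hspace" where
  "lim_space H M P t = kspace (lim_gens H M P t) (lim_kernel H M P t)"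

text \<open>The canonical isometry \<open>v\<^sub>p\<close>.\<close>

definition lim_v ::
  "'h hspace \<Rightarrow> ('h \<Rightarrow> 'h) set \<Rightarrow> (real \<Rightarrow> ('h \<Rightarrow> 'h) \<Rightarrow> 'h \<Rightarrow> 'h) \<Rightarrow> real \<Rightarrow> real set
     \<Rightarrow> 'h ppoint \<Rightarrow> 'h tpoint" where
  "lim_v H M P t p x = kgen (lim_gens H M P t) (lim_kernel H M P t) (p, x)"

definition lim_ext ::
  "'h hspace \<Rightarrow> ('h \<Rightarrow> 'h) set \<Rightarrow> (real \<Rightarrow> ('h \<Rightarrow> 'h) \<Rightarrow> 'h \<Rightarrow> 'h) \<Rightarrow> real
     \<Rightarrow> 'b hspace \<Rightarrow> (real set \<times> 'h ppoint \<Rightarrow> 'b) \<Rightarrow> 'h tpoint \<Rightarrow> 'b" where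
  "lim_ext H M P t = kext (lim_gens H M P t) (lim_kernel H M P t)"

definition lim_lact ::
  "'h hspace \<Rightarrow> ('h \<Rightarrow> 'h) set \<Rightarrow> (real \<Rightarrow> ('h \<Rightarrow> 'h) \<Rightarrow> 'h \<Rightarrow> 'h) \<Rightarrow> real
     \<Rightarrow> ('h \<Rightarrow> 'h) \<Rightarrow> 'h tpoint \<Rightarrow> 'h tpoint" where
  "lim_lact H M P t S = lim_ext H M P t (lim_space H M P t)
     (\<lambda>(p, x). lim_v H M P t p (part_lact H M P t p S x))"

definition lim_comm_act ::
  "'h hspace \<Rightarrow> ('h \<Rightarrow> 'h) set \<Rightarrow> (real \<Rightarrow> ('h \<Rightarrow> 'h) \<Rightarrow> 'h \<Rightarrow> 'h) \<Rightarrow> real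
     \<Rightarrow> ('h \<Rightarrow> 'h) \<Rightarrow> 'h tpoint \<Rightarrow> 'h tpoint" where
  "lim_comm_act H M P t R = lim_ext H M P t (lim_space H M P t)
     (\<lambda>(p, x). lim_v H M P t p (part_comm_act H M P t p R x))"

text \<open>\<open>\<iota>\<^sub>t\<close>, computed with the coarsest partition.\<close>

definition lim_iota ::
  "'h hspace \<Rightarrow> ('h \<Rightarrow> 'h) set \<Rightarrow> (real \<Rightarrow> ('h \<Rightarrow> 'h) \<Rightarrow> 'h \<Rightarrow> 'h) \<Rightarrow> real \<Rightarrow> 'h \<Rightarrow> 'h tpoint" where
  "lim_iota H M P t =
     (\<lambda>h\<in>hcar H. lim_v H M P t {0, t} (part_gen H M P t {0, t} (\<lambda>r. oid H, h)))"

definition intertwiner_corr ::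
  "'h hspace \<Rightarrow> ('h \<Rightarrow> 'h) set \<Rightarrow> (real \<Rightarrow> ('h \<Rightarrow> 'h) \<Rightarrow> 'h \<Rightarrow> 'h) \<Rightarrow> real
     \<Rightarrow> ('h, 'h \<Rightarrow> 'h tpoint) corr" where
  "intertwiner_corr H M P t =
    \<lparr>ecar = {X \<in> bop H (lim_space H M P t). \<forall>S\<in>M. ocomp H X S = ocomp H (lim_lact H M P t S) X},
     eadd = oadd H (lim_space H M P t), escale = oscale H (lim_space H M P t),
     einner = (\<lambda>X Y. ocomp H (hadj H (lim_space H M P t) X) Y),
     elact = (\<lambda>R X. ocomp H (lim_comm_act H M P t R) X),
     eract = (\<lambda>X R. ocomp H X R)\<rparr>"

text \<open>Juxtaposition of a tuple on \<open>p\<^sub>2\<close> (a partition of \<open>[0, s]\<close>) with a tuple on \<open>p\<^sub>1\<close> (of \<open>[0, t]\<close>),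
  giving a tuple on \<open>p\<^sub>2 \<union> (p\<^sub>1 + s)\<close>.\<close>

definition tuple_append :: "real \<Rightarrow> (real \<Rightarrow> 'h \<Rightarrow> 'h) \<Rightarrow> (real \<Rightarrow> 'h \<Rightarrow> 'h) \<Rightarrow> real \<Rightarrow> 'h \<Rightarrow> 'h" where
  "tuple_append s f g = (\<lambda>r. if r < s then f r else g (r - s))"

text \<open>For a tuple \<open>f = S\<^sub>1 \<otimes> \<dots> \<otimes> S\<^sub>m\<close> on \<open>p\<^sub>2\<close>, the operator from \<open>H\<^sub>t\<close> to the space of \<open>t + s\<close>
  sending \<open>v\<^bsub>p\<^sub>1\<^esub> y\<close> to \<open>v\<^bsub>p\<^esub> (S\<^sub>1 \<otimes> \<dots> \<otimes> S\<^sub>m \<otimes> y)\<close> with \<open>p = p\<^sub>2 \<union> (p\<^sub>1 + s)\<close>.\<close>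

definition tuple_tensor ::
  "'h hspace \<Rightarrow> ('h \<Rightarrow> 'h) set \<Rightarrow> (real \<Rightarrow> ('h \<Rightarrow> 'h) \<Rightarrow> 'h \<Rightarrow> 'h) \<Rightarrow> real \<Rightarrow> real \<Rightarrow> real set
     \<Rightarrow> (real \<Rightarrow> 'h \<Rightarrow> 'h) \<Rightarrow> 'h tpoint \<Rightarrow> 'h tpoint" where
  "tuple_tensor H M P t s p2 f = lim_ext H M P t (lim_space H M P (t + s))
     (\<lambda>(p1, y). let p = p2 \<union> (\<lambda>r. r + s) ` p1 in
        lim_v H M P (t + s) p
          (part_ext H M P t p1 (part_space H M P (t + s) p)
             (\<lambda>(g, h). part_gen H M P (t + s) p (tuple_append s f g, h)) y))"

text \<open>\<open>I\<^sub>s \<otimes> X\<close> from \<open>H\<^sub>s\<close> to the space of \<open>t + s\<close>, for an arbitrary \<open>X\<close> in the fibre over \<open>t\<close>: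
  \<open>v\<^bsub>p\<^sub>2\<^esub> (S\<^sub>1 \<otimes> \<dots> \<otimes> S\<^sub>m \<otimes> h)\<close> is sent to \<open>S\<^sub>1 \<otimes> \<dots> \<otimes> S\<^sub>m \<otimes> X h\<close>. If \<open>X = v\<^bsub>p\<^sub>1\<^esub> X'\<close> then
  \<open>(I\<^sub>s \<otimes> X) v\<^bsub>p\<^sub>2\<^esub> = v\<^bsub>p\<^esub> (I\<^sub>s \<otimes> X')\<close>, so that composition with \<open>I\<^sub>s \<otimes> X\<close> is the extension
  of the product from the elements of the form \<open>v\<^bsub>p\<^sub>1\<^esub> X'\<close>, \<open>v\<^bsub>p\<^sub>2\<^esub> Y'\<close> to the whole fibres.\<close>

definition shift_tensor ::
  "'h hspace \<Rightarrow> ('h \<Rightarrow> 'h) set \<Rightarrow> (real \<Rightarrow> ('h \<Rightarrow> 'h) \<Rightarrow> 'h \<Rightarrow> 'h) \<Rightarrow> real \<Rightarrow> real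
     \<Rightarrow> ('h \<Rightarrow> 'h tpoint) \<Rightarrow> 'h tpoint \<Rightarrow> 'h tpoint" where
  "shift_tensor H M P t s X = lim_ext H M P s (lim_space H M P (t + s))
     (\<lambda>(p2, x). part_ext H M P s p2 (lim_space H M P (t + s))
        (\<lambda>(f, h). tuple_tensor H M P t s p2 f (X h)) x)"

type_synonym 'h fpoint = "('h \<Rightarrow> 'h) + ('h \<Rightarrow> 'h tpoint)"

definition cp_fibre ::
  "'h hspace \<Rightarrow> ('h \<Rightarrow> 'h) set \<Rightarrow> (real \<Rightarrow> ('h \<Rightarrow> 'h) \<Rightarrow> 'h \<Rightarrow> 'h) \<Rightarrow> real
     \<Rightarrow> ('h, 'h fpoint) corr" where
  "cp_fibre H M P t =
     (if t = 0 then corr_transport Inl projl (trivial_corr H (commutant H M))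
      else corr_transport Inr projr (intertwiner_corr H M P t))"

definition cp_prodsys ::
  "'h hspace \<Rightarrow> ('h \<Rightarrow> 'h) set \<Rightarrow> (real \<Rightarrow> ('h \<Rightarrow> 'h) \<Rightarrow> 'h \<Rightarrow> 'h) \<Rightarrow> ('h, 'h fpoint) prodsys" where
  "cp_prodsys H M P =
    \<lparr>pfib = cp_fibre H M P,
     pmul = (\<lambda>t s \<xi> \<eta>.
       if t = 0 then elact (cp_fibre H M P s) (projl \<xi>) \<eta>
       else if s = 0 then eract (cp_fibre H M P t) \<xi> (projl \<eta>)
       else Inr (ocomp H (shift_tensor H M P t s (projr \<xi>)) (projr \<eta>))),
     pzero = Inl\<rparr>"

definition identity_rep ::
  "'h hspace \<Rightarrow> ('h \<Rightarrow> 'h) set \<Rightarrow> (real \<Rightarrow> ('h \<Rightarrow> 'h) \<Rightarrow> 'h \<Rightarrow> 'h) \<Rightarrow> real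
     \<Rightarrow> 'h fpoint \<Rightarrow> 'h \<Rightarrow> 'h" where
  "identity_rep H M P t \<xi> =
     (if t = 0 then projl \<xi>
      else ocomp H (hadj H (lim_space H M P t) (lim_iota H M P t)) (projr \<xi>))"

end

theory Submission
  imports Defs
begin

text \<open>
The endomorphism \<open>\<alpha>\<^sub>t(S)\<close> is governed by one rule: \<open>\<alpha>\<^sub>t(S) V\<^sub>t(\<xi>) k = V\<^sub>t(\<xi>) S k\<close> (\<open>alpha_V\<close>). It holds
because the adjoint of \<open>V\<^sub>t\<close> on the tensor product takes \<open>V\<^sub>t(\<xi>) k\<close> back to \<open>\<xi> \<otimes> k\<close>, the representation being
isometric, and it determines \<open>\<alpha>\<^sub>t(S)\<close> because the vectors \<open>V\<^sub>t(\<xi>) k\<close> are total, the representation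
being fully coisometric (\<open>V_total\<close>). On these vectors one reads off that \<open>\<alpha>\<^sub>t\<close> is a unital
*-homomorphism, that it maps \<open>R\<close> to \<open>R\<close> because \<open>\<rho>(a) V\<^sub>t(\<xi>) = V\<^sub>t(a \<xi>)\<close>, and that
\<open>\<alpha>\<^sub>s\<^sub>+\<^sub>t = \<alpha>\<^sub>s \<alpha>\<^sub>t\<close> because \<open>V\<^sub>s\<^sub>+\<^sub>t(\<xi> \<otimes> \<eta>) = V\<^sub>s(\<xi>) V\<^sub>t(\<eta>)\<close>; for the last step the product of two
elements of the fibres must be an element of the fibre over \<open>s + t\<close> (\<open>inter_mult\<close>).

All operators on tensor products and direct limits are prescribed on elementary tensors and have to be
shown to be bounded. By \<open>kext_exists\<close> this is an inequality between positive semidefinite kernels.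
The central inequality is \<open>C W\<^sup>* W \<le> \<parallel>W\<parallel>\<^sup>2 C\<close> for a positive operator matrix \<open>C\<close> whose entries commute
with \<open>W\<^sup>* W\<close> (\<open>psd_dominated\<close>). It bounds \<open>I \<otimes> S\<close>, the action of the commutant of \<open>M\<close> on \<open>H\<^sub>t\<close>, and
the operators \<open>I \<otimes> X\<close> in the product of the product system. It is derived from the Cauchy-Schwarz
inequality for \<open>C\<close>: the numbers \<open>\<langle>h, C (W\<^sup>* W)\<^sup>m h\<rangle>\<close> form a log-convex sequence of geometric growth.

Normality of \<open>\<alpha>\<^sub>t\<close> means that a functional \<open>\<langle>z, \<alpha>\<^sub>t(S) y\<rangle>\<close> can be written as \<open>\<Sum> \<langle>a\<^sub>n, S b\<^sub>n\<rangle>\<close> with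
square-summable \<open>a\<close> and \<open>b\<close>. The operators \<open>V\<^sub>t(\<xi>)\<close> intertwine \<open>S\<close> with \<open>\<alpha>\<^sub>t(S)\<close> and have total
ranges. Countably many of them, \<open>U\<^sub>0, U\<^sub>1, \<dots>\<close>, suffice for given vectors; with \<open>A = \<Sum> U\<^sub>i U\<^sub>i\<^sup>*\<close>, which
commutes with the range of \<open>\<alpha>\<^sub>t\<close>, the powers of \<open>1 - A\<close> tend to zero strongly at \<open>y\<close>, and a telescoping
sum expresses the functional through the vectors \<open>U\<^sub>i\<^sup>* (1 - A)\<^sup>m z\<close> and \<open>U\<^sub>i\<^sup>* (1 - A)\<^sup>m y\<close>
(\<open>inner_pi_expansion\<close>, \<open>predual_pullback\<close>).

Since \<open>u\<^sub>0 H\<close> is invariant under the adjoints of the \<open>V\<^sub>0(a)\<close>, it reduces \<open>\<rho>\<close>, and \<open>\<rho>(a) u\<^sub>0 = u\<^sub>0 a\<close>.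
Hence \<open>u\<^sub>0\<^sup>* S u\<^sub>0\<close> commutes with the commutant of \<open>M\<close> for \<open>S \<in> R\<close>, so that it is in \<open>M\<close>; conversely
\<open>u\<^sub>0 A u\<^sub>0\<^sup>* \<in> R\<close> for \<open>A \<in> M\<close>.

For the dilation formula let \<open>A = u\<^sub>0\<^sup>* S u\<^sub>0\<close>. The vectors \<open>V\<^sub>t(X) u\<^sub>0 h\<close> of \<open>K\<close> and \<open>X h\<close> of \<open>H\<^sub>t\<close> have the
same Gram matrix, and \<open>\<alpha>\<^sub>t(S)\<close> on the former has the same matrix elements as the action of \<open>A\<close> on the
latter. The vectors \<open>u\<^sub>0 k\<close> and \<open>\<iota>\<^sub>t k\<close> have the same norm and the same coefficients with
respect to these families, because \<open>u\<^sub>0\<^sup>* V\<^sub>t(X) u\<^sub>0 = \<iota>\<^sub>t\<^sup>* X\<close>. If \<open>\<iota>\<^sub>t k\<close> is in the closed span of the vectors \<open>X h\<close>,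
it follows that \<open>u\<^sub>0 k\<close> is in the closed span of the other family and that
\<open>\<langle>u\<^sub>0 h, \<alpha>\<^sub>t(S) u\<^sub>0 k\<rangle> = \<langle>\<iota>\<^sub>t h, A \<iota>\<^sub>t k\<rangle> = \<langle>h, P\<^sub>t(A) k\<rangle>\<close> (\<open>gram_transfer\<close>). That \<open>\<iota>\<^sub>t k\<close> is in the closed
span is where the normality of \<open>P\<^sub>t\<close> enters (\<open>unt_approximated\<close>). It gives a square-summable sequence
\<open>z\<close> with \<open>\<langle>k, P\<^sub>t(A\<^sup>* A) k\<rangle> \<le> \<Sum> \<parallel>A z\<^sub>n\<parallel>\<^sup>2\<close> for all \<open>A \<in> M\<close>, so that \<open>(A z\<^sub>n)\<^sub>n \<mapsto> A \<iota>\<^sub>t k\<close> extends to a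
contraction \<open>B\<close> on the cyclic subspace generated by \<open>z\<close> in the infinite multiple of \<open>H\<close>. With the
coordinate maps \<open>J\<^sub>i\<close> of this subspace, the operators \<open>B J\<^sub>i\<^sup>*\<close> belong to the fibre over \<open>t\<close>, and a
vector orthogonal to their ranges is orthogonal to \<open>B z = \<iota>\<^sub>t k\<close>.\<close>

section \<open>Semi-inner product spaces\<close>

abbreviation hsub :: "'a hspace \<Rightarrow> 'a \<Rightarrow> 'a \<Rightarrow> 'a" where
  "hsub G x y \<equiv> hadd G x (hscale G (-1) y)"

context
  fixes G :: "'a hspace"
  assumes G: "semi_inner_space G"
begin

lemmas semi_inner_axioms = G[unfolded semi_inner_space_def]

lemmas hzero_car [simp, intro] =
  semi_inner_axioms[THEN conjunct1, rule_format]
lemmas hadd_car [simp, intro] =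
  semi_inner_axioms[THEN conjunct2, THEN conjunct1, rule_format]
lemmas hscale_car [simp, intro] =
  semi_inner_axioms[THEN conjunct2, THEN conjunct2, THEN conjunct1, rule_format]
lemmas hadd_assoc =
  semi_inner_axioms[THEN conjunct2, THEN conjunct2, THEN conjunct2, THEN conjunct1, rule_format]
lemmas hadd_commute =
  semi_inner_axioms[THEN conjunct2, THEN conjunct2, THEN conjunct2, THEN conjunct2, THEN conjunct1, rule_format]
lemmas hadd_hzero =
  semi_inner_axioms[THEN conjunct2, THEN conjunct2, THEN conjunct2, THEN conjunct2, THEN conjunct2, THEN conjunct1, rule_format]
lemmas hsub_self =
  semi_inner_axioms[THEN conjunct2, THEN conjunct2, THEN conjunct2, THEN conjunct2, THEN conjunct2, THEN conjunct2, THEN conjunct1, rule_format]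
lemmas hscale_hadd =
  semi_inner_axioms[THEN conjunct2, THEN conjunct2, THEN conjunct2, THEN conjunct2, THEN conjunct2, THEN conjunct2, THEN conjunct2, THEN conjunct1, rule_format]
lemmas hscale_plus =
  semi_inner_axioms[THEN conjunct2, THEN conjunct2, THEN conjunct2, THEN conjunct2, THEN conjunct2, THEN conjunct2, THEN conjunct2, THEN conjunct2, THEN conjunct1, rule_format]
lemmas hscale_times =
  semi_inner_axioms[THEN conjunct2, THEN conjunct2, THEN conjunct2, THEN conjunct2, THEN conjunct2, THEN conjunct2, THEN conjunct2, THEN conjunct2, THEN conjunct2, THEN conjunct1, rule_format]
lemmas hscale_one =
  semi_inner_axioms[THEN conjunct2, THEN conjunct2, THEN conjunct2, THEN conjunct2, THEN conjunct2, THEN conjunct2, THEN conjunct2, THEN conjunct2, THEN conjunct2, THEN conjunct2, THEN conjunct1, rule_format]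
lemmas hinner_add_right [simp] =
  semi_inner_axioms[THEN conjunct2, THEN conjunct2, THEN conjunct2, THEN conjunct2, THEN conjunct2, THEN conjunct2, THEN conjunct2, THEN conjunct2, THEN conjunct2, THEN conjunct2, THEN conjunct2, THEN conjunct1, rule_format]
lemmas hinner_scale_right [simp] =
  semi_inner_axioms[THEN conjunct2, THEN conjunct2, THEN conjunct2, THEN conjunct2, THEN conjunct2, THEN conjunct2, THEN conjunct2, THEN conjunct2, THEN conjunct2, THEN conjunct2, THEN conjunct2, THEN conjunct2, THEN conjunct1, rule_format]
lemmas hinner_commute =
  semi_inner_axioms[THEN conjunct2, THEN conjunct2, THEN conjunct2, THEN conjunct2, THEN conjunct2, THEN conjunct2, THEN conjunct2, THEN conjunct2, THEN conjunct2, THEN conjunct2, THEN conjunct2, THEN conjunct2, THEN conjunct2, THEN conjunct1, rule_format]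
lemmas hinner_ge0 =
  semi_inner_axioms[THEN conjunct2, THEN conjunct2, THEN conjunct2, THEN conjunct2, THEN conjunct2, THEN conjunct2, THEN conjunct2, THEN conjunct2, THEN conjunct2, THEN conjunct2, THEN conjunct2, THEN conjunct2, THEN conjunct2, THEN conjunct2, rule_format]

lemma hinner_add_left [simp]:
  assumes "x \<in> hcar G" "y \<in> hcar G" "z \<in> hcar G"
  shows "hinner G (hadd G x y) z = hinner G x z + hinner G y z"
  using assms by (simp add: hinner_commute[of z "hadd G x y"] hinner_commute[of z x] hinner_commute[of z y])

lemma hinner_scale_left [simp]:
  assumes "x \<in> hcar G" "y \<in> hcar G"
  shows "hinner G (hscale G c x) y = cnj c * hinner G x y"
  using assms by (simp add: hinner_commute[of y "hscale G c x"] hinner_commute[of y x])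

lemma hinner_zero_right [simp]:
  assumes "x \<in> hcar G" shows "hinner G x (hzero G) = 0"
  using hinner_add_right[of x "hzero G" "hzero G"] assms by (simp add: hadd_hzero)

lemma hinner_zero_left [simp]:
  assumes "x \<in> hcar G" shows "hinner G (hzero G) x = 0"
  using hinner_commute[of x "hzero G"] assms by simp

lemma hnorm_ge0 [simp]: "x \<in> hcar G \<Longrightarrow> 0 \<le> hnorm G x"
  by (simp add: hnorm_def hinner_ge0)

lemma hnorm_sq: "x \<in> hcar G \<Longrightarrow> (hnorm G x)\<^sup>2 = Re (hinner G x x)"
  by (simp add: hnorm_def hinner_ge0)

lemma hinner_self: "x \<in> hcar G \<Longrightarrow> hinner G x x = complex_of_real ((hnorm G x)\<^sup>2)"
  using hinner_commute[of x x] by (simp add: hnorm_sq complex_eq_iff)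

lemma hinner_Cauchy_Schwarz:
  assumes x: "x \<in> hcar G" and y: "y \<in> hcar G"
  shows "cmod (hinner G x y) \<le> hnorm G x * hnorm G y"
proof -
  define z where "z = hinner G y x"
  define a where "a = Re (hinner G x x)"
  define b where "b = Re (hinner G y y)"
  have yy: "hinner G y y = of_real b" and xx: "hinner G x x = of_real a"
    unfolding a_def b_def using x y by (metis hinner_self hnorm_sq)+
  have xy: "hinner G x y = cnj z" using x y by (simp add: z_def hinner_commute[of y x])
  have ab: "0 \<le> a" "0 \<le> b" using x y by (auto simp: a_def b_def hinner_ge0)
  have key: "0 \<le> a - 2 * s * (cmod z)\<^sup>2 + s\<^sup>2 * (cmod z)\<^sup>2 * b" for s :: real
  proof -
    let ?w = "hadd G x (hscale G (- of_real s * z) y)"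
    have zz: "z * cnj z = of_real ((cmod z)\<^sup>2)" by (metis complex_norm_square)
    have "hinner G ?w ?w = of_real a - 2 * of_real s * (z * cnj z) + (of_real s)\<^sup>2 * (z * cnj z) * of_real b"
      using x y by (simp add: xx yy xy z_def[symmetric] algebra_simps power2_eq_square)
    then have "hinner G ?w ?w = of_real (a - 2 * s * (cmod z)\<^sup>2 + s\<^sup>2 * (cmod z)\<^sup>2 * b)"
      unfolding zz by simp
    moreover have "0 \<le> Re (hinner G ?w ?w)" using x y by (intro hinner_ge0) auto
    ultimately show ?thesis by simp
  qed
  have "(cmod z)\<^sup>2 \<le> a * b"
  proof (cases "b = 0")
    case True
    have "(cmod z)\<^sup>2 = 0"
    proof (rule ccontr)
      assume nz: "(cmod z)\<^sup>2 \<noteq> 0"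
      have "0 \<le> a - 2 * ((a + 1) / (2 * (cmod z)\<^sup>2)) * (cmod z)\<^sup>2"
        using key[of "(a + 1) / (2 * (cmod z)\<^sup>2)"] True by simp
      with nz show False by simp
    qed
    with True ab show ?thesis by simp
  next
    case False
    with ab have "b > 0" by simp
    have "0 \<le> a - (cmod z)\<^sup>2 / b"
      using key[of "1 / b"] \<open>b > 0\<close> by (simp add: field_simps power2_eq_square)
    with \<open>b > 0\<close> show ?thesis by (simp add: field_simps)
  qed
  then have "sqrt ((cmod z)\<^sup>2) \<le> sqrt (a * b)" by (rule real_sqrt_le_mono)
  then have "cmod z \<le> sqrt a * sqrt b" by (simp add: real_sqrt_mult)
  then show ?thesis by (simp add: xy hnorm_def a_def b_def)
qed

lemma hnorm_scale [simp]:
  assumes "x \<in> hcar G" shows "hnorm G (hscale G c x) = cmod c * hnorm G x"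
proof -
  have "hinner G (hscale G c x) (hscale G c x) = (c * cnj c) * hinner G x x"
    using assms by simp
  also have "\<dots> = of_real ((cmod c * hnorm G x)\<^sup>2)"
    unfolding hinner_self[OF assms] complex_norm_square[symmetric] by (simp add: power_mult_distrib)
  finally show ?thesis using assms by (simp add: hnorm_def[of G "hscale G c x"])
qed

lemma hnorm_triangle:
  assumes x: "x \<in> hcar G" and y: "y \<in> hcar G"
  shows "hnorm G (hadd G x y) \<le> hnorm G x + hnorm G y"
proof (rule power2_le_imp_le)
  have "(hnorm G (hadd G x y))\<^sup>2 = (hnorm G x)\<^sup>2 + 2 * Re (hinner G x y) + (hnorm G y)\<^sup>2"
    using x y by (simp add: hnorm_sq hinner_commute[of x y])
  also have "\<dots> \<le> (hnorm G x)\<^sup>2 + 2 * (hnorm G x * hnorm G y) + (hnorm G y)\<^sup>2"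
    using hinner_Cauchy_Schwarz[OF x y] complex_Re_le_cmod[of "hinner G x y"] by linarith
  finally show "(hnorm G (hadd G x y))\<^sup>2 \<le> (hnorm G x + hnorm G y)\<^sup>2"
    by (simp add: power2_sum)
  show "0 \<le> hnorm G x + hnorm G y" using x y by simp
qed

lemma hnorm_cong_inner:
  "hinner G x x = hinner G y y \<Longrightarrow> hnorm G x = hnorm G y"
  by (simp add: hnorm_def)

lemma hdist_triangle:
  assumes x: "x \<in> hcar G" and y: "y \<in> hcar G" and z: "z \<in> hcar G"
  shows "hdist G x z \<le> hdist G x y + hdist G y z"
proof -
  have "hdist G x z = hnorm G (hadd G (hsub G x y) (hsub G y z))"
    unfolding hdist_def by (rule hnorm_cong_inner) (use x y z in \<open>simp add: algebra_simps\<close>)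
  then show ?thesis using hnorm_triangle[of "hsub G x y" "hsub G y z"] x y z
    by (simp add: hdist_def)
qed

lemma hdist_commute: "x \<in> hcar G \<Longrightarrow> y \<in> hcar G \<Longrightarrow> hdist G x y = hdist G y x"
  unfolding hdist_def by (rule hnorm_cong_inner) (simp add: algebra_simps)

lemma hdist_ge0 [simp]: "x \<in> hcar G \<Longrightarrow> y \<in> hcar G \<Longrightarrow> 0 \<le> hdist G x y"
  by (simp add: hdist_def)

lemma hnorm_zero [simp]: "hnorm G (hzero G) = 0"
  by (simp add: hnorm_def)

lemma hdist_self [simp]: "x \<in> hcar G \<Longrightarrow> hdist G x x = 0"
  by (simp add: hdist_def hsub_self)

lemma hdist_add_le:
  assumes "x \<in> hcar G" "y \<in> hcar G" "x' \<in> hcar G" "y' \<in> hcar G"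
  shows "hdist G (hadd G x y) (hadd G x' y') \<le> hdist G x x' + hdist G y y'"
proof -
  have "hdist G (hadd G x y) (hadd G x' y') = hnorm G (hadd G (hsub G x x') (hsub G y y'))"
    unfolding hdist_def by (rule hnorm_cong_inner) (use assms in \<open>simp add: algebra_simps\<close>)
  then show ?thesis using hnorm_triangle[of "hsub G x x'" "hsub G y y'"] assms
    by (simp add: hdist_def)
qed

lemma hdist_scale:
  assumes "x \<in> hcar G" "y \<in> hcar G"
  shows "hdist G (hscale G c x) (hscale G c y) = cmod c * hdist G x y"
proof -
  have "hdist G (hscale G c x) (hscale G c y) = hnorm G (hscale G c (hsub G x y))"
    unfolding hdist_def by (rule hnorm_cong_inner) (use assms in \<open>simp add: algebra_simps\<close>)
  then show ?thesis using assms by (simp add: hdist_def)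
qed

lemma hnorm_le_hdist:
  assumes x: "x \<in> hcar G" and y: "y \<in> hcar G"
  shows "hnorm G x \<le> hnorm G y + hdist G x y"
proof -
  have "hnorm G x = hnorm G (hadd G y (hsub G x y))"
    by (rule hnorm_cong_inner) (use x y in \<open>simp add: algebra_simps\<close>)
  then show ?thesis using hnorm_triangle[of y "hsub G x y"] x y by (simp add: hdist_def)
qed

lemma hinner_diff_le:
  assumes "x \<in> hcar G" "y \<in> hcar G" "x' \<in> hcar G" "y' \<in> hcar G"
  shows "cmod (hinner G x y - hinner G x' y') \<le> hnorm G x * hdist G y y' + hdist G x x' * hnorm G y'"
proof -
  have "hinner G x y - hinner G x' y' = hinner G x (hsub G y y') + hinner G (hsub G x x') y'"
    using assms by (simp add: algebra_simps)
  then have "cmod (hinner G x y - hinner G x' y')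
      \<le> cmod (hinner G x (hsub G y y')) + cmod (hinner G (hsub G x x') y')"
    by (simp add: norm_triangle_ineq)
  moreover have "cmod (hinner G x (hsub G y y')) \<le> hnorm G x * hdist G y y'"
    unfolding hdist_def using assms by (intro hinner_Cauchy_Schwarz) auto
  moreover have "cmod (hinner G (hsub G x x') y') \<le> hdist G x x' * hnorm G y'"
    unfolding hdist_def using assms by (intro hinner_Cauchy_Schwarz) auto
  ultimately show ?thesis by linarith
qed

lemma hinner_tendsto:
  assumes u: "\<And>n. u n \<in> hcar G" "x \<in> hcar G" "(\<lambda>n. hdist G (u n) x) \<longlonglongrightarrow> 0"
    and v: "\<And>n. v n \<in> hcar G" "y \<in> hcar G" "(\<lambda>n. hdist G (v n) y) \<longlonglongrightarrow> 0"
  shows "(\<lambda>n. hinner G (u n) (v n)) \<longlonglongrightarrow> hinner G x y"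
proof -
  define g where "g = (\<lambda>n. (hnorm G x + hdist G (u n) x) * hdist G (v n) y + hdist G (u n) x * hnorm G y)"
  have "g \<longlonglongrightarrow> (hnorm G x + 0) * 0 + 0 * hnorm G y"
    unfolding g_def by (intro tendsto_add tendsto_mult tendsto_const u(3) v(3))
  then have g: "g \<longlonglongrightarrow> 0" by simp
  have le: "norm (hinner G (u n) (v n) - hinner G x y) \<le> g n" for n
  proof -
    have "hnorm G (u n) * hdist G (v n) y \<le> (hnorm G x + hdist G (u n) x) * hdist G (v n) y"
      by (rule mult_right_mono[OF hnorm_le_hdist[OF u(1,2)] hdist_ge0[OF v(1,2)]])
    then show ?thesis using hinner_diff_le[OF u(1)[of n] v(1)[of n] u(2) v(2)]
      unfolding g_def by linarith
  qed
  have "(\<lambda>n. hinner G (u n) (v n) - hinner G x y) \<longlonglongrightarrow> 0"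
    by (rule Lim_null_comparison[OF _ g]) (rule always_eventually, rule allI, rule le)
  then show ?thesis by (rule LIM_zero_cancel)
qed

lemma hnorm_tendsto:
  assumes u: "\<And>n. u n \<in> hcar G" "x \<in> hcar G" "(\<lambda>n. hdist G (u n) x) \<longlonglongrightarrow> 0"
  shows "(\<lambda>n. hnorm G (u n)) \<longlonglongrightarrow> hnorm G x"
  unfolding hnorm_def by (rule tendsto_real_sqrt[OF tendsto_Re[OF hinner_tendsto[OF u u]]])

lemma hsum_car [simp]: "(\<And>i. i < n \<Longrightarrow> f i \<in> hcar G) \<Longrightarrow> hsum G f n \<in> hcar G"
  by (induction n) auto

lemma hinner_hsum_right:
  "x \<in> hcar G \<Longrightarrow> (\<And>i. i < n \<Longrightarrow> f i \<in> hcar G) \<Longrightarrow> hinner G x (hsum G f n) = (\<Sum>i<n. hinner G x (f i))"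
  by (induction n) auto

lemma hinner_hsum_left:
  "x \<in> hcar G \<Longrightarrow> (\<And>i. i < n \<Longrightarrow> f i \<in> hcar G) \<Longrightarrow> hinner G (hsum G f n) x = (\<Sum>i<n. hinner G (f i) x)"
  by (induction n) auto

end

lemma hilbert_semi [simp]: "hilbert_space G \<Longrightarrow> semi_inner_space G"
  by (simp add: hilbert_space_def)

lemma hilbert_definite:
  "hilbert_space G \<Longrightarrow> x \<in> hcar G \<Longrightarrow> hinner G x x = 0 \<Longrightarrow> x = hzero G"
  by (simp add: hilbert_space_def)

lemma hilbert_complete:
  assumes "hilbert_space G" "hcauchy G u"
  obtains x where "x \<in> hcar G" "(\<lambda>n. hdist G (u n) x) \<longlonglongrightarrow> 0"
  using assms by (auto simp: hilbert_space_def)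

lemma hilbert_eqI_sub:
  assumes G: "hilbert_space G" and x: "x \<in> hcar G" "y \<in> hcar G"
    and z: "hinner G (hsub G x y) (hsub G x y) = 0"
  shows "x = y"
proof -
  have s: "semi_inner_space G" using G by simp
  have "hsub G x y = hzero G" using G x z by (intro hilbert_definite) auto
  then have "hadd G (hsub G x y) y = y" using x s by (simp add: hadd_hzero)
  moreover have "hadd G (hsub G x y) y = hadd G x (hsub G y y)"
    using x s by (simp add: hadd_assoc hadd_commute[of G "hscale G (-1) y"])
  moreover have "hadd G x (hsub G y y) = x"
    using x s by (simp add: hsub_self hadd_commute[of G x] hadd_hzero)
  ultimately show ?thesis by simp
qed

text \<open>Density of a span is expressed through orthogonality: the span of a subset of a Hilbert space is
  dense if and only if the subset is total.\<close>

definition total :: "'a hspace \<Rightarrow> 'a set \<Rightarrow> bool" where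
  "total G D \<longleftrightarrow> D \<subseteq> hcar G \<and> (\<forall>w\<in>hcar G. (\<forall>d\<in>D. hinner G d w = 0) \<longrightarrow> w = hzero G)"

lemma total_eqI:
  assumes "hilbert_space G" "total G D" "x \<in> hcar G" "y \<in> hcar G"
    and "\<And>d. d \<in> D \<Longrightarrow> hinner G d x = hinner G d y"
  shows "x = y"
proof (rule hilbert_eqI_sub[OF assms(1,3,4)])
  have D: "\<And>d. d \<in> D \<Longrightarrow> d \<in> hcar G" using assms(2) by (auto simp: total_def)
  have "hsub G x y = hzero G"
    using assms D unfolding total_def by simp
  then show "hinner G (hsub G x y) (hsub G x y) = 0" using assms by simp
qed

lemma total_car: "hilbert_space G \<Longrightarrow> total G (hcar G)"
  by (auto simp: total_def intro: hilbert_definite)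

lemma hilbert_eqI:
  assumes "hilbert_space G" "x \<in> hcar G" "y \<in> hcar G"
    and "\<And>d. d \<in> hcar G \<Longrightarrow> hinner G d x = hinner G d y"
  shows "x = y"
  using total_eqI[OF assms(1) total_car[OF assms(1)] assms(2,3)] assms(4) by blast

lemma hilbert_norm_zero:
  "hilbert_space G \<Longrightarrow> x \<in> hcar G \<Longrightarrow> hnorm G x = 0 \<Longrightarrow> x = hzero G"
  by (simp add: hilbert_definite hinner_self)

section \<open>Completions and kernel spaces\<close>

abbreviation hclass :: "'a hspace \<Rightarrow> (nat \<Rightarrow> 'a) \<Rightarrow> (nat \<Rightarrow> 'a) set" where
  "hclass G u \<equiv> hcauchy_rel G `` {u}"

lemma hcauchy_car: "hcauchy G u \<Longrightarrow> u n \<in> hcar G"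
  by (simp add: hcauchy_def)

context
  fixes G :: "'a hspace"
  assumes G: "semi_inner_space G"
begin

lemma hcauchyI:
  assumes "\<And>n. u n \<in> hcar G"
    and "\<And>e. e > 0 \<Longrightarrow> \<exists>N. \<forall>m\<ge>N. \<forall>n\<ge>N. hdist G (u m) (u n) < e"
  shows "hcauchy G u"
  using assms by (simp add: hcauchy_def)

lemma hcauchy_bounded:
  assumes u: "hcauchy G u"
  obtains B where "0 < B" "\<And>n. hnorm G (u n) \<le> B"
proof -
  obtain N where N: "\<And>m n. m \<ge> N \<Longrightarrow> n \<ge> N \<Longrightarrow> hdist G (u m) (u n) < 1"
    using u unfolding hcauchy_def by (meson zero_less_one)
  define B where "B = Max ((\<lambda>n. hnorm G (u n)) ` {..N}) + 1"
  have le: "hnorm G (u n) \<le> B - 1" if "n \<le> N" for n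
    unfolding B_def using that by (auto intro!: Max_ge)
  have "hnorm G (u n) \<le> B" for n
  proof (cases "n \<le> N")
    case True then show ?thesis using le[of n] by simp
  next
    case False
    then have "hnorm G (u n) \<le> hnorm G (u N) + hdist G (u n) (u N)"
      by (intro hnorm_le_hdist[OF G] hcauchy_car[OF u])
    then show ?thesis using le[of N] N[of n N] False by simp
  qed
  moreover have "0 < B" using le[of N] hnorm_ge0[OF G hcauchy_car[OF u], of N] by simp
  ultimately show ?thesis by (rule that[rotated])
qed

lemma hcauchy_inner_convergent:
  assumes u: "hcauchy G u" and v: "hcauchy G v"
  shows "convergent (\<lambda>n. hinner G (u n) (v n))"
proof -
  obtain B where B: "0 < B" "\<And>n. hnorm G (u n) \<le> B" using hcauchy_bounded[OF u] by blast
  obtain B' where B': "0 < B'" "\<And>n. hnorm G (v n) \<le> B'" using hcauchy_bounded[OF v] by blast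
  have "Cauchy (\<lambda>n. hinner G (u n) (v n))"
  proof (rule CauchyI)
    fix e :: real assume "0 < e"
    define e' where "e' = e / (B + B')"
    have e': "0 < e'" using \<open>0 < e\<close> B B' by (simp add: e'_def)
    obtain N where N: "\<And>m n. m \<ge> N \<Longrightarrow> n \<ge> N \<Longrightarrow> hdist G (u m) (u n) < e'"
      using u e' unfolding hcauchy_def by meson
    obtain N' where N': "\<And>m n. m \<ge> N' \<Longrightarrow> n \<ge> N' \<Longrightarrow> hdist G (v m) (v n) < e'"
      using v e' unfolding hcauchy_def by meson
    have "norm (hinner G (u m) (v m) - hinner G (u n) (v n)) < e" if "m \<ge> max N N'" "n \<ge> max N N'" for m n
    proof -
      have "norm (hinner G (u m) (v m) - hinner G (u n) (v n))
          \<le> hnorm G (u m) * hdist G (v m) (v n) + hdist G (u m) (u n) * hnorm G (v n)"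
        by (intro hinner_diff_le[OF G] hcauchy_car u v)
      also have "\<dots> \<le> B * hdist G (v m) (v n) + hdist G (u m) (u n) * B'"
        by (intro add_mono mult_right_mono mult_left_mono B B' hdist_ge0[OF G] hcauchy_car u v)
      also have "\<dots> < B * e' + e' * B'"
        by (intro add_strict_mono mult_strict_left_mono mult_strict_right_mono B B' N N') (use that in auto)
      also have "\<dots> = (B + B') * e'" by (simp add: algebra_simps)
      also have "\<dots> = e" using B B' by (simp add: e'_def)
      finally show ?thesis .
    qed
    then show "\<exists>M. \<forall>m\<ge>M. \<forall>n\<ge>M. norm (hinner G (u m) (v m) - hinner G (u n) (v n)) < e" by blast
  qed
  then show ?thesis by (rule Cauchy_convergent)
qed

lemma hcauchy_const: "x \<in> hcar G \<Longrightarrow> hcauchy G (\<lambda>n. x)"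
  using hdist_self[OF G] by (intro hcauchyI) auto

lemma hcauchy_add:
  assumes u: "hcauchy G u" and v: "hcauchy G v"
  shows "hcauchy G (\<lambda>n. hadd G (u n) (v n))"
proof (rule hcauchyI)
  show "hadd G (u n) (v n) \<in> hcar G" for n by (intro hadd_car[OF G] hcauchy_car u v)
  fix e :: real assume "0 < e"
  then have e: "0 < e / 2" by simp
  obtain N where N: "\<And>m n. m \<ge> N \<Longrightarrow> n \<ge> N \<Longrightarrow> hdist G (u m) (u n) < e/2"
    using u e unfolding hcauchy_def by meson
  obtain N' where N': "\<And>m n. m \<ge> N' \<Longrightarrow> n \<ge> N' \<Longrightarrow> hdist G (v m) (v n) < e/2"
    using v e unfolding hcauchy_def by meson
  have "hdist G (hadd G (u m) (v m)) (hadd G (u n) (v n)) < e" if "m \<ge> max N N'" "n \<ge> max N N'" for m n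
    using hdist_add_le[OF G hcauchy_car[OF u, of m] hcauchy_car[OF v, of m] hcauchy_car[OF u, of n] hcauchy_car[OF v, of n]]
      N[of m n] N'[of m n] that by simp
  then show "\<exists>N. \<forall>m\<ge>N. \<forall>n\<ge>N. hdist G (hadd G (u m) (v m)) (hadd G (u n) (v n)) < e" by blast
qed

lemma hcauchy_scale:
  assumes u: "hcauchy G u"
  shows "hcauchy G (\<lambda>n. hscale G c (u n))"
proof (rule hcauchyI)
  show "hscale G c (u n) \<in> hcar G" for n by (intro hscale_car[OF G] hcauchy_car u)
  fix e :: real assume "0 < e"
  then have e: "0 < e / (cmod c + 1)" by (simp add: add_nonneg_pos)
  obtain N where N: "\<And>m n. m \<ge> N \<Longrightarrow> n \<ge> N \<Longrightarrow> hdist G (u m) (u n) < e / (cmod c + 1)"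
    using u e unfolding hcauchy_def by meson
  have "hdist G (hscale G c (u m)) (hscale G c (u n)) < e" if "m \<ge> N" "n \<ge> N" for m n
  proof -
    have "hdist G (hscale G c (u m)) (hscale G c (u n)) = cmod c * hdist G (u m) (u n)"
      by (intro hdist_scale[OF G] hcauchy_car u)
    also have "\<dots> \<le> cmod c * (e / (cmod c + 1))"
      using N[OF that] by (intro mult_left_mono) auto
    also have "\<dots> < e" using \<open>0 < e\<close> norm_ge_zero[of c] by (simp add: divide_less_eq add_nonneg_pos distrib_left)
    finally show ?thesis .
  qed
  then show "\<exists>N. \<forall>m\<ge>N. \<forall>n\<ge>N. hdist G (hscale G c (u m)) (hscale G c (u n)) < e" by blast
qed

lemma hcauchy_rel_equiv: "equiv (Collect (hcauchy G)) (hcauchy_rel G)"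
proof (rule equivI)
  show "hcauchy_rel G \<subseteq> Collect (hcauchy G) \<times> Collect (hcauchy G)"
    by (auto simp: hcauchy_rel_def)
  show "refl_on (Collect (hcauchy G)) (hcauchy_rel G)"
    by (auto simp: refl_on_def hcauchy_rel_def hdist_self[OF G hcauchy_car])
  show "sym (hcauchy_rel G)"
  proof (rule symI)
    fix u v assume "(u, v) \<in> hcauchy_rel G"
    then have h: "hcauchy G u" "hcauchy G v" "(\<lambda>n. hdist G (u n) (v n)) \<longlonglongrightarrow> 0"
      by (auto simp: hcauchy_rel_def)
    then have "(\<lambda>n. hdist G (v n) (u n)) = (\<lambda>n. hdist G (u n) (v n))"
      by (intro ext hdist_commute[OF G] hcauchy_car)
    with h show "(v, u) \<in> hcauchy_rel G" by (simp add: hcauchy_rel_def)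
  qed
  show "trans (hcauchy_rel G)"
  proof (rule transI)
    fix u v w assume "(u, v) \<in> hcauchy_rel G" "(v, w) \<in> hcauchy_rel G"
    then have h: "hcauchy G u" "hcauchy G v" "hcauchy G w" "(\<lambda>n. hdist G (u n) (v n)) \<longlonglongrightarrow> 0"
       "(\<lambda>n. hdist G (v n) (w n)) \<longlonglongrightarrow> 0"
      by (auto simp: hcauchy_rel_def)
    have s: "(\<lambda>n. hdist G (u n) (v n) + hdist G (v n) (w n)) \<longlonglongrightarrow> 0"
      using tendsto_add[OF h(4,5)] by simp
    have "(\<lambda>n. hdist G (u n) (w n)) \<longlonglongrightarrow> 0"
    proof (rule Lim_null_comparison[OF always_eventually s], rule allI)
      fix n
      have "0 \<le> hdist G (u n) (w n)" by (intro hdist_ge0[OF G] hcauchy_car h)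
      moreover have "hdist G (u n) (w n) \<le> hdist G (u n) (v n) + hdist G (v n) (w n)"
        by (intro hdist_triangle[OF G] hcauchy_car h)
      ultimately show "norm (hdist G (u n) (w n)) \<le> hdist G (u n) (v n) + hdist G (v n) (w n)" by simp
    qed
    with h show "(u, w) \<in> hcauchy_rel G" by (simp add: hcauchy_rel_def)
  qed
qed

lemma hclass_eqI:
  "hcauchy G u \<Longrightarrow> hcauchy G v \<Longrightarrow> (\<lambda>n. hdist G (u n) (v n)) \<longlonglongrightarrow> 0 \<Longrightarrow> hclass G u = hclass G v"
  using equiv_class_eq[OF hcauchy_rel_equiv, of u v] by (simp add: hcauchy_rel_def)

lemma hclass_car [simp]: "hcauchy G u \<Longrightarrow> hclass G u \<in> hcar (hcompletion G)"
  by (simp add: hcompletion_def quotientI)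

lemma hcompletion_carE:
  assumes "C \<in> hcar (hcompletion G)" obtains u where "hcauchy G u" "C = hclass G u"
  using assms by (auto simp: hcompletion_def quotient_def)

text \<open>The operations of the completion are computed with chosen representatives, which
  differ from the given ones by null sequences.\<close>

lemma some_hclass:
  assumes "hcauchy G u" shows "(u, SOME u'. u' \<in> hclass G u) \<in> hcauchy_rel G"
proof -
  have "(SOME u'. u' \<in> hclass G u) \<in> hclass G u"
    by (rule someI[of _ u]) (use assms equiv_class_self[OF hcauchy_rel_equiv] in blast)
  then show ?thesis by blast
qed

lemma hcauchy_rel_inner:
  assumes "(u, u') \<in> hcauchy_rel G" "(v, v') \<in> hcauchy_rel G"
    and l: "(\<lambda>n. hinner G (u n) (v n)) \<longlonglongrightarrow> l"
  shows "(\<lambda>n. hinner G (u' n) (v' n)) \<longlonglongrightarrow> l"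
proof -
  have h: "hcauchy G u" "hcauchy G v" "hcauchy G u'" "hcauchy G v'" "(\<lambda>n. hdist G (u n) (u' n)) \<longlonglongrightarrow> 0"
       "(\<lambda>n. hdist G (v n) (v' n)) \<longlonglongrightarrow> 0"
    using assms by (auto simp: hcauchy_rel_def)
  obtain B where B: "0 < B" "\<And>n. hnorm G (u n) \<le> B" using hcauchy_bounded[OF h(1)] by blast
  obtain B' where B': "0 < B'" "\<And>n. hnorm G (v' n) \<le> B'" using hcauchy_bounded[OF h(4)] by blast
  have s: "(\<lambda>n. B * hdist G (v n) (v' n) + hdist G (u n) (u' n) * B') \<longlonglongrightarrow> 0"
    using tendsto_add[OF tendsto_mult_right_zero[OF h(6), of B] tendsto_mult_left_zero[OF h(5), of B']] by simp
  have "(\<lambda>n. hinner G (u n) (v n) - hinner G (u' n) (v' n)) \<longlonglongrightarrow> 0"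
  proof (rule Lim_null_comparison[OF always_eventually s], rule allI)
    fix n
    have "norm (hinner G (u n) (v n) - hinner G (u' n) (v' n))
        \<le> hnorm G (u n) * hdist G (v n) (v' n) + hdist G (u n) (u' n) * hnorm G (v' n)"
      by (intro hinner_diff_le[OF G] hcauchy_car h)
    also have "\<dots> \<le> B * hdist G (v n) (v' n) + hdist G (u n) (u' n) * B'"
      by (intro add_mono mult_right_mono mult_left_mono B B' hdist_ge0[OF G] hcauchy_car h)
    finally show "norm (hinner G (u n) (v n) - hinner G (u' n) (v' n))
        \<le> B * hdist G (v n) (v' n) + hdist G (u n) (u' n) * B'" .
  qed
  from tendsto_diff[OF l this] show ?thesis by simp
qed

lemma hclass_add:
  assumes u: "hcauchy G u" and v: "hcauchy G v"
  shows "hadd (hcompletion G) (hclass G u) (hclass G v) = hclass G (\<lambda>n. hadd G (u n) (v n))"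
proof -
  define u' where "u' = (SOME u'. u' \<in> hclass G u)"
  define v' where "v' = (SOME v'. v' \<in> hclass G v)"
  have u': "hcauchy G u'" "(\<lambda>n. hdist G (u n) (u' n)) \<longlonglongrightarrow> 0"
    using some_hclass[OF u] by (auto simp: u'_def hcauchy_rel_def)
  have v': "hcauchy G v'" "(\<lambda>n. hdist G (v n) (v' n)) \<longlonglongrightarrow> 0"
    using some_hclass[OF v] by (auto simp: v'_def hcauchy_rel_def)
  have s: "(\<lambda>n. hdist G (u n) (u' n) + hdist G (v n) (v' n)) \<longlonglongrightarrow> 0"
    using tendsto_add[OF u'(2) v'(2)] by simp
  have "(\<lambda>n. hdist G (hadd G (u n) (v n)) (hadd G (u' n) (v' n))) \<longlonglongrightarrow> 0"
  proof (rule Lim_null_comparison[OF always_eventually s], rule allI)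
    fix n
    have "0 \<le> hdist G (hadd G (u n) (v n)) (hadd G (u' n) (v' n))"
      by (intro hdist_ge0[OF G] hadd_car[OF G] hcauchy_car u v u' v')
    moreover have "hdist G (hadd G (u n) (v n)) (hadd G (u' n) (v' n)) \<le> hdist G (u n) (u' n) + hdist G (v n) (v' n)"
      by (intro hdist_add_le[OF G] hcauchy_car u v u' v')
    ultimately show "norm (hdist G (hadd G (u n) (v n)) (hadd G (u' n) (v' n)))
        \<le> hdist G (u n) (u' n) + hdist G (v n) (v' n)" by simp
  qed
  then have "hclass G (\<lambda>n. hadd G (u n) (v n)) = hclass G (\<lambda>n. hadd G (u' n) (v' n))"
    by (intro hclass_eqI hcauchy_add u v u' v')
  then show ?thesis by (simp add: hcompletion_def u'_def v'_def)
qed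

lemma hclass_scale:
  assumes u: "hcauchy G u"
  shows "hscale (hcompletion G) c (hclass G u) = hclass G (\<lambda>n. hscale G c (u n))"
proof -
  define u' where "u' = (SOME u'. u' \<in> hclass G u)"
  have u': "hcauchy G u'" "(\<lambda>n. hdist G (u n) (u' n)) \<longlonglongrightarrow> 0"
    using some_hclass[OF u] by (auto simp: u'_def hcauchy_rel_def)
  have "(\<lambda>n. hdist G (hscale G c (u n)) (hscale G c (u' n))) = (\<lambda>n. cmod c * hdist G (u n) (u' n))"
    by (intro ext hdist_scale[OF G] hcauchy_car u u')
  then have "(\<lambda>n. hdist G (hscale G c (u n)) (hscale G c (u' n))) \<longlonglongrightarrow> 0"
    using tendsto_mult_right_zero[OF u'(2)] by simp
  then have "hclass G (\<lambda>n. hscale G c (u n)) = hclass G (\<lambda>n. hscale G c (u' n))"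
    by (intro hclass_eqI hcauchy_scale u u')
  then show ?thesis by (simp add: hcompletion_def u'_def)
qed

lemma hclass_zero: "hzero (hcompletion G) = hclass G (\<lambda>n. hzero G)"
  by (simp add: hcompletion_def)

lemma hclass_inner:
  assumes u: "hcauchy G u" and v: "hcauchy G v"
  shows "(\<lambda>n. hinner G (u n) (v n)) \<longlonglongrightarrow> hinner (hcompletion G) (hclass G u) (hclass G v)"
proof -
  obtain l where l: "(\<lambda>n. hinner G (u n) (v n)) \<longlonglongrightarrow> l"
    using hcauchy_inner_convergent[OF u v] by (auto simp: convergent_def)
  have "hinner (hcompletion G) (hclass G u) (hclass G v) = l"
    unfolding hcompletion_def using limI[OF hcauchy_rel_inner[OF some_hclass[OF u] some_hclass[OF v] l]] by simp
  with l show ?thesis by simp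
qed

lemma hclass_inner_eq:
  assumes "hcauchy G u" "hcauchy G v" "(\<lambda>n. hinner G (u n) (v n)) \<longlonglongrightarrow> l"
  shows "hinner (hcompletion G) (hclass G u) (hclass G v) = l"
  using LIMSEQ_unique[OF hclass_inner[OF assms(1,2)] assms(3)] .

lemmas hclass_ops = hclass_add hclass_scale hclass_zero hcauchy_add hcauchy_scale hcauchy_const

lemma hcompletion_semi: "semi_inner_space (hcompletion G)"
proof -
  let ?C = "hcompletion G"
  note ops [simp] = hclass_ops hadd_hzero[OF G] hzero_car[OF G] hcauchy_car
  have 1: "hzero ?C \<in> hcar ?C" by simp
  have 2: "\<forall>x\<in>hcar ?C. \<forall>y\<in>hcar ?C. hadd ?C x y \<in> hcar ?C" by (auto elim!: hcompletion_carE)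
  have 3: "\<forall>c. \<forall>x\<in>hcar ?C. hscale ?C c x \<in> hcar ?C" by (auto elim!: hcompletion_carE)
  have 4: "\<forall>x\<in>hcar ?C. \<forall>y\<in>hcar ?C. \<forall>z\<in>hcar ?C. hadd ?C (hadd ?C x y) z = hadd ?C x (hadd ?C y z)"
    by (auto elim!: hcompletion_carE simp: hadd_assoc[OF G])
  have 5: "\<forall>x\<in>hcar ?C. \<forall>y\<in>hcar ?C. hadd ?C x y = hadd ?C y x"
  proof (intro ballI)
    fix x y assume "x \<in> hcar ?C" "y \<in> hcar ?C"
    then obtain u v where uv: "hcauchy G u" "hcauchy G v" "x = hclass G u" "y = hclass G v"
      by (auto elim!: hcompletion_carE)
    have "(\<lambda>n. hadd G (u n) (v n)) = (\<lambda>n. hadd G (v n) (u n))"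
      by (intro ext hadd_commute[OF G] hcauchy_car uv)
    with uv show "hadd ?C x y = hadd ?C y x" by simp
  qed
  have 6: "\<forall>x\<in>hcar ?C. hadd ?C (hzero ?C) x = x" by (auto elim!: hcompletion_carE)
  have 7: "\<forall>x\<in>hcar ?C. hsub ?C x x = hzero ?C"
    by (auto elim!: hcompletion_carE simp: hsub_self[OF G])
  have 8: "\<forall>c. \<forall>x\<in>hcar ?C. \<forall>y\<in>hcar ?C. hscale ?C c (hadd ?C x y) = hadd ?C (hscale ?C c x) (hscale ?C c y)"
    by (auto elim!: hcompletion_carE simp: hscale_hadd[OF G])
  have 9: "\<forall>c d. \<forall>x\<in>hcar ?C. hscale ?C (c + d) x = hadd ?C (hscale ?C c x) (hscale ?C d x)"
    by (auto elim!: hcompletion_carE simp: hscale_plus[OF G])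
  have 10: "\<forall>c d. \<forall>x\<in>hcar ?C. hscale ?C (c * d) x = hscale ?C c (hscale ?C d x)"
    by (auto elim!: hcompletion_carE simp: hscale_times[OF G])
  have 11: "\<forall>x\<in>hcar ?C. hscale ?C 1 x = x"
    by (auto elim!: hcompletion_carE simp: hscale_one[OF G])
  have 12: "\<forall>x\<in>hcar ?C. \<forall>y\<in>hcar ?C. \<forall>z\<in>hcar ?C. hinner ?C x (hadd ?C y z) = hinner ?C x y + hinner ?C x z"
  proof (intro ballI)
    fix x y z assume "x \<in> hcar ?C" "y \<in> hcar ?C" "z \<in> hcar ?C"
    then obtain u v w where uv: "hcauchy G u" "hcauchy G v" "hcauchy G w" "x = hclass G u" "y = hclass G v" "z = hclass G w"
      by (auto elim!: hcompletion_carE)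
    have "(\<lambda>n. hinner G (u n) (hadd G (v n) (w n))) \<longlonglongrightarrow> hinner ?C x y + hinner ?C x z"
      using tendsto_add[OF hclass_inner[OF uv(1,2)] hclass_inner[OF uv(1,3)]] uv by (simp add: hinner_add_right[OF G])
    then show "hinner ?C x (hadd ?C y z) = hinner ?C x y + hinner ?C x z"
      using hclass_inner_eq[OF uv(1) hcauchy_add[OF uv(2,3)]] uv by simp
  qed
  have 13: "\<forall>c. \<forall>x\<in>hcar ?C. \<forall>y\<in>hcar ?C. hinner ?C x (hscale ?C c y) = c * hinner ?C x y"
  proof (intro ballI allI)
    fix c x y assume "x \<in> hcar ?C" "y \<in> hcar ?C"
    then obtain u v where uv: "hcauchy G u" "hcauchy G v" "x = hclass G u" "y = hclass G v"
      by (auto elim!: hcompletion_carE)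
    have "(\<lambda>n. hinner G (u n) (hscale G c (v n))) \<longlonglongrightarrow> c * hinner ?C x y"
      using tendsto_mult_left[OF hclass_inner[OF uv(1,2)], of c] uv by (simp add: hinner_scale_right[OF G])
    then show "hinner ?C x (hscale ?C c y) = c * hinner ?C x y"
      using hclass_inner_eq[OF uv(1) hcauchy_scale[OF uv(2)]] uv by simp
  qed
  have 14: "\<forall>x\<in>hcar ?C. \<forall>y\<in>hcar ?C. hinner ?C y x = cnj (hinner ?C x y)"
  proof (intro ballI)
    fix x y assume "x \<in> hcar ?C" "y \<in> hcar ?C"
    then obtain u v where uv: "hcauchy G u" "hcauchy G v" "x = hclass G u" "y = hclass G v"
      by (auto elim!: hcompletion_carE)
    have "(\<lambda>n. hinner G (v n) (u n)) = (\<lambda>n. cnj (hinner G (u n) (v n)))"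
      by (intro ext hinner_commute[OF G] hcauchy_car uv)
    then have "(\<lambda>n. hinner G (v n) (u n)) \<longlonglongrightarrow> cnj (hinner ?C x y)"
      using tendsto_cnj[OF hclass_inner[OF uv(1,2)]] uv by simp
    then show "hinner ?C y x = cnj (hinner ?C x y)"
      using hclass_inner_eq[OF uv(2,1)] uv by simp
  qed
  have 15: "\<forall>x\<in>hcar ?C. 0 \<le> Re (hinner ?C x x)"
  proof
    fix x assume "x \<in> hcar ?C"
    then obtain u where u: "hcauchy G u" "x = hclass G u" by (auto elim!: hcompletion_carE)
    have "(\<lambda>n. Re (hinner G (u n) (u n))) \<longlonglongrightarrow> Re (hinner ?C x x)"
      using tendsto_Re[OF hclass_inner[OF u(1) u(1)]] u by simp
    then show "0 \<le> Re (hinner ?C x x)"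
      by (rule LIMSEQ_le_const) (auto intro!: hinner_ge0[OF G] hcauchy_car[OF u(1)])
  qed
  show ?thesis unfolding semi_inner_space_def
    by (intro conjI) (fact 1 2 3 4 5 6 7 8 9 10 11 12 13 14 15)+
qed

lemma hclass_hdist:
  assumes u: "hcauchy G u" and v: "hcauchy G v"
  shows "(\<lambda>n. hdist G (u n) (v n)) \<longlonglongrightarrow> hdist (hcompletion G) (hclass G u) (hclass G v)"
proof -
  let ?w = "\<lambda>n. hsub G (u n) (v n)"
  have w: "hcauchy G ?w" by (intro hcauchy_add hcauchy_scale u v)
  have "hclass G ?w = hsub (hcompletion G) (hclass G u) (hclass G v)"
    using u v by (simp add: hclass_ops)
  then show ?thesis
    unfolding hdist_def hnorm_def using tendsto_real_sqrt[OF tendsto_Re[OF hclass_inner[OF w w]]] by simp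
qed

lemma hclass_const_tendsto:
  assumes u: "hcauchy G u"
  shows "(\<lambda>m. hdist (hcompletion G) (hclass G (\<lambda>n. u m)) (hclass G u)) \<longlonglongrightarrow> 0"
proof (rule LIMSEQ_I)
  fix r :: real assume "0 < r"
  then have r: "0 < r / 2" by simp
  obtain N where N: "\<And>m n. m \<ge> N \<Longrightarrow> n \<ge> N \<Longrightarrow> hdist G (u m) (u n) < r / 2"
    using u r unfolding hcauchy_def by meson
  have "norm (hdist (hcompletion G) (hclass G (\<lambda>n. u m)) (hclass G u) - 0) < r" if "m \<ge> N" for m
  proof -
    have c: "hcauchy G (\<lambda>n. u m)" by (intro hcauchy_const hcauchy_car u)
    have "hdist (hcompletion G) (hclass G (\<lambda>n. u m)) (hclass G u) \<le> r / 2"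
      by (rule LIMSEQ_le_const2[OF hclass_hdist[OF c u]]) (use N[OF that] in \<open>auto intro!: exI[of _ N] less_imp_le\<close>)
    moreover have "0 \<le> hdist (hcompletion G) (hclass G (\<lambda>n. u m)) (hclass G u)"
      by (intro hdist_ge0[OF hcompletion_semi] hclass_car c u)
    ultimately show ?thesis using \<open>0 < r\<close> by simp
  qed
  then show "\<exists>no. \<forall>n\<ge>no. norm (hdist (hcompletion G) (hclass G (\<lambda>na. u n)) (hclass G u) - 0) < r" by blast
qed

text \<open>A Cauchy sequence of classes has a limit: choose constant classes at distance less than
  \<open>1 / (n + 1)\<close> from its terms. The constants form a Cauchy sequence, and its class is the limit.\<close>

lemma hcompletion_hilbert: "hilbert_space (hcompletion G)"
  unfolding hilbert_space_def
proof (intro conjI ballI allI impI)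
  let ?C = "hcompletion G"
  note C = hcompletion_semi
  show "semi_inner_space ?C" by (rule C)
  show "x = hzero ?C" if x: "x \<in> hcar ?C" and z: "hinner ?C x x = 0" for x
  proof -
    obtain u where u: "hcauchy G u" "x = hclass G u" using x by (auto elim!: hcompletion_carE)
    have z': "hcauchy G (\<lambda>n. hzero G)" by (intro hcauchy_const hzero_car[OF G])
    have "hinner ?C (hsub ?C x (hzero ?C)) (hsub ?C x (hzero ?C)) = 0"
      using x z C by simp
    then have "hdist ?C (hclass G u) (hclass G (\<lambda>n. hzero G)) = 0"
      unfolding hdist_def hnorm_def using u by (simp add: hclass_zero)
    then have "(\<lambda>n. hdist G (u n) (hzero G)) \<longlonglongrightarrow> 0"
      using hclass_hdist[OF u(1) z'] by simp
    then show ?thesis using hclass_eqI[OF u(1) z'] u by (simp add: hclass_zero)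
  qed
  fix U assume U: "hcauchy ?C U"
  have "\<exists>x\<in>hcar G. hdist ?C (hclass G (\<lambda>k. x)) (U n) < inverse (real (Suc n))" for n
  proof -
    obtain u where u: "hcauchy G u" "U n = hclass G u"
      using hcauchy_car[OF U, of n] by (auto elim!: hcompletion_carE)
    have "0 < inverse (real (Suc n))" by simp
    then obtain m where "norm (hdist ?C (hclass G (\<lambda>n. u m)) (hclass G u) - 0) < inverse (real (Suc n))"
      using LIMSEQ_D[OF hclass_const_tendsto[OF u(1)]] by blast
    then show ?thesis using u hcauchy_car[OF u(1), of m] by (auto intro!: bexI[of _ "u m"])
  qed
  then obtain x where x: "\<And>n. x n \<in> hcar G"
      "\<And>n. hdist ?C (hclass G (\<lambda>k. x n)) (U n) < inverse (real (Suc n))"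
    by metis
  have cx: "hclass G (\<lambda>k. x n) \<in> hcar ?C" for n by (intro hclass_car hcauchy_const x)
  have dx: "hdist G (x m) (x n) = hdist ?C (hclass G (\<lambda>k. x m)) (hclass G (\<lambda>k. x n))" for m n
    using LIMSEQ_unique[OF tendsto_const hclass_hdist[OF hcauchy_const[OF x(1)] hcauchy_const[OF x(1)]], of m n] by simp
  have inv: "(\<lambda>n. inverse (real (Suc n))) \<longlonglongrightarrow> 0" by (rule LIMSEQ_inverse_real_of_nat)
  have xc: "hcauchy G x"
  proof (rule hcauchyI[OF x(1)])
    fix e :: real assume "0 < e"
    then have e: "0 < e / 3" by simp
    obtain N where N: "\<And>m n. m \<ge> N \<Longrightarrow> n \<ge> N \<Longrightarrow> hdist ?C (U m) (U n) < e / 3"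
      using U e unfolding hcauchy_def by meson
    obtain N' where N': "\<And>n. n \<ge> N' \<Longrightarrow> norm (inverse (real (Suc n)) - 0) < e / 3"
      using LIMSEQ_D[OF inv e] by blast
    have "hdist G (x m) (x n) < e" if mn: "m \<ge> max N N'" "n \<ge> max N N'" for m n
    proof -
      have "hdist G (x m) (x n) \<le> hdist ?C (hclass G (\<lambda>k. x m)) (U m) + hdist ?C (U m) (hclass G (\<lambda>k. x n))"
        unfolding dx by (intro hdist_triangle[OF C] cx hcauchy_car U)
      also have "\<dots> \<le> hdist ?C (hclass G (\<lambda>k. x m)) (U m) + (hdist ?C (U m) (U n) + hdist ?C (U n) (hclass G (\<lambda>k. x n)))"
        by (intro add_left_mono hdist_triangle[OF C] cx hcauchy_car U)
      also have "hdist ?C (U n) (hclass G (\<lambda>k. x n)) = hdist ?C (hclass G (\<lambda>k. x n)) (U n)"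
        by (intro hdist_commute[OF C] cx hcauchy_car U)
      finally have "hdist G (x m) (x n) < inverse (real (Suc m)) + hdist ?C (U m) (U n) + inverse (real (Suc n))"
        using x(2)[of m] x(2)[of n] by linarith
      moreover have "inverse (real (Suc m)) < e / 3" "inverse (real (Suc n)) < e / 3"
        using N'[of m] N'[of n] mn by auto
      moreover have "hdist ?C (U m) (U n) < e / 3" using N mn by simp
      ultimately show ?thesis by linarith
    qed
    then show "\<exists>N. \<forall>m\<ge>N. \<forall>n\<ge>N. hdist G (x m) (x n) < e" by blast
  qed
  have s: "(\<lambda>n. inverse (real (Suc n)) + hdist ?C (hclass G (\<lambda>k. x n)) (hclass G x)) \<longlonglongrightarrow> 0"
    using tendsto_add[OF inv hclass_const_tendsto[OF xc]] by simp
  have "(\<lambda>n. hdist ?C (U n) (hclass G x)) \<longlonglongrightarrow> 0"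
  proof (rule Lim_null_comparison[OF always_eventually s], rule allI)
    fix n
    have "hdist ?C (U n) (hclass G x) \<le> hdist ?C (U n) (hclass G (\<lambda>k. x n)) + hdist ?C (hclass G (\<lambda>k. x n)) (hclass G x)"
      by (intro hdist_triangle[OF C] cx hcauchy_car U hclass_car xc)
    moreover have "hdist ?C (U n) (hclass G (\<lambda>k. x n)) = hdist ?C (hclass G (\<lambda>k. x n)) (U n)"
      by (intro hdist_commute[OF C] cx hcauchy_car U)
    moreover have "0 \<le> hdist ?C (U n) (hclass G x)"
      by (intro hdist_ge0[OF C] hcauchy_car U hclass_car xc)
    ultimately show "norm (hdist ?C (U n) (hclass G x))
        \<le> inverse (real (Suc n)) + hdist ?C (hclass G (\<lambda>k. x n)) (hclass G x)"
      using x(2)[of n] by simp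
  qed
  then show "\<exists>x\<in>hcar ?C. (\<lambda>n. hdist ?C (U n) x) \<longlonglongrightarrow> 0" using hclass_car[OF xc] by blast
qed

end

section \<open>Positive semidefinite kernels\<close>

text \<open>Repetitions are allowed among the points, so that positivity is inherited along arbitrary maps of the
  points.\<close>

definition kform :: "('x \<Rightarrow> 'x \<Rightarrow> complex) \<Rightarrow> nat \<Rightarrow> (nat \<Rightarrow> 'x) \<Rightarrow> (nat \<Rightarrow> complex) \<Rightarrow> complex" where
  "kform k n x c = (\<Sum>i<n. \<Sum>j<n. cnj (c i) * c j * k (x i) (x j))"

definition psd :: "'x set \<Rightarrow> ('x \<Rightarrow> 'x \<Rightarrow> complex) \<Rightarrow> bool" where
  "psd X k \<longleftrightarrow> (\<forall>n x c. (\<forall>i<n. x i \<in> X) \<longrightarrow> Im (kform k n x c) = 0 \<and> 0 \<le> Re (kform k n x c))"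

lemma psdI:
  assumes "\<And>n x c. (\<And>i. i < n \<Longrightarrow> x i \<in> X) \<Longrightarrow> Im (kform k n x c) = 0 \<and> 0 \<le> Re (kform k n x c)"
  shows "psd X k"
  using assms by (auto simp: psd_def)

lemma psd_pullback: "psd Y k \<Longrightarrow> (\<And>x. x \<in> X \<Longrightarrow> \<phi> x \<in> Y) \<Longrightarrow> psd X (\<lambda>x y. k (\<phi> x) (\<phi> y))"
  by (auto simp: psd_def kform_def dest!: spec[of _ "\<phi> \<circ> (_ :: nat \<Rightarrow> _)"])

lemma kform_cong:
  "(\<And>i j. i < n \<Longrightarrow> j < n \<Longrightarrow> k (x i) (x j) = k' (y i) (y j)) \<Longrightarrow> kform k n x c = kform k' n y c"
  unfolding kform_def by (intro sum.cong refl) auto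

lemma psd_cong:
  assumes "\<And>x y. x \<in> X \<Longrightarrow> y \<in> X \<Longrightarrow> k x y = k' x y" shows "psd X k \<longleftrightarrow> psd X k'"
proof -
  have "kform k n x c = kform k' n x c" if "\<forall>i<n. x i \<in> X" for n x c
    using that assms by (intro kform_cong) auto
  then show ?thesis unfolding psd_def by metis
qed

lemma kform_diff: "kform (\<lambda>x y. k x y - l x y) n x c = kform k n x c - kform l n x c"
  by (simp add: kform_def sum_subtractf right_diff_distrib)

lemma kform_mult: "kform (\<lambda>x y. a * k x y) n x c = a * kform k n x c"
  by (simp add: kform_def sum_distrib_left mult.left_commute)

lemma psd_sums:
  assumes k: "\<And>i. psd X (k i)" and s: "\<And>x y. x \<in> X \<Longrightarrow> y \<in> X \<Longrightarrow> (\<lambda>i. k i x y) sums K x y"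
  shows "psd X K"
proof (rule psdI)
  fix n :: nat and x :: "nat \<Rightarrow> _" and c assume x: "\<And>i. i < n \<Longrightarrow> x i \<in> X"
  have "(\<lambda>m. kform (k m) n x c) sums kform K n x c"
    unfolding kform_def by (intro sums_sum sums_mult s x) auto
  then have *: "(\<lambda>m. Re (kform (k m) n x c)) sums Re (kform K n x c)"
    "(\<lambda>m. Im (kform (k m) n x c)) sums Im (kform K n x c)"
    by (simp_all add: sums_complex_iff)
  have i: "Im (kform (k m) n x c) = 0" "0 \<le> Re (kform (k m) n x c)" for m
    using k[of m] x by (auto simp: psd_def)
  have "Im (kform K n x c) = 0"
    by (rule sums_unique2[OF *(2)]) (simp add: i)
  moreover have "0 \<le> Re (kform K n x c)"
    by (rule sums_le[OF _ sums_zero *(1)]) (rule i)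
  ultimately show "Im (kform K n x c) = 0 \<and> 0 \<le> Re (kform K n x c)" by simp
qed

lemma psd_diag:
  assumes "psd X k" "x \<in> X" shows "Im (k x x) = 0" "0 \<le> Re (k x x)"
  using assms(1)[unfolded psd_def, rule_format, of 1 "\<lambda>_. x" "\<lambda>_. 1"] assms(2) by (auto simp: kform_def)

text \<open>Polarization: the form is real at the coefficients \<open>(1, 1)\<close> and \<open>(1, \<i>)\<close>.\<close>

lemma psd_herm:
  assumes k: "psd X k" and x: "x \<in> X" and y: "y \<in> X"
  shows "k y x = cnj (k x y)"
proof -
  have two: "{..<2::nat} = {0, 1}" by auto
  have "Im (kform k 2 (\<lambda>i. if i = 0 then x else y) (\<lambda>_. 1)) = 0"
    using k x y unfolding psd_def by simp
  then have 1: "Im (k x y) + Im (k y x) = 0"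
    using psd_diag[OF k x] psd_diag[OF k y] by (simp add: kform_def two)
  have "Im (kform k 2 (\<lambda>i. if i = 0 then x else y) (\<lambda>i. if i = 0 then 1 else \<i>)) = 0"
    using k x y unfolding psd_def by simp
  then have 2: "Re (k x y) - Re (k y x) = 0"
    using psd_diag[OF k x] psd_diag[OF k y] by (simp add: kform_def two)
  from 1 2 show ?thesis by (simp add: complex_eq_iff)
qed

lemma psd_set:
  assumes k: "psd X k" and F: "finite F" "F \<subseteq> X"
  shows "Im (\<Sum>x\<in>F. \<Sum>y\<in>F. cnj (c x) * c y * k x y) = 0"
    and "0 \<le> Re (\<Sum>x\<in>F. \<Sum>y\<in>F. cnj (c x) * c y * k x y)"
proof -
  obtain h where h: "bij_betw h {..<card F} F"
    using ex_bij_betw_nat_finite[OF F(1)] by (auto simp: atLeast0LessThan)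
  have "(\<Sum>x\<in>F. \<Sum>y\<in>F. cnj (c x) * c y * k x y) = kform k (card F) h (c \<circ> h)"
    unfolding kform_def sum.reindex_bij_betw[OF h, symmetric] by simp
  moreover have "\<forall>i<card F. h i \<in> X" using h F bij_betwE by fastforce
  ultimately show "Im (\<Sum>x\<in>F. \<Sum>y\<in>F. cnj (c x) * c y * k x y) = 0"
    and "0 \<le> Re (\<Sum>x\<in>F. \<Sum>y\<in>F. cnj (c x) * c y * k x y)"
    using k unfolding psd_def by metis+
qed

abbreviation supp :: "('x \<Rightarrow> complex) \<Rightarrow> 'x set" where
  "supp c \<equiv> {x. c x \<noteq> 0}"

lemma free_inner:
  assumes "finite F" "supp c \<subseteq> F" "supp d \<subseteq> F"
  shows "hinner (free_space X k) c d = (\<Sum>x\<in>F. \<Sum>y\<in>F. cnj (c x) * d y * k x y)"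
proof -
  have "(\<Sum>x\<in>F. \<Sum>y\<in>F. cnj (c x) * d y * k x y) = (\<Sum>x\<in>supp c. \<Sum>y\<in>F. cnj (c x) * d y * k x y)"
    by (rule sum.mono_neutral_right) (use assms in auto)
  also have "\<dots> = (\<Sum>x\<in>supp c. \<Sum>y\<in>supp d. cnj (c x) * d y * k x y)"
    by (intro sum.cong refl sum.mono_neutral_right) (use assms in auto)
  finally show ?thesis by (simp add: free_space_def)
qed

lemma free_simps [simp]:
  "c \<in> hcar (free_space X k) \<longleftrightarrow> finite (supp c) \<and> supp c \<subseteq> X"
  "hadd (free_space X k) c d = (\<lambda>x. c x + d x)"
  "hscale (free_space X k) z c = (\<lambda>x. z * c x)"
  "hzero (free_space X k) = (\<lambda>x. 0)"
  by (auto simp: free_space_def)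

lemma supp_add: "supp (\<lambda>x. c x + d x) \<subseteq> supp c \<union> supp d" by auto
lemma supp_scale: "supp (\<lambda>x. z * c x) \<subseteq> supp c" by auto

lemma free_semi:
  assumes k: "psd X k" shows "semi_inner_space (free_space X k)"
proof -
  let ?G = "free_space X k"
  have 2: "\<forall>x\<in>hcar ?G. \<forall>y\<in>hcar ?G. hadd ?G x y \<in> hcar ?G"
  proof (intro ballI)
    fix c d assume "c \<in> hcar ?G" "d \<in> hcar ?G"
    then show "hadd ?G c d \<in> hcar ?G" using supp_add[of c d] by (auto intro: finite_subset[OF supp_add[of c d]])
  qed
  have 3: "\<forall>z. \<forall>x\<in>hcar ?G. hscale ?G z x \<in> hcar ?G"
  proof (intro ballI allI)
    fix z c assume "c \<in> hcar ?G"
    then show "hscale ?G z c \<in> hcar ?G" by (auto intro: finite_subset[OF supp_scale[of z c]])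
  qed
  have 12: "\<forall>x\<in>hcar ?G. \<forall>y\<in>hcar ?G. \<forall>z\<in>hcar ?G. hinner ?G x (hadd ?G y z) = hinner ?G x y + hinner ?G x z"
  proof (intro ballI)
    fix a c d assume h: "a \<in> hcar ?G" "c \<in> hcar ?G" "d \<in> hcar ?G"
    let ?F = "supp a \<union> supp c \<union> supp d"
    have F: "finite ?F" using h by simp
    have "hinner ?G a (hadd ?G c d) = (\<Sum>x\<in>?F. \<Sum>y\<in>?F. cnj (a x) * (c y + d y) * k x y)"
      by (subst free_inner[OF F]) auto
    moreover have "hinner ?G a c = (\<Sum>x\<in>?F. \<Sum>y\<in>?F. cnj (a x) * c y * k x y)"
      by (rule free_inner[OF F]) auto
    moreover have "hinner ?G a d = (\<Sum>x\<in>?F. \<Sum>y\<in>?F. cnj (a x) * d y * k x y)"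
      by (rule free_inner[OF F]) auto
    ultimately show "hinner ?G a (hadd ?G c d) = hinner ?G a c + hinner ?G a d"
      by (simp add: sum.distrib algebra_simps)
  qed
  have 13: "\<forall>c. \<forall>x\<in>hcar ?G. \<forall>y\<in>hcar ?G. hinner ?G x (hscale ?G c y) = c * hinner ?G x y"
  proof (intro ballI allI)
    fix z a c assume h: "a \<in> hcar ?G" "c \<in> hcar ?G"
    let ?F = "supp a \<union> supp c"
    have F: "finite ?F" using h by simp
    have "hinner ?G a (hscale ?G z c) = (\<Sum>x\<in>?F. \<Sum>y\<in>?F. cnj (a x) * (z * c y) * k x y)"
      by (subst free_inner[OF F]) auto
    moreover have "hinner ?G a c = (\<Sum>x\<in>?F. \<Sum>y\<in>?F. cnj (a x) * c y * k x y)"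
      by (rule free_inner[OF F]) auto
    ultimately show "hinner ?G a (hscale ?G z c) = z * hinner ?G a c"
      by (simp add: sum_distrib_left mult.assoc mult.left_commute)
  qed
  have 14: "\<forall>x\<in>hcar ?G. \<forall>y\<in>hcar ?G. hinner ?G y x = cnj (hinner ?G x y)"
  proof (intro ballI)
    fix a c assume h: "a \<in> hcar ?G" "c \<in> hcar ?G"
    let ?F = "supp a \<union> supp c"
    have F: "finite ?F" "?F \<subseteq> X" using h by auto
    have "hinner ?G c a = (\<Sum>x\<in>?F. \<Sum>y\<in>?F. cnj (c x) * a y * k x y)"
      by (rule free_inner[OF F(1)]) auto
    also have "\<dots> = (\<Sum>y\<in>?F. \<Sum>x\<in>?F. cnj (c x) * a y * k x y)" by (rule sum.swap)
    also have "\<dots> = (\<Sum>y\<in>?F. \<Sum>x\<in>?F. cnj (cnj (a y) * c x * k y x))"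
    proof (intro sum.cong refl)
      fix y x assume "y \<in> ?F" "x \<in> ?F"
      then have "k x y = cnj (k y x)" using F(2) by (intro psd_herm[OF k]) auto
      then show "cnj (c x) * a y * k x y = cnj (cnj (a y) * c x * k y x)" by simp
    qed
    also have "\<dots> = cnj (hinner ?G a c)"
      by (subst free_inner[OF F(1)]) auto
    finally show "hinner ?G c a = cnj (hinner ?G a c)" .
  qed
  have 15: "\<forall>x\<in>hcar ?G. 0 \<le> Re (hinner ?G x x)"
  proof
    fix c assume h: "c \<in> hcar ?G"
    then show "0 \<le> Re (hinner ?G c c)"
      using psd_set(2)[OF k, of "supp c" c] by (subst free_inner[of "supp c"]) auto
  qed
  have 1: "hzero ?G \<in> hcar ?G"
    and 4: "\<forall>x\<in>hcar ?G. \<forall>y\<in>hcar ?G. \<forall>z\<in>hcar ?G. hadd ?G (hadd ?G x y) z = hadd ?G x (hadd ?G y z)"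
    and 5: "\<forall>x\<in>hcar ?G. \<forall>y\<in>hcar ?G. hadd ?G x y = hadd ?G y x"
    and 6: "\<forall>x\<in>hcar ?G. hadd ?G (hzero ?G) x = x"
    and 7: "\<forall>x\<in>hcar ?G. hsub ?G x x = hzero ?G"
    and 8: "\<forall>c. \<forall>x\<in>hcar ?G. \<forall>y\<in>hcar ?G. hscale ?G c (hadd ?G x y) = hadd ?G (hscale ?G c x) (hscale ?G c y)"
    and 9: "\<forall>c d. \<forall>x\<in>hcar ?G. hscale ?G (c + d) x = hadd ?G (hscale ?G c x) (hscale ?G d x)"
    and 10: "\<forall>c d. \<forall>x\<in>hcar ?G. hscale ?G (c * d) x = hscale ?G c (hscale ?G d x)"
    and 11: "\<forall>x\<in>hcar ?G. hscale ?G 1 x = x"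
    by (simp_all add: ac_simps distrib_left distrib_right)
  show ?thesis unfolding semi_inner_space_def
    by (intro conjI) (fact 1 2 3 4 5 6 7 8 9 10 11 12 13 14 15)+
qed

lemma kspace_hilbert: "psd X k \<Longrightarrow> hilbert_space (kspace X k)"
  unfolding kspace_def by (intro hcompletion_hilbert free_semi)

abbreviation kdelta :: "'x \<Rightarrow> 'x \<Rightarrow> complex" where
  "kdelta x \<equiv> (\<lambda>y. if y = x then 1 else 0)"

lemma kdelta_car: "x \<in> X \<Longrightarrow> kdelta x \<in> hcar (free_space X k)"
  by auto

lemma kgen_class: "kgen X k x = hclass (free_space X k) (\<lambda>n. kdelta x)"
  by (simp add: kgen_def)

context
  fixes X :: "'x set" and k
  assumes k: "psd X k"
begin

lemma kgen_car [simp, intro]: "x \<in> X \<Longrightarrow> kgen X k x \<in> hcar (kspace X k)"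
  unfolding kgen_class kspace_def
  by (rule hclass_car[OF free_semi[OF k] hcauchy_const[OF free_semi[OF k] kdelta_car]])

lemma free_inner_kdelta:
  assumes "finite (supp c)" shows "hinner (free_space X k) c (kdelta y) = (\<Sum>x\<in>supp c. cnj (c x) * k x y)"
proof -
  have "supp (kdelta y) = {y}" by auto
  then show ?thesis by (simp add: free_space_def)
qed

lemma kgen_inner:
  assumes "x \<in> X" "y \<in> X" shows "hinner (kspace X k) (kgen X k x) (kgen X k y) = k x y"
proof -
  have "supp (kdelta x) = {x}" by auto
  then have "hinner (free_space X k) (kdelta x) (kdelta y) = k x y"
    by (subst free_inner_kdelta) auto
  then show ?thesis unfolding kgen_class kspace_def
    by (intro hclass_inner_eq[OF free_semi[OF k]] hcauchy_const[OF free_semi[OF k]] kdelta_car assms) simp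
qed

text \<open>A vector orthogonal to the generators is orthogonal to their finite combinations, and
  it is the limit of such combinations.\<close>

lemma kgen_total: "total (kspace X k) (kgen X k ` X)"
  unfolding total_def
proof (intro conjI ballI impI)
  let ?F = "free_space X k"
  note F = free_semi[OF k]
  show "kgen X k ` X \<subseteq> hcar (kspace X k)" by auto
  fix w assume w: "w \<in> hcar (kspace X k)" and o: "\<forall>d\<in>kgen X k ` X. hinner (kspace X k) d w = 0"
  obtain u where u: "hcauchy ?F u" "w = hclass ?F u"
    using w hcompletion_carE[OF F] unfolding kspace_def by blast
  have fin: "finite (supp (u m))" "supp (u m) \<subseteq> X" for m using hcauchy_car[OF u(1), of m] by auto
  have z: "(\<lambda>n. hinner ?F (kdelta x) (u n)) \<longlonglongrightarrow> 0" if "x \<in> X" for x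
    using hclass_inner[OF F hcauchy_const[OF F kdelta_car[OF that]] u(1)] o that u(2)
    by (auto simp: kspace_def kgen_class)
  have um: "hinner (kspace X k) (hclass ?F (\<lambda>n. u m)) w = 0" for m
  proof -
    have "hinner ?F (u m) (u n) = (\<Sum>x\<in>supp (u m). cnj (u m x) * hinner ?F (kdelta x) (u n))" for n
    proof -
      have "supp (kdelta x) = {x}" for x :: 'x by auto
      then show ?thesis by (simp add: free_space_def sum_distrib_left mult.assoc)
    qed
    moreover have "(\<lambda>n. \<Sum>x\<in>supp (u m). cnj (u m x) * hinner ?F (kdelta x) (u n)) \<longlonglongrightarrow> (\<Sum>x\<in>supp (u m). cnj (u m x) * 0)"
      by (intro tendsto_sum tendsto_mult_left z) (use fin in auto)
    ultimately have "(\<lambda>n. hinner ?F (u m) (u n)) \<longlonglongrightarrow> 0" by simp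
    then show ?thesis unfolding kspace_def u(2)
      by (intro hclass_inner_eq[OF F] hcauchy_const[OF F] hcauchy_car u)
  qed
  have "(\<lambda>m. hinner (kspace X k) (hclass ?F (\<lambda>n. u m)) w) \<longlonglongrightarrow> hinner (kspace X k) w w"
    unfolding kspace_def u(2)
    by (rule hinner_tendsto[OF hcompletion_semi[OF F]])
      (use hclass_car[OF F] hcauchy_const[OF F] hcauchy_car[OF u(1)] u(1) hclass_const_tendsto[OF F u(1)]
          hdist_self[OF hcompletion_semi[OF F]] in simp_all)
  then have "(\<lambda>m::nat. 0) \<longlonglongrightarrow> hinner (kspace X k) w w" unfolding um .
  then have "hinner (kspace X k) w w = 0" by (rule LIMSEQ_unique[OF _ tendsto_const])
  then show "w = hzero (kspace X k)" using kspace_hilbert[OF k] w by (rule hilbert_definite[rotated 2])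
qed

text \<open>On finite combinations the prescribed values extend linearly to a map \<open>V\<close>, and the domination of
  the kernel of the values says that \<open>\<parallel>V c\<parallel> \<le> C \<parallel>c\<parallel>\<close>. Hence \<open>V\<close> maps Cauchy sequences to Cauchy sequences and
  induces an operator on the completion.\<close>

lemma kext_exists:
  assumes G: "hilbert_space G" and f: "\<And>x. x \<in> X \<Longrightarrow> f x \<in> hcar G"
    and C: "0 \<le> C" and dom: "psd X (\<lambda>x y. of_real (C\<^sup>2) * k x y - hinner G (f x) (f y))"
  obtains A where "A \<in> bop (kspace X k) G" "\<And>x. x \<in> X \<Longrightarrow> A (kgen X k x) = f x"
    "\<And>v. v \<in> hcar (kspace X k) \<Longrightarrow> hnorm G (A v) \<le> C * hnorm (kspace X k) v"
proof -
  let ?F = "free_space X k" and ?K = "kspace X k"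
  note F = free_semi[OF k] and S = hilbert_semi[OF G]
  \<comment> \<open>A finite combination of the values, described by its inner products since sums in \<open>G\<close> are not sums of a type class.\<close>
  have ex: "\<exists>v\<in>hcar G. \<forall>y\<in>hcar G. hinner G y v = (\<Sum>x\<in>B. c x * hinner G y (f x))"
    if "finite B" "B \<subseteq> X" for B and c :: "'x \<Rightarrow> complex"
    using that
  proof (induction B)
    case empty
    show ?case using S by (intro bexI[of _ "hzero G"]) auto
  next
    case (insert b B)
    then obtain v where v: "v \<in> hcar G" "\<forall>y\<in>hcar G. hinner G y v = (\<Sum>x\<in>B. c x * hinner G y (f x))" by auto
    have "f b \<in> hcar G" using insert f by auto
    then show ?case using v insert S by (intro bexI[of _ "hadd G (hscale G (c b) (f b)) v"]) auto
  qed
  have "\<exists>v\<in>hcar G. \<forall>y\<in>hcar G. hinner G y v = (\<Sum>x\<in>supp c. c x * hinner G y (f x))"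
    if "c \<in> hcar ?F" for c using ex[of "supp c" c] that by auto
  then obtain V where V: "\<And>c. c \<in> hcar ?F \<Longrightarrow> V c \<in> hcar G"
    and Vi: "\<And>c y. c \<in> hcar ?F \<Longrightarrow> y \<in> hcar G \<Longrightarrow> hinner G y (V c) = (\<Sum>x\<in>supp c. c x * hinner G y (f x))"
    by metis
  have Vi': "hinner G y (V c) = (\<Sum>x\<in>B. c x * hinner G y (f x))"
    if "c \<in> hcar ?F" "y \<in> hcar G" "finite B" "supp c \<subseteq> B" for c y B
    unfolding Vi[OF that(1,2)] by (rule sum.mono_neutral_left) (use that in auto)
  have Vadd: "V (\<lambda>x. c x + d x) = hadd G (V c) (V d)" if "c \<in> hcar ?F" "d \<in> hcar ?F" for c d
  proof (rule hilbert_eqI[OF G])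
    have cd: "(\<lambda>x. c x + d x) \<in> hcar ?F" using hadd_car[OF F that] by simp
    then show "V (\<lambda>x. c x + d x) \<in> hcar G" by (rule V)
    show "hadd G (V c) (V d) \<in> hcar G" using V that S by auto
    fix y assume y: "y \<in> hcar G"
    let ?B = "supp c \<union> supp d"
    have B: "finite ?B" using that by simp
    have "hinner G y (V (\<lambda>x. c x + d x)) = (\<Sum>x\<in>?B. (c x + d x) * hinner G y (f x))"
      by (rule Vi'[OF cd y B supp_add])
    also have "\<dots> = (\<Sum>x\<in>?B. c x * hinner G y (f x)) + (\<Sum>x\<in>?B. d x * hinner G y (f x))"
      by (simp add: distrib_right sum.distrib)
    also have "\<dots> = hinner G y (V c) + hinner G y (V d)"
      using Vi'[OF that(1) y B] Vi'[OF that(2) y B] by auto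
    finally show "hinner G y (V (\<lambda>x. c x + d x)) = hinner G y (hadd G (V c) (V d))"
      using V that S y by simp
  qed
  have Vscale: "V (\<lambda>x. z * c x) = hscale G z (V c)" if "c \<in> hcar ?F" for z c
  proof (rule hilbert_eqI[OF G])
    have cd: "(\<lambda>x. z * c x) \<in> hcar ?F" using hscale_car[OF F that] by simp
    then show "V (\<lambda>x. z * c x) \<in> hcar G" by (rule V)
    show "hscale G z (V c) \<in> hcar G" using V that S by auto
    fix y assume y: "y \<in> hcar G"
    have "hinner G y (V (\<lambda>x. z * c x)) = (\<Sum>x\<in>supp c. (z * c x) * hinner G y (f x))"
      by (rule Vi'[OF cd y _ supp_scale]) (use that in auto)
    then show "hinner G y (V (\<lambda>x. z * c x)) = hinner G y (hscale G z (V c))"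
      using V that S y Vi[OF that y] by (simp add: sum_distrib_left mult.assoc)
  qed
  have Vnorm: "hnorm G (V c) \<le> C * hnorm ?F c" if "c \<in> hcar ?F" for c
  proof (rule power2_le_imp_le)
    have c: "finite (supp c)" "supp c \<subseteq> X" using that by auto
    have fV: "hinner G (V c) (f x) = (\<Sum>y\<in>supp c. cnj (c y) * hinner G (f y) (f x))" if "x \<in> supp c" for x
    proof -
      have fx: "f x \<in> hcar G" using that c f by auto
      have "hinner G (V c) (f x) = cnj (\<Sum>y\<in>supp c. c y * hinner G (f x) (f y))"
        using hinner_commute[OF S fx V[OF \<open>c \<in> hcar ?F\<close>]] Vi[OF \<open>c \<in> hcar ?F\<close> fx] by simp
      also have "\<dots> = (\<Sum>y\<in>supp c. cnj (c y) * hinner G (f y) (f x))"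
        using c f fx hinner_commute[OF S fx f] by (simp add: subset_iff)
      finally show ?thesis .
    qed
    have "hinner G (V c) (V c) = (\<Sum>x\<in>supp c. c x * (\<Sum>y\<in>supp c. cnj (c y) * hinner G (f y) (f x)))"
      unfolding Vi[OF that V[OF that]] by (intro sum.cong refl) (simp add: fV)
    also have "\<dots> = (\<Sum>x\<in>supp c. \<Sum>y\<in>supp c. cnj (c y) * c x * hinner G (f y) (f x))"
      by (simp add: sum_distrib_left mult.assoc mult.left_commute)
    also have "\<dots> = (\<Sum>y\<in>supp c. \<Sum>x\<in>supp c. cnj (c y) * c x * hinner G (f y) (f x))"
      by (rule sum.swap)
    finally have VV: "hinner G (V c) (V c) = (\<Sum>y\<in>supp c. \<Sum>x\<in>supp c. cnj (c y) * c x * hinner G (f y) (f x))" .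
    have "(\<Sum>x\<in>supp c. \<Sum>y\<in>supp c. cnj (c x) * c y * (of_real (C\<^sup>2) * k x y - hinner G (f x) (f y)))
      = of_real (C\<^sup>2) * hinner ?F c c - hinner G (V c) (V c)"
      unfolding VV free_inner[OF c(1) subset_refl subset_refl]
      by (simp add: right_diff_distrib sum_subtractf sum_distrib_left mult.left_commute)
    then have "0 \<le> Re (of_real (C\<^sup>2) * hinner ?F c c - hinner G (V c) (V c))"
      using psd_set(2)[OF dom c, of c] by simp
    then have "Re (hinner G (V c) (V c)) \<le> C\<^sup>2 * Re (hinner ?F c c)" by simp
    then show "(hnorm G (V c))\<^sup>2 \<le> (C * hnorm ?F c)\<^sup>2"
      by (simp add: hnorm_sq[OF S V[OF that]] hnorm_sq[OF F that] power_mult_distrib)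
    show "0 \<le> C * hnorm ?F c" using C hnorm_ge0[OF F that] by simp
  qed
  have Vdist: "hdist G (V c) (V d) \<le> C * hdist ?F c d" if "c \<in> hcar ?F" "d \<in> hcar ?F" for c d
  proof -
    have d: "hscale ?F (-1) d \<in> hcar ?F" by (rule hscale_car[OF F that(2)])
    have "hsub ?F c d \<in> hcar ?F" by (rule hadd_car[OF F that(1) d])
    from Vnorm[OF this] show ?thesis
      unfolding hdist_def using Vadd[OF that(1) d] Vscale[OF that(2), of "-1"] by simp
  qed
  have Vcauchy: "hcauchy G (\<lambda>n. V (u n))" if u: "hcauchy ?F u" for u
  proof (rule hcauchyI[OF S])
    show "V (u n) \<in> hcar G" for n by (intro V hcauchy_car u)
    fix e :: real assume "0 < e"
    then have e: "0 < e / (C + 1)" using C by simp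
    obtain N where N: "\<And>m n. m \<ge> N \<Longrightarrow> n \<ge> N \<Longrightarrow> hdist ?F (u m) (u n) < e / (C + 1)"
      using u e unfolding hcauchy_def by meson
    have "hdist G (V (u m)) (V (u n)) < e" if "m \<ge> N" "n \<ge> N" for m n
    proof -
      have "hdist G (V (u m)) (V (u n)) \<le> C * hdist ?F (u m) (u n)"
        by (intro Vdist hcauchy_car u)
      also have "\<dots> \<le> C * (e / (C + 1))" using N[OF that] C by (intro mult_left_mono) auto
      also have "\<dots> < e" using \<open>0 < e\<close> C by (simp add: divide_less_eq distrib_left)
      finally show ?thesis .
    qed
    then show "\<exists>N. \<forall>m\<ge>N. \<forall>n\<ge>N. hdist G (V (u m)) (V (u n)) < e" by blast
  qed
  have "\<exists>a\<in>hcar G. \<forall>u. hcauchy ?F u \<and> v = hclass ?F u \<longrightarrow> (\<lambda>n. hdist G (V (u n)) a) \<longlonglongrightarrow> 0"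
    if v: "v \<in> hcar ?K" for v
  proof -
    obtain u where u: "hcauchy ?F u" "v = hclass ?F u"
      using v hcompletion_carE[OF F] unfolding kspace_def by blast
    obtain a where a: "a \<in> hcar G" "(\<lambda>n. hdist G (V (u n)) a) \<longlonglongrightarrow> 0"
      using hilbert_complete[OF G Vcauchy[OF u(1)]] by blast
    have "(\<lambda>n. hdist G (V (u' n)) a) \<longlonglongrightarrow> 0" if u': "hcauchy ?F u'" "v = hclass ?F u'" for u'
    proof -
      have "hdist (hcompletion ?F) (hclass ?F u') (hclass ?F u) = 0"
        using u u' hdist_self[OF hcompletion_semi[OF F]] hclass_car[OF F] by metis
      then have d: "(\<lambda>n. hdist ?F (u' n) (u n)) \<longlonglongrightarrow> 0" using hclass_hdist[OF F u'(1) u(1)] by simp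
      have s: "(\<lambda>n. C * hdist ?F (u' n) (u n) + hdist G (V (u n)) a) \<longlonglongrightarrow> 0"
        using tendsto_add[OF tendsto_mult_right_zero[OF d, of C] a(2)] by simp
      show ?thesis
      proof (rule Lim_null_comparison[OF always_eventually s], rule allI)
        fix n
        have c: "u n \<in> hcar ?F" "u' n \<in> hcar ?F" using hcauchy_car u u' by metis+
        show "norm (hdist G (V (u' n)) a) \<le> C * hdist ?F (u' n) (u n) + hdist G (V (u n)) a"
          using hdist_triangle[OF S V[OF c(2)] V[OF c(1)] a(1)] Vdist[OF c(2) c(1)]
            hdist_ge0[OF S V[OF c(2)] a(1)] by simp
      qed
    qed
    with a show ?thesis by blast
  qed
  then obtain A0 where A0: "\<And>v. v \<in> hcar ?K \<Longrightarrow> A0 v \<in> hcar G"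
    and A0l: "\<And>u. hcauchy ?F u \<Longrightarrow> (\<lambda>n. hdist G (V (u n)) (A0 (hclass ?F u))) \<longlonglongrightarrow> 0"
  proof -
    assume a: "\<And>A0. (\<And>v. v \<in> hcar ?K \<Longrightarrow> A0 v \<in> hcar G) \<Longrightarrow>
        (\<And>u. hcauchy ?F u \<Longrightarrow> (\<lambda>n. hdist G (V (u n)) (A0 (hclass ?F u))) \<longlonglongrightarrow> 0) \<Longrightarrow> thesis"
    assume e: "\<And>v. v \<in> hcar ?K \<Longrightarrow> \<exists>a\<in>hcar G. \<forall>u. hcauchy ?F u \<and> v = hclass ?F u \<longrightarrow> (\<lambda>n. hdist G (V (u n)) a) \<longlonglongrightarrow> 0"
    then obtain A0 where A0: "\<And>v. v \<in> hcar ?K \<Longrightarrow> A0 v \<in> hcar G"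
      "\<And>v u. v \<in> hcar ?K \<Longrightarrow> hcauchy ?F u \<Longrightarrow> v = hclass ?F u \<Longrightarrow> (\<lambda>n. hdist G (V (u n)) (A0 v)) \<longlonglongrightarrow> 0"
      by metis
    show thesis by (rule a[of A0]) (use A0 hclass_car[OF F] in \<open>auto simp: kspace_def\<close>)
  qed
  have A0i: "(\<lambda>n. hinner G y (V (u n))) \<longlonglongrightarrow> hinner G y (A0 (hclass ?F u))"
    if "y \<in> hcar G" "hcauchy ?F u" for y u
    using that A0 A0l hclass_car[OF F] hdist_self[OF S] V[OF hcauchy_car]
    by (intro hinner_tendsto[OF S]) (auto simp: kspace_def)
  define A where "A = restrict A0 (hcar ?K)"
  have Ac: "A v = A0 v" if "v \<in> hcar ?K" for v using that by (simp add: A_def)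
  have Anorm: "hnorm G (A v) \<le> C * hnorm ?K v" if v: "v \<in> hcar ?K" for v
  proof -
    obtain u where u: "hcauchy ?F u" "v = hclass ?F u"
      using v hcompletion_carE[OF F] unfolding kspace_def by blast
    have "(\<lambda>n. hnorm G (V (u n))) \<longlonglongrightarrow> hnorm G (A v)"
      unfolding Ac[OF v] by (rule hnorm_tendsto[OF S]) (use V[OF hcauchy_car[OF u(1)]] A0[OF v] A0l[OF u(1)] u in auto)
    moreover have "(\<lambda>n. hnorm ?F (u n)) \<longlonglongrightarrow> hnorm ?K v"
      unfolding hnorm_def kspace_def u(2) by (rule tendsto_real_sqrt[OF tendsto_Re[OF hclass_inner[OF F u(1) u(1)]]])
    ultimately show ?thesis
      using Vnorm[OF hcauchy_car[OF u(1)]]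
      by (intro LIMSEQ_le[OF _ tendsto_mult_left]) auto
  qed
  have "A \<in> bop ?K G"
    unfolding bop_def
  proof (intro CollectI conjI ballI allI exI[of _ C])
    show "A \<in> extensional (hcar ?K)" by (simp add: A_def)
    show "A \<in> hcar ?K \<rightarrow> hcar G" using A0 by (auto simp: A_def)
    show "hnorm G (A v) \<le> C * hnorm ?K v" if "v \<in> hcar ?K" for v by (rule Anorm[OF that])
    show "A (hadd ?K v w) = hadd G (A v) (A w)" if vw: "v \<in> hcar ?K" "w \<in> hcar ?K" for v w
    proof (rule hilbert_eqI[OF G])
      have K: "semi_inner_space ?K" using kspace_hilbert[OF k] by simp
      show "A (hadd ?K v w) \<in> hcar G" using A0 vw hadd_car[OF K] by (simp add: Ac)
      show "hadd G (A v) (A w) \<in> hcar G" using A0 vw S by (simp add: Ac)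
      fix y assume y: "y \<in> hcar G"
      obtain u u' where u: "hcauchy ?F u" "v = hclass ?F u" and u': "hcauchy ?F u'" "w = hclass ?F u'"
        using vw hcompletion_carE[OF F] unfolding kspace_def by metis
      have eq: "hadd ?K v w = hclass ?F (\<lambda>n. hadd ?F (u n) (u' n))"
        unfolding kspace_def u(2) u'(2) by (rule hclass_add[OF F u(1) u'(1)])
      have "(\<lambda>n. hinner G y (V (hadd ?F (u n) (u' n)))) \<longlonglongrightarrow> hinner G y (A0 (hadd ?K v w))"
        unfolding eq by (rule A0i[OF y hcauchy_add[OF F u(1) u'(1)]])
      moreover have "hinner G y (V (hadd ?F (u n) (u' n))) = hinner G y (V (u n)) + hinner G y (V (u' n))" for n
        using Vadd[OF hcauchy_car[OF u(1)] hcauchy_car[OF u'(1)], of n n] V[OF hcauchy_car[OF u(1)], of n]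
          V[OF hcauchy_car[OF u'(1)], of n] y S by simp
      ultimately have "(\<lambda>n. hinner G y (V (u n)) + hinner G y (V (u' n))) \<longlonglongrightarrow> hinner G y (A0 (hadd ?K v w))"
        by (simp del: free_simps)
      moreover have "(\<lambda>n. hinner G y (V (u n)) + hinner G y (V (u' n))) \<longlonglongrightarrow> hinner G y (A0 v) + hinner G y (A0 w)"
        unfolding u(2) u'(2) by (intro tendsto_add A0i y u u')
      ultimately have "hinner G y (A0 (hadd ?K v w)) = hinner G y (A0 v) + hinner G y (A0 w)"
        by (rule LIMSEQ_unique)
      then show "hinner G y (A (hadd ?K v w)) = hinner G y (hadd G (A v) (A w))"
        using y S A0 vw hadd_car[OF K vw] by (simp add: Ac)
    qed
    show "A (hscale ?K c v) = hscale G c (A v)" if v: "v \<in> hcar ?K" for c v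
    proof (rule hilbert_eqI[OF G])
      have K: "semi_inner_space ?K" using kspace_hilbert[OF k] by simp
      show "A (hscale ?K c v) \<in> hcar G" using A0 v hscale_car[OF K] by (simp add: Ac)
      show "hscale G c (A v) \<in> hcar G" using A0 v S by (simp add: Ac)
      fix y assume y: "y \<in> hcar G"
      obtain u where u: "hcauchy ?F u" "v = hclass ?F u"
        using v hcompletion_carE[OF F] unfolding kspace_def by metis
      have eq: "hscale ?K c v = hclass ?F (\<lambda>n. hscale ?F c (u n))"
        unfolding kspace_def u(2) by (rule hclass_scale[OF F u(1)])
      have "(\<lambda>n. hinner G y (V (hscale ?F c (u n)))) \<longlonglongrightarrow> hinner G y (A0 (hscale ?K c v))"
        unfolding eq by (rule A0i[OF y hcauchy_scale[OF F u(1)]])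
      moreover have "hinner G y (V (hscale ?F c (u n))) = c * hinner G y (V (u n))" for n
        using Vscale[OF hcauchy_car[OF u(1)], of c n] V[OF hcauchy_car[OF u(1)], of n] y S by simp
      ultimately have "(\<lambda>n. c * hinner G y (V (u n))) \<longlonglongrightarrow> hinner G y (A0 (hscale ?K c v))"
        by (simp del: free_simps)
      moreover have "(\<lambda>n. c * hinner G y (V (u n))) \<longlonglongrightarrow> c * hinner G y (A0 v)"
        unfolding u(2) by (intro tendsto_mult_left A0i y u)
      ultimately have "hinner G y (A0 (hscale ?K c v)) = c * hinner G y (A0 v)"
        by (rule LIMSEQ_unique)
      then show "hinner G y (A (hscale ?K c v)) = hinner G y (hscale G c (A v))"
        using y S A0 v hscale_car[OF K v] by (simp add: Ac)
    qed
  qed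
  moreover have "A (kgen X k x) = f x" if x: "x \<in> X" for x
  proof (rule hilbert_eqI[OF G])
    have kx: "kgen X k x \<in> hcar ?K" using x by auto
    show "A (kgen X k x) \<in> hcar G" using A0[OF kx] kx by (simp add: Ac)
    show "f x \<in> hcar G" by (rule f[OF x])
    fix y assume y: "y \<in> hcar G"
    have "supp (kdelta x) = {x}" by auto
    then have "hinner G y (V (kdelta x)) = hinner G y (f x)"
      using Vi[OF kdelta_car[OF x] y] by simp
    then have "(\<lambda>n::nat. hinner G y (f x)) \<longlonglongrightarrow> hinner G y (A0 (kgen X k x))"
      using A0i[OF y hcauchy_const[OF F kdelta_car[OF x]]] unfolding kgen_class by simp
    from LIMSEQ_unique[OF this tendsto_const] show "hinner G y (A (kgen X k x)) = hinner G y (f x)"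
      by (simp add: Ac[OF kx])
  qed
  ultimately show ?thesis using Anorm that by blast
qed

end

section \<open>Projections, the Riesz representation and adjoints\<close>

text \<open>A minimizing sequence of distances to a subspace is Cauchy by the parallelogram law. The subspace may
  fail to be closed, so the projection \<open>p\<close> onto its closure is accompanied by a sequence in the subspace.\<close>

lemma orthogonal_projection:
  assumes G: "hilbert_space G" and L: "L \<subseteq> hcar G" "hzero G \<in> L"
    and add: "\<And>x y. x \<in> L \<Longrightarrow> y \<in> L \<Longrightarrow> hadd G x y \<in> L"
    and scale: "\<And>c x. x \<in> L \<Longrightarrow> hscale G c x \<in> L"
    and x: "x \<in> hcar G"
  obtains p u where "p \<in> hcar G" "\<And>n. u n \<in> L" "(\<lambda>n. hdist G (u n) p) \<longlonglongrightarrow> 0"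
    "\<And>l. l \<in> L \<Longrightarrow> hinner G l (hsub G x p) = 0"
proof -
  note S = hilbert_semi[OF G]
  define D where "D = (\<lambda>l. (hdist G x l)\<^sup>2) ` L"
  define \<delta> where "\<delta> = Inf D"
  have Lc: "l \<in> hcar G" if "l \<in> L" for l using L that by auto
  have Dn: "D \<noteq> {}" "bdd_below D" using L by (auto simp: D_def intro!: bdd_belowI[of _ 0])
  have lo: "\<delta> \<le> (hdist G x l)\<^sup>2" if "l \<in> L" for l
    unfolding \<delta>_def using Dn that by (intro cInf_lower) (auto simp: D_def)
  have "\<exists>l\<in>L. (hdist G x l)\<^sup>2 < \<delta> + inverse (real (Suc n))" for n
  proof -
    have "Inf D < \<delta> + inverse (real (Suc n))" unfolding \<delta>_def by simp
    from cInf_lessD[OF Dn(1) this] show ?thesis by (auto simp: D_def)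
  qed
  then obtain u where u: "\<And>n. u n \<in> L" and ud: "\<And>n. (hdist G x (u n))\<^sup>2 < \<delta> + inverse (real (Suc n))"
    by metis
  note uc = Lc[OF u]
  have sq: "(hdist G a b)\<^sup>2 = Re (hinner G (hsub G a b) (hsub G a b))" if "a \<in> hcar G" "b \<in> hcar G" for a b
    unfolding hdist_def using S that by (intro hnorm_sq) auto
  have inv: "(\<lambda>n. inverse (real (Suc n))) \<longlonglongrightarrow> 0" by (rule LIMSEQ_inverse_real_of_nat)
  have par: "(hdist G (u m) (u n))\<^sup>2 < 2 * inverse (real (Suc m)) + 2 * inverse (real (Suc n))" for m n
  proof -
    let ?h = "hscale G (1/2) (hadd G (u m) (u n))"
    have h: "?h \<in> L" by (intro scale add u)
    have "(hdist G (u m) (u n))\<^sup>2 = 2 * (hdist G x (u m))\<^sup>2 + 2 * (hdist G x (u n))\<^sup>2 - 4 * (hdist G x ?h)\<^sup>2"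
      using S x uc[of m] uc[of n] Lc[OF h] by (simp add: sq algebra_simps)
    then show ?thesis using lo[OF h] ud[of m] ud[of n] by linarith
  qed
  have "hcauchy G u"
  proof (rule hcauchyI[OF S uc])
    fix e :: real assume "0 < e"
    then have e: "0 < e\<^sup>2 / 4" by simp
    then obtain N where N: "\<And>n. n \<ge> N \<Longrightarrow> norm (inverse (real (Suc n)) - 0) < e\<^sup>2 / 4"
      using LIMSEQ_D[OF inv] by blast
    have "hdist G (u m) (u n) < e" if mn: "m \<ge> N" "n \<ge> N" for m n
    proof -
      have "(hdist G (u m) (u n))\<^sup>2 < e\<^sup>2" using par[of m n] N[OF mn(1)] N[OF mn(2)] by simp
      then show ?thesis using \<open>0 < e\<close> by (simp add: power_less_imp_less_base)
    qed
    then show "\<exists>N. \<forall>m\<ge>N. \<forall>n\<ge>N. hdist G (u m) (u n) < e" by blast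
  qed
  then obtain p where p: "p \<in> hcar G" "(\<lambda>n. hdist G (u n) p) \<longlonglongrightarrow> 0"
    using hilbert_complete[OF G] by blast
  have lim: "(\<lambda>n. (hdist G a (u n))\<^sup>2) \<longlonglongrightarrow> (hdist G a p)\<^sup>2" if a: "a \<in> hcar G" for a
  proof -
    have "(\<lambda>n. hdist G (hsub G a (u n)) (hsub G a p)) = (\<lambda>n. hdist G (u n) p)"
      unfolding hdist_def using S a p uc by (intro ext hnorm_cong_inner) (simp_all add: algebra_simps)
    then have "(\<lambda>n. hdist G (hsub G a (u n)) (hsub G a p)) \<longlonglongrightarrow> 0" using p(2) by simp
    then have "(\<lambda>n. hnorm G (hsub G a (u n))) \<longlonglongrightarrow> hnorm G (hsub G a p)"
      using S a p uc by (intro hnorm_tendsto[OF S]) auto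
    then show ?thesis unfolding hdist_def by (rule tendsto_power)
  qed
  have d: "(hdist G x p)\<^sup>2 \<le> \<delta>"
    by (rule LIMSEQ_le[OF lim[OF x]]) (use tendsto_add[OF tendsto_const inv, of \<delta>] less_imp_le[OF ud] in auto)
  have orth: "hinner G l (hsub G x p) = 0" if l: "l \<in> L" for l
  proof -
    let ?q = "hsub G x p"
    define z where "z = hinner G l ?q"
    define s where "s = 1 / ((hnorm G l)\<^sup>2 + 1)"
    have q: "?q \<in> hcar G" using S x p by simp
    let ?c = "of_real s * z"
    let ?a = "hsub G x (hscale G ?c l)"
    have a: "?a \<in> hcar G" using S x Lc[OF l] by simp
    have "\<delta> \<le> (hdist G ?a (u n))\<^sup>2" for n
    proof -
      have "(hdist G ?a (u n))\<^sup>2 = (hdist G x (hadd G (u n) (hscale G ?c l)))\<^sup>2"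
        using S x Lc[OF l] uc[of n] by (simp add: sq algebra_simps)
      then show ?thesis using lo[OF add[OF u scale[OF l]], of n ?c] by simp
    qed
    then have "\<delta> \<le> (hdist G ?a p)\<^sup>2" by (intro LIMSEQ_le_const[OF lim[OF a]]) auto
    moreover have "(hdist G ?a p)\<^sup>2 = (hdist G x p)\<^sup>2 - 2 * s * (cmod z)\<^sup>2 + s\<^sup>2 * (cmod z)\<^sup>2 * (hnorm G l)\<^sup>2"
    proof -
      have eq: "hinner G (hsub G ?a p) (hsub G ?a p) = hinner G (hsub G ?q (hscale G ?c l)) (hsub G ?q (hscale G ?c l))"
        using S x p Lc[OF l] by (simp add: algebra_simps)
      have expand: "hinner G (hsub G a (hscale G b l)) (hsub G a (hscale G b l))
          = hinner G a a - b * hinner G a l - cnj b * hinner G l a + cnj b * b * hinner G l l"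
        if "a \<in> hcar G" "l \<in> hcar G" for a b l
        using S that by (simp add: algebra_simps)
      have ql: "hinner G ?q l = cnj z" unfolding z_def by (rule hinner_commute[OF S Lc[OF l] q])
      have "hinner G (hsub G ?q (hscale G ?c l)) (hsub G ?q (hscale G ?c l))
          = hinner G ?q ?q - ?c * hinner G ?q l - cnj ?c * hinner G l ?q + cnj ?c * ?c * hinner G l l"
        by (rule expand[OF q Lc[OF l]])
      also have "\<dots> = hinner G ?q ?q - 2 * of_real s * (z * cnj z) + (of_real s)\<^sup>2 * (z * cnj z) * of_real ((hnorm G l)\<^sup>2)"
        unfolding ql z_def[symmetric] hinner_self[OF S Lc[OF l]] by (simp add: algebra_simps power2_eq_square)
      also have "\<dots> = hinner G ?q ?q - of_real (2 * s * (cmod z)\<^sup>2) + of_real (s\<^sup>2 * (cmod z)\<^sup>2 * (hnorm G l)\<^sup>2)"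
        unfolding complex_norm_square[symmetric] by simp
      finally show ?thesis unfolding sq[OF a p(1)] sq[OF x p(1)] eq by simp
    qed
    ultimately have "2 * s * (cmod z)\<^sup>2 \<le> s\<^sup>2 * (cmod z)\<^sup>2 * (hnorm G l)\<^sup>2" using d by linarith
    moreover have "0 < s" "s * (hnorm G l)\<^sup>2 < 1" by (auto simp: s_def add_nonneg_pos)
    ultimately have "s * (cmod z)\<^sup>2 \<le> 0"
    proof -
      assume h: "2 * s * (cmod z)\<^sup>2 \<le> s\<^sup>2 * (cmod z)\<^sup>2 * (hnorm G l)\<^sup>2" and s: "0 < s" "s * (hnorm G l)\<^sup>2 < 1"
      have "s\<^sup>2 * (cmod z)\<^sup>2 * (hnorm G l)\<^sup>2 = (s * (cmod z)\<^sup>2) * (s * (hnorm G l)\<^sup>2)"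
        by (simp add: power2_eq_square)
      also have "\<dots> \<le> (s * (cmod z)\<^sup>2) * 1" using s by (intro mult_left_mono) auto
      finally show ?thesis using h by simp
    qed
    with \<open>0 < s\<close> show ?thesis unfolding z_def[symmetric] by (simp add: mult_le_0_iff)
  qed
  show ?thesis by (rule that[OF p(1) u p(2) orth])
qed

text \<open>The representing vector is a multiple of the component of a vector \<open>x\<close> with \<open>\<phi> x \<noteq> 0\<close> that is
  orthogonal to the kernel of \<open>\<phi>\<close>.\<close>

lemma Riesz_representation:
  assumes G: "hilbert_space G"
    and add: "\<And>x y. x \<in> hcar G \<Longrightarrow> y \<in> hcar G \<Longrightarrow> \<phi> (hadd G x y) = \<phi> x + \<phi> y"
    and scale: "\<And>c x. x \<in> hcar G \<Longrightarrow> \<phi> (hscale G c x) = c * \<phi> x"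
    and bd: "\<And>x. x \<in> hcar G \<Longrightarrow> cmod (\<phi> x) \<le> C * hnorm G x"
  obtains v where "v \<in> hcar G" "\<And>x. x \<in> hcar G \<Longrightarrow> \<phi> x = hinner G v x"
proof (cases "\<forall>x\<in>hcar G. \<phi> x = 0")
  case True
  then show ?thesis using that[of "hzero G"] G by simp
next
  case False
  then obtain x where x: "x \<in> hcar G" "\<phi> x \<noteq> 0" by auto
  note S = hilbert_semi[OF G]
  define L where "L = {x \<in> hcar G. \<phi> x = 0}"
  have z: "\<phi> (hzero G) = 0" using bd[of "hzero G"] S by simp
  obtain p u where p: "p \<in> hcar G" "\<And>n. u n \<in> L" "(\<lambda>n. hdist G (u n) p) \<longlonglongrightarrow> 0"
    and o: "\<And>l. l \<in> L \<Longrightarrow> hinner G l (hsub G x p) = 0"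
    by (rule orthogonal_projection[OF G, of L x]) (use x S z in \<open>auto simp: L_def add scale\<close>)
  have uc: "u n \<in> hcar G" "\<phi> (u n) = 0" for n using p(2)[of n] by (auto simp: L_def)
  have sub: "\<phi> (hsub G a b) = \<phi> a - \<phi> b" if "a \<in> hcar G" "b \<in> hcar G" for a b
    using that S by (simp add: add scale)
  have "\<phi> p = 0"
  proof -
    have "cmod (\<phi> p) \<le> C * hdist G (u n) p" for n
      using bd[of "hsub G (u n) p"] S uc p(1) sub[OF uc(1) p(1)] by (simp add: hdist_def)
    then have "cmod (\<phi> p) \<le> C * 0"
      by (intro LIMSEQ_le_const[OF tendsto_mult_left[OF p(3)]]) auto
    then show ?thesis by simp
  qed
  define q where "q = hsub G x p"
  have q: "q \<in> hcar G" "\<phi> q \<noteq> 0" using sub[OF x(1) p(1)] \<open>\<phi> p = 0\<close> x S p(1) by (auto simp: q_def)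
  define b where "b = (hnorm G q)\<^sup>2"
  have qq: "hinner G q q = of_real b" unfolding b_def by (rule hinner_self[OF S q(1)])
  have "b \<noteq> 0"
  proof
    assume "b = 0"
    then have "q = hzero G" using hilbert_definite[OF G q(1)] qq by simp
    then show False using q z by simp
  qed
  show ?thesis
  proof (rule that)
    show "hscale G (cnj (\<phi> q) / of_real b) q \<in> hcar G" using q S by simp
    fix y assume y: "y \<in> hcar G"
    let ?l = "hsub G y (hscale G (\<phi> y / \<phi> q) q)"
    have "?l \<in> L" using q y S sub[OF y hscale_car[OF S q(1)]] by (simp add: L_def scale)
    from o[OF this] have l: "hinner G ?l q = 0" by (simp add: q_def)
    then have "hinner G q ?l = 0"
      using hinner_commute[OF S, of ?l q] q y S by (simp del: hinner_add_left hinner_add_right)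
    then have "hinner G q y = (\<phi> y / \<phi> q) * of_real b" using q(1) y S by (simp add: qq)
    then show "\<phi> y = hinner G (hscale G (cnj (\<phi> q) / of_real b) q) y"
      using q y S \<open>b \<noteq> 0\<close> by simp
  qed
qed

text \<open>The projection onto the closure of the total subspace is the identity, since the difference of a vector and its
  projection is orthogonal to the subspace.\<close>

lemma total_approx:
  assumes G: "hilbert_space G" and L: "total G L" "hzero G \<in> L"
    and add: "\<And>x y. x \<in> L \<Longrightarrow> y \<in> L \<Longrightarrow> hadd G x y \<in> L"
    and scale: "\<And>c x. x \<in> L \<Longrightarrow> hscale G c x \<in> L"
    and x: "x \<in> hcar G"
  obtains u where "\<And>n. u n \<in> L" "(\<lambda>n. hdist G (u n) x) \<longlonglongrightarrow> 0"
proof -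
  have Lc: "L \<subseteq> hcar G" using L by (simp add: total_def)
  obtain p u where p: "p \<in> hcar G" "\<And>n. u n \<in> L" "(\<lambda>n. hdist G (u n) p) \<longlonglongrightarrow> 0"
    and o: "\<And>l. l \<in> L \<Longrightarrow> hinner G l (hsub G x p) = 0"
    using orthogonal_projection[OF G Lc L(2) add scale x] by metis
  have "x = p"
    by (rule total_eqI[OF G L(1) x p(1)])
      (use o Lc p x G in \<open>auto simp: subset_iff algebra_simps\<close>)
  with p that show ?thesis by blast
qed

section \<open>Bounded operators\<close>

lemma bop_car: "A \<in> bop G1 G2 \<Longrightarrow> x \<in> hcar G1 \<Longrightarrow> A x \<in> hcar G2"
  by (auto simp: bop_def)

lemma bop_add: "A \<in> bop G1 G2 \<Longrightarrow> x \<in> hcar G1 \<Longrightarrow> y \<in> hcar G1 \<Longrightarrow> A (hadd G1 x y) = hadd G2 (A x) (A y)"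
  by (auto simp: bop_def)

lemma bop_scale: "A \<in> bop G1 G2 \<Longrightarrow> x \<in> hcar G1 \<Longrightarrow> A (hscale G1 c x) = hscale G2 c (A x)"
  by (auto simp: bop_def)

lemma bop_ext: "A \<in> bop G1 G2 \<Longrightarrow> A \<in> extensional (hcar G1)"
  by (auto simp: bop_def)

lemma bop_bound:
  assumes "semi_inner_space G1" "A \<in> bop G1 G2"
  obtains C where "0 \<le> C" "\<And>x. x \<in> hcar G1 \<Longrightarrow> hnorm G2 (A x) \<le> C * hnorm G1 x"
proof -
  obtain C where C: "\<And>x. x \<in> hcar G1 \<Longrightarrow> hnorm G2 (A x) \<le> C * hnorm G1 x"
    using assms(2) unfolding bop_def by blast
  have "hnorm G2 (A x) \<le> max C 0 * hnorm G1 x" if "x \<in> hcar G1" for x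
  proof -
    have "C * hnorm G1 x \<le> max C 0 * hnorm G1 x"
      using hnorm_ge0[OF assms(1) that] by (intro mult_right_mono) auto
    then show ?thesis using C[OF that] by linarith
  qed
  then show ?thesis using that[of "max C 0"] by simp
qed

lemma bopI:
  assumes "A \<in> extensional (hcar G1)" "\<And>x. x \<in> hcar G1 \<Longrightarrow> A x \<in> hcar G2"
    "\<And>x y. x \<in> hcar G1 \<Longrightarrow> y \<in> hcar G1 \<Longrightarrow> A (hadd G1 x y) = hadd G2 (A x) (A y)"
    "\<And>c x. x \<in> hcar G1 \<Longrightarrow> A (hscale G1 c x) = hscale G2 c (A x)"
    "\<And>x. x \<in> hcar G1 \<Longrightarrow> hnorm G2 (A x) \<le> C * hnorm G1 x"
  shows "A \<in> bop G1 G2"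
  using assms by (auto simp: bop_def intro!: exI[of _ C])

lemma bop_eqI:
  "A \<in> bop G1 G2 \<Longrightarrow> B \<in> bop G1 G2' \<Longrightarrow> (\<And>x. x \<in> hcar G1 \<Longrightarrow> A x = B x) \<Longrightarrow> A = B"
  by (rule extensionalityI[of _ "hcar G1"]) (auto simp: bop_ext)

lemma bop_hzero:
  assumes "hilbert_space G1" "hilbert_space G2" "A \<in> bop G1 G2" shows "A (hzero G1) = hzero G2"
proof -
  obtain C where C: "\<And>x. x \<in> hcar G1 \<Longrightarrow> hnorm G2 (A x) \<le> C * hnorm G1 x"
    using bop_bound[OF hilbert_semi[OF assms(1)] assms(3)] by blast
  have "hnorm G2 (A (hzero G1)) \<le> 0"
    using C[OF hzero_car[OF hilbert_semi[OF assms(1)]]] hnorm_zero[OF hilbert_semi[OF assms(1)]] by simp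
  moreover have c: "A (hzero G1) \<in> hcar G2"
    using bop_car[OF assms(3)] hilbert_semi[OF assms(1)] by simp
  ultimately show ?thesis
    using hnorm_ge0[OF hilbert_semi[OF assms(2)] c] by (intro hilbert_norm_zero[OF assms(2) c]) simp
qed

lemma bop_hsum:
  assumes "hilbert_space G1" "hilbert_space G2" "A \<in> bop G1 G2"
  shows "(\<And>i. i < n \<Longrightarrow> f i \<in> hcar G1) \<Longrightarrow> A (hsum G1 f n) = hsum G2 (\<lambda>i. A (f i)) n"
  using assms by (induction n) (auto simp: bop_hzero bop_add)

text \<open>A bounded sesquilinear form is given by an operator, whose values are Riesz representatives.\<close>

lemma form_operator:
  assumes G1: "hilbert_space G1" and G2: "hilbert_space G2"
    and add: "\<And>x y z. x \<in> hcar G2 \<Longrightarrow> y \<in> hcar G1 \<Longrightarrow> z \<in> hcar G1 \<Longrightarrow> B x (hadd G1 y z) = B x y + B x z"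
    and scale: "\<And>c x y. x \<in> hcar G2 \<Longrightarrow> y \<in> hcar G1 \<Longrightarrow> B x (hscale G1 c y) = c * B x y"
    and add': "\<And>x y z. x \<in> hcar G2 \<Longrightarrow> y \<in> hcar G2 \<Longrightarrow> z \<in> hcar G1 \<Longrightarrow> B (hadd G2 x y) z = B x z + B y z"
    and scale': "\<And>c x y. x \<in> hcar G2 \<Longrightarrow> y \<in> hcar G1 \<Longrightarrow> B (hscale G2 c x) y = cnj c * B x y"
    and bd: "\<And>x y. x \<in> hcar G2 \<Longrightarrow> y \<in> hcar G1 \<Longrightarrow> cmod (B x y) \<le> C * hnorm G2 x * hnorm G1 y"
    and C: "0 \<le> C"
  obtains A where "A \<in> bop G1 G2" "\<And>x y. x \<in> hcar G2 \<Longrightarrow> y \<in> hcar G1 \<Longrightarrow> hinner G2 x (A y) = B x y"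
    "\<And>y. y \<in> hcar G1 \<Longrightarrow> hnorm G2 (A y) \<le> C * hnorm G1 y"
proof -
  note S1 = hilbert_semi[OF G1] and S2 = hilbert_semi[OF G2]
  have "\<exists>v\<in>hcar G2. \<forall>x\<in>hcar G2. hinner G2 x v = B x y" if y: "y \<in> hcar G1" for y
  proof -
    obtain v where v: "v \<in> hcar G2" "\<And>x. x \<in> hcar G2 \<Longrightarrow> cnj (B x y) = hinner G2 v x"
    proof (rule Riesz_representation[OF G2, of "\<lambda>x. cnj (B x y)" "C * hnorm G1 y"])
      show "cmod (cnj (B x y)) \<le> C * hnorm G1 y * hnorm G2 x" if "x \<in> hcar G2" for x
        using bd[OF that y] by (simp add: mult_ac)
    qed (auto simp: add' scale' y)
    have "hinner G2 x v = B x y" if "x \<in> hcar G2" for x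
      using hinner_commute[OF S2 v(1) that] v(2)[OF that] by (metis complex_cnj_cnj)
    with v show ?thesis by blast
  qed
  then obtain A0 where A0: "\<And>y. y \<in> hcar G1 \<Longrightarrow> A0 y \<in> hcar G2"
    "\<And>x y. x \<in> hcar G2 \<Longrightarrow> y \<in> hcar G1 \<Longrightarrow> hinner G2 x (A0 y) = B x y" by metis
  have nb: "hnorm G2 (A0 y) \<le> C * hnorm G1 y" if y: "y \<in> hcar G1" for y
  proof (cases "hnorm G2 (A0 y) = 0")
    case True then show ?thesis using C hnorm_ge0[OF S1 y] by simp
  next
    case False
    then have pos: "0 < hnorm G2 (A0 y)" using hnorm_ge0[OF S2 A0(1)[OF y]] by simp
    have "(hnorm G2 (A0 y))\<^sup>2 = Re (B (A0 y) y)"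
      using A0 y by (simp add: hnorm_sq[OF S2])
    also have "\<dots> \<le> C * hnorm G2 (A0 y) * hnorm G1 y"
      using bd[OF A0(1)[OF y] y] complex_Re_le_cmod[of "B (A0 y) y"] by linarith
    finally have "hnorm G2 (A0 y) * hnorm G2 (A0 y) \<le> hnorm G2 (A0 y) * (C * hnorm G1 y)"
      by (simp add: power2_eq_square mult_ac)
    with pos show ?thesis by simp
  qed
  define A where "A = restrict A0 (hcar G1)"
  have "A \<in> bop G1 G2"
  proof (rule bopI[where C=C])
    show "A (hadd G1 x y) = hadd G2 (A x) (A y)" if "x \<in> hcar G1" "y \<in> hcar G1" for x y
      using that A0 S1 S2 by (intro hilbert_eqI[OF G2]) (auto simp: A_def add)
    show "A (hscale G1 c x) = hscale G2 c (A x)" if "x \<in> hcar G1" for c x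
      using that A0 S1 S2 by (intro hilbert_eqI[OF G2]) (auto simp: A_def scale)
  qed (use A0 nb in \<open>auto simp: A_def\<close>)
  then show ?thesis by (rule that) (use A0 nb in \<open>auto simp: A_def\<close>)
qed

context
  fixes G1 :: "'a hspace" and G2 :: "'b hspace" and A
  assumes G1: "hilbert_space G1" and G2: "hilbert_space G2" and A: "A \<in> bop G1 G2"
begin

lemma hadj_exists:
  "\<exists>B. B \<in> bop G2 G1 \<and> (\<forall>x\<in>hcar G1. \<forall>y\<in>hcar G2. hinner G1 (B y) x = hinner G2 y (A x))"
proof -
  note S1 = hilbert_semi[OF G1] and S2 = hilbert_semi[OF G2]
  obtain C where C: "0 \<le> C" "\<And>x. x \<in> hcar G1 \<Longrightarrow> hnorm G2 (A x) \<le> C * hnorm G1 x"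
    using bop_bound[OF S1 A] by blast
  note Ac = bop_car[OF A]
  obtain B where B: "B \<in> bop G2 G1" "\<And>x y. x \<in> hcar G1 \<Longrightarrow> y \<in> hcar G2 \<Longrightarrow> hinner G1 x (B y) = hinner G2 (A x) y"
  proof (rule form_operator[OF G2 G1, of "\<lambda>x y. hinner G2 (A x) y" C])
    fix x y assume x: "x \<in> hcar G1" and y: "y \<in> hcar G2"
    have "cmod (hinner G2 (A x) y) \<le> hnorm G2 (A x) * hnorm G2 y"
      by (rule hinner_Cauchy_Schwarz[OF S2 Ac[OF x] y])
    also have "\<dots> \<le> C * hnorm G1 x * hnorm G2 y" by (intro mult_right_mono C x hnorm_ge0[OF S2 y])
    finally show "cmod (hinner G2 (A x) y) \<le> C * hnorm G1 x * hnorm G2 y" .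
  qed (use Ac S1 S2 C in \<open>auto simp: bop_add[OF A] bop_scale[OF A]\<close>)
  have "hinner G1 (B y) x = hinner G2 y (A x)" if "x \<in> hcar G1" "y \<in> hcar G2" for x y
    using hinner_commute[OF S1 that(1) bop_car[OF B(1) that(2)]] hinner_commute[OF S2 Ac[OF that(1)] that(2)] B(2)[OF that]
    by simp
  with B show ?thesis by blast
qed

lemma hadj_eqI:
  assumes B: "B \<in> bop G2 G1" and e: "\<And>x y. x \<in> hcar G1 \<Longrightarrow> y \<in> hcar G2 \<Longrightarrow> hinner G1 (B y) x = hinner G2 y (A x)"
  shows "hadj G1 G2 A = B"
  unfolding hadj_def
proof (rule the_equality)
  show "B \<in> bop G2 G1 \<and> (\<forall>x\<in>hcar G1. \<forall>y\<in>hcar G2. hinner G1 (B y) x = hinner G2 y (A x))" using B e by blast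
  fix B' assume B': "B' \<in> bop G2 G1 \<and> (\<forall>x\<in>hcar G1. \<forall>y\<in>hcar G2. hinner G1 (B' y) x = hinner G2 y (A x))"
  show "B' = B"
  proof (rule bop_eqI[of _ G2 G1])
    fix y assume y: "y \<in> hcar G2"
    have c: "B' y \<in> hcar G1" "B y \<in> hcar G1" using bop_car[OF _ y] B B' by auto
    show "B' y = B y"
    proof (rule hilbert_eqI[OF G1 c])
      fix x assume x: "x \<in> hcar G1"
      show "hinner G1 x (B' y) = hinner G1 x (B y)"
        using hinner_commute[OF hilbert_semi[OF G1] c(1) x] hinner_commute[OF hilbert_semi[OF G1] c(2) x] B' e[OF x y] x y by simp
    qed
  qed (use B B' in auto)
qed

lemma hadj_bop: "hadj G1 G2 A \<in> bop G2 G1"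
  and hadj_left: "x \<in> hcar G1 \<Longrightarrow> y \<in> hcar G2 \<Longrightarrow> hinner G1 (hadj G1 G2 A y) x = hinner G2 y (A x)"
  using hadj_exists hadj_eqI by metis+

lemma hadj_car: "y \<in> hcar G2 \<Longrightarrow> hadj G1 G2 A y \<in> hcar G1"
  using hadj_bop by (rule bop_car)

lemma hadj_right:
  assumes "x \<in> hcar G1" "y \<in> hcar G2" shows "hinner G1 x (hadj G1 G2 A y) = hinner G2 (A x) y"
  using hinner_commute[OF hilbert_semi[OF G1] hadj_car[OF assms(2)] assms(1)]
    hinner_commute[OF hilbert_semi[OF G2] assms(2) bop_car[OF A assms(1)]] hadj_left[OF assms] by simp

lemma hadj_bound:
  assumes C0: "0 \<le> C" and C: "\<And>x. x \<in> hcar G1 \<Longrightarrow> hnorm G2 (A x) \<le> C * hnorm G1 x" and y: "y \<in> hcar G2"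
  shows "hnorm G1 (hadj G1 G2 A y) \<le> C * hnorm G2 y"
proof (cases "hnorm G1 (hadj G1 G2 A y) = 0")
  case True then show ?thesis using C0 hnorm_ge0[OF hilbert_semi[OF G2] y] by simp
next
  case False
  let ?z = "hadj G1 G2 A y"
  note S1 = hilbert_semi[OF G1] and S2 = hilbert_semi[OF G2]
  have z: "?z \<in> hcar G1" by (rule hadj_car[OF y])
  have pos: "0 < hnorm G1 ?z" using False hnorm_ge0[OF S1 z] by simp
  have "(hnorm G1 ?z)\<^sup>2 = Re (hinner G2 y (A ?z))"
    using hadj_left[OF z y] by (simp add: hnorm_sq[OF S1 z])
  also have "\<dots> \<le> hnorm G2 y * hnorm G2 (A ?z)"
    using hinner_Cauchy_Schwarz[OF S2 y bop_car[OF A z]] complex_Re_le_cmod[of "hinner G2 y (A ?z)"] by linarith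
  also have "\<dots> \<le> hnorm G2 y * (C * hnorm G1 ?z)"
    by (intro mult_left_mono C z hnorm_ge0[OF S2 y])
  finally have "hnorm G1 ?z * hnorm G1 ?z \<le> hnorm G1 ?z * (C * hnorm G2 y)"
    by (simp add: power2_eq_square mult_ac)
  with pos show ?thesis by simp
qed

end

lemma bop_total_eqI:
  assumes G1: "hilbert_space G1" and G2: "hilbert_space G2" and D: "total G1 D"
    and A: "A \<in> bop G1 G2" and B: "B \<in> bop G1 G2" and e: "\<And>d. d \<in> D \<Longrightarrow> A d = B d"
  shows "A = B"
proof (rule bop_eqI[OF A B])
  note S1 = hilbert_semi[OF G1] and S2 = hilbert_semi[OF G2]
  fix x assume x: "x \<in> hcar G1"
  show "A x = B x"
  proof (rule hilbert_eqI[OF G2 bop_car[OF A x] bop_car[OF B x]])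
    fix y assume y: "y \<in> hcar G2"
    have "hadj G1 G2 A y = hadj G1 G2 B y"
    proof (rule total_eqI[OF G1 D])
      fix d assume "d \<in> D"
      then have d: "d \<in> hcar G1" using D by (auto simp: total_def)
      show "hinner G1 d (hadj G1 G2 A y) = hinner G1 d (hadj G1 G2 B y)"
        using hadj_right[OF G1 G2 A d y] hadj_right[OF G1 G2 B d y] e[OF \<open>d \<in> D\<close>] by simp
    qed (auto intro: hadj_car[OF G1 G2] A B y)
    then show "hinner G2 y (A x) = hinner G2 y (B x)"
      using hadj_left[OF G1 G2 A x y] hadj_left[OF G1 G2 B x y] by simp
  qed
qed

text \<open>The vector \<open>A\<^sup>* w\<close> is orthogonal to a total set.\<close>

lemma total_image_orth:
  assumes G1: "hilbert_space G1" and G2: "hilbert_space G2" and D: "total G1 D"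
    and A: "A \<in> bop G1 G2" and w: "w \<in> hcar G2" and o: "\<And>d. d \<in> D \<Longrightarrow> hinner G2 (A d) w = 0"
    and x: "x \<in> hcar G1"
  shows "hinner G2 (A x) w = 0"
proof -
  have "hadj G1 G2 A w = hzero G1"
  proof (rule total_eqI[OF G1 D hadj_car[OF G1 G2 A w]])
    fix d assume "d \<in> D"
    then have d: "d \<in> hcar G1" using D by (auto simp: total_def)
    then show "hinner G1 d (hadj G1 G2 A w) = hinner G1 d (hzero G1)"
      using hadj_right[OF G1 G2 A d w] o[OF \<open>d \<in> D\<close>] G1 by simp
  qed (use G1 in simp)
  then show ?thesis using hadj_right[OF G1 G2 A x w] G1 x by simp
qed

context
  fixes X :: "'x set" and k and G :: "'b hspace" and f C
  assumes k: "psd X k" and G: "hilbert_space G" and f: "\<And>x. x \<in> X \<Longrightarrow> f x \<in> hcar G"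
    and C: "0 \<le> C" and dom: "psd X (\<lambda>x y. of_real (C\<^sup>2) * k x y - hinner G (f x) (f y))"
begin

lemma kext_eqI:
  assumes A: "A \<in> bop (kspace X k) G" "\<And>x. x \<in> X \<Longrightarrow> A (kgen X k x) = f x"
  shows "kext X k G f = A"
  unfolding kext_def
proof (rule the_equality)
  show "A \<in> bop (kspace X k) G \<and> (\<forall>x\<in>X. A (kgen X k x) = f x)" using A by blast
  fix B assume "B \<in> bop (kspace X k) G \<and> (\<forall>x\<in>X. B (kgen X k x) = f x)"
  then show "B = A"
    using A by (intro bop_total_eqI[OF kspace_hilbert[OF k] G kgen_total[OF k]]) auto
qed

lemma kext_bop: "kext X k G f \<in> bop (kspace X k) G"
  and kext_gen: "x \<in> X \<Longrightarrow> kext X k G f (kgen X k x) = f x"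
  and kext_bound: "v \<in> hcar (kspace X k) \<Longrightarrow> hnorm G (kext X k G f v) \<le> C * hnorm (kspace X k) v"
proof -
  obtain A where A: "A \<in> bop (kspace X k) G" "\<And>x. x \<in> X \<Longrightarrow> A (kgen X k x) = f x"
    "\<And>v. v \<in> hcar (kspace X k) \<Longrightarrow> hnorm G (A v) \<le> C * hnorm (kspace X k) v"
    using kext_exists[OF k G f C dom] by blast
  have e: "kext X k G f = A" by (rule kext_eqI[OF A(1,2)])
  show "kext X k G f \<in> bop (kspace X k) G"
    and "x \<in> X \<Longrightarrow> kext X k G f (kgen X k x) = f x"
    and "v \<in> hcar (kspace X k) \<Longrightarrow> hnorm G (kext X k G f v) \<le> C * hnorm (kspace X k) v"
    unfolding e using A by auto
qed

end

lemma ocomp_apply [simp]: "x \<in> hcar G \<Longrightarrow> ocomp G A B x = A (B x)"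
  by (simp add: ocomp_def compose_eq)

lemma ocomp_bop:
  assumes G1: "semi_inner_space G1" and G2: "semi_inner_space G2"
    and A: "A \<in> bop G2 G3" and B: "B \<in> bop G1 G2" shows "ocomp G1 A B \<in> bop G1 G3"
proof -
  obtain C where C: "0 \<le> C" "\<And>x. x \<in> hcar G2 \<Longrightarrow> hnorm G3 (A x) \<le> C * hnorm G2 x"
    using bop_bound[OF G2 A] by blast
  obtain C' where C': "0 \<le> C'" "\<And>x. x \<in> hcar G1 \<Longrightarrow> hnorm G2 (B x) \<le> C' * hnorm G1 x"
    using bop_bound[OF G1 B] by blast
  show ?thesis
  proof (rule bopI[where C="C * C'"])
    show "ocomp G1 A B \<in> extensional (hcar G1)" by (simp add: ocomp_def compose_extensional)
    fix x assume x: "x \<in> hcar G1"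
    have "hnorm G3 (A (B x)) \<le> C * hnorm G2 (B x)" by (rule C, rule bop_car[OF B x])
    also have "\<dots> \<le> C * (C' * hnorm G1 x)" by (intro mult_left_mono C C' x)
    finally show "hnorm G3 (ocomp G1 A B x) \<le> C * C' * hnorm G1 x" using x by (simp add: mult.assoc)
  qed (use G1 in \<open>auto simp: bop_add[OF A] bop_add[OF B] bop_scale[OF A] bop_scale[OF B] bop_car[OF A] bop_car[OF B]\<close>)
qed

lemma oid_bop: "semi_inner_space G \<Longrightarrow> oid G \<in> bop G G"
  by (rule bopI[where C=1]) (auto simp: oid_def)

lemma oid_apply [simp]: "x \<in> hcar G \<Longrightarrow> oid G x = x"
  by (simp add: oid_def)

lemma oadd_apply [simp]: "x \<in> hcar G \<Longrightarrow> oadd G G' A B x = hadd G' (A x) (B x)"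
  and oscale_apply [simp]: "x \<in> hcar G \<Longrightarrow> oscale G G' c A x = hscale G' c (A x)"
  by (simp_all add: oadd_def oscale_def)

lemma oadd_bop:
  assumes "hilbert_space G1" "hilbert_space G2" "A \<in> bop G1 G2" "B \<in> bop G1 G2"
  shows "oadd G1 G2 A B \<in> bop G1 G2"
proof -
  note S = hilbert_semi[OF assms(1)] hilbert_semi[OF assms(2)]
  note c = bop_car[OF assms(3)] bop_car[OF assms(4)]
  obtain C where C: "0 \<le> C" "\<And>x. x \<in> hcar G1 \<Longrightarrow> hnorm G2 (A x) \<le> C * hnorm G1 x"
    using bop_bound[OF S(1) assms(3)] by blast
  obtain C' where C': "0 \<le> C'" "\<And>x. x \<in> hcar G1 \<Longrightarrow> hnorm G2 (B x) \<le> C' * hnorm G1 x"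
    using bop_bound[OF S(1) assms(4)] by blast
  show ?thesis
  proof (rule bopI[where C="C + C'"])
    show "oadd G1 G2 A B \<in> extensional (hcar G1)" by (simp add: oadd_def)
    show "oadd G1 G2 A B (hadd G1 x y) = hadd G2 (oadd G1 G2 A B x) (oadd G1 G2 A B y)"
      if "x \<in> hcar G1" "y \<in> hcar G1" for x y
      using that c S by (intro hilbert_eqI[OF assms(2)]) (auto simp: bop_add[OF assms(3)] bop_add[OF assms(4)])
    show "oadd G1 G2 A B (hscale G1 a x) = hscale G2 a (oadd G1 G2 A B x)" if "x \<in> hcar G1" for a x
      using that c S by (simp add: bop_scale[OF assms(3)] bop_scale[OF assms(4)] hscale_hadd[OF S(2)])
    fix x assume x: "x \<in> hcar G1"
    show "hnorm G2 (oadd G1 G2 A B x) \<le> (C + C') * hnorm G1 x"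
      using hnorm_triangle[OF S(2) c(1)[OF x] c(2)[OF x]] C(2)[OF x] C'(2)[OF x] x by (simp add: distrib_right)
  qed (use c S in auto)
qed

lemma oscale_bop:
  assumes "hilbert_space G1" "hilbert_space G2" "A \<in> bop G1 G2"
  shows "oscale G1 G2 a A \<in> bop G1 G2"
proof -
  note S = hilbert_semi[OF assms(1)] hilbert_semi[OF assms(2)]
  note c = bop_car[OF assms(3)]
  obtain C where C: "0 \<le> C" "\<And>x. x \<in> hcar G1 \<Longrightarrow> hnorm G2 (A x) \<le> C * hnorm G1 x"
    using bop_bound[OF S(1) assms(3)] by blast
  show ?thesis
  proof (rule bopI[where C="cmod a * C"])
    show "oscale G1 G2 a A \<in> extensional (hcar G1)" by (simp add: oscale_def)
    show "oscale G1 G2 a A (hadd G1 x y) = hadd G2 (oscale G1 G2 a A x) (oscale G1 G2 a A y)"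
      if "x \<in> hcar G1" "y \<in> hcar G1" for x y
      using that c S by (simp add: bop_add[OF assms(3)] hscale_hadd[OF S(2)])
    show "oscale G1 G2 a A (hscale G1 b x) = hscale G2 b (oscale G1 G2 a A x)" if "x \<in> hcar G1" for b x
      using that c S by (intro hilbert_eqI[OF assms(2)]) (auto simp: bop_scale[OF assms(3)])
    fix x assume x: "x \<in> hcar G1"
    show "hnorm G2 (oscale G1 G2 a A x) \<le> cmod a * C * hnorm G1 x"
      using C(2)[OF x] x c S by (simp add: mult.assoc mult_left_mono)
  qed (use c S in auto)
qed

section \<open>Domination of kernels\<close>

lemma psd_Cauchy_Schwarz:
  assumes k: "psd X k" and x: "x \<in> X" and y: "y \<in> X"
  shows "(cmod (k x y))\<^sup>2 \<le> Re (k x x) * Re (k y y)"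
proof -
  note S = hilbert_semi[OF kspace_hilbert[OF k]]
  have "cmod (k x y) \<le> hnorm (kspace X k) (kgen X k x) * hnorm (kspace X k) (kgen X k y)"
    using hinner_Cauchy_Schwarz[OF S kgen_car[OF k x] kgen_car[OF k y]] kgen_inner[OF k x y] by simp
  then have "(cmod (k x y))\<^sup>2 \<le> (hnorm (kspace X k) (kgen X k x) * hnorm (kspace X k) (kgen X k y))\<^sup>2"
    by (intro power_mono) auto
  also have "\<dots> = Re (k x x) * Re (k y y)"
    by (simp add: power_mult_distrib hnorm_sq[OF S kgen_car[OF k x]] hnorm_sq[OF S kgen_car[OF k y]]
      kgen_inner[OF k x x] kgen_inner[OF k y y])
  finally show ?thesis .
qed

text \<open>Log-convexity along powers of two gives \<open>a (2\<^sup>n) \<ge> a 0 \<cdot> b\<^bsup>2\<^sup>n\<^esup>\<close> for the ratio \<open>b\<close> of the first two terms,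
  so \<open>b\<close> cannot exceed the rate of a geometric bound. With \<open>a m = \<langle>h, C D\<^sup>m h\<rangle>\<close> this turns a norm bound
  for \<open>D\<close> into an operator inequality.\<close>

lemma log_convex_ratio_le:
  fixes a :: "nat \<Rightarrow> real"
  assumes conv: "\<And>m. (a m)\<^sup>2 \<le> a 0 * a (2 * m)" and a0: "0 \<le> a 0"
    and growth: "\<And>m. a m \<le> K * r ^ m" and r: "0 \<le> r"
  shows "a 1 \<le> r * a 0"
proof (rule ccontr)
  assume "\<not> a 1 \<le> r * a 0"
  then have lt: "r * a 0 < a 1" by simp
  have "a 0 \<noteq> 0"
  proof
    assume "a 0 = 0"
    then have "(a 1)\<^sup>2 \<le> 0" using conv[of 1] by simp
    then show False using lt \<open>a 0 = 0\<close> by simp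
  qed
  with a0 have pos: "0 < a 0" by simp
  define b where "b = a 1 / a 0"
  have b: "r < b" using lt pos by (simp add: b_def pos_less_divide_eq)
  then have b0: "0 < b" using r by simp
  have ge: "a 0 * b ^ (2 ^ n) \<le> a (2 ^ n)" for n
  proof (induction n)
    case 0 show ?case using pos by (simp add: b_def)
  next
    case (Suc n)
    have "(a 0 * b ^ (2 ^ n))\<^sup>2 \<le> (a (2 ^ n))\<^sup>2"
      using Suc pos b0 by (intro power_mono) auto
    also have "\<dots> \<le> a 0 * a (2 * 2 ^ n)" by (rule conv)
    finally have "a 0 * (a 0 * b ^ (2 * 2 ^ n)) \<le> a 0 * a (2 * 2 ^ n)"
      by (simp add: power2_eq_square power_mult_distrib mult_2 power_add mult_ac)
    with pos show ?case by simp
  qed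
  have bound: "a 0 * b ^ (2 ^ n) \<le> K * r ^ (2 ^ n)" for n using ge[of n] growth[of "2 ^ n"] by linarith
  have "r \<noteq> 0"
  proof
    assume "r = 0"
    have "0 < a 0 * b ^ (2 ^ 0)" using pos b0 by simp
    then show False using bound[of 0] \<open>r = 0\<close> by simp
  qed
  with r have r0: "0 < r" by simp
  have q: "1 < b / r" using b r0 by simp
  obtain n where n: "K / a 0 < (b / r) ^ n" using real_arch_pow[OF q] by blast
  have "(b / r) ^ n \<le> (b / r) ^ (2 ^ n)" using q by (intro power_increasing) (auto intro: less_imp_le)
  also have "\<dots> \<le> K / a 0"
    using bound[of n] pos r0 by (simp add: power_divide field_simps)
  finally show False using n by simp
qed

definition mform :: "'a hspace \<Rightarrow> nat \<Rightarrow> (nat \<Rightarrow> nat \<Rightarrow> 'a \<Rightarrow> 'a) \<Rightarrow> (nat \<Rightarrow> 'a) \<Rightarrow> (nat \<Rightarrow> 'a) \<Rightarrow> complex" where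
  "mform G n C u v = (\<Sum>i<n. \<Sum>j<n. hinner G (u i) (C i j (v j)))"

lemma matpos_mform:
  "matpos G n C \<longleftrightarrow> (\<forall>u. (\<forall>j<n. u j \<in> hcar G) \<longrightarrow> Im (mform G n C u u) = 0 \<and> 0 \<le> Re (mform G n C u u))"
  by (simp add: matpos_def mform_def complex_is_Real_iff)

lemma sum_swap4:
  "(\<Sum>j\<in>J. \<Sum>l\<in>L. \<Sum>a\<in>A. \<Sum>b\<in>B. f j l a b) = (\<Sum>a\<in>A. \<Sum>b\<in>B. \<Sum>j\<in>J. \<Sum>l\<in>L. f j l a b)"
proof -
  have "(\<Sum>j\<in>J. \<Sum>l\<in>L. \<Sum>a\<in>A. \<Sum>b\<in>B. f j l a b) = (\<Sum>j\<in>J. \<Sum>a\<in>A. \<Sum>l\<in>L. \<Sum>b\<in>B. f j l a b)"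
    by (intro sum.cong refl sum.swap)
  also have "\<dots> = (\<Sum>a\<in>A. \<Sum>j\<in>J. \<Sum>l\<in>L. \<Sum>b\<in>B. f j l a b)" by (rule sum.swap)
  also have "\<dots> = (\<Sum>a\<in>A. \<Sum>j\<in>J. \<Sum>b\<in>B. \<Sum>l\<in>L. f j l a b)"
    by (intro sum.cong refl sum.swap)
  also have "\<dots> = (\<Sum>a\<in>A. \<Sum>b\<in>B. \<Sum>j\<in>J. \<Sum>l\<in>L. f j l a b)"
    by (intro sum.cong refl sum.swap)
  finally show ?thesis .
qed

text \<open>This makes the Cauchy-Schwarz inequality available for the form of an operator matrix.\<close>

lemma psd_mform:
  assumes G: "hilbert_space G" and C: "\<And>i j. i < n \<Longrightarrow> j < n \<Longrightarrow> C i j \<in> bop G G" and pos: "matpos G n C"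
  shows "psd {u. \<forall>j<n. u j \<in> hcar G} (mform G n C)"
proof (rule psdI)
  note S = hilbert_semi[OF G]
  fix N :: nat and x :: "nat \<Rightarrow> nat \<Rightarrow> 'a" and c :: "nat \<Rightarrow> complex"
  assume "\<And>i. i < N \<Longrightarrow> x i \<in> {u. \<forall>j<n. u j \<in> hcar G}"
  then have x: "x i j \<in> hcar G" if "i < N" "j < n" for i j using that by auto
  define w where "w = (\<lambda>j. hsum G (\<lambda>i. hscale G (c i) (x i j)) N)"
  have w: "w j \<in> hcar G" if "j < n" for j unfolding w_def using x[OF _ that] S by (intro hsum_car) auto
  have e: "hinner G (w j) (C j l (w l)) = (\<Sum>a<N. \<Sum>b<N. cnj (c a) * c b * hinner G (x a j) (C j l (x b l)))"
    if "j < n" "l < n" for j l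
  proof -
    note Cjl = C[OF that] and Cc = bop_car[OF C[OF that]]
    have Cw: "C j l (w l) = hsum G (\<lambda>b. C j l (hscale G (c b) (x b l))) N"
      unfolding w_def by (rule bop_hsum[OF G G Cjl]) (use x[OF _ that(2)] S in auto)
    have "hinner G (w j) (C j l (w l)) = (\<Sum>b<N. hinner G (w j) (C j l (hscale G (c b) (x b l))))"
      unfolding Cw by (rule hinner_hsum_right[OF S w[OF that(1)]]) (use x[OF _ that(2)] S Cc in auto)
    also have "\<dots> = (\<Sum>b<N. \<Sum>a<N. cnj (c a) * c b * hinner G (x a j) (C j l (x b l)))"
    proof (intro sum.cong refl)
      fix b assume "b \<in> {..<N}"
      then have b: "x b l \<in> hcar G" using x that by simp
      have "hinner G (w j) (hscale G (c b) (C j l (x b l)))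
          = (\<Sum>a<N. hinner G (hscale G (c a) (x a j)) (hscale G (c b) (C j l (x b l))))"
        unfolding w_def by (rule hinner_hsum_left[OF S]) (use x[OF _ that(1)] b S Cc in auto)
      also have "\<dots> = (\<Sum>a<N. cnj (c a) * c b * hinner G (x a j) (C j l (x b l)))"
        using x[OF _ that(1)] b S Cc by (intro sum.cong refl) auto
      finally show "hinner G (w j) (C j l (hscale G (c b) (x b l)))
          = (\<Sum>a<N. cnj (c a) * c b * hinner G (x a j) (C j l (x b l)))"
        unfolding bop_scale[OF Cjl b] .
    qed
    also have "\<dots> = (\<Sum>a<N. \<Sum>b<N. cnj (c a) * c b * hinner G (x a j) (C j l (x b l)))"
      by (rule sum.swap)
    finally show ?thesis .
  qed
  have "kform (mform G n C) N x c = mform G n C w w"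
  proof -
    have "mform G n C w w = (\<Sum>j<n. \<Sum>l<n. \<Sum>a<N. \<Sum>b<N. cnj (c a) * c b * hinner G (x a j) (C j l (x b l)))"
      unfolding mform_def by (intro sum.cong refl) (auto simp: e)
    also have "\<dots> = (\<Sum>a<N. \<Sum>b<N. \<Sum>j<n. \<Sum>l<n. cnj (c a) * c b * hinner G (x a j) (C j l (x b l)))"
      by (rule sum_swap4)
    finally show ?thesis by (simp add: kform_def mform_def sum_distrib_left)
  qed
  then show "Im (kform (mform G n C) N x c) = 0 \<and> 0 \<le> Re (kform (mform G n C) N x c)"
    using pos w by (simp add: matpos_mform)
qed

text \<open>If \<open>D\<close> is self-adjoint and commutes with the entries of a positive matrix \<open>C\<close>, the numbers
  \<open>\<langle>h, C D\<^sup>m h\<rangle>\<close> are log-convex by Cauchy-Schwarz and grow at most like \<open>r\<^sup>m\<close>. Therefore \<open>C D \<le> r C\<close>.\<close>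

lemma matpos_dominated:
  assumes G: "hilbert_space G" and C: "\<And>i j. i < n \<Longrightarrow> j < n \<Longrightarrow> C i j \<in> bop G G" and pos: "matpos G n C"
    and D: "D \<in> bop G G" and sa: "\<And>x y. x \<in> hcar G \<Longrightarrow> y \<in> hcar G \<Longrightarrow> hinner G (D x) y = hinner G x (D y)"
    and comm: "\<And>i j x. i < n \<Longrightarrow> j < n \<Longrightarrow> x \<in> hcar G \<Longrightarrow> C i j (D x) = D (C i j x)"
    and r: "0 \<le> r" "\<And>x. x \<in> hcar G \<Longrightarrow> hnorm G (D x) \<le> r * hnorm G x"
    and h: "\<And>j. j < n \<Longrightarrow> h j \<in> hcar G"
  shows "Im (mform G n C h (\<lambda>j. D (h j))) = 0"
    and "Re (mform G n C h (\<lambda>j. D (h j))) \<le> r * Re (mform G n C h h)"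
proof -
  note S = hilbert_semi[OF G] and Dc = bop_car[OF D]
  let ?U = "{u. \<forall>j<n. u j \<in> hcar G}"
  note psd = psd_mform[OF G C pos]
  define pw where "pw = (\<lambda>m j. (D ^^ m) (h j))"
  have pwc: "pw m j \<in> hcar G" if "j < n" for m j
    unfolding pw_def by (induction m) (auto simp: h[OF that] Dc)
  have U: "pw m \<in> ?U" for m using pwc by simp
  have shift1: "mform G n C (\<lambda>j. D (u j)) v = mform G n C u (\<lambda>j. D (v j))" if "u \<in> ?U" "v \<in> ?U" for u v
    unfolding mform_def
  proof (intro sum.cong refl)
    fix i j assume "i \<in> {..<n}" "j \<in> {..<n}"
    then have ij: "i < n" "j < n" "u i \<in> hcar G" "v j \<in> hcar G" using that by auto
    show "hinner G (D (u i)) (C i j (v j)) = hinner G (u i) (C i j (D (v j)))"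
      using sa[OF ij(3) bop_car[OF C[OF ij(1,2)] ij(4)]] comm[OF ij(1,2,4)] by simp
  qed
  have pwS: "pw (Suc m) = (\<lambda>j. D (pw m j))" for m by (simp add: pw_def)
  \<comment> \<open>The form of \<open>C\<close> at \<open>D\<^sup>l h\<close> and \<open>D\<^sup>m h\<close> depends on \<open>l + m\<close> alone.\<close>
  have shift: "mform G n C (pw l) (pw m) = mform G n C (pw 0) (pw (l + m))" for l m
  proof (induction l arbitrary: m)
    case (Suc l)
    have "mform G n C (pw (Suc l)) (pw m) = mform G n C (pw l) (pw (Suc m))"
      unfolding pwS by (rule shift1[OF U U])
    then show ?case using Suc[of "Suc m"] by simp
  qed simp
  have h0: "pw 0 = h" by (simp add: pw_def)
  have h1: "pw 1 = (\<lambda>j. D (h j))" by (simp add: pw_def)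
  have "mform G n C (pw 1) (pw 0) = cnj (mform G n C (pw 0) (pw 1))" by (rule psd_herm[OF psd U U])
  then have "mform G n C (pw 0) (pw 1) = cnj (mform G n C (pw 0) (pw 1))" using shift[of 1 0] by simp
  then have "Im (mform G n C (pw 0) (pw 1)) = 0" by (metis Reals_cnj_iff complex_is_Real_iff)
  then show "Im (mform G n C h (\<lambda>j. D (h j))) = 0" by (simp only: h0 h1)
  define a where "a m = Re (mform G n C (pw 0) (pw m))" for m
  have "\<exists>c. i < n \<longrightarrow> j < n \<longrightarrow> 0 \<le> c \<and> (\<forall>x\<in>hcar G. hnorm G (C i j x) \<le> c * hnorm G x)" for i j
  proof (cases "i < n \<and> j < n")
    case True
    then show ?thesis using bop_bound[OF S C[of i j]] by metis
  qed auto
  then obtain c where c: "\<And>i j. i < n \<Longrightarrow> j < n \<Longrightarrow> 0 \<le> c i j"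
    "\<And>i j x. i < n \<Longrightarrow> j < n \<Longrightarrow> x \<in> hcar G \<Longrightarrow> hnorm G (C i j x) \<le> c i j * hnorm G x" by metis
  define K where "K = (\<Sum>i<n. \<Sum>j<n. hnorm G (h i) * (c i j * hnorm G (h j)))"
  have pwn: "hnorm G (pw m j) \<le> r ^ m * hnorm G (h j)" if "j < n" for m j
  proof (induction m)
    case 0 show ?case by (simp add: pw_def)
  next
    case (Suc m)
    have "hnorm G (pw (Suc m) j) \<le> r * hnorm G (pw m j)" unfolding pwS by (rule r(2)[OF pwc[OF that]])
    also have "\<dots> \<le> r * (r ^ m * hnorm G (h j))" using Suc r(1) by (rule mult_left_mono)
    finally show ?case by (simp add: mult.assoc)
  qed
  have "a 1 \<le> r * a 0"
  proof (rule log_convex_ratio_le[where K=K])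
    fix m
    have "(cmod (mform G n C (pw 0) (pw m)))\<^sup>2 \<le> Re (mform G n C (pw 0) (pw 0)) * Re (mform G n C (pw m) (pw m))"
      by (rule psd_Cauchy_Schwarz[OF psd U U])
    also have "mform G n C (pw m) (pw m) = mform G n C (pw 0) (pw (2 * m))"
      unfolding shift[of m m] by (simp add: mult_2)
    finally have "(cmod (mform G n C (pw 0) (pw m)))\<^sup>2 \<le> a 0 * a (2 * m)" by (simp add: a_def)
    moreover have "(a m)\<^sup>2 \<le> (cmod (mform G n C (pw 0) (pw m)))\<^sup>2"
      unfolding a_def cmod_power2 by simp
    ultimately show "(a m)\<^sup>2 \<le> a 0 * a (2 * m)" by linarith
    have "a m \<le> cmod (mform G n C (pw 0) (pw m))" unfolding a_def by (rule complex_Re_le_cmod)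
    also have "\<dots> \<le> (\<Sum>i<n. \<Sum>j<n. hnorm G (h i) * (c i j * (r ^ m * hnorm G (h j))))"
      unfolding mform_def
    proof (intro sum_norm_le)
      fix i j assume "i \<in> {..<n}" "j \<in> {..<n}"
      then have ij: "i < n" "j < n" by auto
      have "cmod (hinner G (h i) (C i j (pw m j))) \<le> hnorm G (h i) * hnorm G (C i j (pw m j))"
        by (rule hinner_Cauchy_Schwarz[OF S h[OF ij(1)] bop_car[OF C[OF ij] pwc[OF ij(2)]]])
      also have "\<dots> \<le> hnorm G (h i) * (c i j * hnorm G (pw m j))"
        by (intro mult_left_mono c ij pwc hnorm_ge0[OF S] h)
      also have "\<dots> \<le> hnorm G (h i) * (c i j * (r ^ m * hnorm G (h j)))"
        by (intro mult_left_mono c ij pwn hnorm_ge0[OF S] h)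
      finally show "cmod (hinner G (pw 0 i) (C i j (pw m j))) \<le> hnorm G (h i) * (c i j * (r ^ m * hnorm G (h j)))"
        by (simp add: h0)
    qed
    also have "\<dots> = K * r ^ m" by (simp add: K_def sum_distrib_left sum_distrib_right mult_ac)
    finally show "a m \<le> K * r ^ m" .
  next
    show "0 \<le> a 0" using psd_diag(2)[OF psd U] by (simp add: a_def)
  qed (rule r(1))
  then show "Re (mform G n C h (\<lambda>j. D (h j))) \<le> r * Re (mform G n C h h)" by (simp only: a_def h0 h1)
qed

text \<open>Kernels given by operator matrices: \<open>\<phi> x\<close> is the vector and \<open>C x y\<close> the operator
  attached to the points.\<close>

lemma kform_mform:
  assumes G: "hilbert_space G" and C: "\<And>i j. i < n \<Longrightarrow> j < n \<Longrightarrow> C (x i) (x j) \<in> bop G G"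
    and D: "D \<in> bop G G" and \<phi>: "\<And>i. i < n \<Longrightarrow> \<phi> (x i) \<in> hcar G"
  shows "kform (\<lambda>x y. hinner G (\<phi> x) (C x y (D (\<phi> y)))) n x c
    = mform G n (\<lambda>i j. C (x i) (x j)) (\<lambda>i. hscale G (c i) (\<phi> (x i))) (\<lambda>i. D (hscale G (c i) (\<phi> (x i))))"
  unfolding kform_def mform_def
proof (intro sum.cong refl)
  fix i j assume "i \<in> {..<n}" "j \<in> {..<n}"
  then have ij: "i < n" "j < n" by auto
  note Dp = bop_car[OF D \<phi>[OF ij(2)]]
  show "cnj (c i) * c j * hinner G (\<phi> (x i)) (C (x i) (x j) (D (\<phi> (x j)))) =
        hinner G (hscale G (c i) (\<phi> (x i))) (C (x i) (x j) (D (hscale G (c j) (\<phi> (x j)))))"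
    unfolding bop_scale[OF D \<phi>[OF ij(2)]] bop_scale[OF C[OF ij] Dp]
    using \<phi>[OF ij(1)] bop_car[OF C[OF ij] Dp] hilbert_semi[OF G] by simp
qed

lemma psd_of_matpos:
  assumes G: "hilbert_space G" and C: "\<And>x y. x \<in> X \<Longrightarrow> y \<in> X \<Longrightarrow> C x y \<in> bop G G"
    and pos: "\<And>n x. (\<And>i. i < n \<Longrightarrow> x i \<in> X) \<Longrightarrow> matpos G n (\<lambda>i j. C (x i) (x j))"
    and \<phi>: "\<And>x. x \<in> X \<Longrightarrow> \<phi> x \<in> hcar G"
  shows "psd X (\<lambda>x y. hinner G (\<phi> x) (C x y (\<phi> y)))"
proof (rule psdI)
  fix n :: nat and x :: "nat \<Rightarrow> _" and c assume x: "\<And>i. i < n \<Longrightarrow> x i \<in> X"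
  have S: "semi_inner_space G" using G by simp
  let ?h = "\<lambda>i. hscale G (c i) (\<phi> (x i))"
  have h: "?h i \<in> hcar G" if "i < n" for i using \<phi>[OF x[OF that]] S by simp
  have "kform (\<lambda>x y. hinner G (\<phi> x) (C x y (\<phi> y))) n x c = kform (\<lambda>x y. hinner G (\<phi> x) (C x y (oid G (\<phi> y)))) n x c"
    using \<phi> x by (intro kform_cong) simp
  also have "\<dots> = mform G n (\<lambda>i j. C (x i) (x j)) ?h (\<lambda>i. oid G (?h i))"
    by (rule kform_mform[OF G _ oid_bop[OF S]]) (use C \<phi> x in auto)
  also have "\<dots> = mform G n (\<lambda>i j. C (x i) (x j)) ?h ?h"
    unfolding mform_def using h by (intro sum.cong refl) simp
  finally have k: "kform (\<lambda>x y. hinner G (\<phi> x) (C x y (\<phi> y))) n x c = mform G n (\<lambda>i j. C (x i) (x j)) ?h ?h" .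
  have "matpos G n (\<lambda>i j. C (x i) (x j))" by (rule pos[OF x])
  then show "Im (kform (\<lambda>x y. hinner G (\<phi> x) (C x y (\<phi> y))) n x c) = 0 \<and>
      0 \<le> Re (kform (\<lambda>x y. hinner G (\<phi> x) (C x y (\<phi> y))) n x c)"
    unfolding k matpos_mform by (elim allE[of _ ?h] impE) (auto simp: h)
qed

text \<open>The inequality \<open>C W\<^sup>* W \<le> r\<^sup>2 C\<close> for kernels. An operator on a tensor product that acts by \<open>W\<close> on the last
  factor is bounded by \<open>r\<close> because of it.\<close>

lemma psd_dominated:
  assumes G: "hilbert_space G" and G': "hilbert_space G'"
    and C: "\<And>x y. x \<in> X \<Longrightarrow> y \<in> X \<Longrightarrow> C x y \<in> bop G G"
    and pos: "\<And>n x. (\<And>i. i < n \<Longrightarrow> x i \<in> X) \<Longrightarrow> matpos G n (\<lambda>i j. C (x i) (x j))"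
    and \<phi>: "\<And>x. x \<in> X \<Longrightarrow> \<phi> x \<in> hcar G"
    and W: "W \<in> bop G G'" and r: "0 \<le> r" "\<And>x. x \<in> hcar G \<Longrightarrow> hnorm G' (W x) \<le> r * hnorm G x"
    and comm: "\<And>x y h. x \<in> X \<Longrightarrow> y \<in> X \<Longrightarrow> h \<in> hcar G \<Longrightarrow> C x y (hadj G G' W (W h)) = hadj G G' W (W (C x y h))"
  shows "psd X (\<lambda>x y. of_real (r\<^sup>2) * hinner G (\<phi> x) (C x y (\<phi> y)) - hinner G (\<phi> x) (C x y (hadj G G' W (W (\<phi> y)))))"
proof (rule psdI)
  fix n :: nat and x :: "nat \<Rightarrow> _" and c assume x: "\<And>i. i < n \<Longrightarrow> x i \<in> X"
  have S: "semi_inner_space G" and S': "semi_inner_space G'" using G G' by auto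
  define D where "D = ocomp G (hadj G G' W) W"
  have Wa: "hadj G G' W \<in> bop G' G" by (rule hadj_bop[OF G G' W])
  have D: "D \<in> bop G G" unfolding D_def by (rule ocomp_bop[OF S S' Wa W])
  have Da: "D h = hadj G G' W (W h)" if "h \<in> hcar G" for h using that by (simp add: D_def)
  have sa: "hinner G (D a) b = hinner G a (D b)" if "a \<in> hcar G" "b \<in> hcar G" for a b
    using hadj_left[OF G G' W that(2) bop_car[OF W that(1)]] hadj_right[OF G G' W that(1) bop_car[OF W that(2)]]
    by (simp add: Da that)
  have bd: "hnorm G (D a) \<le> r\<^sup>2 * hnorm G a" if "a \<in> hcar G" for a
  proof -
    have "hnorm G (D a) \<le> r * hnorm G' (W a)"
      unfolding Da[OF that] by (rule hadj_bound[OF G G' W r bop_car[OF W that]])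
    also have "\<dots> \<le> r * (r * hnorm G a)" by (intro mult_left_mono r that)
    finally show ?thesis by (simp add: power2_eq_square mult.assoc)
  qed
  let ?k = "\<lambda>x y. hinner G (\<phi> x) (C x y (\<phi> y))"
  let ?l = "\<lambda>x y. hinner G (\<phi> x) (C x y (hadj G G' W (W (\<phi> y))))"
  let ?h = "\<lambda>i. hscale G (c i) (\<phi> (x i))"
  let ?C = "\<lambda>i j. C (x i) (x j)"
  have h: "?h i \<in> hcar G" if "i < n" for i using \<phi>[OF x[OF that]] S by simp
  have k: "kform ?k n x c = mform G n ?C ?h ?h"
  proof -
    have "kform ?k n x c = kform (\<lambda>x y. hinner G (\<phi> x) (C x y (oid G (\<phi> y)))) n x c"
      using \<phi> x by (intro kform_cong) simp
    also have "\<dots> = mform G n ?C ?h (\<lambda>i. oid G (?h i))"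
      by (rule kform_mform[OF G _ oid_bop[OF S]]) (use C \<phi> x in auto)
    also have "\<dots> = mform G n ?C ?h ?h"
      unfolding mform_def using h by (intro sum.cong refl) simp
    finally show ?thesis .
  qed
  have l: "kform ?l n x c = mform G n ?C ?h (\<lambda>i. D (?h i))"
  proof -
    have "kform ?l n x c = kform (\<lambda>x y. hinner G (\<phi> x) (C x y (D (\<phi> y)))) n x c"
      using \<phi> x by (intro kform_cong) (simp add: Da)
    also have "\<dots> = mform G n ?C ?h (\<lambda>i. D (?h i))"
      by (rule kform_mform[OF G _ D]) (use C \<phi> x in auto)
    finally show ?thesis .
  qed
  have cm: "?C i j (D a) = D (?C i j a)" if "i < n" "j < n" "a \<in> hcar G" for i j a
    using comm[OF x[OF that(1)] x[OF that(2)] that(3)] bop_car[OF C[OF x[OF that(1)] x[OF that(2)]] that(3)] that(3)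
    by (simp add: Da)
  have mp: "matpos G n ?C" by (rule pos[OF x])
  have r2: "0 \<le> r\<^sup>2" by simp
  have Cb: "?C i j \<in> bop G G" if "i < n" "j < n" for i j by (rule C[OF x[OF that(1)] x[OF that(2)]])
  have dom1: "Im (mform G n ?C ?h (\<lambda>i. D (?h i))) = 0"
    by (rule matpos_dominated(1)[OF G Cb mp D sa cm r2 bd h])
  have dom2: "Re (mform G n ?C ?h (\<lambda>i. D (?h i))) \<le> r\<^sup>2 * Re (mform G n ?C ?h ?h)"
    by (rule matpos_dominated(2)[OF G Cb mp D sa cm r2 bd h])
  have k0: "Im (mform G n ?C ?h ?h) = 0" using mp unfolding matpos_mform by (elim allE[of _ ?h] impE) (auto simp: h)
  show "Im (kform (\<lambda>x y. of_real (r\<^sup>2) * ?k x y - ?l x y) n x c) = 0 \<and>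
      0 \<le> Re (kform (\<lambda>x y. of_real (r\<^sup>2) * ?k x y - ?l x y) n x c)"
    unfolding kform_diff kform_mult k l using dom1 dom2 k0 by simp
qed

text \<open>The form of the constant matrix at \<open>u\<close> is the form of \<open>A\<close> at the sum of the \<open>u j\<close>.\<close>

lemma matpos_const:
  assumes G: "hilbert_space G" and A: "A \<in> bop G G"
    and pos: "\<And>x. x \<in> hcar G \<Longrightarrow> Im (hinner G x (A x)) = 0 \<and> 0 \<le> Re (hinner G x (A x))"
  shows "matpos G n (\<lambda>i j. A)"
  unfolding matpos_mform
proof (intro allI impI)
  fix u assume u: "\<forall>j<n. u j \<in> hcar G"
  note S = hilbert_semi[OF G]
  have s: "hsum G u n \<in> hcar G" using u S by (intro hsum_car) auto
  have "hinner G (hsum G u n) (A (hsum G u n)) = (\<Sum>i<n. hinner G (u i) (A (hsum G u n)))"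
    by (rule hinner_hsum_left[OF S bop_car[OF A s]]) (use u in auto)
  also have "\<dots> = (\<Sum>i<n. \<Sum>j<n. hinner G (u i) (A (u j)))"
  proof (intro sum.cong refl)
    fix i assume "i \<in> {..<n}"
    have "A (hsum G u n) = hsum G (\<lambda>j. A (u j)) n" by (rule bop_hsum[OF G G A]) (use u in auto)
    then show "hinner G (u i) (A (hsum G u n)) = (\<Sum>j<n. hinner G (u i) (A (u j)))"
      using hinner_hsum_right[OF S, of "u i" n "\<lambda>j. A (u j)"] u bop_car[OF A] \<open>i \<in> {..<n}\<close> by simp
  qed
  finally have "mform G n (\<lambda>i j. A) u u = hinner G (hsum G u n) (A (hsum G u n))" by (simp add: mform_def)
  then show "Im (mform G n (\<lambda>i j. A) u u) = 0 \<and> 0 \<le> Re (mform G n (\<lambda>i j. A) u u)" using pos[OF s] by simp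
qed

lemma psd_hinner:
  assumes G: "hilbert_space G" shows "psd (hcar G) (hinner G)"
proof -
  have S: "semi_inner_space G" using G by simp
  have "psd (hcar G) (\<lambda>x y. hinner G x (oid G y))"
    by (rule psd_of_matpos[OF G, where C="\<lambda>x y. oid G" and \<phi>="\<lambda>x. x"])
      (auto intro!: oid_bop[OF S] matpos_const[OF G] hinner_ge0[OF S] simp: hinner_self[OF S])
  then show ?thesis by (subst psd_cong[where k'="\<lambda>x y. hinner G x (oid G y)"]) simp_all
qed

lemma psd_bop_dominated:
  assumes G: "hilbert_space G" and G': "hilbert_space G'" and W: "W \<in> bop G G'"
    and r: "0 \<le> r" "\<And>x. x \<in> hcar G \<Longrightarrow> hnorm G' (W x) \<le> r * hnorm G x"
  shows "psd (hcar G) (\<lambda>x y. of_real (r\<^sup>2) * hinner G x y - hinner G' (W x) (W y))"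
proof -
  have S: "semi_inner_space G" using G by simp
  have "psd (hcar G) (\<lambda>x y. of_real (r\<^sup>2) * hinner G x (oid G y) - hinner G x (oid G (hadj G G' W (W y))))"
    by (rule psd_dominated[OF G G', where C="\<lambda>x y. oid G" and \<phi>="\<lambda>x. x"])
      (use W r bop_car[OF W] hadj_car[OF G G' W] in \<open>auto intro!: oid_bop[OF S] matpos_const[OF G] hinner_ge0[OF S] simp: hinner_self[OF S]\<close>)
  moreover have "hinner G x (oid G (hadj G G' W (W y))) = hinner G' (W x) (W y)" if "x \<in> hcar G" "y \<in> hcar G" for x y
    using hadj_right[OF G G' W that(1) bop_car[OF W that(2)]] hadj_car[OF G G' W bop_car[OF W that(2)]] by simp
  ultimately show ?thesis
    by (subst psd_cong[where k'="\<lambda>x y. of_real (r\<^sup>2) * hinner G x (oid G y) - hinner G x (oid G (hadj G G' W (W y)))"]) simp_all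
qed

section \<open>Operator algebras\<close>

lemma hadj_hadj:
  assumes G1: "hilbert_space G1" and G2: "hilbert_space G2" and A: "A \<in> bop G1 G2"
  shows "hadj G2 G1 (hadj G1 G2 A) = A"
  by (rule hadj_eqI[OF G2 G1 hadj_bop[OF G1 G2 A] A]) (simp add: hadj_right[OF G1 G2 A])

lemma hadj_ocomp:
  assumes G1: "hilbert_space G1" and G2: "hilbert_space G2" and G3: "hilbert_space G3"
    and A: "A \<in> bop G2 G3" and B: "B \<in> bop G1 G2"
  shows "hadj G1 G3 (ocomp G1 A B) = ocomp G3 (hadj G1 G2 B) (hadj G2 G3 A)"
proof (rule hadj_eqI[OF G1 G3])
  note S = hilbert_semi[OF G1] hilbert_semi[OF G2] hilbert_semi[OF G3]
  show "ocomp G1 A B \<in> bop G1 G3" by (rule ocomp_bop[OF S(1,2) A B])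
  show "ocomp G3 (hadj G1 G2 B) (hadj G2 G3 A) \<in> bop G3 G1"
    by (rule ocomp_bop[OF S(3,2) hadj_bop[OF G1 G2 B] hadj_bop[OF G2 G3 A]])
  show "hinner G1 (ocomp G3 (hadj G1 G2 B) (hadj G2 G3 A) y) x = hinner G3 y (ocomp G1 A B x)"
    if "x \<in> hcar G1" "y \<in> hcar G3" for x y
    using that by (simp add: hadj_left[OF G1 G2 B] hadj_left[OF G2 G3 A] hadj_car[OF G2 G3 A] bop_car[OF B])
qed

lemma hadj_oid: "hilbert_space G \<Longrightarrow> hadj G G (oid G) = oid G"
  by (rule hadj_eqI) (auto intro: oid_bop)

lemma hadj_oadd:
  assumes G1: "hilbert_space G1" and G2: "hilbert_space G2" and A: "A \<in> bop G1 G2" and B: "B \<in> bop G1 G2"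
  shows "hadj G1 G2 (oadd G1 G2 A B) = oadd G2 G1 (hadj G1 G2 A) (hadj G1 G2 B)"
  using hilbert_semi[OF G1] hilbert_semi[OF G2]
  by (intro hadj_eqI[OF G1 G2] oadd_bop G1 G2 A B hadj_bop)
    (simp_all add: hadj_left[OF G1 G2 A] hadj_left[OF G1 G2 B] hadj_car[OF G1 G2 A] hadj_car[OF G1 G2 B]
       bop_car[OF A] bop_car[OF B])

lemma hadj_oscale:
  assumes G1: "hilbert_space G1" and G2: "hilbert_space G2" and A: "A \<in> bop G1 G2"
  shows "hadj G1 G2 (oscale G1 G2 c A) = oscale G2 G1 (cnj c) (hadj G1 G2 A)"
  using hilbert_semi[OF G1] hilbert_semi[OF G2]
  by (intro hadj_eqI[OF G1 G2] oscale_bop G1 G2 A hadj_bop)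
    (simp_all add: hadj_left[OF G1 G2 A] hadj_car[OF G1 G2 A] bop_car[OF A])

definition star_algebra :: "'a hspace \<Rightarrow> ('a \<Rightarrow> 'a) set \<Rightarrow> bool" where
  "star_algebra G N \<longleftrightarrow> N \<subseteq> bop G G \<and> oid G \<in> N \<and>
     (\<forall>A\<in>N. \<forall>B\<in>N. ocomp G A B \<in> N) \<and> (\<forall>A\<in>N. \<forall>B\<in>N. oadd G G A B \<in> N) \<and>
     (\<forall>c. \<forall>A\<in>N. oscale G G c A \<in> N) \<and> (\<forall>A\<in>N. hadj G G A \<in> N)"

lemma star_algebraD:
  assumes "star_algebra G N"
  shows "A \<in> N \<Longrightarrow> A \<in> bop G G" "oid G \<in> N" "A \<in> N \<Longrightarrow> B \<in> N \<Longrightarrow> ocomp G A B \<in> N"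
    "A \<in> N \<Longrightarrow> B \<in> N \<Longrightarrow> oadd G G A B \<in> N" "A \<in> N \<Longrightarrow> oscale G G c A \<in> N" "A \<in> N \<Longrightarrow> hadj G G A \<in> N"
  using assms by (auto simp: star_algebra_def)

lemma commutant_bop: "A \<in> commutant G S \<Longrightarrow> A \<in> bop G G"
  by (simp add: commutant_def)

lemma commutantD:
  assumes "A \<in> commutant G S" "B \<in> S" "x \<in> hcar G" shows "A (B x) = B (A x)"
proof -
  have "ocomp G A B = ocomp G B A" using assms by (simp add: commutant_def)
  then have "ocomp G A B x = ocomp G B A x" by simp
  then show ?thesis using assms(3) by simp
qed

lemma commutantI:
  assumes "A \<in> bop G G" "\<And>B x. B \<in> S \<Longrightarrow> x \<in> hcar G \<Longrightarrow> A (B x) = B (A x)"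
  shows "A \<in> commutant G S"
  using assms by (auto simp: commutant_def ocomp_def compose_def restrict_def)

lemma commutant_star_algebra:
  assumes G: "hilbert_space G" and S: "S \<subseteq> bop G G" and adj: "\<And>A. A \<in> S \<Longrightarrow> hadj G G A \<in> S"
  shows "star_algebra G (commutant G S)"
  unfolding star_algebra_def
proof (intro conjI ballI allI)
  note Sm = hilbert_semi[OF G]
  have Sb: "B \<in> bop G G" if "B \<in> S" for B using S that by auto
  show "commutant G S \<subseteq> bop G G" by (auto simp: commutant_def)
  show "oid G \<in> commutant G S"
    by (rule commutantI[OF oid_bop[OF Sm]]) (simp add: bop_car[OF Sb])
  fix A assume A: "A \<in> commutant G S"
  note Ab = commutant_bop[OF A]
  show "hadj G G A \<in> commutant G S"
  proof (rule commutantI[OF hadj_bop[OF G G Ab]])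
    fix B x assume B: "B \<in> S" and x: "x \<in> hcar G"
    note Bb = Sb[OF B] and Ba = adj[OF B]
    show "hadj G G A (B x) = B (hadj G G A x)"
    proof (rule hilbert_eqI[OF G hadj_car[OF G G Ab bop_car[OF Bb x]] bop_car[OF Bb hadj_car[OF G G Ab x]]])
      fix d assume d: "d \<in> hcar G"
      have "hinner G d (hadj G G A (B x)) = hinner G (A d) (B x)" by (rule hadj_right[OF G G Ab d bop_car[OF Bb x]])
      also have "\<dots> = hinner G (hadj G G B (A d)) x"
        by (rule hadj_left[OF G G Bb x bop_car[OF Ab d], symmetric])
      also have "hadj G G B (A d) = A (hadj G G B d)" by (rule commutantD[OF A Ba d, symmetric])
      also have "hinner G (A (hadj G G B d)) x = hinner G (hadj G G B d) (hadj G G A x)"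
        by (rule hadj_right[OF G G Ab hadj_car[OF G G Bb d] x, symmetric])
      also have "\<dots> = hinner G d (B (hadj G G A x))" by (rule hadj_left[OF G G Bb hadj_car[OF G G Ab x] d])
      finally show "hinner G d (hadj G G A (B x)) = hinner G d (B (hadj G G A x))" .
    qed
  qed
  show "oscale G G c A \<in> commutant G S" for c
    by (rule commutantI[OF oscale_bop[OF G G Ab]])
      (simp add: bop_car[OF Sb] bop_car[OF Ab] commutantD[OF A] bop_scale[OF Sb])
  fix A' assume A': "A' \<in> commutant G S"
  note Ab' = commutant_bop[OF A']
  show "ocomp G A A' \<in> commutant G S"
    by (rule commutantI[OF ocomp_bop[OF Sm Sm Ab Ab']])
      (simp add: bop_car[OF Sb] bop_car[OF Ab'] commutantD[OF A] commutantD[OF A'])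
  show "oadd G G A A' \<in> commutant G S"
    by (rule commutantI[OF oadd_bop[OF G G Ab Ab']])
      (simp add: bop_car[OF Sb] bop_car[OF Ab] bop_car[OF Ab'] commutantD[OF A] commutantD[OF A'] bop_add[OF Sb])
qed

lemma von_neumann_commutant_star_algebra:
  assumes H: "hilbert_space H" and M: "von_neumann_algebra H M"
  shows "star_algebra H (commutant H M)"
  using M by (intro commutant_star_algebra[OF H]) (auto simp: von_neumann_algebra_def)

lemma von_neumann_star_algebra:
  assumes H: "hilbert_space H" and M: "von_neumann_algebra H M"
  shows "star_algebra H M"
proof -
  note N = von_neumann_commutant_star_algebra[OF assms]
  have "star_algebra H (commutant H (commutant H M))"
    using star_algebraD[OF N] by (intro commutant_star_algebra[OF H]) auto
  then show ?thesis using M by (simp add: von_neumann_algebra_def)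
qed

lemma von_neumannI:
  assumes "von_neumann_algebra H M" "A \<in> bop H H" "\<And>B x. B \<in> commutant H M \<Longrightarrow> x \<in> hcar H \<Longrightarrow> A (B x) = B (A x)"
  shows "A \<in> M"
proof -
  have "A \<in> commutant H (commutant H M)" by (rule commutantI[OF assms(2,3)])
  then show ?thesis using assms(1) by (simp add: von_neumann_algebra_def)
qed

section \<open>Isometric, fully coisometric representations\<close>

text \<open>The two closure assumptions on the product system make \<open>V\<^sub>t(\<xi>)\<^sup>* V\<^sub>t(\<eta>)\<close> and
  \<open>V\<^sub>t(\<xi>) V\<^sub>s(\<eta>)\<close> values of the representation again.\<close>

locale coisometric_representation =
  fixes H :: "'a hspace" and N :: "('a \<Rightarrow> 'a) set" and E :: "('a, 'e) prodsys"
    and K :: "'k hspace" and V :: "real \<Rightarrow> 'e \<Rightarrow> 'k \<Rightarrow> 'k"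
  assumes H: "hilbert_space H" and N: "star_algebra H N" and K: "hilbert_space K"
    and cov: "covariant_rep H N E K V" and iso: "isometric_rep E K V" and coiso: "fully_coisometric_rep E K V"
    and einner_coeff: "\<And>t \<xi> \<eta>. 0 \<le> t \<Longrightarrow> \<xi> \<in> ecar (pfib E t) \<Longrightarrow> \<eta> \<in> ecar (pfib E t)
      \<Longrightarrow> einner (pfib E t) \<xi> \<eta> \<in> N"
    and fibre_zero: "ecar (pfib E 0) = pzero E ` N"
    and pmul_closed: "\<And>t s \<xi> \<eta>. 0 \<le> t \<Longrightarrow> 0 \<le> s \<Longrightarrow> \<xi> \<in> ecar (pfib E t) \<Longrightarrow> \<eta> \<in> ecar (pfib E s)
      \<Longrightarrow> pmul E t s \<xi> \<eta> \<in> ecar (pfib E (t + s))"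
begin

definition rho :: "('a \<Rightarrow> 'a) \<Rightarrow> 'k \<Rightarrow> 'k" where "rho a = V 0 (pzero E a)"

definition R :: "('k \<Rightarrow> 'k) set" where "R = commutant K (rho ` N)"

definition alpha :: "real \<Rightarrow> ('k \<Rightarrow> 'k) \<Rightarrow> 'k \<Rightarrow> 'k" where
  "alpha t S = ocomp K (rep_tilde E K V t)
     (ocomp K (rep_id_tensor E K V t S) (hadj (rep_space E K V t) K (rep_tilde E K V t)))"

lemmas KS = hilbert_semi[OF K]

lemma V_bop: "0 \<le> t \<Longrightarrow> \<xi> \<in> ecar (pfib E t) \<Longrightarrow> V t \<xi> \<in> bop K K"
  using cov by (simp add: covariant_rep_def)

lemma V_pmul:
  assumes "0 \<le> t" "0 \<le> s" "\<xi> \<in> ecar (pfib E t)" "\<eta> \<in> ecar (pfib E s)" "h \<in> hcar K"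
  shows "V (t + s) (pmul E t s \<xi> \<eta>) h = V t \<xi> (V s \<eta> h)"
proof -
  have "V (t + s) (pmul E t s \<xi> \<eta>) = ocomp K (V t \<xi>) (V s \<eta>)"
    using cov assms by (simp add: covariant_rep_def)
  then show ?thesis using assms by simp
qed

lemma rho_star: "star_hom H N K rho"
  using cov by (simp add: covariant_rep_def rho_def[abs_def])

lemma rho_bop: "a \<in> N \<Longrightarrow> rho a \<in> bop K K"
  using rho_star by (simp add: star_hom_def)

lemma rho_hadj: "a \<in> N \<Longrightarrow> rho (hadj H H a) = hadj K K (rho a)"
  using rho_star by (simp add: star_hom_def)

lemma R_star_algebra: "star_algebra K R"
  unfolding R_def
proof (rule commutant_star_algebra[OF K])
  show "rho ` N \<subseteq> bop K K" using rho_bop by auto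
  fix A assume "A \<in> rho ` N"
  then obtain a where a: "a \<in> N" "A = rho a" by auto
  then show "hadj K K A \<in> rho ` N" using rho_hadj[OF a(1)] star_algebraD(6)[OF N a(1)] by force
qed

lemma R_bop: "S \<in> R \<Longrightarrow> S \<in> bop K K"
  using R_star_algebra by (rule star_algebraD)

lemma R_commute: "S \<in> R \<Longrightarrow> a \<in> N \<Longrightarrow> x \<in> hcar K \<Longrightarrow> S (rho a x) = rho a (S x)"
  unfolding R_def by (rule commutantD) auto

lemma V_inner:
  assumes t: "0 \<le> t" and \<xi>: "\<xi> \<in> ecar (pfib E t)" "\<eta> \<in> ecar (pfib E t)" and h: "h \<in> hcar K" "k \<in> hcar K"
  shows "hinner K (V t \<xi> h) (V t \<eta> k) = hinner K h (rho (einner (pfib E t) \<xi> \<eta>) k)"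
proof -
  have "rho (einner (pfib E t) \<xi> \<eta>) = ocomp K (hadj K K (V t \<xi>)) (V t \<eta>)"
    using iso t \<xi> by (simp add: isometric_rep_def rho_def)
  then show ?thesis
    using hadj_right[OF K K V_bop[OF t \<xi>(1)] h(1) bop_car[OF V_bop[OF t \<xi>(2)] h(2)]] h(2) by simp
qed

context
  fixes t :: real
  assumes t: "0 \<le> t"
begin

abbreviation "gens \<equiv> tensor_gens (pfib E t) K"
abbreviation "kern \<equiv> tensor_kernel (pfib E t) rho K"
abbreviation "Vf \<equiv> (\<lambda>(\<xi>, h). V t \<xi> h)"

lemma Vf_car: "x \<in> gens \<Longrightarrow> Vf x \<in> hcar K"
  by (auto simp: tensor_gens_def intro: bop_car[OF V_bop[OF t]])

lemma kern_eq: "x \<in> gens \<Longrightarrow> y \<in> gens \<Longrightarrow> kern x y = hinner K (Vf x) (Vf y)"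
  by (auto simp: tensor_gens_def tensor_kernel_def V_inner[OF t])

lemma kern_psd: "psd gens kern"
proof -
  have "psd gens (\<lambda>x y. hinner K (Vf x) (Vf y))"
    by (rule psd_pullback[OF psd_hinner[OF K] Vf_car])
  then show ?thesis by (subst psd_cong[OF kern_eq])
qed

lemma tilde_dom: "psd gens (\<lambda>x y. of_real (1\<^sup>2) * kern x y - hinner K (Vf x) (Vf y))"
proof -
  have "psd gens (\<lambda>x y. 0)" by (simp add: psd_def kform_def)
  then show ?thesis by (subst psd_cong[where k'="\<lambda>x y. 0"]) (simp_all add: kern_eq)
qed

abbreviation "VT \<equiv> rep_tilde E K V t"
abbreviation "SP \<equiv> rep_space E K V t"

lemma SP_eq: "SP = kspace gens kern"
  by (simp add: rep_space_def tensor_space_def rho_def[abs_def])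

lemma VT_eq: "VT = kext gens kern K Vf"
  by (simp add: rep_tilde_def tilde_def rho_def[abs_def])

lemma SP_hilbert: "hilbert_space SP"
  unfolding SP_eq by (rule kspace_hilbert[OF kern_psd])

lemma VT_bop: "VT \<in> bop SP K"
  unfolding VT_eq SP_eq by (rule kext_bop[OF kern_psd K Vf_car _ tilde_dom]) simp_all

lemma VT_gen: "x \<in> gens \<Longrightarrow> VT (kgen gens kern x) = Vf x"
  unfolding VT_eq by (rule kext_gen[OF kern_psd K Vf_car _ tilde_dom]) simp_all

lemma gen_car: "x \<in> gens \<Longrightarrow> kgen gens kern x \<in> hcar SP"
  unfolding SP_eq by (rule kgen_car[OF kern_psd])

lemma gen_total: "total SP (kgen gens kern ` gens)"
  unfolding SP_eq by (rule kgen_total[OF kern_psd])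

text \<open>As \<open>V\<^sub>t\<close> induces an isometry on the tensor product, its adjoint inverts it on the range.\<close>

lemma VT_adj: "x \<in> gens \<Longrightarrow> hadj SP K VT (Vf x) = kgen gens kern x"
proof (rule total_eqI[OF SP_hilbert gen_total])
  assume x: "x \<in> gens"
  show "hadj SP K VT (Vf x) \<in> hcar SP" by (rule hadj_car[OF SP_hilbert K VT_bop Vf_car[OF x]])
  show "kgen gens kern x \<in> hcar SP" by (rule gen_car[OF x])
  fix d assume "d \<in> kgen gens kern ` gens"
  then obtain y where y: "y \<in> gens" "d = kgen gens kern y" by auto
  show "hinner SP d (hadj SP K VT (Vf x)) = hinner SP d (kgen gens kern x)"
    unfolding y(2) hadj_right[OF SP_hilbert K VT_bop gen_car[OF y(1)] Vf_car[OF x]] VT_gen[OF y(1)]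
    unfolding SP_eq kgen_inner[OF kern_psd y(1) x] by (rule kern_eq[OF y(1) x, symmetric])
qed

text \<open>Let \<open>V\<close> be the operator on the tensor product. A vector \<open>w\<close> orthogonal to all \<open>V\<^sub>t(\<xi>) h\<close> satisfies \<open>V\<^sup>* w = 0\<close>,
  hence \<open>w = V V\<^sup>* w = 0\<close> by full coisometry.\<close>

lemma V_total: "total K {V t \<xi> h | \<xi> h. \<xi> \<in> ecar (pfib E t) \<and> h \<in> hcar K}"
  unfolding total_def
proof (intro conjI ballI impI)
  show "{V t \<xi> h |\<xi> h. \<xi> \<in> ecar (pfib E t) \<and> h \<in> hcar K} \<subseteq> hcar K"
    by (auto intro: bop_car[OF V_bop[OF t]])
  fix w assume w: "w \<in> hcar K" and o: "\<forall>d\<in>{V t \<xi> h |\<xi> h. \<xi> \<in> ecar (pfib E t) \<and> h \<in> hcar K}. hinner K d w = 0"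
  have "hadj SP K VT w = hzero SP"
  proof (rule total_eqI[OF SP_hilbert gen_total hadj_car[OF SP_hilbert K VT_bop w]])
    fix d assume "d \<in> kgen gens kern ` gens"
    then obtain y where y: "y \<in> gens" "d = kgen gens kern y" by auto
    have "hinner K (Vf y) w = 0" using o y(1) by (auto simp: tensor_gens_def)
    then show "hinner SP d (hadj SP K VT w) = hinner SP d (hzero SP)"
      using hadj_right[OF SP_hilbert K VT_bop gen_car[OF y(1)] w] gen_car[OF y(1)] SP_hilbert
      by (simp add: y(2) VT_gen[OF y(1)])
  qed (use SP_hilbert in simp)
  moreover have "VT (hadj SP K VT w) = w"
  proof -
    have "ocomp K VT (hadj SP K VT) = oid K" using coiso t by (simp add: fully_coisometric_rep_def)
    then have "ocomp K VT (hadj SP K VT) w = oid K w" by simp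
    then show ?thesis using w by simp
  qed
  ultimately show "w = hzero K" using bop_hzero[OF SP_hilbert K VT_bop] by simp
qed

text \<open>The operators \<open>\<rho>(\<langle>\<xi>, \<eta>\<rangle>)\<close> form positive matrices, and elements of \<open>R\<close> commute with them.\<close>

lemma id_tensor_dom:
  assumes S: "S \<in> R" and r: "0 \<le> r" "\<And>x. x \<in> hcar K \<Longrightarrow> hnorm K (S x) \<le> r * hnorm K x"
  shows "psd gens (\<lambda>x y. of_real (r\<^sup>2) * kern x y
     - hinner SP ((\<lambda>(\<xi>, h). kgen gens kern (\<xi>, S h)) x) ((\<lambda>(\<xi>, h). kgen gens kern (\<xi>, S h)) y))"
proof -
  note Sb = R_bop[OF S]
  have Sa: "hadj K K S \<in> R" by (rule star_algebraD(6)[OF R_star_algebra S])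
  define C where "C x y = rho (einner (pfib E t) (fst x) (fst y))" for x y :: "'e \<times> 'k"
  have N: "einner (pfib E t) (fst x) (fst y) \<in> N" if "x \<in> gens" "y \<in> gens" for x y
    using that by (auto simp: tensor_gens_def intro: einner_coeff[OF t])
  have Cb: "C x y \<in> bop K K" if "x \<in> gens" "y \<in> gens" for x y
    unfolding C_def by (rule rho_bop[OF N[OF that]])
  have car: "snd x \<in> hcar K" if "x \<in> gens" for x using that by (auto simp: tensor_gens_def)
  have pos: "matpos K n (\<lambda>i j. C (x i) (x j))" if x: "\<And>i. i < n \<Longrightarrow> x i \<in> gens" for n and x :: "nat \<Rightarrow> _"
    unfolding matpos_mform
  proof (intro allI impI)
    fix u assume u: "\<forall>j<n. u j \<in> hcar K"
    have g: "(fst (x i), u i) \<in> gens" if "i < n" for i using x[OF that] u that by (auto simp: tensor_gens_def)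
    have "mform K n (\<lambda>i j. C (x i) (x j)) u u = kform kern n (\<lambda>i. (fst (x i), u i)) (\<lambda>_. 1)"
      by (simp add: mform_def kform_def tensor_kernel_def C_def)
    then show "Im (mform K n (\<lambda>i j. C (x i) (x j)) u u) = 0 \<and> 0 \<le> Re (mform K n (\<lambda>i j. C (x i) (x j)) u u)"
      using kern_psd[unfolded psd_def, rule_format, of n "\<lambda>i. (fst (x i), u i)" "\<lambda>_. 1"] g by simp
  qed
  have "psd gens (\<lambda>x y. of_real (r\<^sup>2) * hinner K (snd x) (C x y (snd y))
      - hinner K (snd x) (C x y (hadj K K S (S (snd y)))))"
  proof (rule psd_dominated[OF K K Cb pos car Sb r])
    fix x y h assume xy: "x \<in> gens" "y \<in> gens" and h: "h \<in> hcar K"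
    show "C x y (hadj K K S (S h)) = hadj K K S (S (C x y h))"
      unfolding C_def using R_commute[OF S N[OF xy] h] R_commute[OF Sa N[OF xy] bop_car[OF Sb h]] by simp
  qed
  moreover have "of_real (r\<^sup>2) * kern x y
     - hinner SP ((\<lambda>(\<xi>, h). kgen gens kern (\<xi>, S h)) x) ((\<lambda>(\<xi>, h). kgen gens kern (\<xi>, S h)) y)
     = of_real (r\<^sup>2) * hinner K (snd x) (C x y (snd y)) - hinner K (snd x) (C x y (hadj K K S (S (snd y))))"
    if xy: "x \<in> gens" "y \<in> gens" for x y
  proof -
    obtain \<xi> h \<eta> k where e: "x = (\<xi>, h)" "y = (\<eta>, k)" by fastforce
    have hk: "h \<in> hcar K" "k \<in> hcar K" using car[OF xy(1)] car[OF xy(2)] e by auto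
    have g: "(\<xi>, S h) \<in> gens" "(\<eta>, S k) \<in> gens" using xy bop_car[OF Sb] by (auto simp: tensor_gens_def e)
    have "hinner SP (kgen gens kern (\<xi>, S h)) (kgen gens kern (\<eta>, S k)) = hinner K (S h) (C x y (S k))"
      unfolding SP_eq kgen_inner[OF kern_psd g] by (simp add: tensor_kernel_def C_def e)
    also have "\<dots> = hinner K h (hadj K K S (C x y (S k)))"
      by (rule hadj_right[OF K K Sb hk(1) bop_car[OF Cb[OF xy] bop_car[OF Sb hk(2)]], symmetric])
    also have "hadj K K S (C x y (S k)) = C x y (hadj K K S (S k))"
      unfolding C_def by (rule R_commute[OF Sa N[OF xy] bop_car[OF Sb hk(2)]])
    finally show ?thesis by (simp add: e tensor_kernel_def C_def)
  qed
  ultimately show ?thesis by (subst psd_cong) auto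
qed

lemma id_tensor_props:
  assumes S: "S \<in> R"
  shows "rep_id_tensor E K V t S \<in> bop SP SP"
    and "\<xi> \<in> ecar (pfib E t) \<Longrightarrow> h \<in> hcar K \<Longrightarrow>
      rep_id_tensor E K V t S (kgen gens kern (\<xi>, h)) = kgen gens kern (\<xi>, S h)"
proof -
  obtain r where r: "0 \<le> r" "\<And>x. x \<in> hcar K \<Longrightarrow> hnorm K (S x) \<le> r * hnorm K x"
    using bop_bound[OF KS R_bop[OF S]] by blast
  let ?f = "\<lambda>(\<xi>, h). kgen gens kern (\<xi>, S h)"
  have e: "rep_id_tensor E K V t S = kext gens kern SP ?f"
    by (simp add: rep_id_tensor_def id_tensor_def elem_tensor_def rho_def[abs_def] rep_space_def)
  have f: "?f x \<in> hcar SP" if "x \<in> gens" for x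
  proof -
    have "(fst x, S (snd x)) \<in> gens" using that bop_car[OF R_bop[OF S]] by (auto simp: tensor_gens_def)
    from gen_car[OF this] show ?thesis by (simp add: case_prod_unfold)
  qed
  show "rep_id_tensor E K V t S \<in> bop SP SP"
    unfolding e by (subst (2) SP_eq, rule kext_bop[OF kern_psd SP_hilbert f r(1) id_tensor_dom[OF S r]])
  show "rep_id_tensor E K V t S (kgen gens kern (\<xi>, h)) = kgen gens kern (\<xi>, S h)"
    if "\<xi> \<in> ecar (pfib E t)" "h \<in> hcar K"
    unfolding e using kext_gen[OF kern_psd SP_hilbert f r(1) id_tensor_dom[OF S r], of "(\<xi>, h)"] that
    by (simp add: tensor_gens_def)
qed

lemma alpha_bop: "S \<in> R \<Longrightarrow> alpha t S \<in> bop K K"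
  unfolding alpha_def
  by (intro ocomp_bop[OF KS hilbert_semi[OF SP_hilbert]] VT_bop id_tensor_props hadj_bop[OF SP_hilbert K])

text \<open>The adjoint of \<open>V\<^sub>t\<close> takes \<open>V\<^sub>t(\<xi>) h\<close> to \<open>\<xi> \<otimes> h\<close>, which \<open>I \<otimes> S\<close> takes to \<open>\<xi> \<otimes> S h\<close>.\<close>

lemma alpha_V:
  assumes S: "S \<in> R" and \<xi>: "\<xi> \<in> ecar (pfib E t)" and h: "h \<in> hcar K"
  shows "alpha t S (V t \<xi> h) = V t \<xi> (S h)"
proof -
  have g: "(\<xi>, h) \<in> gens" "(\<xi>, S h) \<in> gens"
    using \<xi> h bop_car[OF R_bop[OF S] h] by (auto simp: tensor_gens_def)
  have "alpha t S (V t \<xi> h) = VT (rep_id_tensor E K V t S (hadj SP K VT (V t \<xi> h)))"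
    unfolding alpha_def using Vf_car[OF g(1)] by simp
  also have "hadj SP K VT (V t \<xi> h) = kgen gens kern (\<xi>, h)" using VT_adj[OF g(1)] by simp
  also have "VT (rep_id_tensor E K V t S (kgen gens kern (\<xi>, h))) = V t \<xi> (S h)"
    using VT_gen[OF g(2)] by (simp add: id_tensor_props(2)[OF S \<xi> h])
  finally show ?thesis .
qed

lemma alpha_eqI:
  assumes S: "S \<in> R" and A: "A \<in> bop K K"
    and e: "\<And>\<xi> h. \<xi> \<in> ecar (pfib E t) \<Longrightarrow> h \<in> hcar K \<Longrightarrow> A (V t \<xi> h) = V t \<xi> (S h)"
  shows "alpha t S = A"
  by (rule bop_total_eqI[OF K K V_total alpha_bop[OF S] A]) (auto simp: alpha_V[OF S] e)

text \<open>On the total set, \<open>\<rho>(a) V\<^sub>t(\<xi>) = V\<^sub>t(a \<xi>)\<close>: the left action is the multiplication by elements of the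
  fibre over zero.\<close>

lemma alpha_R:
  assumes S: "S \<in> R" shows "alpha t S \<in> R"
  unfolding R_def
proof (rule commutantI[OF alpha_bop[OF S]])
  fix B x assume "B \<in> rho ` N" and x: "x \<in> hcar K"
  then obtain a where a: "a \<in> N" "B = rho a" by auto
  note ab = rho_bop[OF a(1)] and al = alpha_bop[OF S]
  have "ocomp K (alpha t S) (rho a) = ocomp K (rho a) (alpha t S)"
  proof (rule bop_total_eqI[OF K K V_total ocomp_bop[OF KS KS al ab] ocomp_bop[OF KS KS ab al]])
    fix d assume "d \<in> {V t \<xi> h |\<xi> h. \<xi> \<in> ecar (pfib E t) \<and> h \<in> hcar K}"
    then obtain \<xi> h where d: "d = V t \<xi> h" and \<xi>: "\<xi> \<in> ecar (pfib E t)" and h: "h \<in> hcar K" by auto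
    have z: "pzero E a \<in> ecar (pfib E 0)" using a fibre_zero by auto
    have p: "pmul E 0 t (pzero E a) \<xi> \<in> ecar (pfib E t)" using pmul_closed[OF _ t z \<xi>] by simp
    have m: "rho a (V t \<xi> k) = V t (pmul E 0 t (pzero E a) \<xi>) k" if "k \<in> hcar K" for k
      using V_pmul[OF _ t z \<xi> that] by (simp add: rho_def)
    have dc: "d \<in> hcar K" unfolding d by (rule bop_car[OF V_bop[OF t \<xi>] h])
    show "ocomp K (alpha t S) (rho a) d = ocomp K (rho a) (alpha t S) d"
      using dc by (simp add: d m[OF h] alpha_V[OF S p h] alpha_V[OF S \<xi> h] m[OF bop_car[OF R_bop[OF S] h]])
  qed
  then have "ocomp K (alpha t S) (rho a) x = ocomp K (rho a) (alpha t S) x" by simp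
  then show "alpha t S (B x) = B (alpha t S x)" using x by (simp add: a)
qed

text \<open>All identities are checked on the total set. For the adjoint,
  \<open>\<langle>\<alpha>\<^sub>t(S) V\<^sub>t(\<eta>) k, V\<^sub>t(\<xi>) h\<rangle> = \<langle>S k, \<rho>(\<langle>\<eta>, \<xi>\<rangle>) h\<rangle>\<close>, and \<open>S\<^sup>*\<close> commutes with \<open>\<rho>(\<langle>\<eta>, \<xi>\<rangle>)\<close>.\<close>

lemma alpha_star_hom: "star_hom K R K (alpha t)"
proof -
  note Rs = star_algebraD[OF R_star_algebra]
  have add: "alpha t (oadd K K S T) = oadd K K (alpha t S) (alpha t T)" if "S \<in> R" "T \<in> R" for S T
    by (rule alpha_eqI[OF Rs(4)[OF that] oadd_bop[OF K K alpha_bop[OF that(1)] alpha_bop[OF that(2)]]])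
      (simp add: alpha_V that bop_car[OF V_bop[OF t]] bop_add[OF V_bop[OF t]] bop_car[OF R_bop[OF that(1)]] bop_car[OF R_bop[OF that(2)]])
  have scale: "alpha t (oscale K K c S) = oscale K K c (alpha t S)" if "S \<in> R" for c S
    by (rule alpha_eqI[OF Rs(5)[OF that] oscale_bop[OF K K alpha_bop[OF that]]])
      (simp add: alpha_V that bop_car[OF V_bop[OF t]] bop_scale[OF V_bop[OF t]] bop_car[OF R_bop[OF that]])
  have mult: "alpha t (ocomp K S T) = ocomp K (alpha t S) (alpha t T)" if "S \<in> R" "T \<in> R" for S T
    by (rule alpha_eqI[OF Rs(3)[OF that] ocomp_bop[OF KS KS alpha_bop[OF that(1)] alpha_bop[OF that(2)]]])
      (simp add: alpha_V that bop_car[OF V_bop[OF t]] bop_car[OF R_bop[OF that(1)]] bop_car[OF R_bop[OF that(2)]])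
  have adj: "alpha t (hadj K K S) = hadj K K (alpha t S)" if S: "S \<in> R" for S
  proof (rule alpha_eqI[OF Rs(6)[OF S] hadj_bop[OF K K alpha_bop[OF S]]])
    note Sb = R_bop[OF S] and Sa = Rs(6)[OF S]
    fix \<xi> h assume \<xi>: "\<xi> \<in> ecar (pfib E t)" and h: "h \<in> hcar K"
    note Vh = bop_car[OF V_bop[OF t \<xi>] h] and Sh = hadj_car[OF K K Sb h]
    show "hadj K K (alpha t S) (V t \<xi> h) = V t \<xi> (hadj K K S h)"
    proof (rule total_eqI[OF K V_total hadj_car[OF K K alpha_bop[OF S] Vh] bop_car[OF V_bop[OF t \<xi>] Sh]])
      fix d assume "d \<in> {V t \<xi> h |\<xi> h. \<xi> \<in> ecar (pfib E t) \<and> h \<in> hcar K}"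
      then obtain \<eta> k where d: "d = V t \<eta> k" and \<eta>: "\<eta> \<in> ecar (pfib E t)" and k: "k \<in> hcar K" by auto
      note ein = einner_coeff[OF t \<eta> \<xi>]
      have "hinner K d (hadj K K (alpha t S) (V t \<xi> h)) = hinner K (alpha t S d) (V t \<xi> h)"
        unfolding d by (rule hadj_right[OF K K alpha_bop[OF S] bop_car[OF V_bop[OF t \<eta>] k] Vh])
      also have "\<dots> = hinner K (S k) (rho (einner (pfib E t) \<eta> \<xi>) h)"
        unfolding d alpha_V[OF S \<eta> k] by (rule V_inner[OF t \<eta> \<xi> bop_car[OF Sb k] h])
      also have "\<dots> = hinner K k (hadj K K S (rho (einner (pfib E t) \<eta> \<xi>) h))"
        by (rule hadj_right[OF K K Sb k bop_car[OF rho_bop[OF ein] h], symmetric])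
      also have "\<dots> = hinner K k (rho (einner (pfib E t) \<eta> \<xi>) (hadj K K S h))"
        by (simp add: R_commute[OF Sa ein h])
      also have "\<dots> = hinner K d (V t \<xi> (hadj K K S h))"
        unfolding d by (rule V_inner[OF t \<eta> \<xi> k Sh, symmetric])
      finally show "hinner K d (hadj K K (alpha t S) (V t \<xi> h)) = hinner K d (V t \<xi> (hadj K K S h))" .
    qed
  qed
  show ?thesis unfolding star_hom_def op_linear_def
    using alpha_bop add scale mult adj by blast
qed

lemma alpha_oid: "alpha t (oid K) = oid K"
  by (rule alpha_eqI[OF star_algebraD(2)[OF R_star_algebra] oid_bop[OF KS]]) (simp add: bop_car[OF V_bop[OF t]])

end

text \<open>The fibre over zero acts by \<open>\<rho>\<close>, whose range commutes with \<open>S\<close>.\<close>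

lemma alpha_zero:
  assumes S: "S \<in> R" shows "alpha 0 S = S"
proof (rule alpha_eqI[OF _ S R_bop[OF S]])
  fix \<xi> h assume "\<xi> \<in> ecar (pfib E 0)" and h: "h \<in> hcar K"
  then obtain a where a: "a \<in> N" "\<xi> = pzero E a" using fibre_zero by auto
  show "S (V 0 \<xi> h) = V 0 \<xi> (S h)" using R_commute[OF S a(1) h] by (simp add: a rho_def)
qed simp

text \<open>Both sides agree on \<open>V\<^sub>s(\<xi>) V\<^sub>t(\<eta>) k = V\<^sub>s\<^sub>+\<^sub>t(\<xi> \<otimes> \<eta>) k\<close>. Since the vectors \<open>V\<^sub>t(\<eta>) k\<close> are total, they agree on
  all vectors \<open>V\<^sub>s(\<xi>) h\<close>, which are total again.\<close>

lemma alpha_semigroup: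
  assumes s: "0 \<le> s" and t: "0 \<le> t" and S: "S \<in> R"
  shows "alpha (s + t) S = alpha s (alpha t S)"
proof -
  have st: "0 \<le> s + t" using s t by simp
  note aS = alpha_R[OF t S]
  let ?A = "alpha (s + t) S" and ?B = "alpha s (alpha t S)"
  note A = alpha_bop[OF st S] and B = alpha_bop[OF s aS]
  have key: "?A (V s \<xi> (V t \<eta> k)) = ?B (V s \<xi> (V t \<eta> k))"
    if \<xi>: "\<xi> \<in> ecar (pfib E s)" and \<eta>: "\<eta> \<in> ecar (pfib E t)" and k: "k \<in> hcar K" for \<xi> \<eta> k
  proof -
    note Sk = bop_car[OF R_bop[OF S] k]
    have "?A (V s \<xi> (V t \<eta> k)) = V (s + t) (pmul E s t \<xi> \<eta>) (S k)"
      using alpha_V[OF st S pmul_closed[OF s t \<xi> \<eta>] k] V_pmul[OF s t \<xi> \<eta> k] by simp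
    also have "\<dots> = V s \<xi> (V t \<eta> (S k))" by (rule V_pmul[OF s t \<xi> \<eta> Sk])
    also have "\<dots> = ?B (V s \<xi> (V t \<eta> k))"
      using alpha_V[OF t S \<eta> k] alpha_V[OF s aS \<xi> bop_car[OF V_bop[OF t \<eta>] k]] by simp
    finally show ?thesis .
  qed
  have key2: "?A (V s \<xi> h) = ?B (V s \<xi> h)" if \<xi>: "\<xi> \<in> ecar (pfib E s)" and h: "h \<in> hcar K" for \<xi> h
  proof -
    note Vb = V_bop[OF s \<xi>]
    have "ocomp K ?A (V s \<xi>) = ocomp K ?B (V s \<xi>)"
      by (rule bop_total_eqI[OF K K V_total[OF t] ocomp_bop[OF KS KS A Vb] ocomp_bop[OF KS KS B Vb]])
        (auto simp: key[OF \<xi>] bop_car[OF V_bop[OF t]])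
    then have "ocomp K ?A (V s \<xi>) h = ocomp K ?B (V s \<xi>) h" by simp
    then show ?thesis using h by simp
  qed
  show ?thesis by (rule bop_total_eqI[OF K K V_total[OF s] A B]) (auto simp: key2)
qed

end

section \<open>Normality of representations generated by intertwiners\<close>

lemma infsum_nat:
  fixes f :: "nat \<Rightarrow> 'a::banach"
  assumes "summable (\<lambda>n. norm (f n))" shows "infsum f UNIV = suminf f"
  by (rule infsumI[OF norm_summable_imp_has_sum[OF assms summable_sums[OF summable_norm_cancel[OF assms]]]])

text \<open>Absolutely convergent double series, enumerated by \<open>prod_decode\<close>.\<close>

lemma double_suminf:
  fixes f :: "nat \<Rightarrow> nat \<Rightarrow> 'a::banach"
  assumes 1: "\<And>j. summable (\<lambda>i. norm (f j i))" and 2: "summable (\<lambda>j. \<Sum>i. norm (f j i))"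
  shows "summable (\<lambda>n. norm (case_prod f (prod_decode n)))"
    and "(\<lambda>n. case_prod f (prod_decode n)) sums (\<Sum>j. \<Sum>i. f j i)"
proof -
  let ?g = "case_prod f" and ?S = "Sigma (UNIV :: nat set) (\<lambda>_. UNIV :: nat set)"
  have bij: "bij_betw prod_decode UNIV ?S" using bij_prod_decode by simp
  have n: "(\<Sum>\<^sub>\<infinity>i\<in>UNIV. norm (f j i)) = (\<Sum>i. norm (f j i))" for j
    by (rule infsum_nat) (simp add: 1)
  have nn: "0 \<le> (\<Sum>i. norm (f j i))" for j by (rule suminf_nonneg[OF 1]) simp
  have abs: "(\<lambda>x. norm (?g x)) summable_on ?S"
  proof (rule Infinite_Sum.abs_summable_on_Sigma_iff[where f="?g", THEN iffD2], intro conjI ballI)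
    show "(\<lambda>y. norm (?g (j, y))) summable_on UNIV" for j
      using 1 by (simp add: summable_on_UNIV_nonneg_real_iff)
    have "summable (\<lambda>j. norm (\<Sum>i. norm (f j i)))" using 2 nn by simp
    then show "(\<lambda>x. norm (\<Sum>\<^sub>\<infinity>y\<in>UNIV. norm (?g (x, y)))) summable_on UNIV"
      by (simp add: n summable_on_UNIV_nonneg_real_iff)
  qed
  then have "(\<lambda>n. norm (?g (prod_decode n))) summable_on UNIV"
    using summable_on_reindex_bij_betw[OF bij, of "\<lambda>x. norm (?g x)"] by simp
  then show s: "summable (\<lambda>n. norm (case_prod f (prod_decode n)))"
    by (rule summable_on_imp_summable)
  have "suminf (\<lambda>n. ?g (prod_decode n)) = infsum (\<lambda>n. ?g (prod_decode n)) UNIV"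
    by (rule infsum_nat[OF s, symmetric])
  also have "\<dots> = infsum ?g ?S" by (rule infsum_reindex_bij_betw[OF bij])
  also have "\<dots> = infsum (\<lambda>j. infsum (\<lambda>i. ?g (j, i)) UNIV) UNIV"
    by (rule infsum_Sigma_banach[OF abs_summable_summable[OF abs], symmetric])
  also have "\<dots> = infsum (\<lambda>j. \<Sum>i. f j i) UNIV" by (simp add: infsum_nat[OF 1])
  also have "\<dots> = (\<Sum>j. \<Sum>i. f j i)"
  proof (rule infsum_nat)
    show "summable (\<lambda>j. norm (\<Sum>i. f j i))"
    proof (rule summable_comparison_test'[OF 2, of 0])
      show "norm (norm (\<Sum>i. f j i)) \<le> (\<Sum>i. norm (f j i))" for j using summable_norm[OF 1] by simp
    qed
  qed
  finally show "(\<lambda>n. case_prod f (prod_decode n)) sums (\<Sum>j. \<Sum>i. f j i)"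
    using summable_sums[OF summable_norm_cancel[OF s]] by simp
qed

definition sq_summable :: "'a hspace \<Rightarrow> (nat \<Rightarrow> 'a) \<Rightarrow> bool" where
  "sq_summable G x \<longleftrightarrow> (\<forall>n. x n \<in> hcar G) \<and> summable (\<lambda>n. (hnorm G (x n))\<^sup>2)"

lemma sq_summable_bop:
  assumes G: "semi_inner_space G" and G': "semi_inner_space G'" and x: "sq_summable G x" and A: "A \<in> bop G G'"
  shows "sq_summable G' (\<lambda>n. A (x n))"
  unfolding sq_summable_def
proof (intro conjI allI)
  have xc: "x n \<in> hcar G" for n using x by (simp add: sq_summable_def)
  show Ac: "A (x n) \<in> hcar G'" for n by (rule bop_car[OF A xc])
  obtain C where C: "0 \<le> C" "\<And>x. x \<in> hcar G \<Longrightarrow> hnorm G' (A x) \<le> C * hnorm G x"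
    using bop_bound[OF G A] by blast
  have le: "(hnorm G' (A (x n)))\<^sup>2 \<le> C\<^sup>2 * (hnorm G (x n))\<^sup>2" for n
    using power_mono[OF C(2)[OF xc[of n]] hnorm_ge0[OF G' Ac], of 2] by (simp add: power_mult_distrib)
  show "summable (\<lambda>n. (hnorm G' (A (x n)))\<^sup>2)"
    by (rule summable_comparison_test'[of "\<lambda>n. C\<^sup>2 * (hnorm G (x n))\<^sup>2" 0])
      (use x le in \<open>auto simp: sq_summable_def intro: summable_mult\<close>)
qed

lemma inner_le_sq:
  assumes G: "semi_inner_space G" and "x \<in> hcar G" "y \<in> hcar G"
  shows "cmod (hinner G x y) \<le> ((hnorm G x)\<^sup>2 + (hnorm G y)\<^sup>2) / 2"
  using hinner_Cauchy_Schwarz[OF assms] sum_squares_bound[of "hnorm G x" "hnorm G y"] by simp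

lemma sq_summable_inner:
  assumes G: "semi_inner_space G" and x: "sq_summable G x" and y: "sq_summable G y"
  shows "summable (\<lambda>n. cmod (hinner G (x n) (y n)))"
    and "(\<Sum>n. cmod (hinner G (x n) (y n))) \<le> ((\<Sum>n. (hnorm G (x n))\<^sup>2) + (\<Sum>n. (hnorm G (y n))\<^sup>2)) / 2"
proof -
  have c: "x n \<in> hcar G" "y n \<in> hcar G" for n using x y by (auto simp: sq_summable_def)
  have sx: "summable (\<lambda>n. (hnorm G (x n))\<^sup>2)" and sy: "summable (\<lambda>n. (hnorm G (y n))\<^sup>2)"
    using x y by (auto simp: sq_summable_def)
  have s: "summable (\<lambda>n. ((hnorm G (x n))\<^sup>2 + (hnorm G (y n))\<^sup>2) / 2)"
    by (intro summable_divide summable_add sx sy)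
  show *: "summable (\<lambda>n. cmod (hinner G (x n) (y n)))"
    by (rule summable_comparison_test'[OF s, of 0]) (use inner_le_sq[OF G c] in simp)
  have "(\<Sum>n. cmod (hinner G (x n) (y n))) \<le> (\<Sum>n. ((hnorm G (x n))\<^sup>2 + (hnorm G (y n))\<^sup>2) / 2)"
    by (rule suminf_le[OF inner_le_sq[OF G c] * s])
  also have "\<dots> = ((\<Sum>n. (hnorm G (x n))\<^sup>2) + (\<Sum>n. (hnorm G (y n))\<^sup>2)) / 2"
    by (simp add: suminf_divide[OF summable_add[OF sx sy]] suminf_add[OF sx sy])
  finally show "(\<Sum>n. cmod (hinner G (x n) (y n))) \<le> ((\<Sum>n. (hnorm G (x n))\<^sup>2) + (\<Sum>n. (hnorm G (y n))\<^sup>2)) / 2" .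
qed

text \<open>Flattening turns a sequence of functionals \<open>\<Sum> \<langle>x\<^sub>n, S y\<^sub>n\<rangle>\<close> with summable bounds for the sequences into one such
  functional.\<close>

lemma sq_summable_flatten:
  assumes x: "\<And>j. sq_summable G (x j)" and b: "\<And>j. (\<Sum>i. (hnorm G (x j i))\<^sup>2) \<le> \<beta> j" and \<beta>: "summable \<beta>"
  shows "sq_summable G (\<lambda>n. case_prod x (prod_decode n))"
    and "(\<Sum>n. (hnorm G (case_prod x (prod_decode n)))\<^sup>2) \<le> suminf \<beta>"
proof -
  let ?f = "\<lambda>j i. (hnorm G (x j i))\<^sup>2"
  have 1: "summable (\<lambda>i. norm (?f j i))" for j using x[of j] by (simp add: sq_summable_def)
  have nn: "0 \<le> (\<Sum>i. ?f j i)" for j using x[of j] by (intro suminf_nonneg) (auto simp: sq_summable_def)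
  have 2: "summable (\<lambda>j. \<Sum>i. norm (?f j i))"
    by (rule summable_comparison_test'[OF \<beta>, of 0]) (use b nn in simp)
  have eq: "case_prod ?f (prod_decode n) = (hnorm G (case_prod x (prod_decode n)))\<^sup>2" for n
    by (simp add: case_prod_unfold)
  note d = double_suminf[OF 1 2, unfolded eq]
  show "sq_summable G (\<lambda>n. case_prod x (prod_decode n))"
    unfolding sq_summable_def using d(1) x by (auto simp: sq_summable_def case_prod_unfold)
  have "(\<Sum>n. (hnorm G (case_prod x (prod_decode n)))\<^sup>2) = (\<Sum>j. \<Sum>i. ?f j i)"
    using d(2) by (rule sums_unique[symmetric])
  also have "\<dots> \<le> suminf \<beta>" using 2 by (intro suminf_le b \<beta>) simp
  finally show "(\<Sum>n. (hnorm G (case_prod x (prod_decode n)))\<^sup>2) \<le> suminf \<beta>" .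
qed

lemma inner_flatten:
  assumes G: "semi_inner_space G"
    and x: "\<And>j. sq_summable G (x j)" "\<And>j. (\<Sum>i. (hnorm G (x j i))\<^sup>2) \<le> \<beta> j" "summable \<beta>"
    and y: "\<And>j. sq_summable G (y j)" "\<And>j. (\<Sum>i. (hnorm G (y j i))\<^sup>2) \<le> \<gamma> j" "summable \<gamma>"
  shows "(\<lambda>n. hinner G (case_prod x (prod_decode n)) (case_prod y (prod_decode n)))
    sums (\<Sum>j. \<Sum>i. hinner G (x j i) (y j i))"
proof -
  let ?f = "\<lambda>j i. hinner G (x j i) (y j i)"
  have 1: "summable (\<lambda>i. norm (?f j i))" for j by (rule sq_summable_inner(1)[OF G x(1) y(1)])
  have 2: "summable (\<lambda>j. \<Sum>i. norm (?f j i))"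
  proof (rule summable_comparison_test')
    show "summable (\<lambda>j. (\<beta> j + \<gamma> j) / 2)" by (intro summable_divide summable_add x y)
    show "norm (\<Sum>i. norm (?f j i)) \<le> (\<beta> j + \<gamma> j) / 2" if "j \<ge> 0" for j
      using sq_summable_inner(2)[OF G x(1) y(1), of j j] x(2)[of j] y(2)[of j] suminf_nonneg[OF 1[of j]] by simp
  qed
  have eq: "case_prod ?f (prod_decode n) = hinner G (case_prod x (prod_decode n)) (case_prod y (prod_decode n))" for n
    by (simp add: case_prod_unfold)
  show ?thesis using double_suminf(2)[OF 1 2] unfolding eq .
qed

text \<open>Suppose that \<open>\<pi>\<close> is intertwined with the identical representation of \<open>R\<close> by operators whose
  ranges are total. With \<open>A = \<Sum> U\<^sub>i U\<^sub>i\<^sup>*\<close> for suitably scaled intertwiners \<open>U\<^sub>i\<close> and \<open>T = 1 - A\<close>, the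
  identity
  \<open>\<langle>T\<^sup>m z, \<pi>(S) T\<^sup>m y\<rangle> - \<langle>T\<^sup>m\<^sup>+\<^sup>1 z, \<pi>(S) T\<^sup>m\<^sup>+\<^sup>1 y\<rangle> = \<Sum> \<langle>U\<^sub>i\<^sup>* T\<^sup>m z, S U\<^sub>i\<^sup>* (T\<^sup>m y + T\<^sup>m\<^sup>+\<^sup>1 y)\<rangle>\<close>
  telescopes to an expression of \<open>\<langle>z, \<pi>(S) y\<rangle>\<close> through square-summable sequences.\<close>

locale intertwined =
  fixes K :: "'k hspace" and R :: "('k \<Rightarrow> 'k) set" and \<pi> :: "('k \<Rightarrow> 'k) \<Rightarrow> 'k \<Rightarrow> 'k"
  assumes K: "hilbert_space K" and R: "star_algebra K R" and \<pi>: "star_hom K R K \<pi>"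
begin

lemmas KS = hilbert_semi[OF K]

definition intw :: "('k \<Rightarrow> 'k) set" where
  "intw = {W \<in> bop K K. \<forall>S\<in>R. \<forall>h\<in>hcar K. \<pi> S (W h) = W (S h)}"

lemma R_bop: "S \<in> R \<Longrightarrow> S \<in> bop K K" using star_algebraD(1)[OF R] .

lemma pi_bop: "S \<in> R \<Longrightarrow> \<pi> S \<in> bop K K" using \<pi> by (simp add: star_hom_def)

lemma intw_bop: "W \<in> intw \<Longrightarrow> W \<in> bop K K" by (simp add: intw_def)

lemma intw_scale: "W \<in> intw \<Longrightarrow> oscale K K c W \<in> intw"
  by (auto simp: intw_def oscale_bop[OF K K] bop_scale[OF pi_bop] bop_car[OF R_bop] bop_car)

lemma intw_adj:
  assumes W: "W \<in> intw" and S: "S \<in> R" and y: "y \<in> hcar K"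
  shows "hadj K K W (\<pi> S y) = S (hadj K K W y)"
proof -
  note Wb = intw_bop[OF W] and Sb = R_bop[OF S] and Sa = star_algebraD(6)[OF R S]
  note pb = pi_bop[OF S]
  have pa: "\<pi> (hadj K K S) = hadj K K (\<pi> S)" using \<pi> S by (simp add: star_hom_def)
  show ?thesis
  proof (rule hilbert_eqI[OF K hadj_car[OF K K Wb bop_car[OF pb y]] bop_car[OF Sb hadj_car[OF K K Wb y]]])
    fix d assume d: "d \<in> hcar K"
    have "hinner K d (hadj K K W (\<pi> S y)) = hinner K (W d) (\<pi> S y)"
      by (rule hadj_right[OF K K Wb d bop_car[OF pb y]])
    also have "\<dots> = hinner K (hadj K K (\<pi> S) (W d)) y"
      by (rule hadj_left[OF K K pb y bop_car[OF Wb d], symmetric])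
    also have "hadj K K (\<pi> S) (W d) = W (hadj K K S d)"
      unfolding pa[symmetric] using W Sa d by (simp add: intw_def)
    also have "hinner K (W (hadj K K S d)) y = hinner K (hadj K K S d) (hadj K K W y)"
      by (rule hadj_right[OF K K Wb hadj_car[OF K K Sb d] y, symmetric])
    also have "\<dots> = hinner K d (S (hadj K K W y))"
      by (rule hadj_left[OF K K Sb hadj_car[OF K K Wb y] d])
    finally show "hinner K d (hadj K K W (\<pi> S y)) = hinner K d (S (hadj K K W y))" .
  qed
qed

text \<open>Equivalently, \<open>x\<close> is in the closed span of the ranges of the operators in \<open>C\<close>.\<close>

definition separated :: "('k \<Rightarrow> 'k) set \<Rightarrow> 'k \<Rightarrow> bool" where
  "separated C x \<longleftrightarrow> (\<forall>q\<in>hcar K. (\<forall>W\<in>C. \<forall>h\<in>hcar K. hinner K q (W h) = 0) \<longrightarrow> hinner K q x = 0)"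

text \<open>A sequence of finite sums of vectors \<open>W h\<close> that tends to \<open>x\<close> involves countably many \<open>W\<close>.\<close>

lemma separated_countable:
  assumes tot: "total K {W h | W h. W \<in> intw \<and> h \<in> hcar K}" and x: "x \<in> hcar K"
  shows "\<exists>C. countable C \<and> C \<subseteq> intw \<and> separated C x"
proof -
  define L where "L = {x \<in> hcar K. \<exists>C. countable C \<and> C \<subseteq> intw \<and> separated C x}"
  have W: "W h \<in> L" if "W \<in> intw" "h \<in> hcar K" for W h
  proof -
    have "countable {W} \<and> {W} \<subseteq> intw \<and> separated {W} (W h)" using that by (auto simp: separated_def)
    then show ?thesis unfolding L_def using bop_car[OF intw_bop[OF that(1)] that(2)] by blast
  qed
  have tL: "total K L" unfolding total_def
  proof (intro conjI ballI impI)
    show "L \<subseteq> hcar K" by (auto simp: L_def)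
    fix w assume "w \<in> hcar K" "\<forall>d\<in>L. hinner K d w = 0"
    then show "w = hzero K" using tot W unfolding total_def by blast
  qed
  have z: "hzero K \<in> L" unfolding L_def using KS by (auto simp: separated_def intro!: exI[of _ "{}"])
  have a: "hadd K x y \<in> L" if "x \<in> L" "y \<in> L" for x y
  proof -
    obtain C C' where C: "countable C" "C \<subseteq> intw" "separated C x" "countable C'" "C' \<subseteq> intw" "separated C' y"
      and c: "x \<in> hcar K" "y \<in> hcar K"
      using \<open>x \<in> L\<close> \<open>y \<in> L\<close> unfolding L_def by blast
    have "separated (C \<union> C') (hadd K x y)" using C c KS by (auto simp: separated_def)
    then show ?thesis unfolding L_def using C c KS
      by (auto intro!: exI[of _ "C \<union> C'"])
  qed
  have s: "hscale K c x \<in> L" if "x \<in> L" for c x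
    using that KS by (auto simp: L_def separated_def)
  obtain u where u: "\<And>n. u n \<in> L" "(\<lambda>n. hdist K (u n) x) \<longlonglongrightarrow> 0"
    using total_approx[OF K tL z a s x] by blast
  have "\<forall>n. \<exists>C. countable C \<and> C \<subseteq> intw \<and> separated C (u n)" using u(1) unfolding L_def by blast
  then obtain C where C: "\<And>n. countable (C n)" "\<And>n. C n \<subseteq> intw" "\<And>n. separated (C n) (u n)" by metis
  have uc: "u n \<in> hcar K" for n using u(1) by (simp add: L_def)
  have "separated (\<Union>n. C n) x" unfolding separated_def
  proof (intro ballI impI)
    fix q assume q: "q \<in> hcar K" and o: "\<forall>W\<in>\<Union>n. C n. \<forall>h\<in>hcar K. hinner K q (W h) = 0"
    have "hinner K q (u n) = 0" for n using C(3)[of n] q o by (auto simp: separated_def)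
    moreover have "(\<lambda>n. hinner K q (u n)) \<longlonglongrightarrow> hinner K q x"
      by (rule hinner_tendsto[OF KS]) (use q x uc u KS in auto)
    ultimately have "(\<lambda>n::nat. 0) \<longlonglongrightarrow> hinner K q x" by simp
    then show "hinner K q x = 0" by (rule LIMSEQ_unique[OF _ tendsto_const])
  qed
  moreover have "countable (\<Union>n. C n)" using C by auto
  moreover have "(\<Union>n. C n) \<subseteq> intw" using C by auto
  ultimately show ?thesis by blast
qed

lemma zero_intw: "oscale K K 0 (oid K) \<in> intw"
proof -
  have e: "oscale K K 0 (oid K) h = hzero K" if "h \<in> hcar K" for h
    using that KS by (intro hilbert_eqI[OF K]) auto
  then show ?thesis
    using KS by (simp add: intw_def oscale_bop[OF K K oid_bop[OF KS]] bop_car[OF R_bop] bop_hzero[OF K K pi_bop])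
qed

text \<open>One sequence of intertwiners serves countably many vectors. The scaling makes \<open>\<Sum> U\<^sub>i U\<^sub>i\<^sup>*\<close> a norm
  convergent series with sum at most one.\<close>

lemma separating_sequence:
  assumes tot: "total K {W h | W h. W \<in> intw \<and> h \<in> hcar K}" and y: "\<And>j::nat. y j \<in> hcar K"
  obtains U where "\<And>i::nat. U i \<in> intw" "\<And>i x. x \<in> hcar K \<Longrightarrow> hnorm K (U i x) \<le> (1/2)^(Suc i) * hnorm K x"
    "\<And>j. separated (range U) (y j)"
proof -
  obtain C where C: "\<And>j. countable (C j)" "\<And>j. C j \<subseteq> intw" "\<And>j. separated (C j) (y j)"
    using separated_countable[OF tot y] by metis
  \<comment> \<open>The zero operator makes the set nonempty, so that it is the range of a sequence.\<close>
  define D where "D = insert (oscale K K 0 (oid K)) (\<Union>j. C j)"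
  have D: "countable D" "D \<noteq> {}" "D \<subseteq> intw" using C zero_intw by (auto simp: D_def)
  define W where "W = from_nat_into D"
  have W: "W i \<in> intw" for i using from_nat_into[OF D(2), of i] D(3) by (auto simp: W_def)
  have rW: "range W = D" unfolding W_def by (rule range_from_nat_into[OF D(2,1)])
  have "\<exists>B>0. \<forall>x\<in>hcar K. hnorm K (W i x) \<le> B * hnorm K x" for i
  proof -
    obtain B where B: "0 \<le> B" "\<And>x. x \<in> hcar K \<Longrightarrow> hnorm K (W i x) \<le> B * hnorm K x"
      using bop_bound[OF KS intw_bop[OF W[of i]]] by blast
    have "hnorm K (W i x) \<le> (B + 1) * hnorm K x" if "x \<in> hcar K" for x
      using B(2)[OF that] hnorm_ge0[OF KS that] by (simp add: distrib_right)
    with B(1) show ?thesis by (intro exI[of _ "B + 1"]) auto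
  qed
  then obtain B where B: "\<And>i. B i > 0" "\<And>i x. x \<in> hcar K \<Longrightarrow> hnorm K (W i x) \<le> B i * hnorm K x" by metis
  define e where "e i = (1/2)^(Suc i) / B i" for i
  have e: "e i > 0" for i using B(1)[of i] by (simp add: e_def)
  define U where "U i = oscale K K (of_real (e i)) (W i)" for i
  show ?thesis
  proof (rule that[of U])
    show "U i \<in> intw" for i unfolding U_def by (rule intw_scale[OF W])
    show "hnorm K (U i x) \<le> (1/2)^(Suc i) * hnorm K x" if x: "x \<in> hcar K" for i x
    proof -
      have "hnorm K (U i x) = e i * hnorm K (W i x)"
        unfolding U_def using x e[of i] bop_car[OF intw_bop[OF W] x] KS by simp
      also have "\<dots> \<le> e i * (B i * hnorm K x)" using e[of i] by (intro mult_left_mono B x) auto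
      also have "\<dots> = (1/2)^(Suc i) * hnorm K x" using B(1)[of i] by (simp add: e_def)
      finally show ?thesis .
    qed
    show "separated (range U) (y j)" for j
      unfolding separated_def
    proof (intro ballI impI)
      fix q assume q: "q \<in> hcar K" and o: "\<forall>W\<in>range U. \<forall>h\<in>hcar K. hinner K q (W h) = 0"
      have "hinner K q (w h) = 0" if "w \<in> C j" "h \<in> hcar K" for w h
      proof -
        have "w \<in> range W" using that(1) unfolding rW D_def by auto
        then obtain i where i: "w = W i" by auto
        have "hinner K q (U i h) = 0" using o that by auto
        then show ?thesis using e[of i] that q bop_car[OF intw_bop[OF W] that(2), of i] KS
          by (simp add: U_def i)
      qed
      then show "hinner K q (y j) = 0" using C(3)[of j] q by (auto simp: separated_def)
    qed
  qed
qed

end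

locale intertwiner_sequence = intertwined K R \<pi> for K :: "'k hspace" and R \<pi> +
  fixes U :: "nat \<Rightarrow> 'k \<Rightarrow> 'k"
  assumes U: "\<And>i. U i \<in> intw"
    and Ub: "\<And>i x. x \<in> hcar K \<Longrightarrow> hnorm K (U i x) \<le> (1/2)^(Suc i) * hnorm K x"
begin

abbreviation "Ua i \<equiv> hadj K K (U i)"

lemma Ua_car: "x \<in> hcar K \<Longrightarrow> Ua i x \<in> hcar K"
  by (rule hadj_car[OF K K intw_bop[OF U]])

lemma Ua_sq: "x \<in> hcar K \<Longrightarrow> (hnorm K (Ua i x))\<^sup>2 \<le> (1/2)^(Suc i) * (hnorm K x)\<^sup>2"
proof -
  assume x: "x \<in> hcar K"
  have "hnorm K (Ua i x) \<le> (1/2)^(Suc i) * hnorm K x"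
    by (rule hadj_bound[OF K K intw_bop[OF U] _ Ub x]) auto
  then have "(hnorm K (Ua i x))\<^sup>2 \<le> ((1/2)^(Suc i) * hnorm K x)\<^sup>2"
    by (intro power_mono hnorm_ge0[OF KS Ua_car[OF x]])
  also have "\<dots> = ((1/2)^(Suc i) * (1/2)^(Suc i)) * (hnorm K x)\<^sup>2" by (simp add: power2_eq_square)
  also have "\<dots> \<le> ((1/2)^(Suc i) * 1) * (hnorm K x)\<^sup>2"
    by (intro mult_right_mono mult_left_mono power_le_one) auto
  finally show ?thesis by simp
qed

lemma half_sums: "(\<lambda>i. (1/2::real)^(Suc i) * c) sums c"
  using sums_mult2[OF power_half_series, of c] by simp

lemma Ua_summable: "x \<in> hcar K \<Longrightarrow> sq_summable K (\<lambda>i. Ua i x)"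
  unfolding sq_summable_def
  using summable_comparison_test'[OF sums_summable[OF half_sums[of "(hnorm K x)\<^sup>2"]], of 0 "\<lambda>i. (hnorm K (Ua i x))\<^sup>2"]
    Ua_sq Ua_car by auto

lemma Ua_sum_le: "x \<in> hcar K \<Longrightarrow> (\<Sum>i. (hnorm K (Ua i x))\<^sup>2) \<le> (hnorm K x)\<^sup>2"
proof -
  assume x: "x \<in> hcar K"
  have "(\<Sum>i. (hnorm K (Ua i x))\<^sup>2) \<le> (\<Sum>i. (1/2)^(Suc i) * (hnorm K x)\<^sup>2)"
    by (rule suminf_le[OF Ua_sq[OF x] _ sums_summable[OF half_sums]])
      (use Ua_summable[OF x] in \<open>simp add: sq_summable_def\<close>)
  also have "\<dots> = (hnorm K x)\<^sup>2" by (rule sums_unique[OF half_sums, symmetric])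
  finally show ?thesis .
qed

text \<open>The sum of the operators \<open>U\<^sub>i U\<^sub>i\<^sup>*\<close>, by its sesquilinear form.\<close>

lemma A_exists:
  "\<exists>A. A \<in> bop K K \<and> (\<forall>x\<in>hcar K. \<forall>y\<in>hcar K. (\<lambda>i. hinner K (Ua i x) (Ua i y)) sums hinner K x (A y))"
proof -
  define B where "B x y = (\<Sum>i. hinner K (Ua i x) (Ua i y))" for x y
  have s: "(\<lambda>i. hinner K (Ua i x) (Ua i y)) sums B x y" if "x \<in> hcar K" "y \<in> hcar K" for x y
    unfolding B_def
    by (rule summable_sums[OF summable_norm_cancel[OF sq_summable_inner(1)[OF KS Ua_summable[OF that(1)] Ua_summable[OF that(2)]]]])
  note Ub' = hadj_bop[OF K K intw_bop[OF U]]
  obtain A where A: "A \<in> bop K K" "\<And>x y. x \<in> hcar K \<Longrightarrow> y \<in> hcar K \<Longrightarrow> hinner K x (A y) = B x y"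
  proof (rule form_operator[OF K K, of B 1])
    fix x y z c assume c: "x \<in> hcar K" "y \<in> hcar K"
    show "B x (hscale K c y) = c * B x y"
      by (rule sums_unique2[OF s]) (use c KS sums_mult[OF s[OF c], of c] in \<open>simp_all add: bop_scale[OF Ub'] Ua_car\<close>)
    show "B (hscale K c x) y = cnj c * B x y"
      by (rule sums_unique2[OF s]) (use c KS sums_mult[OF s[OF c], of "cnj c"] in \<open>simp_all add: bop_scale[OF Ub'] Ua_car\<close>)
    show "cmod (B x y) \<le> 1 * hnorm K x * hnorm K y"
    proof -
      have 1: "cmod (B u v) \<le> ((hnorm K u)\<^sup>2 + (hnorm K v)\<^sup>2) / 2" if "u \<in> hcar K" "v \<in> hcar K" for u v
      proof -
        have "cmod (B u v) \<le> (\<Sum>i. cmod (hinner K (Ua i u) (Ua i v)))"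
          unfolding B_def by (intro summable_norm sq_summable_inner(1)[OF KS] Ua_summable that)
        also have "\<dots> \<le> ((\<Sum>i. (hnorm K (Ua i u))\<^sup>2) + (\<Sum>i. (hnorm K (Ua i v))\<^sup>2)) / 2"
          by (intro sq_summable_inner(2)[OF KS] Ua_summable that)
        also have "\<dots> \<le> ((hnorm K u)\<^sup>2 + (hnorm K v)\<^sup>2) / 2"
          using Ua_sum_le[OF that(1)] Ua_sum_le[OF that(2)] by simp
        finally show ?thesis .
      qed
      have kx: "psd (hcar K) (\<lambda>u v. B u v)"
      proof (rule psd_sums[where k="\<lambda>i u v. hinner K (Ua i u) (Ua i v)"])
        show "psd (hcar K) (\<lambda>u v. hinner K (Ua i u) (Ua i v))" for i
          by (rule psd_pullback[OF psd_hinner[OF K] Ua_car])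
      qed (rule s)
      have d: "Re (B u u) \<le> (hnorm K u)\<^sup>2" if "u \<in> hcar K" for u
        using 1[OF that that] complex_Re_le_cmod[of "B u u"] by simp
      have "(cmod (B x y))\<^sup>2 \<le> Re (B x x) * Re (B y y)" by (rule psd_Cauchy_Schwarz[OF kx c])
      also have "\<dots> \<le> (hnorm K x)\<^sup>2 * (hnorm K y)\<^sup>2"
        by (intro mult_mono d c psd_diag(2)[OF kx]) auto
      also have "\<dots> = (1 * hnorm K x * hnorm K y)\<^sup>2" by (simp add: power_mult_distrib)
      finally show ?thesis by (rule power2_le_imp_le) (use c KS in auto)
    qed
    assume z: "z \<in> hcar K"
    show "B x (hadd K y z) = B x y + B x z"
      by (rule sums_unique2[OF s]) (use c z KS sums_add[OF s[OF c] s[OF c(1) z]] in \<open>simp_all add: bop_add[OF Ub'] Ua_car\<close>)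
    show "B (hadd K x y) z = B x z + B y z"
      by (rule sums_unique2[OF s]) (use c z KS sums_add[OF s[OF c(1) z] s[OF c(2) z]] in \<open>simp_all add: bop_add[OF Ub'] Ua_car\<close>)
  qed auto
  then show ?thesis using s by auto
qed

definition A where
  "A = (SOME A. A \<in> bop K K \<and> (\<forall>x\<in>hcar K. \<forall>y\<in>hcar K. (\<lambda>i. hinner K (Ua i x) (Ua i y)) sums hinner K x (A y)))"

lemma A_bop: "A \<in> bop K K"
  and A_sums: "x \<in> hcar K \<Longrightarrow> y \<in> hcar K \<Longrightarrow> (\<lambda>i. hinner K (Ua i x) (Ua i y)) sums hinner K x (A y)"
  using someI_ex[OF A_exists] unfolding A_def[symmetric] by auto

lemmas A_car = bop_car[OF A_bop]

lemma A_psd: "psd (hcar K) (\<lambda>x y. hinner K x (A y))"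
proof (rule psd_sums[where k="\<lambda>i u v. hinner K (Ua i u) (Ua i v)"])
  show "psd (hcar K) (\<lambda>u v. hinner K (Ua i u) (Ua i v))" for i
    by (rule psd_pullback[OF psd_hinner[OF K] Ua_car])
qed (rule A_sums)

lemma A_sa: "x \<in> hcar K \<Longrightarrow> y \<in> hcar K \<Longrightarrow> hinner K (A x) y = hinner K x (A y)"
  using psd_herm[OF A_psd, of y x] hinner_commute[OF KS, of y "A x"] A_car by simp

definition q where "q x = Re (hinner K x (A x))"

lemma q_nonneg: "x \<in> hcar K \<Longrightarrow> 0 \<le> q x"
  unfolding q_def by (rule psd_diag(2)[OF A_psd])

lemma q_sums: "x \<in> hcar K \<Longrightarrow> (\<lambda>i. (hnorm K (Ua i x))\<^sup>2) sums q x"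
  unfolding q_def using sums_Re[OF A_sums[of x x]] by (simp add: hnorm_sq[OF KS Ua_car])

lemma q_le: "x \<in> hcar K \<Longrightarrow> q x \<le> (hnorm K x)\<^sup>2"
  using Ua_sum_le[of x] sums_unique[OF q_sums[of x]] by simp

text \<open>For a positive contraction, \<open>A\<^sup>2 \<le> A\<close>, by the Cauchy-Schwarz inequality for the form of \<open>A\<close>.\<close>

lemma A_sq_le: 
  assumes x: "x \<in> hcar K" shows "(hnorm K (A x))\<^sup>2 \<le> q x"
proof (cases "hnorm K (A x) = 0")
  case True then show ?thesis using q_nonneg[OF x] by simp
next
  case False
  let ?n = "(hnorm K (A x))\<^sup>2"
  have n: "0 < ?n" using False by simp
  have "(cmod (hinner K (A x) (A x)))\<^sup>2 \<le> q (A x) * q x"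
    unfolding q_def by (rule psd_Cauchy_Schwarz[OF A_psd A_car[OF x] x])
  also have "\<dots> \<le> ?n * q x" by (intro mult_right_mono q_le A_car x q_nonneg)
  finally have "?n * ?n \<le> ?n * q x"
    by (simp add: hinner_self[OF KS A_car[OF x]] power2_eq_square norm_mult)
  then show ?thesis using n by (rule mult_left_le_imp_le)
qed

definition T where "T x = hsub K x (A x)"

lemma T_car: "x \<in> hcar K \<Longrightarrow> T x \<in> hcar K" unfolding T_def using KS A_car by simp

text \<open>\<open>T\<^sup>2 = 1 - 2 A + A\<^sup>2 \<le> 1 - A\<close>. Summed along an orbit of \<open>T\<close>, this bounds \<open>\<Sum> q (T\<^sup>m x)\<close>.\<close>

lemma T_sq:
  assumes x: "x \<in> hcar K" shows "(hnorm K (T x))\<^sup>2 \<le> (hnorm K x)\<^sup>2 - q x"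
proof -
  have "(hnorm K (T x))\<^sup>2 = (hnorm K x)\<^sup>2 - 2 * q x + (hnorm K (A x))\<^sup>2"
    using x KS A_car[OF x] T_car[OF x] A_sa[OF x x] by (simp add: hnorm_sq q_def T_def)
  then show ?thesis using A_sq_le[OF x] by simp
qed

definition Tn where "Tn n x = (T ^^ n) x"

lemma Tn_car: "x \<in> hcar K \<Longrightarrow> Tn n x \<in> hcar K"
  unfolding Tn_def by (induction n) (auto intro: T_car)

lemma Tn_Suc: "Tn (Suc n) x = T (Tn n x)" by (simp add: Tn_def)

lemma Tn_0: "Tn 0 x = x" by (simp add: Tn_def)

lemma Tn_partial: "x \<in> hcar K \<Longrightarrow> (\<Sum>m<n. q (Tn m x)) + (hnorm K (Tn n x))\<^sup>2 \<le> (hnorm K x)\<^sup>2"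
proof (induction n)
  case 0 then show ?case by (simp add: Tn_0)
next
  case (Suc n)
  then show ?case using T_sq[OF Tn_car[OF Suc(2)], of n] by (simp add: Tn_Suc)
qed

lemma q_Tn_summable: "x \<in> hcar K \<Longrightarrow> summable (\<lambda>m. q (Tn m x))"
  and q_Tn_sum_le: "x \<in> hcar K \<Longrightarrow> (\<Sum>m. q (Tn m x)) \<le> (hnorm K x)\<^sup>2"
proof -
  assume x: "x \<in> hcar K"
  have b: "(\<Sum>m<n. q (Tn m x)) \<le> (hnorm K x)\<^sup>2" for n
  proof -
    have "0 \<le> (hnorm K (Tn n x))\<^sup>2" by simp
    then show ?thesis using Tn_partial[OF x, of n] by linarith
  qed
  show s: "summable (\<lambda>m. q (Tn m x))"
    by (rule summableI_nonneg_bounded[OF _ b]) (rule q_nonneg[OF Tn_car[OF x]])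
  show "(\<Sum>m. q (Tn m x)) \<le> (hnorm K x)\<^sup>2"
    by (rule suminf_le_const[OF s b])
qed

lemma Tn_norm_le: "x \<in> hcar K \<Longrightarrow> hnorm K (Tn n x) \<le> hnorm K x"
proof -
  assume x: "x \<in> hcar K"
  have "0 \<le> (\<Sum>m<n. q (Tn m x))" by (intro sum_nonneg q_nonneg Tn_car x)
  then have "(hnorm K (Tn n x))\<^sup>2 \<le> (hnorm K x)\<^sup>2" using Tn_partial[OF x, of n] by linarith
  then show ?thesis by (rule power2_le_imp_le) (use x KS in simp)
qed

lemma T_sub: "x \<in> hcar K \<Longrightarrow> y \<in> hcar K \<Longrightarrow> T (hsub K x y) = hsub K (T x) (T y)"
  using KS A_car by (intro hilbert_eqI[OF K]) (auto simp: T_def bop_add[OF A_bop] bop_scale[OF A_bop] algebra_simps)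

lemma Tn_sub: "x \<in> hcar K \<Longrightarrow> y \<in> hcar K \<Longrightarrow> Tn n (hsub K x y) = hsub K (Tn n x) (Tn n y)"
  by (induction n) (auto simp: Tn_0 Tn_Suc T_sub Tn_car)

lemma T_A: "x \<in> hcar K \<Longrightarrow> T (A x) = A (T x)"
  using KS A_car by (simp add: T_def bop_add[OF A_bop] bop_scale[OF A_bop])

lemma Tn_A: "x \<in> hcar K \<Longrightarrow> Tn n (A x) = A (Tn n x)"
  by (induction n) (auto simp: Tn_0 Tn_Suc T_A Tn_car)

text \<open>\<open>\<parallel>T\<^sup>n A x\<parallel>\<^sup>2 = \<parallel>A T\<^sup>n x\<parallel>\<^sup>2 \<le> q (T\<^sup>n x)\<close>, the terms of a convergent series.\<close>

lemma Tn_A_tendsto: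
  assumes x: "x \<in> hcar K" shows "(\<lambda>n. hnorm K (Tn n (A x))) \<longlonglongrightarrow> 0"
proof -
  have "(\<lambda>n. (hnorm K (Tn n (A x)))\<^sup>2) \<longlonglongrightarrow> 0"
  proof (rule Lim_null_comparison[OF always_eventually summable_LIMSEQ_zero[OF q_Tn_summable[OF x]]], rule allI)
    show "norm ((hnorm K (Tn n (A x)))\<^sup>2) \<le> q (Tn n x)" for n
      using A_sq_le[OF Tn_car[OF x]] by (simp add: Tn_A[OF x])
  qed
  from tendsto_real_sqrt[OF this] show ?thesis
    using hnorm_ge0[OF KS Tn_car[OF A_car[OF x]]] by simp
qed

text \<open>The vector \<open>y\<close> lies in the closure of the range of \<open>A\<close>: if \<open>r\<close> is the component of \<open>y\<close> orthogonal to the range,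
  then \<open>\<langle>r, A r\<rangle> = 0\<close>, so \<open>U\<^sub>i\<^sup>* r = 0\<close> for all \<open>i\<close>, and \<open>r\<close> is orthogonal to \<open>y\<close> by separation. On the range the
  powers of \<open>T\<close> tend to zero, and they are contractions.\<close>

lemma Tn_tendsto:
  assumes y: "y \<in> hcar K" and sep: "separated (range U) y"
  shows "(\<lambda>n. hnorm K (Tn n y)) \<longlonglongrightarrow> 0"
proof -
  let ?L = "A ` hcar K"
  have L: "?L \<subseteq> hcar K" "hzero K \<in> ?L"
    using A_car bop_hzero[OF K K A_bop] hzero_car[OF KS] by (auto simp: image_iff) (metis)
  obtain p u where p: "p \<in> hcar K" and u: "\<And>n. u n \<in> ?L" "(\<lambda>n. hdist K (u n) p) \<longlonglongrightarrow> 0"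
    and o: "\<And>l. l \<in> ?L \<Longrightarrow> hinner K l (hsub K y p) = 0"
  proof (rule orthogonal_projection[OF K L _ _ y])
    show "hadd K a b \<in> ?L" if "a \<in> ?L" "b \<in> ?L" for a b
      using that KS bop_add[OF A_bop] by (auto simp: image_iff) (metis hadd_car)
    show "hscale K c a \<in> ?L" if "a \<in> ?L" for c a
      using that KS bop_scale[OF A_bop] by (auto simp: image_iff) (metis hscale_car)
  qed blast
  let ?r = "hsub K y p"
  have r: "?r \<in> hcar K" using y p KS by simp
  have uc: "u n \<in> hcar K" for n using u(1) L by auto
  have q0: "q ?r = 0"
  proof -
    have "hinner K (A ?r) ?r = 0" using o r by blast
    then show ?thesis unfolding q_def using A_sa[OF r r] by simp
  qed
  have "Ua i ?r = hzero K" for i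
  proof -
    have "(hnorm K (Ua i ?r))\<^sup>2 \<le> 0"
    proof -
      have "sum (\<lambda>i. (hnorm K (Ua i ?r))\<^sup>2) {i} \<le> (\<Sum>i. (hnorm K (Ua i ?r))\<^sup>2)"
        using sums_summable[OF q_sums[OF r]] by (intro sum_le_suminf) auto
      then show ?thesis using sums_unique[OF q_sums[OF r]] q0 by simp
    qed
    then show ?thesis by (intro hilbert_norm_zero[OF K Ua_car[OF r]]) simp
  qed
  then have "hinner K ?r (U i h) = 0" if "h \<in> hcar K" for i h
    using hadj_left[OF K K intw_bop[OF U] that r, of i] that KS by simp
  then have ry: "hinner K ?r y = 0" using sep r by (auto simp: separated_def)
  have rp: "hinner K ?r p = 0"
  proof -
    have "hinner K ?r (u n) = 0" for n using hinner_commute[OF KS uc r, of n] o[OF u(1)] by simp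
    moreover have "(\<lambda>n. hinner K ?r (u n)) \<longlonglongrightarrow> hinner K ?r p"
      by (rule hinner_tendsto[OF KS]) (use r p uc u KS in auto)
    ultimately have "(\<lambda>n::nat. 0) \<longlonglongrightarrow> hinner K ?r p" by simp
    then show ?thesis by (rule LIMSEQ_unique[OF _ tendsto_const])
  qed
  have yp: "y = p"
  proof (rule hilbert_eqI_sub[OF K y p])
    have "hinner K ?r ?r = hinner K ?r y - hinner K ?r p"
      by (subst hinner_add_right[OF KS r y]) (use r p KS in auto)
    then show "hinner K ?r ?r = 0" using ry rp by simp
  qed
  show ?thesis
  proof (rule LIMSEQ_I)
    fix e :: real assume "0 < e"
    then have e2: "0 < e / 2" by simp
    obtain k where "\<And>n. n \<ge> k \<Longrightarrow> norm (hdist K (u n) p - 0) < e / 2"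
      using LIMSEQ_D[OF u(2) e2] by blast
    from this[of k] have k: "hdist K (u k) y < e / 2" by (simp add: yp)
    obtain v where v: "v \<in> hcar K" "u k = A v" using u(1)[of k] by auto
    obtain N where N: "\<And>n. n \<ge> N \<Longrightarrow> norm (hnorm K (Tn n (A v)) - 0) < e / 2"
      using LIMSEQ_D[OF Tn_A_tendsto[OF v(1)] e2] by blast
    have "norm (hnorm K (Tn n y) - 0) < e" if "n \<ge> N" for n
    proof -
      have "hnorm K (Tn n y) \<le> hnorm K (Tn n (A v)) + hdist K (Tn n y) (Tn n (A v))"
        by (rule hnorm_le_hdist[OF KS Tn_car[OF y] Tn_car[OF A_car[OF v(1)]]])
      also have "hdist K (Tn n y) (Tn n (A v)) = hnorm K (Tn n (hsub K y (A v)))"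
        unfolding hdist_def Tn_sub[OF y A_car[OF v(1)]] ..
      also have "\<dots> \<le> hnorm K (hsub K y (A v))" by (rule Tn_norm_le) (use y A_car[OF v(1)] KS in simp)
      also have "\<dots> = hdist K (u k) y"
        using hdist_commute[OF KS y uc, of k] by (simp add: hdist_def v(2))
      finally show ?thesis using N[OF that] k hnorm_ge0[OF KS Tn_car[OF y]] by simp
    qed
    then show "\<exists>no. \<forall>n\<ge>no. norm (hnorm K (Tn n y) - 0) < e" by blast
  qed
qed

lemma A_pi:
  assumes S: "S \<in> R" and x: "x \<in> hcar K" shows "A (\<pi> S x) = \<pi> S (A x)"
proof (rule hilbert_eqI[OF K A_car[OF bop_car[OF pi_bop[OF S] x]] bop_car[OF pi_bop[OF S] A_car[OF x]]])
  fix d assume d: "d \<in> hcar K"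
  note pb = pi_bop[OF S]
  have Sa: "hadj K K S \<in> R" by (rule star_algebraD(6)[OF R S])
  have pa: "\<pi> (hadj K K S) = hadj K K (\<pi> S)" using \<pi> S by (simp add: star_hom_def)
  have pd: "hadj K K (\<pi> S) d \<in> hcar K" by (rule hadj_car[OF K K pb d])
  have e: "hinner K (Ua i d) (Ua i (\<pi> S x)) = hinner K (Ua i (hadj K K (\<pi> S) d)) (Ua i x)" for i
    unfolding intw_adj[OF U S x] pa[symmetric] intw_adj[OF U Sa d]
    by (rule hadj_left[OF K K R_bop[OF S] Ua_car[OF x] Ua_car[OF d], symmetric])
  have "hinner K d (A (\<pi> S x)) = hinner K (hadj K K (\<pi> S) d) (A x)"
    using A_sums[OF d bop_car[OF pb x]] unfolding e by (rule sums_unique2[OF _ A_sums[OF pd x]])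
  also have "\<dots> = hinner K d (\<pi> S (A x))" by (rule hadj_left[OF K K pb A_car[OF x] d])
  finally show "hinner K d (A (\<pi> S x)) = hinner K d (\<pi> S (A x))" .
qed

lemma inner_A_pi:
  assumes S: "S \<in> R" and z: "z \<in> hcar K" and y: "y \<in> hcar K"
  shows "(\<lambda>i. hinner K (Ua i z) (S (Ua i y))) sums hinner K z (A (\<pi> S y))"
  using A_sums[OF z bop_car[OF pi_bop[OF S] y]] by (simp add: intw_adj[OF U S y])

text \<open>The telescoping identity is summed over \<open>m\<close>. Its remainder vanishes as \<open>T\<^sup>m y\<close> tends to zero, and
  the norms of the flattened sequences are controlled by \<open>\<Sum> q (T\<^sup>m z) \<le> \<parallel>z\<parallel>\<^sup>2\<close> and \<open>\<Sum> q (T\<^sup>m y) \<le> \<parallel>y\<parallel>\<^sup>2\<close>.\<close>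

lemma inner_pi_expansion:
  assumes z: "z \<in> hcar K" and y: "y \<in> hcar K" and sep: "separated (range U) y"
  obtains a b where "sq_summable K a" "(\<Sum>n. (hnorm K (a n))\<^sup>2) \<le> (hnorm K z)\<^sup>2"
    "sq_summable K b" "(\<Sum>n. (hnorm K (b n))\<^sup>2) \<le> 4 * (hnorm K y)\<^sup>2"
    "\<And>S. S \<in> R \<Longrightarrow> (\<lambda>n. hinner K (a n) (S (b n))) sums hinner K z (\<pi> S y)"
proof -
  define w where "w m = hadd K (Tn m y) (Tn (Suc m) y)" for m
  have wc: "w m \<in> hcar K" for m unfolding w_def using KS Tn_car[OF y] by simp
  define \<beta> where "\<beta> m = q (Tn m z)" for m
  define \<gamma> where "\<gamma> m = 2 * q (Tn m y) + 2 * q (Tn (Suc m) y)" for m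
  \<comment> \<open>The parallelogram law for the form of \<open>A\<close>; it accounts for the factor 4 in the bound for \<open>b\<close>.\<close>
  have par: "q (hadd K u v) \<le> 2 * q u + 2 * q v" if "u \<in> hcar K" "v \<in> hcar K" for u v
  proof -
    have "q (hadd K u v) + q (hsub K u v) = 2 * q u + 2 * q v"
      using that KS A_car by (simp add: q_def bop_add[OF A_bop] bop_scale[OF A_bop])
    moreover have "0 \<le> q (hsub K u v)" by (rule q_nonneg) (use that KS in simp)
    ultimately show ?thesis by linarith
  qed
  have a1: "sq_summable K (\<lambda>i. Ua i (Tn m z))" "sq_summable K (\<lambda>i. Ua i (w m))" for m
    by (intro Ua_summable Tn_car z wc)+
  have a2: "(\<Sum>i. (hnorm K (Ua i (Tn m z)))\<^sup>2) \<le> \<beta> m" for m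
    using sums_unique[OF q_sums[OF Tn_car[OF z]]] by (simp add: \<beta>_def)
  have b2: "(\<Sum>i. (hnorm K (Ua i (w m)))\<^sup>2) \<le> \<gamma> m" for m
    using sums_unique[OF q_sums[OF wc, of m]] par[OF Tn_car[OF y] Tn_car[OF y], of m "Suc m"] by (simp add: \<gamma>_def w_def)
  have a3: "summable \<beta>" "suminf \<beta> \<le> (hnorm K z)\<^sup>2"
    unfolding \<beta>_def by (rule q_Tn_summable[OF z], rule q_Tn_sum_le[OF z])
  have s1: "summable (\<lambda>m. q (Tn m y))" by (rule q_Tn_summable[OF y])
  have s2: "summable (\<lambda>m. q (Tn (Suc m) y))" using s1 by (subst summable_Suc_iff)
  have b3: "summable \<gamma>" unfolding \<gamma>_def by (intro summable_add summable_mult s1 s2)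
  have b4: "suminf \<gamma> \<le> 4 * (hnorm K y)\<^sup>2"
  proof -
    have "suminf \<gamma> = 2 * (\<Sum>m. q (Tn m y)) + 2 * (\<Sum>m. q (Tn (Suc m) y))"
      unfolding \<gamma>_def by (simp add: suminf_add[OF summable_mult[OF s1] summable_mult[OF s2], symmetric] suminf_mult[OF s1] suminf_mult[OF s2])
    moreover have "(\<Sum>m. q (Tn (Suc m) y)) \<le> (\<Sum>m. q (Tn m y))"
      using suminf_split_head[OF s1] q_nonneg[OF Tn_car[OF y], of 0] by simp
    ultimately show ?thesis using q_Tn_sum_le[OF y] by linarith
  qed
  let ?a = "\<lambda>n. case_prod (\<lambda>m i. Ua i (Tn m z)) (prod_decode n)"
  let ?b = "\<lambda>n. case_prod (\<lambda>m i. Ua i (w m)) (prod_decode n)"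
  show ?thesis
  proof (rule that[of ?a ?b])
    show "sq_summable K ?a" by (rule sq_summable_flatten(1)[OF a1(1) a2 a3(1)])
    show "(\<Sum>n. (hnorm K (?a n))\<^sup>2) \<le> (hnorm K z)\<^sup>2"
      using sq_summable_flatten(2)[OF a1(1) a2 a3(1)] a3(2) by linarith
    show "sq_summable K ?b" by (rule sq_summable_flatten(1)[OF a1(2) b2 b3])
    show "(\<Sum>n. (hnorm K (?b n))\<^sup>2) \<le> 4 * (hnorm K y)\<^sup>2"
      using sq_summable_flatten(2)[OF a1(2) b2 b3] b4 by linarith
    fix S assume S: "S \<in> R"
    note Sb = R_bop[OF S] and pb = pi_bop[OF S]
    obtain c where c: "0 \<le> c" "\<And>x. x \<in> hcar K \<Longrightarrow> hnorm K (S x) \<le> c * hnorm K x"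
      using bop_bound[OF KS Sb] by blast
    have sb: "sq_summable K (\<lambda>i. S (Ua i (w m)))" for m by (rule sq_summable_bop[OF KS KS a1(2) Sb])
    have sb2: "(\<Sum>i. (hnorm K (S (Ua i (w m))))\<^sup>2) \<le> c\<^sup>2 * \<gamma> m" for m
    proof -
      have "(hnorm K (S (Ua i (w m))))\<^sup>2 \<le> c\<^sup>2 * (hnorm K (Ua i (w m)))\<^sup>2" for i
        using power_mono[OF c(2)[OF Ua_car[OF wc]] hnorm_ge0[OF KS bop_car[OF Sb Ua_car[OF wc]]], of i m 2]
        by (simp add: power_mult_distrib)
      then have "(\<Sum>i. (hnorm K (S (Ua i (w m))))\<^sup>2) \<le> (\<Sum>i. c\<^sup>2 * (hnorm K (Ua i (w m)))\<^sup>2)"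
        using sb[of m] a1(2)[of m] by (intro suminf_le) (auto simp: sq_summable_def intro: summable_mult)
      also have "\<dots> = c\<^sup>2 * (\<Sum>i. (hnorm K (Ua i (w m)))\<^sup>2)"
        using a1(2)[of m] by (intro suminf_mult) (auto simp: sq_summable_def)
      also have "\<dots> \<le> c\<^sup>2 * \<gamma> m" by (intro mult_left_mono b2) auto
      finally show ?thesis .
    qed
    have fl: "(\<lambda>n. hinner K (?a n) (case_prod (\<lambda>m i. S (Ua i (w m))) (prod_decode n)))
        sums (\<Sum>m. \<Sum>i. hinner K (Ua i (Tn m z)) (S (Ua i (w m))))"
      by (rule inner_flatten[OF KS a1(1) a2 a3(1) sb sb2 summable_mult[OF b3]])
    define t where "t m = hinner K (Tn m z) (\<pi> S (Tn m y))" for m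
    have inner: "(\<Sum>i. hinner K (Ua i (Tn m z)) (S (Ua i (w m)))) = t m - t (Suc m)" for m
    proof -
      let ?z = "Tn m z" and ?y = "Tn m y"
      note zc = Tn_car[OF z, of m] and yc = Tn_car[OF y, of m]
      have "(\<Sum>i. hinner K (Ua i ?z) (S (Ua i (w m)))) = hinner K ?z (A (\<pi> S (w m)))"
        by (rule sums_unique[OF inner_A_pi[OF S zc wc], symmetric])
      also have "\<dots> = hinner K ?z (\<pi> S ?y) - hinner K (T ?z) (\<pi> S (T ?y))"
        using zc yc KS A_car bop_car[OF pb] A_sa
        by (simp add: w_def Tn_Suc T_def bop_add[OF pb] bop_scale[OF pb] bop_add[OF A_bop] bop_scale[OF A_bop] A_pi[OF S] algebra_simps)
      finally show ?thesis by (simp add: t_def Tn_Suc)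
    qed
    have "t \<longlonglongrightarrow> 0"
    proof -
      obtain c' where c': "0 \<le> c'" "\<And>x. x \<in> hcar K \<Longrightarrow> hnorm K (\<pi> S x) \<le> c' * hnorm K x"
        using bop_bound[OF KS pb] by blast
      have "(\<lambda>n. hnorm K z * (c' * hnorm K (Tn n y))) \<longlonglongrightarrow> 0"
        by (intro tendsto_mult_right_zero Tn_tendsto[OF y sep])
      then show ?thesis
      proof (rule Lim_null_comparison[rotated])
        have "norm (t n) \<le> hnorm K z * (c' * hnorm K (Tn n y))" for n
        proof -
          note zc = Tn_car[OF z, of n] and yc = Tn_car[OF y, of n]
          have "norm (t n) \<le> hnorm K (Tn n z) * hnorm K (\<pi> S (Tn n y))"
            unfolding t_def by (rule hinner_Cauchy_Schwarz[OF KS zc bop_car[OF pb yc]])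
          also have "\<dots> \<le> hnorm K z * (c' * hnorm K (Tn n y))"
            by (intro mult_mono Tn_norm_le z c' yc hnorm_ge0[OF KS] bop_car[OF pb])
          finally show ?thesis .
        qed
        then show "\<forall>\<^sub>F n in sequentially. norm (t n) \<le> hnorm K z * (c' * hnorm K (Tn n y))" by simp
      qed
    qed
    then have "(\<lambda>m. t m - t (Suc m)) sums (t 0 - 0)" by (rule telescope_sums')
    then have "(\<Sum>m. \<Sum>i. hinner K (Ua i (Tn m z)) (S (Ua i (w m)))) = hinner K z (\<pi> S y)"
      unfolding inner by (simp add: sums_iff t_def Tn_0)
    moreover have "case_prod (\<lambda>m i. S (Ua i (w m))) (prod_decode n) = S (?b n)" for n
      by (simp add: case_prod_unfold)
    ultimately show "(\<lambda>n. hinner K (?a n) (S (?b n))) sums hinner K z (\<pi> S y)"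
      using fl by simp
  qed
qed

end

context intertwined
begin

text \<open>The expansions of the terms \<open>\<langle>x\<^sub>n, \<pi>(S) y\<^sub>n\<rangle>\<close> have norms bounded by those of \<open>x\<^sub>n\<close> and \<open>y\<^sub>n\<close>, so they combine to one
  expansion.\<close>

lemma predual_pullback:
  assumes tot: "total K {W h | W h. W \<in> intw \<and> h \<in> hcar K}"
    and x: "sq_summable K x" and y: "sq_summable K y"
  obtains a b where "sq_summable K a" "sq_summable K b"
    "\<And>S. S \<in> R \<Longrightarrow> (\<Sum>n. hinner K (x n) (\<pi> S (y n))) = (\<Sum>n. hinner K (a n) (S (b n)))"
proof -
  have xc: "x n \<in> hcar K" and yc: "y n \<in> hcar K" for n using x y by (auto simp: sq_summable_def)
  obtain U where intw: "\<And>i::nat. U i \<in> intw"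
    and small: "\<And>i x. x \<in> hcar K \<Longrightarrow> hnorm K (U i x) \<le> (1/2)^(Suc i) * hnorm K x"
    and sep: "\<And>j. separated (range U) (y j)"
    by (rule separating_sequence[OF tot yc], rule that)
  interpret intertwiner_sequence K R \<pi> U by unfold_locales (rule intw, rule small)
  have "\<forall>j. \<exists>ab. sq_summable K (fst ab) \<and> (\<Sum>n. (hnorm K (fst ab n))\<^sup>2) \<le> (hnorm K (x j))\<^sup>2 \<and>
    sq_summable K (snd ab) \<and> (\<Sum>n. (hnorm K (snd ab n))\<^sup>2) \<le> 4 * (hnorm K (y j))\<^sup>2 \<and>
    (\<forall>S\<in>R. (\<lambda>n. hinner K (fst ab n) (S (snd ab n))) sums hinner K (x j) (\<pi> S (y j)))"
    (is "\<forall>j. \<exists>ab. ?P j ab")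
  proof
    fix j
    obtain a b where "?P j (a, b)"
      by (rule inner_pi_expansion[OF xc yc sep, of j j]) auto
    then show "\<exists>ab. ?P j ab" ..
  qed
  from choice[OF this] obtain ab where ab: "\<forall>j. ?P j (ab j)" ..
  define a where "a j = fst (ab j)" for j
  define b where "b j = snd (ab j)" for j
  have a: "sq_summable K (a j)" "(\<Sum>n. (hnorm K (a j n))\<^sup>2) \<le> (hnorm K (x j))\<^sup>2"
    and b: "sq_summable K (b j)" "(\<Sum>n. (hnorm K (b j n))\<^sup>2) \<le> 4 * (hnorm K (y j))\<^sup>2"
    and ab: "S \<in> R \<Longrightarrow> (\<lambda>n. hinner K (a j n) (S (b j n))) sums hinner K (x j) (\<pi> S (y j))" for j S
    using ab unfolding a_def b_def by auto
  have sx: "summable (\<lambda>j. (hnorm K (x j))\<^sup>2)" and sy: "summable (\<lambda>j. 4 * (hnorm K (y j))\<^sup>2)"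
    using x y by (auto simp: sq_summable_def intro: summable_mult)
  let ?a = "\<lambda>n. case_prod a (prod_decode n)" and ?b = "\<lambda>n. case_prod b (prod_decode n)"
  show ?thesis
  proof (rule that[of ?a ?b])
    show "sq_summable K ?a" by (rule sq_summable_flatten(1)[OF a sx])
    show "sq_summable K ?b" by (rule sq_summable_flatten(1)[OF b sy])
    fix S assume S: "S \<in> R"
    note Sb = R_bop[OF S]
    obtain c where c: "0 \<le> c" "\<And>x. x \<in> hcar K \<Longrightarrow> hnorm K (S x) \<le> c * hnorm K x"
      using bop_bound[OF KS Sb] by blast
    have sb: "sq_summable K (\<lambda>i. S (b m i))" for m by (rule sq_summable_bop[OF KS KS b(1) Sb])
    have bc: "b m i \<in> hcar K" for m i using b(1)[of m] by (simp add: sq_summable_def)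
    have sb2: "(\<Sum>i. (hnorm K (S (b m i)))\<^sup>2) \<le> c\<^sup>2 * (4 * (hnorm K (y m))\<^sup>2)" for m
    proof -
      have "(hnorm K (S (b m i)))\<^sup>2 \<le> c\<^sup>2 * (hnorm K (b m i))\<^sup>2" for i
        using power_mono[OF c(2)[OF bc] hnorm_ge0[OF KS bop_car[OF Sb bc]], of m i 2]
        by (simp add: power_mult_distrib)
      then have "(\<Sum>i. (hnorm K (S (b m i)))\<^sup>2) \<le> (\<Sum>i. c\<^sup>2 * (hnorm K (b m i))\<^sup>2)"
        using sb[of m] b(1)[of m] by (intro suminf_le) (auto simp: sq_summable_def intro: summable_mult)
      also have "\<dots> = c\<^sup>2 * (\<Sum>i. (hnorm K (b m i))\<^sup>2)"
        using b(1)[of m] by (intro suminf_mult) (auto simp: sq_summable_def)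
      also have "\<dots> \<le> c\<^sup>2 * (4 * (hnorm K (y m))\<^sup>2)" by (intro mult_left_mono b) auto
      finally show ?thesis .
    qed
    have "(\<lambda>n. hinner K (?a n) (case_prod (\<lambda>m i. S (b m i)) (prod_decode n)))
        sums (\<Sum>m. \<Sum>i. hinner K (a m i) (S (b m i)))"
      by (rule inner_flatten[OF KS a sx sb sb2 summable_mult[OF sy]])
    moreover have "case_prod (\<lambda>m i. S (b m i)) (prod_decode n) = S (?b n)" for n
      by (simp add: case_prod_unfold)
    moreover have "(\<Sum>i. hinner K (a m i) (S (b m i))) = hinner K (x m) (\<pi> S (y m))" for m
      by (rule sums_unique[OF ab[OF S], symmetric])
    ultimately show "(\<Sum>n. hinner K (x n) (\<pi> S (y n))) = (\<Sum>n. hinner K (?a n) (S (?b n)))"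
      by (simp add: sums_iff)
  qed
qed

text \<open>Every weak-* continuous functional pulls back to one, so preimages of subbasic open sets are open.\<close>

lemma normal:
  assumes tot: "total K {W h | W h. W \<in> intw \<and> h \<in> hcar K}"
  shows "normal_map K R K \<pi>"
  unfolding normal_map_def sigma_weak_def[of K] initial_topology_def
proof (rule continuous_on_generated_topo)
  let ?B = "{{A \<in> bop K K. w A \<in> U} |w U. w \<in> predual K (bop K K) \<and> open U}"
  let ?T = "subtopology (topology_generated_by ?B) R"
  have z: "(\<lambda>A. 0) \<in> predual K (bop K K)"
    unfolding predual_def using KS by (auto intro!: exI[of _ "\<lambda>n. hzero K"] simp: bop_car)
  have UB: "\<Union>?B = bop K K"
  proof (intro equalityI subsetI)
    fix A assume "A \<in> bop K K"
    then show "A \<in> \<Union>?B" using z by (intro UnionI[of "{A \<in> bop K K. (0::complex) \<in> UNIV}"]) (auto intro!: exI[of _ UNIV] exI[of _ "\<lambda>A. 0"])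
  qed auto
  have ts: "topspace ?T = R" using UB R_bop by auto
  show "\<pi> ` topspace ?T \<subseteq> \<Union>?B" unfolding ts UB using pi_bop by auto
  fix V assume "V \<in> ?B"
  then obtain w O' where w: "w \<in> predual K (bop K K)" and O: "open O'" and V: "V = {A \<in> bop K K. w A \<in> O'}" by auto
  obtain x y where xy: "sq_summable K x" "sq_summable K y"
    and wxy: "\<And>A. A \<in> bop K K \<Longrightarrow> w A = (\<Sum>n. hinner K (x n) (A (y n)))"
    using w unfolding predual_def sq_summable_def by blast
  obtain a b where ab: "sq_summable K a" "sq_summable K b"
    "\<And>S. S \<in> R \<Longrightarrow> (\<Sum>n. hinner K (x n) (\<pi> S (y n))) = (\<Sum>n. hinner K (a n) (S (b n)))"
    by (rule predual_pullback[OF tot xy], rule that)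
  define w' where "w' A = (\<Sum>n. hinner K (a n) (A (b n)))" for A
  have w': "w' \<in> predual K (bop K K)" using ab unfolding predual_def sq_summable_def w'_def by blast
  have "\<pi> -` V \<inter> topspace ?T = {A \<in> bop K K. w' A \<in> O'} \<inter> R"
    unfolding ts V using R_bop pi_bop by (auto simp: wxy ab(3) w'_def)
  moreover have "openin (topology_generated_by ?B) {A \<in> bop K K. w' A \<in> O'}"
    by (rule topology_generated_by_Basis) (use w' O in blast)
  ultimately show "openin ?T (\<pi> -` V \<inter> topspace ?T)" by (auto simp: openin_subtopology)
qed

end

text \<open>The operators \<open>V\<^sub>t(\<xi>)\<close> intertwine \<open>S\<close> with \<open>\<alpha>\<^sub>t(S)\<close>, and their ranges are total.\<close>

lemma (in coisometric_representation) alpha_normal: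
  assumes t: "0 \<le> t" shows "normal_map K R K (alpha t)"
proof -
  interpret I: intertwined K R "alpha t"
    by unfold_locales (rule K R_star_algebra alpha_star_hom[OF t])+
  have i: "V t \<xi> \<in> I.intw" if "\<xi> \<in> ecar (pfib E t)" for \<xi>
    using that by (auto simp: I.intw_def V_bop[OF t] alpha_V[OF t])
  show ?thesis
  proof (rule I.normal)
    show "total K {W h |W h. W \<in> I.intw \<and> h \<in> hcar K}"
      unfolding total_def
    proof (intro conjI ballI impI)
      show "{W h |W h. W \<in> I.intw \<and> h \<in> hcar K} \<subseteq> hcar K" by (auto intro: bop_car[OF I.intw_bop])
      fix w assume w: "w \<in> hcar K" "\<forall>d\<in>{W h |W h. W \<in> I.intw \<and> h \<in> hcar K}. hinner K d w = 0"
      then show "w = hzero K" using V_total[OF t] i unfolding total_def by blast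
    qed
  qed
qed

section \<open>Elementary tensors over partitions\<close>

lemma total_sesq_eqI:
  assumes G1: "hilbert_space G1" and G2: "hilbert_space G2" and G: "hilbert_space G"
    and D1: "total G1 D1" and D2: "total G2 D2"
    and A: "A \<in> bop G1 G" and B: "B \<in> bop G2 G" and C: "C \<in> bop G2 G1"
    and e: "\<And>d d'. d \<in> D1 \<Longrightarrow> d' \<in> D2 \<Longrightarrow> hinner G (A d) (B d') = hinner G1 d (C d')"
    and x: "x \<in> hcar G1" and y: "y \<in> hcar G2"
  shows "hinner G (A x) (B y) = hinner G1 x (C y)"
proof -
  have "ocomp G2 (hadj G1 G A) B = C"
  proof (rule bop_total_eqI[OF G2 G1 D2 ocomp_bop[OF hilbert_semi[OF G2] hilbert_semi[OF G] hadj_bop[OF G1 G A] B] C])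
    fix d' assume d': "d' \<in> D2"
    then have dc: "d' \<in> hcar G2" using D2 by (auto simp: total_def)
    have "hadj G1 G A (B d') = C d'"
    proof (rule total_eqI[OF G1 D1 hadj_car[OF G1 G A bop_car[OF B dc]] bop_car[OF C dc]])
      fix d assume d: "d \<in> D1"
      then have "d \<in> hcar G1" using D1 by (auto simp: total_def)
      then show "hinner G1 d (hadj G1 G A (B d')) = hinner G1 d (C d')"
        using hadj_right[OF G1 G A _ bop_car[OF B dc]] e[OF d d'] by simp
    qed
    then show "ocomp G2 (hadj G1 G A) B d' = C d'" using dc by simp
  qed
  then have "hadj G1 G A (B y) = C y" using y by (metis ocomp_apply)
  then show ?thesis using hadj_right[OF G1 G A x bop_car[OF B y]] by simp
qed

locale cp_data =
  fixes H :: "'h hspace" and M :: "('h \<Rightarrow> 'h) set" and P :: "real \<Rightarrow> ('h \<Rightarrow> 'h) \<Rightarrow> 'h \<Rightarrow> 'h"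
  assumes H: "hilbert_space H" and M: "von_neumann_algebra H M" and P: "cp_semigroup H M P"
begin

lemmas HS = hilbert_semi[OF H]
lemmas M_star = von_neumann_star_algebra[OF H M]
lemmas N_star = von_neumann_commutant_star_algebra[OF H M]
lemmas M_bop = star_algebraD(1)[OF M_star]
lemmas M_oid = star_algebraD(2)[OF M_star]
lemmas M_comp = star_algebraD(3)[OF M_star]
lemmas M_add = star_algebraD(4)[OF M_star]
lemmas M_scale = star_algebraD(5)[OF M_star]
lemmas M_adj = star_algebraD(6)[OF M_star]

lemma P_M: "0 \<le> t \<Longrightarrow> A \<in> M \<Longrightarrow> P t A \<in> M"
  and P_add: "0 \<le> t \<Longrightarrow> A \<in> M \<Longrightarrow> B \<in> M \<Longrightarrow> P t (oadd H H A B) = oadd H H (P t A) (P t B)"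
  and P_scale: "0 \<le> t \<Longrightarrow> A \<in> M \<Longrightarrow> P t (oscale H H c A) = oscale H H c (P t A)"
  and P_cp: "0 \<le> t \<Longrightarrow> completely_positive H M (P t)"
  and P_normal: "0 \<le> t \<Longrightarrow> normal_map H M H (P t)"
  and P_oid: "0 \<le> t \<Longrightarrow> P t (oid H) = oid H"
  and P_zero: "A \<in> M \<Longrightarrow> P 0 A = A"
  and P_semigroup: "0 \<le> s \<Longrightarrow> 0 \<le> t \<Longrightarrow> A \<in> M \<Longrightarrow> P (s + t) A = P s (P t A)"
  using P unfolding cp_semigroup_def op_linear_def by simp_all

text \<open>The innermost position, which the identity occupies in the inner product of \<open>H\<^sub>p\<close>, is left free
  for an operator \<open>A\<close>. The left action of \<open>M\<close> and the concatenation of partitions put operators there.\<close>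

abbreviation chain where "chain f g A xs \<equiv> part_chain H P f g A xs"

abbreviation sandwich where "sandwich S A T \<equiv> ocomp H (hadj H H S) (ocomp H A T)"

lemma sandwich_M: "S \<in> M \<Longrightarrow> A \<in> M \<Longrightarrow> T \<in> M \<Longrightarrow> sandwich S A T \<in> M"
  by (intro M_comp M_adj)

lemma sandwich_apply:
  assumes "S \<in> M" "A \<in> M" "T \<in> M" "h \<in> hcar H"
  shows "sandwich S A T h = hadj H H S (A (T h))"
  using assms(4) by simp

lemma sandwich_inner:
  assumes "S \<in> M" "A \<in> M" "T \<in> M" "h \<in> hcar H" "k \<in> hcar H"
  shows "hinner H h (sandwich S A T k) = hinner H (S h) (A (T k))"
  unfolding sandwich_apply[OF assms(1,2,3,5)]
  by (rule hadj_right[OF H H M_bop[OF assms(1)] assms(4) bop_car[OF M_bop[OF assms(2)] bop_car[OF M_bop[OF assms(3)] assms(5)]]])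

lemma chain_M:
  assumes "\<And>r. f r \<in> M" "\<And>r. g r \<in> M"
  shows "A \<in> M \<Longrightarrow> sorted xs \<Longrightarrow> chain f g A xs \<in> M"
proof (induction xs arbitrary: A rule: induct_list012)
  case (3 x y zs)
  have "P (y - x) (sandwich (f x) A (g x)) \<in> M"
    using 3(3,4) by (intro P_M sandwich_M assms) auto
  then show ?case using 3(2)[of "P (y - x) (sandwich (f x) A (g x))"] 3(4) by simp
qed auto

lemma sandwich_add:
  assumes S: "S \<in> M" and A: "A \<in> M" and B: "B \<in> M" and T: "T \<in> M"
  shows "sandwich S (oadd H H A B) T = oadd H H (sandwich S A T) (sandwich S B T)"
proof (rule bop_eqI[OF M_bop[OF sandwich_M[OF S M_add[OF A B] T]] M_bop[OF M_add[OF sandwich_M[OF S A T] sandwich_M[OF S B T]]]])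
  fix h assume h: "h \<in> hcar H"
  note Th = bop_car[OF M_bop[OF T] h]
  show "sandwich S (oadd H H A B) T h = oadd H H (sandwich S A T) (sandwich S B T) h"
    using h Th bop_car[OF M_bop[OF A] Th] bop_car[OF M_bop[OF B] Th] by (simp add: bop_add[OF M_bop[OF M_adj[OF S]]])
qed

lemma sandwich_scale:
  assumes S: "S \<in> M" and A: "A \<in> M" and T: "T \<in> M"
  shows "sandwich S (oscale H H c A) T = oscale H H c (sandwich S A T)"
proof (rule bop_eqI[OF M_bop[OF sandwich_M[OF S M_scale[OF A] T]] M_bop[OF M_scale[OF sandwich_M[OF S A T]]]])
  fix h assume h: "h \<in> hcar H"
  note Th = bop_car[OF M_bop[OF T] h]
  show "sandwich S (oscale H H c A) T h = oscale H H c (sandwich S A T) h"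
    using h Th bop_car[OF M_bop[OF A] Th] by (simp add: bop_scale[OF M_bop[OF M_adj[OF S]]])
qed

lemma chain_add:
  assumes f: "\<And>r. f r \<in> M" "\<And>r. g r \<in> M"
  shows "A \<in> M \<Longrightarrow> B \<in> M \<Longrightarrow> sorted xs \<Longrightarrow> chain f g (oadd H H A B) xs = oadd H H (chain f g A xs) (chain f g B xs)"
proof (induction xs arbitrary: A B rule: induct_list012)
  case (3 x y zs)
  have yx: "0 \<le> y - x" using 3(5) by auto
  have M: "P (y - x) (sandwich (f x) A (g x)) \<in> M" "P (y - x) (sandwich (f x) B (g x)) \<in> M"
    by (intro P_M[OF yx] sandwich_M f 3)+
  show ?case using 3(2)[OF M] 3(5)
    by (simp add: sandwich_add[OF f(1) 3(3,4) f(2)] P_add[OF yx sandwich_M[OF f(1) 3(3) f(2)] sandwich_M[OF f(1) 3(4) f(2)]])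
qed auto

lemma chain_scale:
  assumes f: "\<And>r. f r \<in> M" "\<And>r. g r \<in> M"
  shows "A \<in> M \<Longrightarrow> sorted xs \<Longrightarrow> chain f g (oscale H H c A) xs = oscale H H c (chain f g A xs)"
proof (induction xs arbitrary: A rule: induct_list012)
  case (3 x y zs)
  have yx: "0 \<le> y - x" using 3(4) by auto
  have M: "P (y - x) (sandwich (f x) A (g x)) \<in> M" by (intro P_M[OF yx] sandwich_M f 3)
  show ?case using 3(2)[OF M] 3(4)
    by (simp add: sandwich_scale[OF f(1) 3(3) f(2)] P_scale[OF yx sandwich_M[OF f(1) 3(3) f(2)]])
qed auto

lemma matpos_sandwich:
  assumes A: "\<And>i j. i < n \<Longrightarrow> j < n \<Longrightarrow> A i j \<in> M" and pos: "matpos H n A" and f: "\<And>i. i < n \<Longrightarrow> f i \<in> M"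
  shows "matpos H n (\<lambda>i j. sandwich (f i) (A i j) (f j))"
  unfolding matpos_mform
proof (intro allI impI)
  fix u assume u: "\<forall>j<n. u j \<in> hcar H"
  have "mform H n (\<lambda>i j. sandwich (f i) (A i j) (f j)) u u = mform H n A (\<lambda>j. f j (u j)) (\<lambda>j. f j (u j))"
    unfolding mform_def using u by (intro sum.cong refl sandwich_inner A f) auto
  moreover have "\<forall>j<n. f j (u j) \<in> hcar H" using u bop_car[OF M_bop[OF f]] by blast
  ultimately show "Im (mform H n (\<lambda>i j. sandwich (f i) (A i j) (f j)) u u) = 0 \<and>
      0 \<le> Re (mform H n (\<lambda>i j. sandwich (f i) (A i j) (f j)) u u)"
    using pos[unfolded matpos_mform, rule_format, of "\<lambda>j. f j (u j)"] by simp
qed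

text \<open>Complete positivity passes from step to step.\<close>

lemma chain_matpos:
  assumes f: "\<And>i r. i < n \<Longrightarrow> f i r \<in> M"
  shows "(\<And>i j. i < n \<Longrightarrow> j < n \<Longrightarrow> A i j \<in> M) \<Longrightarrow> matpos H n A \<Longrightarrow> sorted xs
    \<Longrightarrow> matpos H n (\<lambda>i j. chain (f i) (f j) (A i j) xs)"
proof (induction xs arbitrary: A rule: induct_list012)
  case (3 x y zs)
  have yx: "0 \<le> y - x" using 3(5) by auto
  have sM: "sandwich (f i x) (A i j) (f j x) \<in> M" if "i < n" "j < n" for i j
    by (intro sandwich_M f 3 that)
  have "matpos H n (\<lambda>i j. sandwich (f i x) (A i j) (f j x))"
    by (rule matpos_sandwich[OF 3(3,4) f])
  then have p: "matpos H n (\<lambda>i j. P (y - x) (sandwich (f i x) (A i j) (f j x)))"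
    using P_cp[OF yx, unfolded completely_positive_def, rule_format,
        of n "\<lambda>i j. sandwich (f i x) (A i j) (f j x)"] sM by simp
  have "matpos H n (\<lambda>i j. chain (f i) (f j) (P (y - x) (sandwich (f i x) (A i j) (f j x))) (y # zs))"
    by (rule 3(2)[OF _ p]) (use 3(5) sM P_M[OF yx] in auto)
  then show ?case by simp
qed auto

lemma chain_cong:
  "(\<And>r. r \<in> set (butlast xs) \<Longrightarrow> f r = f' r \<and> g r = g' r) \<Longrightarrow> chain f g A xs = chain f' g' A xs"
  by (induction xs arbitrary: A rule: induct_list012) auto

lemma chain_append:
  "chain f g A (xs @ y # zs) = chain f g (chain f g A (xs @ [y])) (y # zs)"
  by (induction xs arbitrary: A rule: induct_list012) auto

lemma chain_shift:
  "(\<And>r. r \<in> set xs \<Longrightarrow> f (r + s) = f' r \<and> g (r + s) = g' r) \<Longrightarrow> chain f g A (map (\<lambda>r. r + s) xs) = chain f' g' A xs"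
  by (induction xs arbitrary: A rule: induct_list012) auto

lemma sandwich_oid: "A \<in> M \<Longrightarrow> sandwich (oid H) A (oid H) = A"
  by (rule bop_eqI[OF M_bop[OF sandwich_M[OF M_oid _ M_oid]] M_bop]) (auto simp: hadj_oid[OF H] bop_car[OF M_bop])

text \<open>A new point \<open>r\<close> between \<open>x\<close> and \<open>y\<close> with the identity attached to it splits \<open>P\<^bsub>y - x\<^esub>\<close> into
  \<open>P\<^bsub>y - r\<^esub> P\<^bsub>r - x\<^esub>\<close>. The bounds \<open>hd xs\<close> and \<open>b\<close> keep \<open>r\<close> away from the ends, where it would lengthen the
  interval.\<close>

lemma chain_insort:
  assumes f: "\<And>r. f r \<in> M" "\<And>r. g r \<in> M" and r: "f r = oid H" "g r = oid H"
  shows "A \<in> M \<Longrightarrow> sorted xs \<Longrightarrow> r \<notin> set xs \<Longrightarrow> xs \<noteq> [] \<Longrightarrow> hd xs < r \<Longrightarrow> b \<in> set xs \<Longrightarrow> r < b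
    \<Longrightarrow> chain f g A (insort r xs) = chain f g A xs"
proof (induction xs arbitrary: A rule: induct_list012)
  case (3 x y zs)
  show ?case
  proof (cases "r < y")
    case True
    have M: "sandwich (f x) A (g x) \<in> M" by (intro sandwich_M f 3)
    have "P (y - r) (P (r - x) (sandwich (f x) A (g x))) = P (y - x) (sandwich (f x) A (g x))"
      using P_semigroup[OF _ _ M, of "y - r" "r - x"] True 3(7) by simp
    moreover have "P (r - x) (sandwich (f x) A (g x)) \<in> M" using 3(7) by (intro P_M M) simp
    ultimately show ?thesis using True 3(7) by (simp add: r sandwich_oid)
  next
    case False
    have yr: "y < r" using False 3(5) by auto
    have b: "b \<in> set (y # zs)" using 3(7,8,9) by auto
    have yx: "0 \<le> y - x" using 3(4) by auto
    have M: "P (y - x) (sandwich (f x) A (g x)) \<in> M" by (intro P_M[OF yx] sandwich_M f 3)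
    have "chain f g (P (y - x) (sandwich (f x) A (g x))) (insort r (y # zs))
        = chain f g (P (y - x) (sandwich (f x) A (g x))) (y # zs)"
      by (rule 3(2)[OF M]) (use 3 yr b in auto)
    then show ?thesis using yr 3(7) by simp
  qed
qed auto

lemma chain_refine:
  assumes f: "\<And>r. f r \<in> M" "\<And>r. g r \<in> M" and p: "p \<in> partitions t"
    and S: "finite S" "S \<subseteq> {0..t}" and r: "\<And>r. r \<in> S - p \<Longrightarrow> f r = oid H \<and> g r = oid H"
  shows "chain f g (oid H) (sorted_list_of_set (p \<union> S)) = chain f g (oid H) (sorted_list_of_set p)"
  using S r
proof (induction S)
  case (insert x S)
  have IH: "chain f g (oid H) (sorted_list_of_set (p \<union> S)) = chain f g (oid H) (sorted_list_of_set p)"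
    using insert by auto
  show ?case
  proof (cases "x \<in> p \<union> S")
    case True
    then have "p \<union> insert x S = p \<union> S" by auto
    then show ?thesis using IH by simp
  next
    case False
    let ?q = "p \<union> S"
    have q: "finite ?q" "0 \<in> ?q" "t \<in> ?q" "?q \<subseteq> {0..t}" using p insert by (auto simp: partitions_def)
    have x: "0 < x" "x < t" "f x = oid H" "g x = oid H" using False q insert by (auto simp: order_less_le)
    have ne: "?q \<noteq> {}" using q by auto
    have "Min ?q = 0" using q by (intro Min_eqI) auto
    then have hd: "hd (sorted_list_of_set ?q) = 0" using sorted_list_of_set_nonempty[OF q(1) ne] by simp
    have "p \<union> insert x S = insert x ?q" by auto
    then have "sorted_list_of_set (p \<union> insert x S) = insort x (sorted_list_of_set ?q)"
      using sorted_list_of_set_insert[OF q(1) False] by simp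
    moreover have "chain f g (oid H) (insort x (sorted_list_of_set ?q)) = chain f g (oid H) (sorted_list_of_set ?q)"
      by (rule chain_insort[where f=f and g=g and b=t]) (use f q ne x hd False M_oid in auto)
    ultimately show ?thesis using IH by simp
  qed
qed simp

lemma part_list:
  assumes p: "p \<in> partitions t" and t: "0 < t"
  obtains r rs where "sorted_list_of_set p = 0 # r # rs" "0 \<notin> set (r # rs)" "sorted (0 # r # rs)" "0 \<le> r"
proof -
  have q: "finite p" "0 \<in> p" "t \<in> p" "p \<subseteq> {0..t}" using p by (auto simp: partitions_def)
  have ne: "p \<noteq> {}" using q by auto
  have "Min p = 0" using q by (intro Min_eqI) auto
  then have l: "sorted_list_of_set p = 0 # sorted_list_of_set (p - {0})"
    using sorted_list_of_set_nonempty[OF q(1) ne] by simp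
  have "p - {0} \<noteq> {}" using q t by auto
  then have "sorted_list_of_set (p - {0}) \<noteq> []" using q by simp
  then obtain r rs where r: "sorted_list_of_set (p - {0}) = r # rs" by (cases "sorted_list_of_set (p - {0})") auto
  have s: "set (r # rs) = p - {0}" unfolding r[symmetric] using q by simp
  have "sorted (sorted_list_of_set p)" by simp
  then have so: "sorted (0 # r # rs)" unfolding l r .
  show ?thesis by (rule that[of r rs]) (use l r s so in auto)
qed

abbreviation gens where "gens t p \<equiv> part_gens H M t p"
abbreviation kern where "kern p \<equiv> part_kernel H P p"
abbreviation PS where "PS t p \<equiv> part_space H M P t p"
abbreviation pg where "pg t p \<equiv> part_gen H M P t p"
abbreviation lst where "lst p \<equiv> (sorted_list_of_set p :: real list)"

lemma gens_M: "(f, h) \<in> gens t p \<Longrightarrow> f r \<in> M"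
  using M_oid by (auto simp: part_gens_def)

lemma gens_car: "(f, h) \<in> gens t p \<Longrightarrow> h \<in> hcar H"
  by (simp add: part_gens_def)

lemma gens_mono: "p \<subseteq> q \<Longrightarrow> x \<in> gens t p \<Longrightarrow> x \<in> gens t q"
  using M_oid by (cases x) (auto simp: part_gens_def)

text \<open>By this equality the insertion of identities is isometric.\<close>

lemma kern_refine:
  assumes p: "p \<in> partitions t" and q: "q \<in> partitions t" and pq: "p \<subseteq> q"
    and x: "x \<in> gens t p" and y: "y \<in> gens t p"
  shows "kern q x y = kern p x y"
proof -
  obtain f h g k where e: "x = (f, h)" "y = (g, k)" by fastforce
  have "p \<union> q = q" using pq by auto
  moreover have "chain f g (oid H) (lst (p \<union> q)) = chain f g (oid H) (lst p)"
  proof (rule chain_refine[OF _ _ p])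
    show "f r \<in> M" "g r \<in> M" for r using gens_M x y e by auto
    show "finite q" "q \<subseteq> {0..t}" using q by (auto simp: partitions_def)
    show "f r = oid H \<and> g r = oid H" if "r \<in> q - p" for r
      using that x y by (auto simp: e part_gens_def)
  qed
  ultimately show ?thesis by (simp add: e part_kernel_def)
qed

lemma chain_gens_matpos:
  assumes "\<And>i. i < n \<Longrightarrow> x i \<in> gens t p" "A \<in> M" "matpos H n (\<lambda>i j. A)"
  shows "matpos H n (\<lambda>i j. chain (fst (x i)) (fst (x j)) A (lst p))"
proof (rule chain_matpos)
  show "fst (x i) r \<in> M" if "i < n" for i r
    using assms(1)[OF that] gens_M[of "fst (x i)" "snd (x i)" t p r] by simp
qed (use assms in auto)

lemma chain_gens_psd:
  assumes A: "A \<in> M" and pos: "\<And>x. x \<in> hcar H \<Longrightarrow> Im (hinner H x (A x)) = 0 \<and> 0 \<le> Re (hinner H x (A x))"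
  shows "psd (gens t p) (\<lambda>x y. hinner H (snd x) (chain (fst x) (fst y) A (lst p) (snd y)))"
proof (rule psd_of_matpos[OF H])
  show "chain (fst x) (fst y) A (lst p) \<in> bop H H" if "x \<in> gens t p" "y \<in> gens t p" for x y
    using that gens_M[of "fst x" "snd x"] gens_M[of "fst y" "snd y"] by (intro M_bop chain_M A) auto
  show "matpos H n (\<lambda>i j. chain (fst (x i)) (fst (x j)) A (lst p))" if "\<And>i. i < n \<Longrightarrow> x i \<in> gens t p" for n x
    by (rule chain_gens_matpos[OF that A matpos_const[OF H M_bop[OF A] pos]])
  show "snd x \<in> hcar H" if "x \<in> gens t p" for x using that gens_car[of "fst x" "snd x"] by simp
qed

lemma kern_alt: "kern p x y = hinner H (snd x) (chain (fst x) (fst y) (oid H) (lst p) (snd y))"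
  by (simp add: part_kernel_def case_prod_unfold)

lemma kern_psd: "psd (gens t p) (kern p)"
  unfolding kern_alt[abs_def]
  by (rule chain_gens_psd[OF M_oid]) (auto simp: hinner_self[OF HS])

lemma PS_hilbert: "hilbert_space (PS t p)"
  unfolding part_space_def by (rule kspace_hilbert[OF kern_psd])

lemma pg_car: "x \<in> gens t p \<Longrightarrow> pg t p x \<in> hcar (PS t p)"
  unfolding part_gen_def part_space_def by (rule kgen_car[OF kern_psd])

lemma pg_inner: "x \<in> gens t p \<Longrightarrow> y \<in> gens t p \<Longrightarrow> hinner (PS t p) (pg t p x) (pg t p y) = kern p x y"
  unfolding part_gen_def part_space_def by (rule kgen_inner[OF kern_psd])

lemma pg_total: "total (PS t p) (pg t p ` gens t p)"
  unfolding part_gen_def part_space_def by (rule kgen_total[OF kern_psd])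

context
  fixes t p and G :: "'b hspace" and f C
  assumes G: "hilbert_space G" and f: "\<And>x. x \<in> gens t p \<Longrightarrow> f x \<in> hcar G"
    and C: "0 \<le> C" and dom: "psd (gens t p) (\<lambda>x y. of_real (C\<^sup>2) * kern p x y - hinner G (f x) (f y))"
begin

lemma part_ext_bop: "part_ext H M P t p G f \<in> bop (PS t p) G"
  and part_ext_gen: "x \<in> gens t p \<Longrightarrow> part_ext H M P t p G f (pg t p x) = f x"
  and part_ext_bound: "v \<in> hcar (PS t p) \<Longrightarrow> hnorm G (part_ext H M P t p G f v) \<le> C * hnorm (PS t p) v"
  unfolding part_ext_def part_space_def part_gen_def
  by (rule kext_bop[OF kern_psd G f C dom], assumption)
    (rule kext_gen[OF kern_psd G f C dom], assumption+, rule kext_bound[OF kern_psd G f C dom], assumption+)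

end

text \<open>Chains depend linearly and positively on the innermost operator, so \<open>A \<le> r\<^sup>2\<close> is passed on to the
  kernel.\<close>

lemma chain_dominated:
  assumes A: "A \<in> M" and r: "0 \<le> r"
    and b: "\<And>x. x \<in> hcar H \<Longrightarrow> Im (hinner H x (A x)) = 0 \<and> Re (hinner H x (A x)) \<le> r\<^sup>2 * (hnorm H x)\<^sup>2"
  shows "psd (gens t p) (\<lambda>x y. of_real (r\<^sup>2) * kern p x y
    - hinner H (snd x) (chain (fst x) (fst y) A (lst p) (snd y)))"
proof -
  define D where "D = oadd H H (oscale H H (of_real (r\<^sup>2)) (oid H)) (oscale H H (-1) A)"
  note M1 = M_scale[OF M_oid, of "of_real (r\<^sup>2)"] and M2 = M_scale[OF A, of "-1"]
  have D: "D \<in> M" unfolding D_def by (rule M_add[OF M1 M2])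
  have "psd (gens t p) (\<lambda>x y. hinner H (snd x) (chain (fst x) (fst y) D (lst p) (snd y)))"
  proof (rule chain_gens_psd[OF D])
    fix x assume x: "x \<in> hcar H"
    have "hinner H x (D x) = of_real (r\<^sup>2) * hinner H x x - hinner H x (A x)"
      unfolding D_def using x HS bop_car[OF M_bop[OF A] x] by simp
    then show "Im (hinner H x (D x)) = 0 \<and> 0 \<le> Re (hinner H x (D x))"
      using b[OF x] by (simp add: hinner_self[OF HS x])
  qed
  moreover have "hinner H (snd x) (chain (fst x) (fst y) D (lst p) (snd y)) = of_real (r\<^sup>2) * kern p x y
    - hinner H (snd x) (chain (fst x) (fst y) A (lst p) (snd y))" if "x \<in> gens t p" "y \<in> gens t p" for x y
  proof -
    have f: "fst x r' \<in> M" "fst y r' \<in> M" for r' using gens_M[of "fst x" "snd x"] gens_M[of "fst y" "snd y"] that by auto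
    have c: "snd x \<in> hcar H" "snd y \<in> hcar H" using gens_car[of "fst x" "snd x"] gens_car[of "fst y" "snd y"] that by auto
    have s: "sorted (lst p)" by simp
    have "chain (fst x) (fst y) D (lst p) = oadd H H (oscale H H (of_real (r\<^sup>2)) (chain (fst x) (fst y) (oid H) (lst p)))
        (oscale H H (-1) (chain (fst x) (fst y) A (lst p)))"
      unfolding D_def chain_add[OF f M1 M2 s] chain_scale[OF f M_oid s] chain_scale[OF f A s] ..
    then show ?thesis
      using c HS bop_car[OF M_bop[OF chain_M[OF f M_oid s]] c(2)] bop_car[OF M_bop[OF chain_M[OF f A s]] c(2)]
      by (simp add: kern_alt)
  qed
  ultimately show ?thesis by (subst (asm) psd_cong) auto
qed

text \<open>The left action of \<open>S\<close> on codes of elementary tensors: the first factor is attached to the point \<open>0\<close>.\<close>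

abbreviation lmul where "lmul S f \<equiv> f(0 := ocomp H S (f 0))"

lemma lmul_gens:
  assumes "(f, h) \<in> gens t p" "S \<in> M" "p \<in> partitions t" "0 < t"
  shows "(lmul S f, h) \<in> gens t p"
  using assms M_comp[OF assms(2) gens_M[OF assms(1)]] by (auto simp: part_gens_def partitions_def)

text \<open>In the first step of the chain, \<open>(S f\<^sub>0)\<^sup>* (T g\<^sub>0) = f\<^sub>0\<^sup>* (S\<^sup>* T) g\<^sub>0\<close>.\<close>

lemma chain_lmul:
  assumes p: "p \<in> partitions t" and t: "0 < t" and f: "\<And>r. f r \<in> M" "\<And>r. g r \<in> M" and S: "S \<in> M" and T: "T \<in> M"
  shows "chain (lmul S f) (lmul T g) (oid H) (lst p) = chain f g (ocomp H (hadj H H S) T) (lst p)"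
proof -
  obtain r rs where l: "lst p = 0 # r # rs" "0 \<notin> set (r # rs)" by (rule part_list[OF p t])
  let ?ST = "ocomp H (hadj H H S) T"
  have ST: "?ST \<in> M" by (intro M_comp M_adj S T)
  have Sf: "ocomp H S (f 0) \<in> M" "ocomp H T (g 0) \<in> M" by (intro M_comp S T f)+
  have "sandwich (ocomp H S (f 0)) (oid H) (ocomp H T (g 0)) = sandwich (f 0) ?ST (g 0)"
  proof (rule bop_eqI[OF M_bop[OF sandwich_M[OF Sf(1) M_oid Sf(2)]] M_bop[OF sandwich_M[OF f(1) ST f(2)]]])
    fix k assume k: "k \<in> hcar H"
    note gk = bop_car[OF M_bop[OF f(2)[of 0]] k]
    note Tg = bop_car[OF M_bop[OF T] gk]
    show "sandwich (ocomp H S (f 0)) (oid H) (ocomp H T (g 0)) k = sandwich (f 0) ?ST (g 0) k"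
      unfolding hadj_ocomp[OF H H H M_bop[OF S] M_bop[OF f(1)]] using k gk Tg by simp
  qed
  moreover have "chain (lmul S f) (lmul T g) B (r # rs) = chain f g B (r # rs)" for B
  proof (rule chain_cong)
    fix r' assume "r' \<in> set (butlast (r # rs))"
    then have "r' \<noteq> 0" using l(2) in_set_butlastD by metis
    then show "(lmul S f) r' = f r' \<and> (lmul T g) r' = g r'" by simp
  qed
  ultimately show ?thesis unfolding l(1) by simp
qed

lemma kern_lmul:
  assumes "p \<in> partitions t" "0 < t" "(f, h) \<in> gens t p" "(g, k) \<in> gens t p" "S \<in> M" "T \<in> M"
  shows "kern p (lmul S f, h) (lmul T g, k) = hinner H h (chain f g (ocomp H (hadj H H S) T) (lst p) k)"
  using chain_lmul[where f=f and g=g, OF assms(1,2) gens_M[OF assms(3)] gens_M[OF assms(4)] assms(5,6)]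
  by (simp add: part_kernel_def)

lemma lmul_oid: "f 0 \<in> M \<Longrightarrow> lmul (oid H) f = f"
proof -
  assume "f 0 \<in> M"
  then have "ocomp H (oid H) (f 0) = f 0"
    by (intro bop_eqI[OF M_bop[OF M_comp[OF M_oid]] M_bop]) (auto simp: bop_car[OF M_bop])
  then show ?thesis by simp
qed

lemma lact_dom:
  assumes p: "p \<in> partitions t" and t: "0 < t" and S: "S \<in> M"
    and r: "0 \<le> r" "\<And>x. x \<in> hcar H \<Longrightarrow> hnorm H (S x) \<le> r * hnorm H x"
  shows "psd (gens t p) (\<lambda>x y. of_real (r\<^sup>2) * kern p x y
    - hinner (PS t p) ((\<lambda>(f, h). pg t p (lmul S f, h)) x) ((\<lambda>(f, h). pg t p (lmul S f, h)) y))"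
proof -
  let ?A = "ocomp H (hadj H H S) S"
  have "psd (gens t p) (\<lambda>x y. of_real (r\<^sup>2) * kern p x y
    - hinner H (snd x) (chain (fst x) (fst y) ?A (lst p) (snd y)))"
  proof (rule chain_dominated[OF M_comp[OF M_adj[OF S] S] r(1)])
    fix x assume x: "x \<in> hcar H"
    note Sx = bop_car[OF M_bop[OF S] x]
    have "hinner H x (?A x) = of_real ((hnorm H (S x))\<^sup>2)"
      using x hadj_right[OF H H M_bop[OF S] x Sx] by (simp add: hinner_self[OF HS Sx])
    moreover have "(hnorm H (S x))\<^sup>2 \<le> r\<^sup>2 * (hnorm H x)\<^sup>2"
      using power_mono[OF r(2)[OF x] hnorm_ge0[OF HS Sx], of 2] by (simp add: power_mult_distrib)
    ultimately show "Im (hinner H x (?A x)) = 0 \<and> Re (hinner H x (?A x)) \<le> r\<^sup>2 * (hnorm H x)\<^sup>2" by simp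
  qed
  moreover have "hinner (PS t p) ((\<lambda>(f, h). pg t p (lmul S f, h)) x) ((\<lambda>(f, h). pg t p (lmul S f, h)) y)
      = hinner H (snd x) (chain (fst x) (fst y) ?A (lst p) (snd y))" if "x \<in> gens t p" "y \<in> gens t p" for x y
  proof -
    obtain f h g k where e: "x = (f, h)" "y = (g, k)" by fastforce
    show ?thesis using that lmul_gens[OF _ S p t] unfolding e
      by (simp add: pg_inner kern_lmul[OF p t _ _ S S])
  qed
  ultimately show ?thesis by (subst psd_cong) auto
qed

lemma part_lact_props:
  assumes p: "p \<in> partitions t" and t: "0 < t" and S: "S \<in> M"
    and r: "0 \<le> r" "\<And>x. x \<in> hcar H \<Longrightarrow> hnorm H (S x) \<le> r * hnorm H x"
  shows "part_lact H M P t p S \<in> bop (PS t p) (PS t p)"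
    and "(f, h) \<in> gens t p \<Longrightarrow> part_lact H M P t p S (pg t p (f, h)) = pg t p (lmul S f, h)"
    and "v \<in> hcar (PS t p) \<Longrightarrow> hnorm (PS t p) (part_lact H M P t p S v) \<le> r * hnorm (PS t p) v"
proof -
  have c: "(\<lambda>(f, h). pg t p (lmul S f, h)) x \<in> hcar (PS t p)" if "x \<in> gens t p" for x
    using that lmul_gens[OF _ S p t] pg_car by (cases x) auto
  note d = lact_dom[OF assms]
  show "part_lact H M P t p S \<in> bop (PS t p) (PS t p)"
    unfolding part_lact_def by (rule part_ext_bop[OF PS_hilbert c r(1) d])
  show "part_lact H M P t p S (pg t p (f, h)) = pg t p (lmul S f, h)" if "(f, h) \<in> gens t p"
    unfolding part_lact_def using part_ext_gen[OF PS_hilbert c r(1) d that] by simp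
  show "hnorm (PS t p) (part_lact H M P t p S v) \<le> r * hnorm (PS t p) v" if "v \<in> hcar (PS t p)"
    unfolding part_lact_def by (rule part_ext_bound[OF PS_hilbert c r(1) d that])
qed

text \<open>The chains lie in \<open>M\<close>, hence commute with \<open>W\<^sup>* W\<close>. The lemma bounds the action of the commutant of \<open>M\<close> on the
  last factor, where \<open>W\<close> belongs to the commutant, and the operators \<open>I \<otimes> X\<close>, where \<open>W = X\<close>.\<close>

lemma commutant_dom:
  assumes G: "hilbert_space G" and W: "W \<in> bop H G"
    and comm: "\<And>A h. A \<in> M \<Longrightarrow> h \<in> hcar H \<Longrightarrow> A (hadj H G W (W h)) = hadj H G W (W (A h))"
    and r: "0 \<le> r" "\<And>x. x \<in> hcar H \<Longrightarrow> hnorm G (W x) \<le> r * hnorm H x"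
  shows "psd (gens t p) (\<lambda>x y. of_real (r\<^sup>2) * kern p x y
    - hinner H (snd x) (chain (fst x) (fst y) (oid H) (lst p) (hadj H G W (W (snd y)))))"
  unfolding kern_alt
proof (rule psd_dominated[OF H G, where C="\<lambda>x y. chain (fst x) (fst y) (oid H) (lst p)" and \<phi>=snd])
  have cM: "chain (fst x) (fst y) (oid H) (lst p) \<in> M" if "x \<in> gens t p" "y \<in> gens t p" for x y
    using that gens_M[of "fst x" "snd x"] gens_M[of "fst y" "snd y"] by (intro chain_M M_oid) auto
  show "chain (fst x) (fst y) (oid H) (lst p) \<in> bop H H" if "x \<in> gens t p" "y \<in> gens t p" for x y
    by (rule M_bop[OF cM[OF that]])
  show "matpos H n (\<lambda>i j. chain (fst (x i)) (fst (x j)) (oid H) (lst p))" if "\<And>i. i < n \<Longrightarrow> x i \<in> gens t p" for n x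
    by (rule chain_gens_matpos[OF that M_oid matpos_const[OF H M_bop[OF M_oid]]]) (auto simp: hinner_self[OF HS])
  show "snd x \<in> hcar H" if "x \<in> gens t p" for x using that gens_car[of "fst x" "snd x"] by simp
  show "chain (fst x) (fst y) (oid H) (lst p) (hadj H G W (W h)) = hadj H G W (W (chain (fst x) (fst y) (oid H) (lst p) h))"
    if "x \<in> gens t p" "y \<in> gens t p" "h \<in> hcar H" for x y h by (rule comm[OF cM[OF that(1,2)] that(3)])
qed (use W r in auto)

lemma commutant_M: "R \<in> commutant H M \<Longrightarrow> A \<in> M \<Longrightarrow> h \<in> hcar H \<Longrightarrow> R (A h) = A (R h)"
  by (rule commutantD)

lemma part_comm_act_props:
  assumes R: "R \<in> commutant H M"
    and r: "0 \<le> r" "\<And>x. x \<in> hcar H \<Longrightarrow> hnorm H (R x) \<le> r * hnorm H x"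
  shows "part_comm_act H M P t p R \<in> bop (PS t p) (PS t p)"
    and "(f, h) \<in> gens t p \<Longrightarrow> part_comm_act H M P t p R (pg t p (f, h)) = pg t p (f, R h)"
    and "v \<in> hcar (PS t p) \<Longrightarrow> hnorm (PS t p) (part_comm_act H M P t p R v) \<le> r * hnorm (PS t p) v"
proof -
  note Rb = commutant_bop[OF R]
  have Ra: "hadj H H R \<in> commutant H M" by (rule star_algebraD(6)[OF N_star R])
  have g: "(f, R h) \<in> gens t p" if "(f, h) \<in> gens t p" for f h
    using that bop_car[OF Rb] by (auto simp: part_gens_def)
  have c: "(\<lambda>(f, h). pg t p (f, R h)) x \<in> hcar (PS t p)" if "x \<in> gens t p" for x
    using that g pg_car by (cases x) auto
  have "psd (gens t p) (\<lambda>x y. of_real (r\<^sup>2) * kern p x y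
    - hinner H (snd x) (chain (fst x) (fst y) (oid H) (lst p) (hadj H H R (R (snd y)))))"
    by (rule commutant_dom[OF H Rb _ r])
      (simp add: commutant_M[OF R, symmetric] commutant_M[OF Ra] bop_car[OF Rb] commutant_M[OF Ra, symmetric])
  moreover have "hinner (PS t p) ((\<lambda>(f, h). pg t p (f, R h)) x) ((\<lambda>(f, h). pg t p (f, R h)) y)
     = hinner H (snd x) (chain (fst x) (fst y) (oid H) (lst p) (hadj H H R (R (snd y))))"
    if "x \<in> gens t p" "y \<in> gens t p" for x y
  proof -
    obtain f h g' k where e: "x = (f, h)" "y = (g', k)" by fastforce
    have hk: "h \<in> hcar H" "k \<in> hcar H" using that gens_car unfolding e by auto
    have cM: "chain f g' (oid H) (lst p) \<in> M" using that gens_M unfolding e by (intro chain_M M_oid) auto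
    have "hinner H (R h) (chain f g' (oid H) (lst p) (R k)) = hinner H h (hadj H H R (chain f g' (oid H) (lst p) (R k)))"
      by (rule hadj_right[OF H H Rb hk(1) bop_car[OF M_bop[OF cM] bop_car[OF Rb hk(2)]], symmetric])
    also have "hadj H H R (chain f g' (oid H) (lst p) (R k)) = chain f g' (oid H) (lst p) (hadj H H R (R k))"
      by (rule commutant_M[OF Ra cM bop_car[OF Rb hk(2)]])
    finally show ?thesis using that g unfolding e by (simp add: pg_inner kern_alt)
  qed
  ultimately have d: "psd (gens t p) (\<lambda>x y. of_real (r\<^sup>2) * kern p x y
    - hinner (PS t p) ((\<lambda>(f, h). pg t p (f, R h)) x) ((\<lambda>(f, h). pg t p (f, R h)) y))"
    by (subst psd_cong) auto
  show "part_comm_act H M P t p R \<in> bop (PS t p) (PS t p)"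
    unfolding part_comm_act_def by (rule part_ext_bop[OF PS_hilbert c r(1) d])
  show "part_comm_act H M P t p R (pg t p (f, h)) = pg t p (f, R h)" if "(f, h) \<in> gens t p"
    unfolding part_comm_act_def using part_ext_gen[OF PS_hilbert c r(1) d that] by simp
  show "hnorm (PS t p) (part_comm_act H M P t p R v) \<le> r * hnorm (PS t p) v" if "v \<in> hcar (PS t p)"
    unfolding part_comm_act_def by (rule part_ext_bound[OF PS_hilbert c r(1) d that])
qed

end

section \<open>The direct limits\<close>

context cp_data
begin

abbreviation inc where "inc t p q \<equiv> part_incl H M P t p q"
abbreviation LS where "LS t \<equiv> lim_space H M P t"
abbreviation lv where "lv t p \<equiv> lim_v H M P t p"

lemma partitions_Un: "p \<in> partitions t \<Longrightarrow> q \<in> partitions t \<Longrightarrow> p \<union> q \<in> partitions t"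
  by (auto simp: partitions_def)

context
  fixes t p q
  assumes p: "p \<in> partitions t" and q: "q \<in> partitions t" and pq: "p \<subseteq> q"
begin

lemma inc_dom: "psd (gens t p) (\<lambda>x y. of_real (1\<^sup>2) * kern p x y
   - hinner (PS t q) ((\<lambda>(f, h). pg t q (f, h)) x) ((\<lambda>(f, h). pg t q (f, h)) y))"
proof -
  have "psd (gens t p) (\<lambda>x y. 0)" by (simp add: psd_def kform_def)
  moreover have "of_real (1\<^sup>2) * kern p x y
      - hinner (PS t q) ((\<lambda>(f, h). pg t q (f, h)) x) ((\<lambda>(f, h). pg t q (f, h)) y) = 0"
    if "x \<in> gens t p" "y \<in> gens t p" for x y
    using pg_inner[OF gens_mono[OF pq that(1)] gens_mono[OF pq that(2)]] kern_refine[OF p q pq that]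
    by (simp add: case_prod_unfold)
  ultimately show ?thesis by (subst psd_cong) auto
qed

lemma inc_bop: "inc t p q \<in> bop (PS t p) (PS t q)"
  unfolding part_incl_def
  by (rule part_ext_bop[OF PS_hilbert _ _ inc_dom]) (use pg_car gens_mono[OF pq] in auto)

lemma inc_gen: "x \<in> gens t p \<Longrightarrow> inc t p q (pg t p x) = pg t q x"
  unfolding part_incl_def
  by (subst part_ext_gen[OF PS_hilbert _ _ inc_dom]) (use pg_car gens_mono[OF pq] in \<open>auto simp: case_prod_unfold\<close>)

lemma inc_car: "u \<in> hcar (PS t p) \<Longrightarrow> inc t p q u \<in> hcar (PS t q)"
  by (rule bop_car[OF inc_bop])

lemma inc_inner:
  assumes "u \<in> hcar (PS t p)" "v \<in> hcar (PS t p)"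
  shows "hinner (PS t q) (inc t p q u) (inc t p q v) = hinner (PS t p) u v"
proof -
  note S = hilbert_semi[OF PS_hilbert]
  have "hinner (PS t q) (inc t p q u) (inc t p q v) = hinner (PS t p) u (oid (PS t p) v)"
  proof (rule total_sesq_eqI[OF PS_hilbert PS_hilbert PS_hilbert pg_total pg_total inc_bop inc_bop oid_bop[OF S] _ assms])
    fix d d' assume "d \<in> pg t p ` gens t p" "d' \<in> pg t p ` gens t p"
    then obtain x y where xy: "x \<in> gens t p" "y \<in> gens t p" "d = pg t p x" "d' = pg t p y" by auto
    show "hinner (PS t q) (inc t p q d) (inc t p q d') = hinner (PS t p) d (oid (PS t p) d')"
      using pg_inner[OF gens_mono[OF pq xy(1)] gens_mono[OF pq xy(2)]] kern_refine[OF p q pq xy(1,2)]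
      by (simp add: xy(3,4) inc_gen xy(1,2) pg_inner pg_car)
  qed
  then show ?thesis using assms by simp
qed

end

lemma inc_trans:
  assumes p: "p \<in> partitions t" and q: "q \<in> partitions t" and r: "r \<in> partitions t" and pq: "p \<subseteq> q" "q \<subseteq> r"
    and u: "u \<in> hcar (PS t p)"
  shows "inc t q r (inc t p q u) = inc t p r u"
proof -
  have pr: "p \<subseteq> r" using pq by auto
  note S = hilbert_semi[OF PS_hilbert]
  have "ocomp (PS t p) (inc t q r) (inc t p q) = inc t p r"
  proof (rule bop_total_eqI[OF PS_hilbert PS_hilbert pg_total ocomp_bop[OF S S inc_bop[OF q r pq(2)] inc_bop[OF p q pq(1)]] inc_bop[OF p r pr]])
    fix d assume "d \<in> pg t p ` gens t p"
    then obtain x where x: "x \<in> gens t p" "d = pg t p x" by auto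
    show "ocomp (PS t p) (inc t q r) (inc t p q) d = inc t p r d"
      by (simp add: x pg_car inc_gen[OF p q pq(1)] inc_gen[OF q r pq(2)] inc_gen[OF p r pr] gens_mono[OF pq(1)])
  qed
  then have "ocomp (PS t p) (inc t q r) (inc t p q) u = inc t p r u" by simp
  then show ?thesis using u by simp
qed

abbreviation lgens where "lgens t \<equiv> lim_gens H M P t"
abbreviation lkern where "lkern t \<equiv> lim_kernel H M P t"

text \<open>The defining refinement \<open>p \<union> q\<close> depends on the pair. As inclusions are isometric, any larger partition will do,
  and finitely many generators can be compared in one space.\<close>

lemma lkern_any:
  assumes p: "p \<in> partitions t" and q: "q \<in> partitions t" and r: "r \<in> partitions t" "p \<subseteq> r" "q \<subseteq> r"
    and u: "u \<in> hcar (PS t p)" and v: "v \<in> hcar (PS t q)"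
  shows "lkern t (p, u) (q, v) = hinner (PS t r) (inc t p r u) (inc t q r v)"
proof -
  note pq = partitions_Un[OF p q]
  have s: "p \<union> q \<subseteq> r" using r by auto
  have "hinner (PS t r) (inc t (p \<union> q) r (inc t p (p \<union> q) u)) (inc t (p \<union> q) r (inc t q (p \<union> q) v))
     = hinner (PS t (p \<union> q)) (inc t p (p \<union> q) u) (inc t q (p \<union> q) v)"
    by (rule inc_inner[OF pq r(1) s inc_car[OF p pq _ u] inc_car[OF q pq _ v]]) auto
  then show ?thesis
    by (simp add: lim_kernel_def inc_trans[OF p pq r(1) _ s u] inc_trans[OF q pq r(1) _ s v])
qed

lemma common_refinement:
  fixes n :: nat
  assumes "\<And>i. i < n \<Longrightarrow> x i \<in> lgens t" "0 < n"
  obtains r where "r \<in> partitions t" "\<And>i. i < n \<Longrightarrow> fst (x i) \<subseteq> r"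
proof -
  have x: "fst (x i) \<in> partitions t" if "i < n" for i using assms(1)[OF that] by (auto simp: lim_gens_def)
  have h: "finite (fst (x i))" "fst (x i) \<subseteq> {0..t}" "0 \<in> fst (x i)" "t \<in> fst (x i)" if "i < n" for i
    using x[OF that] by (auto simp: partitions_def)
  have "(\<Union>i<n. fst (x i)) \<in> partitions t"
    unfolding partitions_def using h(1,2) h(3,4)[OF assms(2)] assms(2)
    by (intro CollectI conjI finite_UN_I UN_least UN_I[of 0]) auto
  then show ?thesis by (rule that) auto
qed

lemma lkern_psd: "psd (lgens t) (lkern t)"
proof (rule psdI)
  fix n :: nat and x :: "nat \<Rightarrow> _" and c assume x: "\<And>i. i < n \<Longrightarrow> x i \<in> lgens t"
  show "Im (kform (lkern t) n x c) = 0 \<and> 0 \<le> Re (kform (lkern t) n x c)"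
  proof (cases "n = 0")
    case True then show ?thesis by (simp add: kform_def)
  next
    case False
    then have n0: "0 < n" by simp
    obtain r where r: "r \<in> partitions t" "\<And>i. i < n \<Longrightarrow> fst (x i) \<subseteq> r"
      by (rule common_refinement[of n x t, OF x n0], assumption, rule that)
    have xp: "fst (x i) \<in> partitions t" "snd (x i) \<in> hcar (PS t (fst (x i)))" if "i < n" for i
      using x[OF that] by (auto simp: lim_gens_def)
    have "kform (lkern t) n x c = kform (hinner (PS t r)) n (\<lambda>i. inc t (fst (x i)) r (snd (x i))) c"
      by (rule kform_cong) (use lkern_any[OF xp(1) xp(1) r(1) r(2) r(2) xp(2) xp(2)] in simp)
    moreover have "inc t (fst (x i)) r (snd (x i)) \<in> hcar (PS t r)" if "i < n" for i
      by (rule inc_car[OF xp(1) r(1) r(2) xp(2)]) (rule that)+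
    ultimately show ?thesis
      using psd_hinner[OF PS_hilbert, unfolded psd_def, rule_format, of n "\<lambda>i. inc t (fst (x i)) r (snd (x i))" t r c] by simp
  qed
qed

lemma LS_hilbert: "hilbert_space (LS t)"
  unfolding lim_space_def by (rule kspace_hilbert[OF lkern_psd])

lemmas LSS = hilbert_semi[OF LS_hilbert]
lemmas PSS = hilbert_semi[OF PS_hilbert]

lemma lgensI: "p \<in> partitions t \<Longrightarrow> u \<in> hcar (PS t p) \<Longrightarrow> (p, u) \<in> lgens t"
  by (simp add: lim_gens_def)

lemma lv_car: "p \<in> partitions t \<Longrightarrow> u \<in> hcar (PS t p) \<Longrightarrow> lv t p u \<in> hcar (LS t)"
  unfolding lim_v_def lim_space_def by (rule kgen_car[OF lkern_psd lgensI])

lemma lv_inner: "p \<in> partitions t \<Longrightarrow> u \<in> hcar (PS t p) \<Longrightarrow> q \<in> partitions t \<Longrightarrow> v \<in> hcar (PS t q)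
    \<Longrightarrow> hinner (LS t) (lv t p u) (lv t q v) = lkern t (p, u) (q, v)"
  unfolding lim_v_def lim_space_def by (rule kgen_inner[OF lkern_psd lgensI lgensI])

lemma lv_total: "total (LS t) ((\<lambda>(p, u). lv t p u) ` lgens t)"
proof -
  have "(\<lambda>(p, u). lv t p u) ` lgens t = kgen (lgens t) (lkern t) ` lgens t"
    by (intro image_cong refl) (auto simp: lim_v_def)
  then show ?thesis unfolding lim_space_def using kgen_total[OF lkern_psd] by simp
qed

lemma lv_eqI:
  assumes "y \<in> hcar (LS t)" "z \<in> hcar (LS t)"
    and "\<And>q v. q \<in> partitions t \<Longrightarrow> v \<in> hcar (PS t q) \<Longrightarrow> hinner (LS t) (lv t q v) y = hinner (LS t) (lv t q v) z"
  shows "y = z"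
  by (rule total_eqI[OF LS_hilbert lv_total assms(1,2)]) (use assms(3) in \<open>auto simp: lim_gens_def\<close>)

text \<open>The canonical isometry as an extensional operator.\<close>

definition vr where "vr t p = restrict (lv t p) (hcar (PS t p))"

lemma vr_bop:
  assumes p: "p \<in> partitions t" shows "vr t p \<in> bop (PS t p) (LS t)"
proof (rule bopI[where C=1])
  note c = lv_car[OF p]
  show "vr t p (hadd (PS t p) u v) = hadd (LS t) (vr t p u) (vr t p v)"
    if u: "u \<in> hcar (PS t p)" and v: "v \<in> hcar (PS t p)" for u v
  proof -
    have uv: "hadd (PS t p) u v \<in> hcar (PS t p)" using PSS u v by simp
    have "lv t p (hadd (PS t p) u v) = hadd (LS t) (lv t p u) (lv t p v)"
    proof (rule lv_eqI)
      show "lv t p (hadd (PS t p) u v) \<in> hcar (LS t)" by (rule c[OF uv])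
      show "hadd (LS t) (lv t p u) (lv t p v) \<in> hcar (LS t)" using c u v LSS by simp
      fix q w assume q: "q \<in> partitions t" and w: "w \<in> hcar (PS t q)"
      have ic: "inc t q (q \<union> p) w \<in> hcar (PS t (q \<union> p))" "inc t p (q \<union> p) u \<in> hcar (PS t (q \<union> p))" "inc t p (q \<union> p) v \<in> hcar (PS t (q \<union> p))"
        using inc_car[OF q partitions_Un[OF q p] _ w] inc_car[OF p partitions_Un[OF q p] _ u] inc_car[OF p partitions_Un[OF q p] _ v] by auto
      show "hinner (LS t) (lv t q w) (lv t p (hadd (PS t p) u v)) = hinner (LS t) (lv t q w) (hadd (LS t) (lv t p u) (lv t p v))"
        using c u v LSS lv_car[OF q w] uv bop_add[OF inc_bop[OF p partitions_Un[OF q p]] u v] ic PSS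
        by (simp add: lv_inner q w p lim_kernel_def)
    qed
    then show ?thesis using u v uv by (simp add: vr_def)
  qed
  show "vr t p (hscale (PS t p) a u) = hscale (LS t) a (vr t p u)"
    if u: "u \<in> hcar (PS t p)" for a u
  proof -
    have uv: "hscale (PS t p) a u \<in> hcar (PS t p)" using PSS u by simp
    have "lv t p (hscale (PS t p) a u) = hscale (LS t) a (lv t p u)"
    proof (rule lv_eqI)
      show "lv t p (hscale (PS t p) a u) \<in> hcar (LS t)" by (rule c[OF uv])
      show "hscale (LS t) a (lv t p u) \<in> hcar (LS t)" using c u LSS by simp
      fix q w assume q: "q \<in> partitions t" and w: "w \<in> hcar (PS t q)"
      have ic: "inc t q (q \<union> p) w \<in> hcar (PS t (q \<union> p))" "inc t p (q \<union> p) u \<in> hcar (PS t (q \<union> p))"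
        using inc_car[OF q partitions_Un[OF q p] _ w] inc_car[OF p partitions_Un[OF q p] _ u] by auto
      show "hinner (LS t) (lv t q w) (lv t p (hscale (PS t p) a u)) = hinner (LS t) (lv t q w) (hscale (LS t) a (lv t p u))"
        using c u LSS lv_car[OF q w] uv bop_scale[OF inc_bop[OF p partitions_Un[OF q p]] u] ic PSS
        by (simp add: lv_inner q w p lim_kernel_def)
    qed
    then show ?thesis using u uv by (simp add: vr_def)
  qed
  show "hnorm (LS t) (vr t p u) \<le> 1 * hnorm (PS t p) u" if u: "u \<in> hcar (PS t p)" for u
    using u lkern_any[OF p p p _ _ u u] inc_inner[OF p p _ u u] by (simp add: vr_def hnorm_def lv_inner[OF p u p u])
qed (use lv_car[OF p] in \<open>auto simp: vr_def\<close>)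

lemma vr_apply: "u \<in> hcar (PS t p) \<Longrightarrow> vr t p u = lv t p u"
  by (simp add: vr_def)

lemma lv_inc:
  assumes p: "p \<in> partitions t" and q: "q \<in> partitions t" and pq: "p \<subseteq> q" and u: "u \<in> hcar (PS t p)"
  shows "lv t q (inc t p q u) = lv t p u"
proof (rule lv_eqI)
  note iu = inc_car[OF p q pq u]
  show "lv t q (inc t p q u) \<in> hcar (LS t)" by (rule lv_car[OF q iu])
  show "lv t p u \<in> hcar (LS t)" by (rule lv_car[OF p u])
  fix r w assume r: "r \<in> partitions t" and w: "w \<in> hcar (PS t r)"
  note rq = partitions_Un[OF r q]
  have s: "r \<subseteq> r \<union> q" "q \<subseteq> r \<union> q" "p \<subseteq> r \<union> q" using pq by auto
  show "hinner (LS t) (lv t r w) (lv t q (inc t p q u)) = hinner (LS t) (lv t r w) (lv t p u)"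
    unfolding lv_inner[OF r w q iu] lv_inner[OF r w p u] lkern_any[OF r q rq s(1,2) w iu] lkern_any[OF r p rq s(1,3) w u]
    using inc_trans[OF p q rq pq s(2) u] by simp
qed

text \<open>The images of the elementary tensors in the direct limit.\<close>

definition elt where "elt t p x = lv t p (pg t p x)"

lemma elt_car: "p \<in> partitions t \<Longrightarrow> x \<in> gens t p \<Longrightarrow> elt t p x \<in> hcar (LS t)"
  unfolding elt_def by (rule lv_car[OF _ pg_car])

lemma elt_refine: "p \<in> partitions t \<Longrightarrow> q \<in> partitions t \<Longrightarrow> p \<subseteq> q \<Longrightarrow> x \<in> gens t p \<Longrightarrow> elt t q x = elt t p x"
  unfolding elt_def using lv_inc[of p t q "pg t p x"] by (simp add: inc_gen pg_car)

lemma elt_inner: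
  assumes p: "p \<in> partitions t" and x: "x \<in> gens t p" "y \<in> gens t p"
  shows "hinner (LS t) (elt t p x) (elt t p y) = kern p x y"
  unfolding elt_def lv_inner[OF p pg_car[OF x(1)] p pg_car[OF x(2)]]
    lkern_any[OF p p p subset_refl subset_refl pg_car[OF x(1)] pg_car[OF x(2)]]
    inc_inner[OF p p subset_refl pg_car[OF x(1)] pg_car[OF x(2)]] by (rule pg_inner[OF x])

definition elts where "elts t = {elt t p x | p x. p \<in> partitions t \<and> x \<in> gens t p}"

lemma elt_total: "total (LS t) (elts t)"
  unfolding total_def
proof (intro conjI ballI impI)
  show "elts t \<subseteq> hcar (LS t)" using elt_car by (auto simp: elts_def)
  fix w assume w: "w \<in> hcar (LS t)" and o: "\<forall>d\<in>elts t. hinner (LS t) d w = 0"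
  have z: "hinner (LS t) (lv t p u) w = 0" if p: "p \<in> partitions t" and u: "u \<in> hcar (PS t p)" for p u
  proof -
    have "hinner (LS t) (vr t p u) w = 0"
    proof (rule total_image_orth[OF PS_hilbert LS_hilbert pg_total vr_bop[OF p] w _ u])
      fix d assume "d \<in> pg t p ` gens t p"
      then obtain x where x: "x \<in> gens t p" "d = pg t p x" by auto
      have "elt t p x \<in> elts t" using p x unfolding elts_def by blast
      then show "hinner (LS t) (vr t p d) w = 0"
        using o by (simp add: vr_apply x pg_car elt_def)
    qed
    then show ?thesis by (simp add: vr_apply[OF u])
  qed
  show "w = hzero (LS t)"
    by (rule lv_eqI[OF w]) (use z LSS lv_car in auto)
qed

lemma elts_pairE:
  assumes "d \<in> elts t" "d' \<in> elts t"
  obtains p f h g k where "p \<in> partitions t" "(f, h) \<in> gens t p" "(g, k) \<in> gens t p" "d = elt t p (f, h)" "d' = elt t p (g, k)"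
proof -
  obtain p x q y where e: "p \<in> partitions t" "x \<in> gens t p" "d = elt t p x" "q \<in> partitions t" "y \<in> gens t q" "d' = elt t q y"
    using assms by (auto simp: elts_def)
  note pq = partitions_Un[OF e(1,4)]
  obtain f h g k where fg: "x = (f, h)" "y = (g, k)" by fastforce
  show ?thesis
  proof (rule that[OF pq])
    show "(f, h) \<in> gens t (p \<union> q)" "(g, k) \<in> gens t (p \<union> q)"
      using gens_mono[of p "p \<union> q"] gens_mono[of q "p \<union> q"] e fg by auto
    show "d = elt t (p \<union> q) (f, h)" "d' = elt t (p \<union> q) (g, k)"
      using elt_refine[OF e(1) pq _ e(2)] elt_refine[OF e(4) pq _ e(5)] e fg by auto
  qed
qed

lemma elts_E:
  assumes "d \<in> elts t" obtains p f h where "p \<in> partitions t" "(f, h) \<in> gens t p" "d = elt t p (f, h)"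
  using assms by (auto simp: elts_def)

text \<open>Compatible, uniformly bounded operators on the spaces of the partitions extend to the limit.\<close>

context
  fixes t and G :: "'b hspace" and \<phi> B C
  assumes G: "hilbert_space G"
    and B: "\<And>p. p \<in> partitions t \<Longrightarrow> B p \<in> bop (PS t p) G"
    and bound: "\<And>p u. p \<in> partitions t \<Longrightarrow> u \<in> hcar (PS t p) \<Longrightarrow> hnorm G (B p u) \<le> C * hnorm (PS t p) u"
    and C: "0 \<le> C"
    and compat: "\<And>p q x. p \<in> partitions t \<Longrightarrow> q \<in> partitions t \<Longrightarrow> p \<subseteq> q \<Longrightarrow> x \<in> gens t p \<Longrightarrow> B q (pg t q x) = B p (pg t p x)"
    and \<phi>: "\<And>p u. p \<in> partitions t \<Longrightarrow> u \<in> hcar (PS t p) \<Longrightarrow> \<phi> (p, u) = B p u"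
begin

lemma compat_inc:
  assumes p: "p \<in> partitions t" and q: "q \<in> partitions t" and pq: "p \<subseteq> q" and u: "u \<in> hcar (PS t p)"
  shows "B q (inc t p q u) = B p u"
proof -
  have "ocomp (PS t p) (B q) (inc t p q) = B p"
  proof (rule bop_total_eqI[OF PS_hilbert G pg_total ocomp_bop[OF PSS PSS B[OF q] inc_bop[OF p q pq]] B[OF p]])
    fix d assume "d \<in> pg t p ` gens t p"
    then obtain x where x: "x \<in> gens t p" "d = pg t p x" by auto
    show "ocomp (PS t p) (B q) (inc t p q) d = B p d"
      using compat[OF p q pq x(1)] by (simp add: x pg_car inc_gen[OF p q pq])
  qed
  then have "ocomp (PS t p) (B q) (inc t p q) u = B p u" by simp
  then show ?thesis using u by simp
qed

text \<open>Finitely many generators lie over a common refinement \<open>r\<close>, where the inequality is the bound for \<open>B r\<close>.\<close>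

lemma lim_dom: "psd (lgens t) (\<lambda>x y. of_real (C\<^sup>2) * lkern t x y - hinner G (\<phi> x) (\<phi> y))"
proof (rule psdI)
  let ?k = "\<lambda>x y. of_real (C\<^sup>2) * lkern t x y - hinner G (\<phi> x) (\<phi> y)"
  fix n :: nat and x :: "nat \<Rightarrow> _" and c assume x: "\<And>i. i < n \<Longrightarrow> x i \<in> lgens t"
  show "Im (kform ?k n x c) = 0 \<and> 0 \<le> Re (kform ?k n x c)"
  proof (cases "n = 0")
    case True then show ?thesis by (simp add: kform_def)
  next
    case False
    then have n0: "0 < n" by simp
    obtain r where r: "r \<in> partitions t" "\<And>i. i < n \<Longrightarrow> fst (x i) \<subseteq> r"
      by (rule common_refinement[of n x t, OF x n0], assumption, rule that)
    have xp: "fst (x i) \<in> partitions t" "snd (x i) \<in> hcar (PS t (fst (x i)))" if "i < n" for i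
      using x[OF that] by (auto simp: lim_gens_def)
    let ?y = "\<lambda>i. inc t (fst (x i)) r (snd (x i))"
    let ?l = "\<lambda>u v. of_real (C\<^sup>2) * hinner (PS t r) u v - hinner G (B r u) (B r v)"
    have ph: "\<phi> (x i) = B r (?y i)" if "i < n" for i
      using \<phi>[OF xp[OF that]] compat_inc[OF xp(1)[OF that] r(1) r(2)[OF that] xp(2)[OF that]] by simp
    have "kform ?k n x c = kform ?l n ?y c"
      by (rule kform_cong) (use lkern_any[OF xp(1) xp(1) r(1) r(2) r(2) xp(2) xp(2)] ph in simp)
    moreover have "?y i \<in> hcar (PS t r)" if "i < n" for i
      by (rule inc_car[OF xp(1) r(1) r(2) xp(2)]) (rule that)+
    moreover have "psd (hcar (PS t r)) ?l"
      by (rule psd_bop_dominated[OF PS_hilbert G B[OF r(1)] C bound[OF r(1)]])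
    ultimately show ?thesis
      using psd_def[THEN iffD1, rule_format, of "hcar (PS t r)" ?l n ?y c] by simp
  qed
qed

lemma phi_car: "x \<in> lgens t \<Longrightarrow> \<phi> x \<in> hcar G"
  using \<phi> bop_car[OF B] by (auto simp: lim_gens_def)

lemma lim_ext_bop: "lim_ext H M P t G \<phi> \<in> bop (LS t) G"
  unfolding lim_ext_def lim_space_def by (rule kext_bop[OF lkern_psd G phi_car C lim_dom])

lemma lim_ext_lv: "p \<in> partitions t \<Longrightarrow> u \<in> hcar (PS t p) \<Longrightarrow> lim_ext H M P t G \<phi> (lv t p u) = B p u"
  unfolding lim_ext_def lim_v_def using kext_gen[OF lkern_psd G phi_car C lim_dom lgensI] \<phi> by simp

lemma lim_ext_elt: "p \<in> partitions t \<Longrightarrow> x \<in> gens t p \<Longrightarrow> lim_ext H M P t G \<phi> (elt t p x) = B p (pg t p x)"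
  unfolding elt_def by (rule lim_ext_lv[OF _ pg_car])

end

text \<open>The left actions of \<open>M\<close> and of its commutant on \<open>H\<^sub>t\<close>.\<close>

abbreviation la where "la t S \<equiv> lim_lact H M P t S"
abbreviation ca where "ca t R \<equiv> lim_comm_act H M P t R"

lemma vr_norm: "p \<in> partitions t \<Longrightarrow> u \<in> hcar (PS t p) \<Longrightarrow> hnorm (LS t) (vr t p u) = hnorm (PS t p) u"
  using lkern_any[of p t p p u u] inc_inner[of p t p u u] by (simp add: vr_apply hnorm_def lv_inner)

lemma
  assumes t: "0 < t" and S: "S \<in> M"
  shows la_bop: "la t S \<in> bop (LS t) (LS t)"
    and la_elt: "p \<in> partitions t \<Longrightarrow> (f, h) \<in> gens t p \<Longrightarrow> la t S (elt t p (f, h)) = elt t p (lmul S f, h)"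
proof -
  obtain r where r: "0 \<le> r" "\<And>x. x \<in> hcar H \<Longrightarrow> hnorm H (S x) \<le> r * hnorm H x"
    using bop_bound[OF HS M_bop[OF S]] by blast
  let ?B = "\<lambda>p. ocomp (PS t p) (vr t p) (part_lact H M P t p S)"
  let ?\<phi> = "\<lambda>(p, x). lv t p (part_lact H M P t p S x)"
  note L = part_lact_props[OF _ t S r]
  have B: "?B p \<in> bop (PS t p) (LS t)" if "p \<in> partitions t" for p
    by (rule ocomp_bop[OF PSS PSS vr_bop[OF that] L(1)[OF that]])
  have Bg: "?B p (pg t p (f, h)) = elt t p (lmul S f, h)" if "p \<in> partitions t" "(f, h) \<in> gens t p" for p f h
    using that by (simp add: pg_car L(2) vr_apply lmul_gens[OF that(2) S that(1) t] elt_def)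
  have bd: "hnorm (LS t) (?B p u) \<le> r * hnorm (PS t p) u" if "p \<in> partitions t" "u \<in> hcar (PS t p)" for p u
    using that by (simp add: vr_norm bop_car[OF L(1)] L(3))
  have cp: "?B q (pg t q x) = ?B p (pg t p x)" if pq: "p \<in> partitions t" "q \<in> partitions t" "p \<subseteq> q" "x \<in> gens t p" for p q x
  proof -
    obtain f h where x: "x = (f, h)" by fastforce
    have g: "(f, h) \<in> gens t q" "(f, h) \<in> gens t p" using gens_mono[OF pq(3,4)] pq(4) x by auto
    show ?thesis unfolding x Bg[OF pq(2) g(1)] Bg[OF pq(1) g(2)]
      by (rule elt_refine[OF pq(1,2,3) lmul_gens[OF g(2) S pq(1) t]])
  qed
  have ph: "?\<phi> (p, u) = ?B p u" if "p \<in> partitions t" "u \<in> hcar (PS t p)" for p u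
    using that by (simp add: vr_apply bop_car[OF L(1)])
  show "la t S \<in> bop (LS t) (LS t)"
    unfolding lim_lact_def by (rule lim_ext_bop[OF LS_hilbert B bd r(1) cp ph])
  show "la t S (elt t p (f, h)) = elt t p (lmul S f, h)" if "p \<in> partitions t" "(f, h) \<in> gens t p"
    unfolding lim_lact_def using lim_ext_elt[OF LS_hilbert B bd r(1) cp ph that] Bg[OF that] by simp
qed

lemma
  assumes R: "R \<in> commutant H M"
  shows ca_bop: "ca t R \<in> bop (LS t) (LS t)"
    and ca_elt: "p \<in> partitions t \<Longrightarrow> (f, h) \<in> gens t p \<Longrightarrow> ca t R (elt t p (f, h)) = elt t p (f, R h)"
proof -
  obtain r where r: "0 \<le> r" "\<And>x. x \<in> hcar H \<Longrightarrow> hnorm H (R x) \<le> r * hnorm H x"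
    using bop_bound[OF HS commutant_bop[OF R]] by blast
  let ?B = "\<lambda>p. ocomp (PS t p) (vr t p) (part_comm_act H M P t p R)"
  let ?\<phi> = "\<lambda>(p, x). lv t p (part_comm_act H M P t p R x)"
  note L = part_comm_act_props[OF R r]
  have B: "?B p \<in> bop (PS t p) (LS t)" if "p \<in> partitions t" for p
    by (rule ocomp_bop[OF PSS PSS vr_bop[OF that] L(1)])
  have g: "(f, R h) \<in> gens t p" if "(f, h) \<in> gens t p" for f h p
    using that bop_car[OF commutant_bop[OF R]] by (auto simp: part_gens_def)
  have Bg: "?B p (pg t p (f, h)) = elt t p (f, R h)" if "p \<in> partitions t" "(f, h) \<in> gens t p" for p f h
    using that g by (simp add: pg_car L(2) vr_apply elt_def)
  have bd: "hnorm (LS t) (?B p u) \<le> r * hnorm (PS t p) u" if "p \<in> partitions t" "u \<in> hcar (PS t p)" for p u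
    using that by (simp add: vr_norm bop_car[OF L(1)] L(3))
  have cp: "?B q (pg t q x) = ?B p (pg t p x)" if pq: "p \<in> partitions t" "q \<in> partitions t" "p \<subseteq> q" "x \<in> gens t p" for p q x
  proof -
    obtain f h where x: "x = (f, h)" by fastforce
    have h: "(f, h) \<in> gens t q" "(f, h) \<in> gens t p" using gens_mono[OF pq(3,4)] pq(4) x by auto
    show ?thesis unfolding x Bg[OF pq(2) h(1)] Bg[OF pq(1) h(2)]
      by (rule elt_refine[OF pq(1,2,3) g[OF h(2)]])
  qed
  have ph: "?\<phi> (p, u) = ?B p u" if "p \<in> partitions t" "u \<in> hcar (PS t p)" for p u
    using that by (simp add: vr_apply bop_car[OF L(1)])
  show "ca t R \<in> bop (LS t) (LS t)"
    unfolding lim_comm_act_def by (rule lim_ext_bop[OF LS_hilbert B bd r(1) cp ph])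
  show "ca t R (elt t p (f, h)) = elt t p (f, R h)" if "p \<in> partitions t" "(f, h) \<in> gens t p"
    unfolding lim_comm_act_def using lim_ext_elt[OF LS_hilbert B bd r(1) cp ph that] Bg[OF that] by simp
qed

lemma elt_inner_la:
  assumes t: "0 < t" and p: "p \<in> partitions t" and x: "(f, h) \<in> gens t p" "(g, k) \<in> gens t p" and S: "S \<in> M"
  shows "hinner (LS t) (elt t p (f, h)) (la t S (elt t p (g, k))) = hinner H h (chain f g S (lst p) k)"
proof -
  have f0: "f 0 \<in> M" by (rule gens_M[OF x(1)])
  have SS: "ocomp H (hadj H H (oid H)) S = S"
    unfolding hadj_oid[OF H] by (rule bop_eqI[OF M_bop[OF M_comp[OF M_oid S]] M_bop[OF S]]) (simp add: bop_car[OF M_bop[OF S]])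
  have "kern p (f, h) (lmul S g, k) = kern p (lmul (oid H) f, h) (lmul S g, k)"
    unfolding lmul_oid[of f, OF f0] ..
  also have "\<dots> = hinner H h (chain f g S (lst p) k)"
    using kern_lmul[OF p t x M_oid S] unfolding SS .
  finally show ?thesis
    unfolding la_elt[OF t S p x(2)] elt_inner[OF p x(1) lmul_gens[OF x(2) S p t]] .
qed

lemma la_adj:
  assumes t: "0 < t" and S: "S \<in> M" and u: "u \<in> hcar (LS t)" and v: "v \<in> hcar (LS t)"
  shows "hinner (LS t) (la t S u) v = hinner (LS t) u (la t (hadj H H S) v)"
proof -
  note Sa = M_adj[OF S]
  have "hinner (LS t) (la t S u) (oid (LS t) v) = hinner (LS t) u (la t (hadj H H S) v)"
  proof (rule total_sesq_eqI[OF LS_hilbert LS_hilbert LS_hilbert elt_total elt_total la_bop[OF t S] oid_bop[OF LSS] la_bop[OF t Sa] _ u v])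
    fix d d' assume "d \<in> elts t" "d' \<in> elts t"
    then obtain p f h g k where e: "p \<in> partitions t" "(f, h) \<in> gens t p" "(g, k) \<in> gens t p" "d = elt t p (f, h)" "d' = elt t p (g, k)"
      by (rule elts_pairE)
    note Sf = lmul_gens[OF e(2) S e(1) t]
    have g0: "g 0 \<in> M" by (rule gens_M[OF e(3)])
    have SS: "ocomp H (hadj H H S) (oid H) = hadj H H S"
      by (rule bop_eqI[OF M_bop[OF M_comp[OF Sa M_oid]] M_bop[OF Sa]]) simp
    have "hinner (LS t) (la t S d) (oid (LS t) d') = kern p (lmul S f, h) (lmul (oid H) g, k)"
      unfolding lmul_oid[of g, OF g0] using elt_car[OF e(1,3)] by (simp add: e(4,5) la_elt[OF t S e(1,2)] elt_inner[OF e(1) Sf e(3)])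
    also have "\<dots> = hinner H h (chain f g (hadj H H S) (lst p) k)"
      using kern_lmul[OF e(1) t e(2,3) S M_oid] unfolding SS .
    also have "\<dots> = hinner (LS t) d (la t (hadj H H S) d')"
      unfolding e(4,5) by (rule elt_inner_la[OF t e(1,2,3) Sa, symmetric])
    finally show "hinner (LS t) (la t S d) (oid (LS t) d') = hinner (LS t) d (la t (hadj H H S) d')" .
  qed
  then show ?thesis using v by simp
qed

lemma la_comp:
  assumes t: "0 < t" and S: "S \<in> M" and T: "T \<in> M" and u: "u \<in> hcar (LS t)"
  shows "la t S (la t T u) = la t (ocomp H S T) u"
proof -
  note ST = M_comp[OF S T]
  have "ocomp (LS t) (la t S) (la t T) = la t (ocomp H S T)"
  proof (rule bop_total_eqI[OF LS_hilbert LS_hilbert elt_total ocomp_bop[OF LSS LSS la_bop[OF t S] la_bop[OF t T]] la_bop[OF t ST]])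
    fix d assume "d \<in> elts t"
    then obtain p f h where e: "p \<in> partitions t" "(f, h) \<in> gens t p" "d = elt t p (f, h)" by (rule elts_E)
    have f0: "f 0 \<in> M" by (rule gens_M[OF e(2)])
    have a: "ocomp H S (ocomp H T (f 0)) = ocomp H (ocomp H S T) (f 0)"
      by (rule bop_eqI[OF M_bop[OF M_comp[OF S M_comp[OF T f0]]] M_bop[OF M_comp[OF ST f0]]])
        (simp add: bop_car[OF M_bop[OF f0]])
    show "ocomp (LS t) (la t S) (la t T) d = la t (ocomp H S T) d"
      using elt_car[OF e(1,2)] by (simp add: e(3) la_elt[OF t T e(1,2)] la_elt[OF t ST e(1,2)] la_elt[OF t S e(1) lmul_gens[OF e(2) T e(1) t]] a)
  qed
  then have "ocomp (LS t) (la t S) (la t T) u = la t (ocomp H S T) u" by simp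
  then show ?thesis using u by simp
qed

lemma la_ca:
  assumes t: "0 < t" and S: "S \<in> M" and R: "R \<in> commutant H M" and u: "u \<in> hcar (LS t)"
  shows "la t S (ca t R u) = ca t R (la t S u)"
proof -
  have "ocomp (LS t) (la t S) (ca t R) = ocomp (LS t) (ca t R) (la t S)"
  proof (rule bop_total_eqI[OF LS_hilbert LS_hilbert elt_total ocomp_bop[OF LSS LSS la_bop[OF t S] ca_bop[OF R]]
        ocomp_bop[OF LSS LSS ca_bop[OF R] la_bop[OF t S]]])
    fix d assume "d \<in> elts t"
    then obtain p f h where e: "p \<in> partitions t" "(f, h) \<in> gens t p" "d = elt t p (f, h)" by (rule elts_E)
    have g: "(f, R h) \<in> gens t p" using e(2) bop_car[OF commutant_bop[OF R]] by (auto simp: part_gens_def)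
    show "ocomp (LS t) (la t S) (ca t R) d = ocomp (LS t) (ca t R) (la t S) d"
      using elt_car[OF e(1,2)]
      by (simp add: e(3) la_elt[OF t S e(1,2)] la_elt[OF t S e(1) g] ca_elt[OF R e(1,2)]
          ca_elt[OF R e(1) lmul_gens[OF e(2) S e(1) t]])
  qed
  then have "ocomp (LS t) (la t S) (ca t R) u = ocomp (LS t) (ca t R) (la t S) u" by simp
  then show ?thesis using u by simp
qed

end

section \<open>Products in the fibres\<close>

context cp_data
begin

text \<open>The first components of the codes of elementary tensors.\<close>

definition tup where "tup t p = {f. (\<forall>r\<in>p - {t}. f r \<in> M) \<and> (\<forall>r. r \<notin> p - {t} \<longrightarrow> f r = oid H)}"

lemma gens_iff: "(f, h) \<in> gens t p \<longleftrightarrow> f \<in> tup t p \<and> h \<in> hcar H"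
  by (simp add: part_gens_def tup_def)

lemma tup_M: "f \<in> tup t p \<Longrightarrow> f r \<in> M"
  using M_oid by (auto simp: tup_def)

abbreviation cat :: "real \<Rightarrow> real set \<Rightarrow> real set \<Rightarrow> real set" where
  "cat s p2 p1 \<equiv> p2 \<union> (\<lambda>r. r + s) ` p1"

lemma cat_partition:
  assumes "p2 \<in> partitions s" "p1 \<in> partitions t" shows "cat s p2 p1 \<in> partitions (t + s)"
proof -
  have a: "finite p2" "finite p1" "0 \<in> p2" "t \<in> p1" and b: "\<And>r. r \<in> p2 \<Longrightarrow> 0 \<le> r \<and> r \<le> s" "\<And>r. r \<in> p1 \<Longrightarrow> 0 \<le> r \<and> r \<le> t"
    using assms by (auto simp: partitions_def)
  have st: "0 \<le> s" "0 \<le> t" using b(1)[OF a(3)] b(2)[OF a(4)] by auto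
  have "cat s p2 p1 \<subseteq> {0..t + s}"
  proof
    fix r assume "r \<in> cat s p2 p1"
    then show "r \<in> {0..t + s}" using b st by fastforce
  qed
  moreover have "finite (cat s p2 p1)" "0 \<in> cat s p2 p1" "t + s \<in> cat s p2 p1" using a by auto
  ultimately show ?thesis unfolding partitions_def by blast
qed

lemma cat_list:
  assumes p2: "p2 \<in> partitions s" and p1: "p1 \<in> partitions t"
  shows "lst (cat s p2 p1) = lst (p2 - {s}) @ map (\<lambda>r. r + s) (lst p1)"
    and "lst p2 = lst (p2 - {s}) @ [s]"
proof -
  have f: "finite p2" "finite p1" "p2 \<subseteq> {0..s}" "s \<in> p2" "p1 \<subseteq> {0..t}" "0 \<in> p1"
    using p1 p2 by (auto simp: partitions_def)
  have lt: "r < s" if "r \<in> p2 - {s}" for r using f that by force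
  show "lst (cat s p2 p1) = lst (p2 - {s}) @ map (\<lambda>r. r + s) (lst p1)"
  proof (rule sorted_distinct_set_unique)
    show "sorted (lst (p2 - {s}) @ map (\<lambda>r. r + s) (lst p1))"
      using f lt by (force simp: sorted_append sorted_map intro: less_imp_le order_trans[OF less_imp_le[OF lt]])
    show "distinct (lst (p2 - {s}) @ map (\<lambda>r. r + s) (lst p1))"
      using f lt by (force simp: distinct_map inj_on_def)
    show "set (lst (cat s p2 p1)) = set (lst (p2 - {s}) @ map (\<lambda>r. r + s) (lst p1))"
      using f by force
  qed simp_all
  show "lst p2 = lst (p2 - {s}) @ [s]"
  proof (rule sorted_distinct_set_unique)
    show "sorted (lst (p2 - {s}) @ [s])"
      using f lt by (force simp: sorted_append intro: less_imp_le)
  qed (use f in auto)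
qed

context
  fixes s t p2 p1
  assumes p2: "p2 \<in> partitions s" and p1: "p1 \<in> partitions t"
begin

lemma tuple_append_tup:
  assumes f: "f \<in> tup s p2" and g: "g \<in> tup t p1"
  shows "tuple_append s f g \<in> tup (t + s) (cat s p2 p1)"
proof -
  have "tuple_append s f g r \<in> M" for r using tup_M[OF f] tup_M[OF g] by (simp add: tuple_append_def)
  moreover have "tuple_append s f g r = oid H" if "r \<notin> cat s p2 p1 - {t + s}" for r
  proof (cases "r < s")
    case True
    then have "r \<notin> p2 - {s}" using that p1 by (auto simp: partitions_def)
    then show ?thesis using f True by (auto simp: tuple_append_def tup_def)
  next
    case False
    have "r - s \<notin> p1 - {t}" using that by (force intro: image_eqI[of _ _ "r - s"])
    then show ?thesis using g False by (auto simp: tuple_append_def tup_def)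
  qed
  ultimately show ?thesis by (auto simp: tup_def)
qed

text \<open>The evaluation over \<open>p\<^sub>2 \<union> (p\<^sub>1 + s)\<close> first runs through \<open>[0, s]\<close>. Its result there is the innermost
  operator of the evaluation over \<open>p\<^sub>1\<close>.\<close>

lemma chain_cat:
  assumes f: "f \<in> tup s p2" "f' \<in> tup s p2" and g: "g \<in> tup t p1" "g' \<in> tup t p1"
  shows "chain (tuple_append s f g) (tuple_append s f' g') (oid H) (lst (cat s p2 p1))
    = chain g g' (chain f f' (oid H) (lst p2)) (lst p1)"
proof -
  let ?F = "tuple_append s f g" and ?F' = "tuple_append s f' g'" and ?xs = "lst (p2 - {s})"
  have q: "finite p2" "finite p1" "p2 \<subseteq> {0..s}" "s \<in> p2" "p1 \<subseteq> {0..t}" "0 \<in> p1"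
    using p1 p2 by (auto simp: partitions_def)
  have ne: "p1 \<noteq> {}" using q by auto
  have "Min p1 = 0" using q by (intro Min_eqI) auto
  then obtain rs where l1: "lst p1 = 0 # rs" using sorted_list_of_set_nonempty[OF q(2) ne] by auto
  have m: "map (\<lambda>r. r + s) (lst p1) = s # map (\<lambda>r. r + s) rs" by (simp add: l1)
  have "chain ?F ?F' (oid H) (lst (cat s p2 p1)) = chain ?F ?F' (oid H) (?xs @ s # map (\<lambda>r. r + s) rs)"
    unfolding cat_list(1)[OF p2 p1] m ..
  also have "\<dots> = chain ?F ?F' (chain ?F ?F' (oid H) (lst p2)) (map (\<lambda>r. r + s) (lst p1))"
    unfolding chain_append[of _ _ _ ?xs] cat_list(2)[OF p2 p1, symmetric] m ..
  also have "chain ?F ?F' (oid H) (lst p2) = chain f f' (oid H) (lst p2)"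
  proof (rule chain_cong)
    fix r assume "r \<in> set (butlast (lst p2))"
    then have "r \<in> p2 - {s}" unfolding cat_list(2)[OF p2 p1] using q by simp
    then have "r < s" using q by force
    then show "?F r = f r \<and> ?F' r = f' r" by (simp add: tuple_append_def)
  qed
  also have "chain ?F ?F' B (map (\<lambda>r. r + s) (lst p1)) = chain g g' B (lst p1)" for B
  proof (rule chain_shift)
    fix r assume "r \<in> set (lst p1)"
    then have "0 \<le> r" using q by auto
    then show "?F (r + s) = g r \<and> ?F' (r + s) = g' r" by (simp add: tuple_append_def)
  qed
  finally show ?thesis .
qed

lemma kern_cat:
  assumes "f \<in> tup s p2" "f' \<in> tup s p2" "g \<in> tup t p1" "g' \<in> tup t p1"
  shows "kern (cat s p2 p1) (tuple_append s f g, h) (tuple_append s f' g', k)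
    = hinner H h (chain g g' (chain f f' (oid H) (lst p2)) (lst p1) k)"
  using chain_cat[OF assms] by (simp add: part_kernel_def)

end

context
  fixes s t :: real
  assumes s: "0 < s" and t: "0 < t"
begin

abbreviation tt where "tt p2 f \<equiv> tuple_tensor H M P t s p2 f"

text \<open>The operator \<open>y \<mapsto> f \<otimes> y\<close> is bounded: the square of the norm of \<open>f \<otimes> y\<close> is \<open>\<langle>y, A y\<rangle>\<close> with the element
  \<open>A\<close> of \<open>M\<close> that is the inner product of \<open>f\<close> with itself.\<close>

lemma
  assumes p2: "p2 \<in> partitions s" and f: "f \<in> tup s p2"
  shows tt_bop: "tt p2 f \<in> bop (LS t) (LS (t + s))"
    and tt_elt: "p1 \<in> partitions t \<Longrightarrow> (g, h) \<in> gens t p1 \<Longrightarrow>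
      tt p2 f (elt t p1 (g, h)) = elt (t + s) (cat s p2 p1) (tuple_append s f g, h)"
proof -
  define A where "A = chain f f (oid H) (lst p2)"
  have A: "A \<in> M" unfolding A_def by (rule chain_M[OF tup_M[OF f] tup_M[OF f] M_oid]) simp
  obtain c where c: "0 \<le> c" "\<And>x. x \<in> hcar H \<Longrightarrow> hnorm H (A x) \<le> c * hnorm H x"
    using bop_bound[OF HS M_bop[OF A]] by blast
  define r where "r = sqrt c"
  have r: "0 \<le> r" "r\<^sup>2 = c" using c(1) by (auto simp: r_def)
  have Ab: "Im (hinner H x (A x)) = 0 \<and> Re (hinner H x (A x)) \<le> r\<^sup>2 * (hnorm H x)\<^sup>2" if x: "x \<in> hcar H" for x
  proof
    have "(f, x) \<in> gens s p2" using f x by (simp add: gens_iff)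
    from psd_diag(1)[OF kern_psd this] show "Im (hinner H x (A x)) = 0" by (simp add: part_kernel_def A_def)
    have "Re (hinner H x (A x)) \<le> hnorm H x * hnorm H (A x)"
      using hinner_Cauchy_Schwarz[OF HS x bop_car[OF M_bop[OF A] x]] complex_Re_le_cmod[of "hinner H x (A x)"] by linarith
    also have "\<dots> \<le> hnorm H x * (c * hnorm H x)" by (intro mult_left_mono c x hnorm_ge0[OF HS])
    finally show "Re (hinner H x (A x)) \<le> r\<^sup>2 * (hnorm H x)\<^sup>2" unfolding r(2) by (simp add: power2_eq_square mult_ac)
  qed
  let ?c = "\<lambda>p1. cat s p2 p1"
  let ?f = "\<lambda>p1. \<lambda>(g, h). pg (t + s) (?c p1) (tuple_append s f g, h)"
  let ?E = "\<lambda>p1. part_ext H M P t p1 (PS (t + s) (?c p1)) (?f p1)"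
  let ?B = "\<lambda>p1. ocomp (PS t p1) (vr (t + s) (?c p1)) (?E p1)"
  let ?\<phi> = "\<lambda>(p1, y). let p = p2 \<union> (\<lambda>r. r + s) ` p1 in lim_v H M P (t + s) p
          (part_ext H M P t p1 (part_space H M P (t + s) p)
             (\<lambda>(g, h). part_gen H M P (t + s) p (tuple_append s f g, h)) y)"
  have g: "(tuple_append s f g, h) \<in> gens (t + s) (?c p1)" if "p1 \<in> partitions t" "(g, h) \<in> gens t p1" for p1 g h
    using that tuple_append_tup[OF p2 that(1) f] by (simp add: gens_iff)
  have fc: "?f p1 x \<in> hcar (PS (t + s) (?c p1))" if "p1 \<in> partitions t" "x \<in> gens t p1" for p1 x
    using that g pg_car by (cases x) auto
  have d: "psd (gens t p1) (\<lambda>x y. of_real (r\<^sup>2) * kern p1 x y - hinner (PS (t + s) (?c p1)) (?f p1 x) (?f p1 y))"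
    if p1: "p1 \<in> partitions t" for p1
  proof -
    have "hinner (PS (t + s) (?c p1)) (?f p1 x) (?f p1 y) = hinner H (snd x) (chain (fst x) (fst y) A (lst p1) (snd y))"
      if xy: "x \<in> gens t p1" "y \<in> gens t p1" for x y
    proof -
      obtain a h b k where e: "x = (a, h)" "y = (b, k)" by fastforce
      have ab: "a \<in> tup t p1" "b \<in> tup t p1" using xy unfolding e gens_iff by auto
      show ?thesis
        unfolding e case_prod_conv pg_inner[OF g[OF p1 xy(1)[unfolded e]] g[OF p1 xy(2)[unfolded e]]]
          kern_cat[OF p2 p1 f f ab] A_def by simp
    qed
    then show ?thesis using chain_dominated[OF A r(1) Ab] by (subst psd_cong) auto
  qed
  have X1: "?E p1 \<in> bop (PS t p1) (PS (t + s) (?c p1))" if "p1 \<in> partitions t" for p1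
    by (rule part_ext_bop[OF PS_hilbert fc[OF that] r(1) d[OF that]])
  have X2: "?E p1 (pg t p1 x) = ?f p1 x" if "p1 \<in> partitions t" "x \<in> gens t p1" for p1 x
    by (rule part_ext_gen[OF PS_hilbert fc[OF that(1)] r(1) d[OF that(1)] that(2)])
  have X3: "hnorm (PS (t + s) (?c p1)) (?E p1 u) \<le> r * hnorm (PS t p1) u"
    if "p1 \<in> partitions t" "u \<in> hcar (PS t p1)" for p1 u
    by (rule part_ext_bound[OF PS_hilbert fc[OF that(1)] r(1) d[OF that(1)] that(2)])
  note cp = cat_partition[OF p2]
  have B: "?B p1 \<in> bop (PS t p1) (LS (t + s))" if "p1 \<in> partitions t" for p1
    by (rule ocomp_bop[OF PSS PSS vr_bop[OF cp[OF that]] X1[OF that]])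
  have Bg: "?B p1 (pg t p1 (g, h)) = elt (t + s) (?c p1) (tuple_append s f g, h)"
    if "p1 \<in> partitions t" "(g, h) \<in> gens t p1" for p1 g h
    using that X2[OF that] g[OF that] by (simp add: pg_car vr_apply elt_def)
  have Ec: "?E p1 u \<in> hcar (PS (t + s) (?c p1))" if "p1 \<in> partitions t" "u \<in> hcar (PS t p1)" for p1 u
    by (rule bop_car[OF X1[OF that(1)] that(2)])
  have bd: "hnorm (LS (t + s)) (?B p1 u) \<le> r * hnorm (PS t p1) u" if "p1 \<in> partitions t" "u \<in> hcar (PS t p1)" for p1 u
    using that X3[OF that] by (simp add: vr_norm[OF cp[OF that(1)] Ec[OF that]])
  have co: "?B q (pg t q x) = ?B p (pg t p x)" if pq: "p \<in> partitions t" "q \<in> partitions t" "p \<subseteq> q" "x \<in> gens t p" for p q x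
  proof -
    obtain a h where x: "x = (a, h)" by fastforce
    have h: "(a, h) \<in> gens t q" "(a, h) \<in> gens t p" using gens_mono[OF pq(3,4)] pq(4) x by auto
    have "?c p \<subseteq> ?c q" using pq(3) by auto
    then show ?thesis unfolding x Bg[OF pq(2) h(1)] Bg[OF pq(1) h(2)]
      by (rule elt_refine[OF cp[OF pq(1)] cp[OF pq(2)] _ g[OF pq(1) h(2)]])
  qed
  have ph: "?\<phi> (p1, u) = ?B p1 u" if "p1 \<in> partitions t" "u \<in> hcar (PS t p1)" for p1 u
    using that Ec[OF that] by (simp add: vr_apply Let_def)
  show "tt p2 f \<in> bop (LS t) (LS (t + s))"
    unfolding tuple_tensor_def by (rule lim_ext_bop[OF LS_hilbert B bd r(1) co ph])
  show "tt p2 f (elt t p1 (g, h)) = elt (t + s) (cat s p2 p1) (tuple_append s f g, h)"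
    if "p1 \<in> partitions t" "(g, h) \<in> gens t p1"
    unfolding tuple_tensor_def using lim_ext_elt[OF LS_hilbert B bd r(1) co ph that] Bg[OF that] by simp
qed

text \<open>This is the inner product of an interior tensor product over \<open>M\<close>: the left factors contribute
  their \<open>M\<close>-valued inner product, which acts on the right factor.\<close>

lemma tt_inner:
  assumes p2: "p2 \<in> partitions s" and f: "f \<in> tup s p2" "f' \<in> tup s p2"
    and y: "y \<in> hcar (LS t)" "y' \<in> hcar (LS t)"
  shows "hinner (LS (t + s)) (tt p2 f y) (tt p2 f' y')
    = hinner (LS t) y (la t (chain f f' (oid H) (lst p2)) y')"
proof (rule total_sesq_eqI[OF LS_hilbert LS_hilbert LS_hilbert elt_total elt_total tt_bop[OF p2 f(1)] tt_bop[OF p2 f(2)] _ _ y])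
  have A: "chain f f' (oid H) (lst p2) \<in> M" by (rule chain_M[OF tup_M[OF f(1)] tup_M[OF f(2)] M_oid]) simp
  show "la t (chain f f' (oid H) (lst p2)) \<in> bop (LS t) (LS t)" by (rule la_bop[OF t A])
  fix d d' assume "d \<in> elts t" "d' \<in> elts t"
  then obtain p g h g' k where e: "p \<in> partitions t" "(g, h) \<in> gens t p" "(g', k) \<in> gens t p" "d = elt t p (g, h)" "d' = elt t p (g', k)"
    by (rule elts_pairE)
  have gg: "g \<in> tup t p" "g' \<in> tup t p" "h \<in> hcar H" "k \<in> hcar H" using e(2,3) by (auto simp: gens_iff)
  have G: "(tuple_append s f g, h) \<in> gens (t + s) (cat s p2 p)" "(tuple_append s f' g', k) \<in> gens (t + s) (cat s p2 p)"
    using gg tuple_append_tup[OF p2 e(1)] f by (auto simp: gens_iff)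
  show "hinner (LS (t + s)) (tt p2 f d) (tt p2 f' d') = hinner (LS t) d (la t (chain f f' (oid H) (lst p2)) d')"
    unfolding e(4,5) tt_elt[OF p2 f(1) e(1,2)] tt_elt[OF p2 f(2) e(1,3)] elt_inner[OF cat_partition[OF p2 e(1)] G]
      kern_cat[OF p2 e(1) f gg(1,2)] elt_inner_la[OF t e(1,2,3) A] ..
qed

lemma tt_refine:
  assumes p: "p \<in> partitions s" and q: "q \<in> partitions s" and pq: "p \<subseteq> q" and f: "f \<in> tup s p" and y: "y \<in> hcar (LS t)"
  shows "tt q f y = tt p f y"
proof -
  have fq: "f \<in> tup s q" using gens_mono[OF pq, of "(f, hzero H)" s] f HS by (simp add: gens_iff)
  have "tt q f = tt p f"
  proof (rule bop_total_eqI[OF LS_hilbert LS_hilbert elt_total tt_bop[OF q fq] tt_bop[OF p f]])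
    fix d assume "d \<in> elts t"
    then obtain p1 g h where e: "p1 \<in> partitions t" "(g, h) \<in> gens t p1" "d = elt t p1 (g, h)" by (rule elts_E)
    have c: "cat s p p1 \<subseteq> cat s q p1" using pq by auto
    have G: "(tuple_append s f g, h) \<in> gens (t + s) (cat s p p1)"
      using e(2) tuple_append_tup[OF p e(1) f] by (auto simp: gens_iff)
    show "tt q f d = tt p f d"
      unfolding e(3) tt_elt[OF q fq e(1,2)] tt_elt[OF p f e(1,2)]
      by (rule elt_refine[OF cat_partition[OF p e(1)] cat_partition[OF q e(1)] c G])
  qed
  then show ?thesis by simp
qed

lemma tt_la:
  assumes p2: "p2 \<in> partitions s" and f: "f \<in> tup s p2" and S: "S \<in> M" and y: "y \<in> hcar (LS t)"
  shows "la (t + s) S (tt p2 f y) = tt p2 (lmul S f) y"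
proof -
  have ts: "0 < t + s" using s t by simp
  have Sf: "lmul S f \<in> tup s p2"
    using lmul_gens[of f "hzero H" s p2 S] f S p2 s HS by (simp add: gens_iff)
  have "ocomp (LS t) (la (t + s) S) (tt p2 f) = tt p2 (lmul S f)"
  proof (rule bop_total_eqI[OF LS_hilbert LS_hilbert elt_total ocomp_bop[OF LSS LSS la_bop[OF ts S] tt_bop[OF p2 f]] tt_bop[OF p2 Sf]])
    fix d assume "d \<in> elts t"
    then obtain p1 g h where e: "p1 \<in> partitions t" "(g, h) \<in> gens t p1" "d = elt t p1 (g, h)" by (rule elts_E)
    have G: "(tuple_append s f g, h) \<in> gens (t + s) (cat s p2 p1)"
      using e(2) tuple_append_tup[OF p2 e(1) f] by (auto simp: gens_iff)
    have a: "tuple_append s (lmul S f) g = lmul S (tuple_append s f g)"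
      using s by (auto simp: tuple_append_def)
    show "ocomp (LS t) (la (t + s) S) (tt p2 f) d = tt p2 (lmul S f) d"
      using elt_car[OF e(1,2)]
      by (simp add: e(3) tt_elt[OF p2 f e(1,2)] tt_elt[OF p2 Sf e(1,2)] la_elt[OF ts S cat_partition[OF p2 e(1)] G] a)
  qed
  then have "ocomp (LS t) (la (t + s) S) (tt p2 f) y = tt p2 (lmul S f) y" by simp
  then show ?thesis using y by simp
qed

end

text \<open>The space of intertwiners from \<open>H\<close> to \<open>H\<^sub>t\<close>, which is the fibre over a positive time \<open>t\<close>.\<close>

definition inter where "inter t = {X \<in> bop H (LS t). \<forall>S\<in>M. ocomp H X S = ocomp H (la t S) X}"

lemma inter_bop: "X \<in> inter t \<Longrightarrow> X \<in> bop H (LS t)" by (simp add: inter_def)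

lemma inter_la:
  assumes "X \<in> inter t" "S \<in> M" "h \<in> hcar H" shows "X (S h) = la t S (X h)"
proof -
  have "ocomp H X S = ocomp H (la t S) X" using assms by (simp add: inter_def)
  then have "ocomp H X S h = ocomp H (la t S) X h" by simp
  then show ?thesis using assms(3) by simp
qed

lemma interI:
  assumes "X \<in> bop H (LS t)" "\<And>S h. S \<in> M \<Longrightarrow> h \<in> hcar H \<Longrightarrow> X (S h) = la t S (X h)"
  shows "X \<in> inter t"
  using assms by (auto simp: inter_def ocomp_def compose_def restrict_def fun_eq_iff)

lemma inter_einner:
  assumes t: "0 < t" and X: "X \<in> inter t" and Y: "Y \<in> inter t"
  shows "ocomp H (hadj H (LS t) X) Y \<in> commutant H M"
proof (rule commutantI)
  note Xb = inter_bop[OF X] and Yb = inter_bop[OF Y]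
  show "ocomp H (hadj H (LS t) X) Y \<in> bop H H" by (rule ocomp_bop[OF HS LSS hadj_bop[OF H LS_hilbert Xb] Yb])
  fix S h assume S: "S \<in> M" and h: "h \<in> hcar H"
  note Sh = bop_car[OF M_bop[OF S] h] and Yh = bop_car[OF Yb h]
  have "hadj H (LS t) X (Y (S h)) = S (hadj H (LS t) X (Y h))"
  proof (rule hilbert_eqI[OF H hadj_car[OF H LS_hilbert Xb bop_car[OF Yb Sh]] bop_car[OF M_bop[OF S] hadj_car[OF H LS_hilbert Xb Yh]]])
    fix d assume d: "d \<in> hcar H"
    note Sd = hadj_car[OF H H M_bop[OF S] d]
    have "hinner H d (hadj H (LS t) X (Y (S h))) = hinner (LS t) (X d) (Y (S h))"
      by (rule hadj_right[OF H LS_hilbert Xb d bop_car[OF Yb Sh]])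
    also have "\<dots> = hinner (LS t) (X d) (la t (hadj H H (hadj H H S)) (Y h))"
      unfolding hadj_hadj[OF H H M_bop[OF S]] inter_la[OF Y S h] ..
    also have "\<dots> = hinner (LS t) (la t (hadj H H S) (X d)) (Y h)"
      by (rule la_adj[OF t M_adj[OF S] bop_car[OF Xb d] Yh, symmetric])
    also have "\<dots> = hinner (LS t) (X (hadj H H S d)) (Y h)" unfolding inter_la[OF X M_adj[OF S] d] ..
    also have "\<dots> = hinner H (hadj H H S d) (hadj H (LS t) X (Y h))"
      by (rule hadj_right[OF H LS_hilbert Xb Sd Yh, symmetric])
    also have "\<dots> = hinner H d (S (hadj H (LS t) X (Y h)))"
      by (rule hadj_left[OF H H M_bop[OF S] hadj_car[OF H LS_hilbert Xb Yh] d])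
    finally show "hinner H d (hadj H (LS t) X (Y (S h))) = hinner H d (S (hadj H (LS t) X (Y h)))" .
  qed
  then show "ocomp H (hadj H (LS t) X) Y (S h) = S (ocomp H (hadj H (LS t) X) Y h)"
    using h Sh by simp
qed

lemma inter_ca:
  assumes t: "0 < t" and X: "X \<in> inter t" and R: "R \<in> commutant H M"
  shows "ocomp H (ca t R) X \<in> inter t"
proof (rule interI[OF ocomp_bop[OF HS LSS ca_bop[OF R] inter_bop[OF X]]])
  fix S h assume S: "S \<in> M" and h: "h \<in> hcar H"
  show "ocomp H (ca t R) X (S h) = la t S (ocomp H (ca t R) X h)"
    using bop_car[OF M_bop[OF S] h] h by (simp add: inter_la[OF X S h] la_ca[OF t S R bop_car[OF inter_bop[OF X] h]])
qed

lemma inter_ract: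
  assumes X: "X \<in> inter t" and R: "R \<in> commutant H M"
  shows "ocomp H X R \<in> inter t"
proof (rule interI[OF ocomp_bop[OF HS HS inter_bop[OF X] commutant_bop[OF R]]])
  fix S h assume S: "S \<in> M" and h: "h \<in> hcar H"
  show "ocomp H X R (S h) = la t S (ocomp H X R h)"
    using bop_car[OF M_bop[OF S] h] h
    by (simp add: commutant_M[OF R S h] inter_la[OF X S bop_car[OF commutant_bop[OF R] h]])
qed

text \<open>The product of the product system. Since
  \<open>\<langle>f \<otimes> X h, g \<otimes> X k\<rangle> = \<langle>X h, C X k\<rangle> = \<langle>h, C X\<^sup>* X k\<rangle>\<close>, where \<open>C\<close> is the \<open>M\<close>-valued inner product of \<open>f\<close> and \<open>g\<close>,
  the operator \<open>I \<otimes> X\<close> on \<open>H\<^sub>s\<close> is bounded. It intertwines the left actions because it leaves the first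
  factor alone.\<close>

lemma inter_mult:
  assumes t: "0 < t" and s: "0 < s" and X: "X \<in> inter t" and Y: "Y \<in> inter s"
  shows "ocomp H (shift_tensor H M P t s X) Y \<in> inter (t + s)"
proof -
  note Xb = inter_bop[OF X] and Yb = inter_bop[OF Y]
  obtain r where r: "0 \<le> r" "\<And>x. x \<in> hcar H \<Longrightarrow> hnorm (LS t) (X x) \<le> r * hnorm H x"
    using bop_bound[OF HS Xb] by blast
  have ts: "0 < t + s" using s t by simp
  let ?tt = "\<lambda>p2 f. tuple_tensor H M P t s p2 f"
  let ?f = "\<lambda>p2. \<lambda>(f, h). ?tt p2 f (X h)"
  let ?B = "\<lambda>p2. part_ext H M P s p2 (LS (t + s)) (?f p2)"
  let ?\<phi> = "\<lambda>(p2, x). part_ext H M P s p2 (lim_space H M P (t + s)) (\<lambda>(f, h). tuple_tensor H M P t s p2 f (X h)) x"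
  have XX: "ocomp H (hadj H (LS t) X) X \<in> commutant H M" by (rule inter_einner[OF t X X])
  have fc: "?f p2 x \<in> hcar (LS (t + s))" if "p2 \<in> partitions s" "x \<in> gens s p2" for p2 x
    using that bop_car[OF tt_bop[OF s t]] bop_car[OF Xb] by (cases x) (auto simp: gens_iff)
  have d: "psd (gens s p2) (\<lambda>x y. of_real (r\<^sup>2) * kern p2 x y - hinner (LS (t + s)) (?f p2 x) (?f p2 y))"
    if p2: "p2 \<in> partitions s" for p2
  proof -
    have "psd (gens s p2) (\<lambda>x y. of_real (r\<^sup>2) * kern p2 x y
      - hinner H (snd x) (chain (fst x) (fst y) (oid H) (lst p2) (hadj H (LS t) X (X (snd y)))))"
    proof (rule commutant_dom[OF LS_hilbert Xb _ r])
      fix A h assume A: "A \<in> M" and h: "h \<in> hcar H"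
      show "A (hadj H (LS t) X (X h)) = hadj H (LS t) X (X (A h))"
        using commutantD[OF XX A h] h bop_car[OF M_bop[OF A] h] by simp
    qed
    moreover have "hinner (LS (t + s)) (?f p2 x) (?f p2 y)
      = hinner H (snd x) (chain (fst x) (fst y) (oid H) (lst p2) (hadj H (LS t) X (X (snd y))))"
      if xy: "x \<in> gens s p2" "y \<in> gens s p2" for x y
    proof -
      obtain f h g k where e: "x = (f, h)" "y = (g, k)" by fastforce
      have fg: "f \<in> tup s p2" "g \<in> tup s p2" "h \<in> hcar H" "k \<in> hcar H" using xy e by (auto simp: gens_iff)
      let ?A = "chain f g (oid H) (lst p2)"
      have A: "?A \<in> M" by (rule chain_M[OF tup_M[OF fg(1)] tup_M[OF fg(2)] M_oid]) simp
      have Ak: "?A k \<in> hcar H" by (rule bop_car[OF M_bop[OF A] fg(4)])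
      have "hinner (LS (t + s)) (?tt p2 f (X h)) (?tt p2 g (X k)) = hinner (LS t) (X h) (la t ?A (X k))"
        by (rule tt_inner[OF s t p2 fg(1,2) bop_car[OF Xb fg(3)] bop_car[OF Xb fg(4)]])
      also have "\<dots> = hinner (LS t) (X h) (X (?A k))" unfolding inter_la[OF X A fg(4)] ..
      also have "\<dots> = hinner H h (hadj H (LS t) X (X (?A k)))"
        by (rule hadj_right[OF H LS_hilbert Xb fg(3) bop_car[OF Xb Ak], symmetric])
      also have "hadj H (LS t) X (X (?A k)) = ?A (hadj H (LS t) X (X k))"
        using commutantD[OF XX A fg(4)] fg(4) Ak by simp
      finally show ?thesis unfolding e by simp
    qed
    ultimately show ?thesis by (subst psd_cong) auto
  qed
  have B: "?B p2 \<in> bop (PS s p2) (LS (t + s))" if "p2 \<in> partitions s" for p2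
    by (rule part_ext_bop[OF LS_hilbert fc[OF that] r(1) d[OF that]])
  have bd: "hnorm (LS (t + s)) (?B p2 u) \<le> r * hnorm (PS s p2) u" if "p2 \<in> partitions s" "u \<in> hcar (PS s p2)" for p2 u
    by (rule part_ext_bound[OF LS_hilbert fc[OF that(1)] r(1) d[OF that(1)] that(2)])
  have Bg: "?B p2 (pg s p2 (f, h)) = ?tt p2 f (X h)" if "p2 \<in> partitions s" "(f, h) \<in> gens s p2" for p2 f h
    using part_ext_gen[OF LS_hilbert fc[OF that(1)] r(1) d[OF that(1)] that(2)] by simp
  have co: "?B q (pg s q x) = ?B p (pg s p x)" if pq: "p \<in> partitions s" "q \<in> partitions s" "p \<subseteq> q" "x \<in> gens s p" for p q x
  proof -
    obtain a h where x: "x = (a, h)" by fastforce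
    have h: "(a, h) \<in> gens s q" "(a, h) \<in> gens s p" using gens_mono[OF pq(3,4)] pq(4) x by auto
    show ?thesis unfolding x Bg[OF pq(2) h(1)] Bg[OF pq(1) h(2)]
      by (rule tt_refine[OF s t pq(1,2,3)]) (use h(2) bop_car[OF Xb] in \<open>auto simp: gens_iff\<close>)
  qed
  have ph: "?\<phi> (p2, u) = ?B p2 u" if "p2 \<in> partitions s" "u \<in> hcar (PS s p2)" for p2 u by simp
  let ?st = "shift_tensor H M P t s X"
  have st: "?st \<in> bop (LS s) (LS (t + s))"
    unfolding shift_tensor_def by (rule lim_ext_bop[OF LS_hilbert B bd r(1) co ph])
  have ste: "?st (elt s p2 (f, h)) = ?tt p2 f (X h)" if "p2 \<in> partitions s" "(f, h) \<in> gens s p2" for p2 f h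
    unfolding shift_tensor_def using lim_ext_elt[OF LS_hilbert B bd r(1) co ph that] Bg[OF that] by simp
  have stl: "la (t + s) S (?st u) = ?st (la s S u)" if S: "S \<in> M" and u: "u \<in> hcar (LS s)" for S u
  proof -
    have "ocomp (LS s) (la (t + s) S) ?st = ocomp (LS s) ?st (la s S)"
    proof (rule bop_total_eqI[OF LS_hilbert LS_hilbert elt_total ocomp_bop[OF LSS LSS la_bop[OF ts S] st]
          ocomp_bop[OF LSS LSS st la_bop[OF s S]]])
      fix d assume "d \<in> elts s"
      then obtain p f h where e: "p \<in> partitions s" "(f, h) \<in> gens s p" "d = elt s p (f, h)" by (rule elts_E)
      have fh: "f \<in> tup s p" "h \<in> hcar H" using e(2) by (auto simp: gens_iff)
      show "ocomp (LS s) (la (t + s) S) ?st d = ocomp (LS s) ?st (la s S) d"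
        using elt_car[OF e(1,2)]
        by (simp add: e(3) ste[OF e(1,2)] la_elt[OF s S e(1,2)] ste[OF e(1) lmul_gens[OF e(2) S e(1) s]]
            tt_la[OF s t e(1) fh(1) S bop_car[OF Xb fh(2)]])
    qed
    then have "ocomp (LS s) (la (t + s) S) ?st u = ocomp (LS s) ?st (la s S) u" by simp
    then show ?thesis using u by simp
  qed
  show ?thesis
  proof (rule interI[OF ocomp_bop[OF HS LSS st Yb]])
    fix S h assume S: "S \<in> M" and h: "h \<in> hcar H"
    show "ocomp H ?st Y (S h) = la (t + s) S (ocomp H ?st Y h)"
      using h bop_car[OF M_bop[OF S] h] by (simp add: inter_la[OF Y S h] stl[OF S bop_car[OF Yb h]])
  qed
qed

subsection \<open>The unit vectors\<close>

text \<open>The vector \<open>\<iota>\<^sub>t h\<close>.\<close>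

definition unt where "unt t h = elt t {0, t} (\<lambda>r. oid H, h)"

context
  fixes t :: real assumes t: "0 < t"
begin

lemma unt_partition: "{0, t} \<in> partitions t" using t by (auto simp: partitions_def)

lemma unt_gens: "h \<in> hcar H \<Longrightarrow> ((\<lambda>r. oid H), h) \<in> gens t p"
  using M_oid by (simp add: part_gens_def)

lemma unt_car: "h \<in> hcar H \<Longrightarrow> unt t h \<in> hcar (LS t)"
  unfolding unt_def by (rule elt_car[OF unt_partition unt_gens])

lemma unt_refine: "p \<in> partitions t \<Longrightarrow> h \<in> hcar H \<Longrightarrow> unt t h = elt t p (\<lambda>r. oid H, h)"
  unfolding unt_def by (rule elt_refine[OF unt_partition _ _ unt_gens, symmetric]) (auto simp: partitions_def)

text \<open>Over the coarsest partition the chain with innermost operator \<open>S\<close> is \<open>P\<^sub>t(S)\<close>. So \<open>P\<^sub>t\<close> is the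
  compression of the left action to the range of \<open>\<iota>\<^sub>t\<close>.\<close>

lemma unt_la:
  assumes S: "S \<in> M" and h: "h \<in> hcar H" and k: "k \<in> hcar H"
  shows "hinner (LS t) (unt t h) (la t S (unt t k)) = hinner H h (P t S k)"
proof -
  have l: "lst {0, t} = [0, t]" using t sorted_list_of_set_insert[of "{t}" 0] by simp
  show ?thesis
    unfolding unt_def elt_inner_la[OF t unt_partition unt_gens[OF h] unt_gens[OF k] S] l
    by (simp add: sandwich_oid[OF S])
qed

lemma unt_inner:
  assumes h: "h \<in> hcar H" and k: "k \<in> hcar H"
  shows "hinner (LS t) (unt t h) (unt t k) = hinner H h k"
proof -
  have l: "lst {0, t} = [0, t]" using t sorted_list_of_set_insert[of "{t}" 0] by simp
  show ?thesis
    unfolding unt_def elt_inner[OF unt_partition unt_gens[OF h] unt_gens[OF k]] part_kernel_def case_prod_conv l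
    using t k by (simp add: sandwich_oid[OF M_oid] P_oid)
qed

lemma lim_iota_apply: "h \<in> hcar H \<Longrightarrow> lim_iota H M P t h = unt t h"
  by (simp add: lim_iota_def unt_def elt_def)

lemma lim_iota_bop: "lim_iota H M P t \<in> bop H (LS t)"
proof (rule bopI[where C=1])
  show "lim_iota H M P t \<in> extensional (hcar H)" by (simp add: lim_iota_def)
  have key: "hinner (LS t) d (unt t h) = hinner H h' (A h)" if "p \<in> partitions t" "(f, h') \<in> gens t p" "d = elt t p (f, h')"
      "A = chain f (\<lambda>r. oid H) (oid H) (lst p)" "h \<in> hcar H" for d p f h' A h
    unfolding that(3,4) unt_refine[OF that(1,5)] elt_inner[OF that(1,2) unt_gens[OF that(5)]] by (simp add: part_kernel_def)
  have cb: "chain f (\<lambda>r. oid H) (oid H) (lst p) \<in> bop H H" if "(f, h') \<in> gens t p" for f h' p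
    by (rule M_bop[OF chain_M[OF gens_M[OF that] M_oid M_oid]]) simp
  show "lim_iota H M P t (hadd H x y) = hadd (LS t) (lim_iota H M P t x) (lim_iota H M P t y)"
    if x: "x \<in> hcar H" and y: "y \<in> hcar H" for x y
  proof -
    have xy: "hadd H x y \<in> hcar H" using x y HS by simp
    have "unt t (hadd H x y) = hadd (LS t) (unt t x) (unt t y)"
    proof (rule total_eqI[OF LS_hilbert elt_total unt_car[OF xy]])
      show "hadd (LS t) (unt t x) (unt t y) \<in> hcar (LS t)" using LSS unt_car x y by simp
      fix d assume "d \<in> elts t"
      then obtain p f h where e: "p \<in> partitions t" "(f, h) \<in> gens t p" "d = elt t p (f, h)" by (rule elts_E)
      note c = elt_car[OF e(1,2)] and hc = gens_car[OF e(2)] and b = cb[OF e(2)]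
      show "hinner (LS t) d (unt t (hadd H x y)) = hinner (LS t) d (hadd (LS t) (unt t x) (unt t y))"
        using key[OF e refl xy] key[OF e refl x] key[OF e refl y] bop_add[OF b x y] bop_car[OF b x] bop_car[OF b y] hc c
          LSS HS unt_car x y e(3) by simp
    qed
    then show ?thesis using x y xy by (simp add: lim_iota_apply)
  qed
  show "lim_iota H M P t (hscale H c x) = hscale (LS t) c (lim_iota H M P t x)"
    if x: "x \<in> hcar H" for c x
  proof -
    have xy: "hscale H c x \<in> hcar H" using x HS by simp
    have "unt t (hscale H c x) = hscale (LS t) c (unt t x)"
    proof (rule total_eqI[OF LS_hilbert elt_total unt_car[OF xy]])
      show "hscale (LS t) c (unt t x) \<in> hcar (LS t)" using LSS unt_car x by simp
      fix d assume "d \<in> elts t"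
      then obtain p f h where e: "p \<in> partitions t" "(f, h) \<in> gens t p" "d = elt t p (f, h)" by (rule elts_E)
      note c = elt_car[OF e(1,2)] and hc = gens_car[OF e(2)] and b = cb[OF e(2)]
      show "hinner (LS t) d (unt t (hscale H c x)) = hinner (LS t) d (hscale (LS t) c (unt t x))"
        using key[OF e refl xy] key[OF e refl x] bop_scale[OF b x] bop_car[OF b x] hc c
          LSS HS unt_car x e(3) by simp
    qed
    then show ?thesis using x xy by (simp add: lim_iota_apply)
  qed
  show "hnorm (LS t) (lim_iota H M P t x) \<le> 1 * hnorm H x" if "x \<in> hcar H" for x
    using that unt_inner[OF that that] by (simp add: lim_iota_apply hnorm_def)
qed (auto simp: lim_iota_apply unt_car)

end

end

section \<open>Normal maps and intertwiners\<close>

text \<open>Interleaving two sequences adds the functionals \<open>\<Sum> \<parallel>A z\<^sub>n\<parallel>\<^sup>2\<close>.\<close>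

lemma sq_summable_interleave:
  assumes x: "sq_summable G x" and y: "sq_summable G y"
  defines "z \<equiv> \<lambda>n. if even n then x (n div 2) else y ((n - 1) div 2)"
  shows "sq_summable G z" and "(\<Sum>n. (hnorm G (z n))\<^sup>2) = (\<Sum>n. (hnorm G (x n))\<^sup>2) + (\<Sum>n. (hnorm G (y n))\<^sup>2)"
proof -
  have s: "(\<lambda>n. (hnorm G (x n))\<^sup>2) sums (\<Sum>n. (hnorm G (x n))\<^sup>2)" "(\<lambda>n. (hnorm G (y n))\<^sup>2) sums (\<Sum>n. (hnorm G (y n))\<^sup>2)"
    using x y by (auto simp: sq_summable_def)
  have e: "(\<lambda>n. (hnorm G (z n))\<^sup>2) = (\<lambda>n. if even n then (hnorm G (x (n div 2)))\<^sup>2 else (hnorm G (y ((n - 1) div 2)))\<^sup>2)"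
    by (auto simp: z_def)
  have "(\<lambda>n. (hnorm G (z n))\<^sup>2) sums ((\<Sum>n. (hnorm G (y n))\<^sup>2) + (\<Sum>n. (hnorm G (x n))\<^sup>2))"
    unfolding e by (rule sums_if[OF s(2,1)])
  then show "sq_summable G z" "(\<Sum>n. (hnorm G (z n))\<^sup>2) = (\<Sum>n. (hnorm G (x n))\<^sup>2) + (\<Sum>n. (hnorm G (y n))\<^sup>2)"
    using x y by (auto simp: sq_summable_def z_def sums_iff)
qed

lemma sq_sum_interleave_op:
  assumes G: "hilbert_space G" and x: "sq_summable G x" and y: "sq_summable G y" and A: "A \<in> bop G G"
  defines "z \<equiv> \<lambda>n. if even n then x (n div 2) else y ((n - 1) div 2)"
  shows "(\<Sum>n. (hnorm G (A (z n)))\<^sup>2) = (\<Sum>n. (hnorm G (A (x n)))\<^sup>2) + (\<Sum>n. (hnorm G (A (y n)))\<^sup>2)"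
proof -
  note S = hilbert_semi[OF G]
  have e: "A (z n) = (if even n then A (x (n div 2)) else A (y ((n - 1) div 2)))" for n by (simp add: z_def)
  show ?thesis
    unfolding e by (rule sq_summable_interleave(2)[OF sq_summable_bop[OF S S x A] sq_summable_bop[OF S S y A]])
qed

lemma zero_op:
  assumes G: "hilbert_space G" and h: "h \<in> hcar G" shows "oscale G G 0 (oid G) h = hzero G"
  using h hilbert_semi[OF G] by (intro hilbert_eqI[OF G]) auto

text \<open>For a subbasic neighbourhood, given by \<open>w(A) = \<Sum> \<langle>x\<^sub>n, A y\<^sub>n\<rangle>\<close>, the estimate
  \<open>\<bar>w(A\<^sup>* A)\<bar> \<le> (\<Sum> \<parallel>A x\<^sub>n\<parallel>\<^sup>2 + \<Sum> \<parallel>A y\<^sub>n\<parallel>\<^sup>2) / 2\<close> shows that a multiple of the interleaving of \<open>x\<close> and \<open>y\<close> serves as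
  \<open>z\<close>. Intersections are treated by interleaving, too.\<close>

lemma sigma_weak_neighbourhood:
  assumes G: "hilbert_space G"
    and U: "generate_topology_on {{A \<in> bop G G. w A \<in> O'} |w O'. w \<in> predual G (bop G G) \<and> open O'} U"
    and z: "oscale G G 0 (oid G) \<in> U"
  shows "\<exists>z. sq_summable G z \<and> (\<forall>A\<in>bop G G. (\<Sum>n. (hnorm G (A (z n)))\<^sup>2) < 1 \<longrightarrow> ocomp G (hadj G G A) A \<in> U)"
  using U z
proof (induction rule: generate_topology_on.induct)
  case Empty then show ?case by simp
next
  case (Int U V)
  obtain x where x: "sq_summable G x" "\<forall>A\<in>bop G G. (\<Sum>n. (hnorm G (A (x n)))\<^sup>2) < 1 \<longrightarrow> ocomp G (hadj G G A) A \<in> U"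
    using Int by auto
  obtain y where y: "sq_summable G y" "\<forall>A\<in>bop G G. (\<Sum>n. (hnorm G (A (y n)))\<^sup>2) < 1 \<longrightarrow> ocomp G (hadj G G A) A \<in> V"
    using Int by auto
  let ?z = "\<lambda>n. if even n then x (n div 2) else y ((n - 1) div 2)"
  have "ocomp G (hadj G G A) A \<in> U \<inter> V" if A: "A \<in> bop G G" and l: "(\<Sum>n. (hnorm G (A (?z n)))\<^sup>2) < 1" for A
  proof -
    note S = hilbert_semi[OF G]
    have "0 \<le> (\<Sum>n. (hnorm G (A (x n)))\<^sup>2)" "0 \<le> (\<Sum>n. (hnorm G (A (y n)))\<^sup>2)"
      using sq_summable_bop[OF S S x(1) A] sq_summable_bop[OF S S y(1) A]
      by (auto simp: sq_summable_def intro: suminf_nonneg)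
    then show ?thesis using sq_sum_interleave_op[OF G x(1) y(1) A] l x(2) y(2) A by auto
  qed
  then show ?case using sq_summable_interleave(1)[OF x(1) y(1)] by blast
next
  case (UN K)
  then obtain k where k: "k \<in> K" "oscale G G 0 (oid G) \<in> k" by auto
  from UN.IH[OF this] show ?case using k(1) by blast
next
  case (Basis U)
  note S = hilbert_semi[OF G]
  obtain w O' where w: "w \<in> predual G (bop G G)" and O': "open O'" and U: "U = {A \<in> bop G G. w A \<in> O'}"
    using Basis(1) by auto
  obtain x y where xy: "sq_summable G x" "sq_summable G y"
    and wxy: "\<And>A. A \<in> bop G G \<Longrightarrow> w A = (\<Sum>n. hinner G (x n) (A (y n)))"
    using w unfolding predual_def sq_summable_def by blast
  have xc: "x n \<in> hcar G" "y n \<in> hcar G" for n using xy by (auto simp: sq_summable_def)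
  have "w (oscale G G 0 (oid G)) = 0"
    using Basis(2) U wxy[of "oscale G G 0 (oid G)"] by (simp add: zero_op[OF G xc(2)] S xc)
  then have "0 \<in> O'" using Basis(2) U by auto
  then obtain \<delta> where \<delta>: "0 < \<delta>" "ball 0 \<delta> \<subseteq> O'" using O' open_contains_ball by blast
  define c where "c = complex_of_real (1 / sqrt \<delta>)"
  define D where "D = oscale G G c (oid G)"
  have D: "D \<in> bop G G" unfolding D_def by (rule oscale_bop[OF G G oid_bop[OF S]])
  have sx: "sq_summable G (\<lambda>n. D (x n))" "sq_summable G (\<lambda>n. D (y n))"
    by (rule sq_summable_bop[OF S S xy(1) D], rule sq_summable_bop[OF S S xy(2) D])
  let ?z = "\<lambda>n. if even n then D (x (n div 2)) else D (y ((n - 1) div 2))"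
  have "ocomp G (hadj G G A) A \<in> U" if A: "A \<in> bop G G" and l: "(\<Sum>n. (hnorm G (A (?z n)))\<^sup>2) < 1" for A
  proof -
    note Ax = sq_summable_bop[OF S S xy(1) A] and Ay = sq_summable_bop[OF S S xy(2) A]
    have n: "(hnorm G (A (D v)))\<^sup>2 = (hnorm G (A v))\<^sup>2 / \<delta>" if v: "v \<in> hcar G" for v
    proof -
      have "A (D v) = hscale G c (A v)" unfolding D_def using v bop_scale[OF A v] by simp
      then show ?thesis using bop_car[OF A v] S \<delta>(1) by (simp add: c_def norm_divide power_divide power_mult_distrib)
    qed
    have q: "(\<Sum>n. (hnorm G (A (?z n)))\<^sup>2) = ((\<Sum>n. (hnorm G (A (x n)))\<^sup>2) + (\<Sum>n. (hnorm G (A (y n)))\<^sup>2)) / \<delta>"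
      using sq_sum_interleave_op[OF G sx A] Ax Ay
      by (simp add: n[OF xc(1)] n[OF xc(2)] suminf_divide sq_summable_def add_divide_distrib)
    have le: "(\<Sum>n. (hnorm G (A (x n)))\<^sup>2) + (\<Sum>n. (hnorm G (A (y n)))\<^sup>2) < \<delta>"
      using l[unfolded q] \<delta>(1) by (simp add: pos_divide_less_eq)
    have AA: "ocomp G (hadj G G A) A \<in> bop G G" by (rule ocomp_bop[OF S S hadj_bop[OF G G A] A])
    have "w (ocomp G (hadj G G A) A) = (\<Sum>n. hinner G (A (x n)) (A (y n)))"
      unfolding wxy[OF AA] by (simp add: xc hadj_right[OF G G A xc(1) bop_car[OF A xc(2)]])
    then have "cmod (w (ocomp G (hadj G G A) A)) \<le> (\<Sum>n. cmod (hinner G (A (x n)) (A (y n))))"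
      using summable_norm[OF sq_summable_inner(1)[OF S Ax Ay]] by simp
    also have "\<dots> \<le> ((\<Sum>n. (hnorm G (A (x n)))\<^sup>2) + (\<Sum>n. (hnorm G (A (y n)))\<^sup>2)) / 2"
      by (rule sq_summable_inner(2)[OF S Ax Ay])
    also have "\<dots> < \<delta>" using le \<delta>(1) by simp
    finally show ?thesis using \<delta>(2) AA U by auto
  qed
  then show ?case using sq_summable_interleave(1)[OF sx] by blast
qed

text \<open>The preimage under \<open>\<Phi>\<close> of the operators \<open>C\<close> with \<open>\<bar>\<langle>k, C k\<rangle>\<bar> < 1\<close> is a neighbourhood of zero. The sequence \<open>z\<close>
  attached to it gives the inequality up to scaling, and both sides are homogeneous of degree two
  in \<open>A\<close>.\<close>

lemma normal_map_bound:
  assumes G: "hilbert_space G" and M: "star_algebra G M" and \<Phi>: "normal_map G M G \<Phi>"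
    and \<Phi>M: "\<And>A. A \<in> M \<Longrightarrow> \<Phi> A \<in> M" and scale: "\<And>c A. A \<in> M \<Longrightarrow> \<Phi> (oscale G G c A) = oscale G G c (\<Phi> A)"
    and k: "k \<in> hcar G"
  obtains z where "sq_summable G z"
    "\<And>A. A \<in> M \<Longrightarrow> cmod (hinner G k (\<Phi> (ocomp G (hadj G G A) A) k)) \<le> (\<Sum>n. (hnorm G (A (z n)))\<^sup>2)"
proof -
  note S = hilbert_semi[OF G] and Ms = star_algebraD[OF M]
  let ?B = "{{A \<in> bop G G. w A \<in> O'} |w O'. w \<in> predual G (bop G G) \<and> open O'}"
  let ?Z = "oscale G G 0 (oid G)"
  have Z: "?Z \<in> M" by (rule Ms(5)[OF Ms(2)])
  define v where "v A = hinner G k (A k)" for A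
  have v: "v \<in> predual G (bop G G)"
  proof -
    let ?x = "\<lambda>n::nat. if n = 0 then k else hzero G"
    have s: "summable (\<lambda>n. (hnorm G (?x n))\<^sup>2)"
      by (rule summable_finite[of "{0}"]) (use S in auto)
    have "v A = (\<Sum>n. hinner G (?x n) (A (?x n)))" if A: "A \<in> bop G G" for A
    proof -
      have "(\<lambda>n. hinner G (?x n) (A (?x n))) sums (\<Sum>n\<in>{0}. hinner G (?x n) (A (?x n)))"
        by (rule sums_finite) (use S bop_hzero[OF G G A] in auto)
      then show ?thesis by (simp add: v_def sums_iff)
    qed
    then show ?thesis unfolding predual_def using s k S by (intro CollectI exI[of _ ?x]) auto
  qed
  let ?V = "{A \<in> bop G G. v A \<in> ball 0 1}"
  have "openin (sigma_weak G) ?V"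
    unfolding sigma_weak_def initial_topology_def by (rule topology_generated_by_Basis) (use v open_ball in blast)
  then have "openin (subtopology (sigma_weak G) M) {A \<in> topspace (subtopology (sigma_weak G) M). \<Phi> A \<in> ?V}"
    using \<Phi> unfolding normal_map_def by (rule openin_continuous_map_preimage[rotated])
  then obtain W where W: "openin (sigma_weak G) W"
    and eq: "{A \<in> topspace (subtopology (sigma_weak G) M). \<Phi> A \<in> ?V} = W \<inter> M"
    by (auto simp: openin_subtopology)
  have "\<Union>?B = bop G G"
  proof (intro equalityI subsetI)
    fix A assume "A \<in> bop G G"
    then show "A \<in> \<Union>?B" using v by (intro UnionI[of "{A \<in> bop G G. v A \<in> UNIV}"]) (auto intro!: exI[of _ v] exI[of _ UNIV])
  qed auto
  then have ts: "topspace (subtopology (sigma_weak G) M) = M"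
    unfolding sigma_weak_def initial_topology_def using Ms(1) by auto
  have gen: "generate_topology_on ?B W"
    using W unfolding sigma_weak_def initial_topology_def by (rule openin_topology_generated_by)
  have "\<Phi> ?Z = ?Z"
  proof (rule bop_eqI[OF Ms(1)[OF \<Phi>M[OF Z]] Ms(1)[OF Z]])
    fix h assume h: "h \<in> hcar G"
    have "\<Phi> ?Z h = hscale G 0 (\<Phi> (oid G) h)" unfolding scale[OF Ms(2)] using h by simp
    also have "\<dots> = hzero G" using bop_car[OF Ms(1)[OF \<Phi>M[OF Ms(2)]] h] S by (intro hilbert_eqI[OF G]) auto
    finally show "\<Phi> ?Z h = ?Z h" unfolding zero_op[OF G h] .
  qed
  then have "?Z \<in> W \<inter> M" unfolding eq[symmetric] ts using Z Ms(1)[OF Z] k S by (simp add: v_def zero_op[OF G k] del: oscale_apply)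
  then obtain z where z: "sq_summable G z"
    and zW: "\<And>A. A \<in> bop G G \<Longrightarrow> (\<Sum>n. (hnorm G (A (z n)))\<^sup>2) < 1 \<Longrightarrow> ocomp G (hadj G G A) A \<in> W"
    using sigma_weak_neighbourhood[OF G gen] by blast
  have zc: "z n \<in> hcar G" for n using z by (simp add: sq_summable_def)
  have key: "cmod (hinner G k (\<Phi> (ocomp G (hadj G G A) A) k)) \<le> (\<Sum>n. (hnorm G (A (z n)))\<^sup>2)" (is "?l \<le> ?s") if A: "A \<in> M" for A
  proof (rule field_le_epsilon)
    fix e :: real assume e: "0 < e"
    note Ab = Ms(1)[OF A]
    let ?AA = "ocomp G (hadj G G A) A"
    have AA: "?AA \<in> M" by (intro Ms A)
    have sA: "summable (\<lambda>n. (hnorm G (A (z n)))\<^sup>2)" using sq_summable_bop[OF S S z Ab] by (simp add: sq_summable_def)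
    have s0: "0 \<le> ?s" by (rule suminf_nonneg[OF sA]) simp
    \<comment> \<open>The multiple \<open>c A\<close> satisfies the strict bound that is required of elements of the neighbourhood.\<close>
    define c where "c = 1 / sqrt (?s + e)"
    have c: "0 < c" "c\<^sup>2 * (?s + e) = 1" using s0 e by (auto simp: c_def power_divide)
    let ?D = "oscale G G (of_real c) A"
    have D: "?D \<in> M" by (rule Ms(5)[OF A])
    have "(hnorm G (?D (z n)))\<^sup>2 = c\<^sup>2 * (hnorm G (A (z n)))\<^sup>2" for n
      using zc bop_car[OF Ab zc] S by (simp add: power_mult_distrib)
    then have "(\<Sum>n. (hnorm G (?D (z n)))\<^sup>2) = c\<^sup>2 * ?s" by (simp add: suminf_mult[OF sA])
    also have "\<dots> < c\<^sup>2 * (?s + e)" by (rule mult_strict_left_mono) (use c(1) e in auto)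
    finally have "ocomp G (hadj G G ?D) ?D \<in> W" using c zW[OF Ms(1)[OF D]] by simp
    then have "ocomp G (hadj G G ?D) ?D \<in> W \<inter> M" using Ms(3)[OF Ms(6)[OF D] D] by simp
    then have less: "cmod (v (\<Phi> (ocomp G (hadj G G ?D) ?D))) < 1" unfolding eq[symmetric] by simp
    have "ocomp G (hadj G G ?D) ?D = oscale G G (of_real (c\<^sup>2)) ?AA"
    proof (rule bop_eqI[OF Ms(1)[OF Ms(3)[OF Ms(6)[OF D] D]] Ms(1)[OF Ms(5)[OF AA]]])
      fix h assume h: "h \<in> hcar G"
      note Ah = bop_car[OF Ab h]
      note AAh = hadj_car[OF G G Ab Ah]
      show "ocomp G (hadj G G ?D) ?D h = oscale G G (of_real (c\<^sup>2)) ?AA h"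
        unfolding hadj_oscale[OF G G Ab] using h Ah S AAh
        by (simp add: bop_scale[OF hadj_bop[OF G G Ab] Ah] power2_eq_square hscale_times[OF S AAh])
    qed
    then have "v (\<Phi> (ocomp G (hadj G G ?D) ?D)) = of_real (c\<^sup>2) * hinner G k (\<Phi> ?AA k)"
      using scale[OF AA, of "of_real (c\<^sup>2)"] k bop_car[OF Ms(1)[OF \<Phi>M[OF AA]] k] S by (simp add: v_def)
    then have "c\<^sup>2 * ?l < 1" using less by (simp add: norm_mult norm_power)
    then have "c\<^sup>2 * ?l < c\<^sup>2 * (?s + e)" unfolding c(2) .
    from mult_left_less_imp_less[OF this zero_le_power2] show "?l \<le> ?s + e" by simp
  qed
  show ?thesis by (rule that[OF z key])
qed

text \<open>The form at a family \<open>A i\<close> is the value on the diagonal at the combination \<open>\<Sum> c i A i\<close>, an element of the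
  algebra.\<close>

lemma psd_sesquilinear:
  assumes M: "star_algebra G M"
    and add: "\<And>A B C. A \<in> M \<Longrightarrow> B \<in> M \<Longrightarrow> C \<in> M \<Longrightarrow> \<Phi> A (oadd G G B C) = \<Phi> A B + \<Phi> A C"
    and scale: "\<And>c A B. A \<in> M \<Longrightarrow> B \<in> M \<Longrightarrow> \<Phi> A (oscale G G c B) = c * \<Phi> A B"
    and add': "\<And>A B C. A \<in> M \<Longrightarrow> B \<in> M \<Longrightarrow> C \<in> M \<Longrightarrow> \<Phi> (oadd G G A B) C = \<Phi> A C + \<Phi> B C"
    and scale': "\<And>c A B. A \<in> M \<Longrightarrow> B \<in> M \<Longrightarrow> \<Phi> (oscale G G c A) B = cnj c * \<Phi> A B"
    and pos: "\<And>A. A \<in> M \<Longrightarrow> Im (\<Phi> A A) = 0 \<and> 0 \<le> Re (\<Phi> A A)"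
  shows "psd M \<Phi>"
proof (rule psdI)
  note Ms = star_algebraD[OF M]
  fix n :: nat and A and c :: "nat \<Rightarrow> complex" assume A: "\<And>i. i < n \<Longrightarrow> A i \<in> M"
  have "\<exists>D\<in>M. \<forall>B\<in>M. \<Phi> B D = (\<Sum>i<m. c i * \<Phi> B (A i)) \<and> \<Phi> D B = (\<Sum>i<m. cnj (c i) * \<Phi> (A i) B)" if "m \<le> n" for m
    using that
  proof (induction m)
    case 0
    have "\<Phi> B (oscale G G 0 (oid G)) = 0 \<and> \<Phi> (oscale G G 0 (oid G)) B = 0" if "B \<in> M" for B
      using scale[OF that Ms(2), of 0] scale'[OF Ms(2) that, of 0] by simp
    then show ?case using Ms(5)[OF Ms(2), of 0] by auto
  next
    case (Suc m)
    then obtain D where D: "D \<in> M" "\<forall>B\<in>M. \<Phi> B D = (\<Sum>i<m. c i * \<Phi> B (A i)) \<and> \<Phi> D B = (\<Sum>i<m. cnj (c i) * \<Phi> (A i) B)"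
      by auto
    have Am: "A m \<in> M" using A Suc by simp
    note sA = Ms(5)[OF Am, of "c m"]
    show ?case
    proof (rule bexI[of _ "oadd G G D (oscale G G (c m) (A m))"])
      show "oadd G G D (oscale G G (c m) (A m)) \<in> M" by (rule Ms(4)[OF D(1) sA])
      show "\<forall>B\<in>M. \<Phi> B (oadd G G D (oscale G G (c m) (A m))) = (\<Sum>i<Suc m. c i * \<Phi> B (A i)) \<and>
        \<Phi> (oadd G G D (oscale G G (c m) (A m))) B = (\<Sum>i<Suc m. cnj (c i) * \<Phi> (A i) B)"
        using D Am sA by (simp add: add add' scale scale')
    qed
  qed
  then obtain D where D: "D \<in> M" "\<And>B. B \<in> M \<Longrightarrow> \<Phi> B D = (\<Sum>i<n. c i * \<Phi> B (A i))"
    "\<And>B. B \<in> M \<Longrightarrow> \<Phi> D B = (\<Sum>i<n. cnj (c i) * \<Phi> (A i) B)" by blast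
  have "kform \<Phi> n A c = (\<Sum>i<n. cnj (c i) * (\<Sum>j<n. c j * \<Phi> (A i) (A j)))"
    by (simp add: kform_def sum_distrib_left mult.assoc)
  also have "\<dots> = (\<Sum>i<n. cnj (c i) * \<Phi> (A i) D)" by (intro sum.cong refl) (simp add: D(2) A)
  also have "\<dots> = \<Phi> D D" by (rule D(3)[OF D(1), symmetric])
  finally show "Im (kform \<Phi> n A c) = 0 \<and> 0 \<le> Re (kform \<Phi> n A c)" using pos[OF D(1)] by simp
qed

lemma psd_zero: "psd X (\<lambda>x y. 0)"
  by (simp add: psd_def kform_def)

section \<open>Unit vectors are approximated by intertwiners\<close>

text \<open>The Hilbert space \<open>D\<close> generated by the classes \<open>[A]\<close> with
  \<open>\<langle>[A], [B]\<rangle> = \<Sum> \<langle>A z\<^sub>n, B z\<^sub>n\<rangle>\<close> is the cyclic space of the sequence \<open>z\<close> in the infinite multiple of \<open>H\<close>.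
  On it act the coordinate maps \<open>J i\<close>, the left action \<open>lam\<close> of \<open>M\<close>, and the contraction \<open>B\<close>
  to \<open>H\<^sub>t\<close> that sends \<open>[A]\<close> to \<open>A \<iota>\<^sub>t k\<close>; all of them respect the actions of \<open>M\<close>.\<close>

locale cyclic_space = cp_data H M P for H :: "'h hspace" and M P +
  fixes z :: "nat \<Rightarrow> 'h" and t :: real and k :: 'h
  assumes z: "sq_summable H z" and t: "0 < t" and k: "k \<in> hcar H"
    and bound: "\<And>A. A \<in> M \<Longrightarrow> cmod (hinner H k (P t (ocomp H (hadj H H A) A) k)) \<le> (\<Sum>n. (hnorm H (A (z n)))\<^sup>2)"
begin

lemma zc: "z n \<in> hcar H" using z by (simp add: sq_summable_def)

lemma Az: "A \<in> M \<Longrightarrow> A (z n) \<in> hcar H" by (rule bop_car[OF M_bop zc])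

lemma Az_sq: "A \<in> M \<Longrightarrow> sq_summable H (\<lambda>n. A (z n))" by (rule sq_summable_bop[OF HS HS z M_bop])

definition kz where "kz A B = (\<Sum>n. hinner H (A (z n)) (B (z n)))"

lemma kz_sums: "A \<in> M \<Longrightarrow> B \<in> M \<Longrightarrow> (\<lambda>n. hinner H (A (z n)) (B (z n))) sums kz A B"
  unfolding kz_def by (rule summable_sums[OF summable_norm_cancel[OF sq_summable_inner(1)[OF HS Az_sq Az_sq]]])

lemma term_psd: "psd M (\<lambda>A B. hinner H (A (z n)) (B (z n)))"
  by (rule psd_pullback[OF psd_hinner[OF H] Az])

lemma kz_psd: "psd M kz"
  by (rule psd_sums[where k="\<lambda>n A B. hinner H (A (z n)) (B (z n))", OF term_psd kz_sums])

abbreviation "D \<equiv> kspace M kz"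
abbreviation "cl A \<equiv> kgen M kz A"

lemmas D_hilbert = kspace_hilbert[OF kz_psd]
lemmas DS = hilbert_semi[OF D_hilbert]
lemmas cl_car = kgen_car[OF kz_psd]
lemmas cl_inner = kgen_inner[OF kz_psd]
lemmas cl_total = kgen_total[OF kz_psd]

lemma J_dom: "psd M (\<lambda>A B. of_real (1\<^sup>2) * kz A B - hinner H (A (z i)) (B (z i)))"
proof (rule psd_sums[where k="\<lambda>n A B. if n = i then 0 else hinner H (A (z n)) (B (z n))"])
  show "psd M (\<lambda>A B. if n = i then 0 else hinner H (A (z n)) (B (z n)))" for n
    using psd_zero term_psd by (cases "n = i") auto
  fix A B assume AB: "A \<in> M" "B \<in> M"
  have "(\<lambda>n. hinner H (A (z n)) (B (z n)) - (if n = i then hinner H (A (z n)) (B (z n)) else 0))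
      sums (kz A B - hinner H (A (z i)) (B (z i)))"
    by (rule sums_diff[OF kz_sums[OF AB] sums_single])
  moreover have "(\<lambda>n. hinner H (A (z n)) (B (z n)) - (if n = i then hinner H (A (z n)) (B (z n)) else 0))
    = (\<lambda>n. if n = i then 0 else hinner H (A (z n)) (B (z n)))" by auto
  ultimately show "(\<lambda>n. if n = i then 0 else hinner H (A (z n)) (B (z n)))
      sums (of_real (1\<^sup>2) * kz A B - hinner H (A (z i)) (B (z i)))" by simp
qed

definition J where "J i = kext M kz H (\<lambda>A. A (z i))"

lemma J_bop: "J i \<in> bop D H"
  and J_cl: "A \<in> M \<Longrightarrow> J i (cl A) = A (z i)"
proof -
  have one: "(0::real) \<le> 1" by simp
  show "J i \<in> bop D H" unfolding J_def
    by (rule kext_bop[where f="\<lambda>A. A (z i)" and C=1], rule kz_psd, rule H, erule Az, rule one, rule J_dom)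
  show "J i (cl A) = A (z i)" if A: "A \<in> M" unfolding J_def
    by (rule kext_gen[where f="\<lambda>A. A (z i)" and C=1], rule kz_psd, rule H, erule Az, rule one, rule J_dom, rule A)
qed

abbreviation "u \<equiv> unt t k"

lemmas u_car = unt_car[OF t k]
lemmas la_car = bop_car[OF la_bop[OF t]]

lemma la_inner:
  assumes A: "A \<in> M" and B: "B \<in> M"
  shows "hinner (LS t) (la t A u) (la t B u) = hinner H k (P t (ocomp H (hadj H H A) B) k)"
proof -
  have "hinner (LS t) (la t A u) (la t B u) = hinner (LS t) u (la t (hadj H H A) (la t B u))"
    by (rule la_adj[OF t A u_car la_car[OF B u_car]])
  also have "\<dots> = hinner (LS t) u (la t (ocomp H (hadj H H A) B) u)"
    unfolding la_comp[OF t M_adj[OF A] B u_car] ..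
  also have "\<dots> = hinner H k (P t (ocomp H (hadj H H A) B) k)"
    by (rule unt_la[OF t M_comp[OF M_adj[OF A] B] k k])
  finally show ?thesis .
qed

lemma kz_self: "A \<in> M \<Longrightarrow> kz A A = of_real (\<Sum>n. (hnorm H (A (z n)))\<^sup>2)"
proof -
  assume A: "A \<in> M"
  have s: "(\<lambda>n. (hnorm H (A (z n)))\<^sup>2) sums (\<Sum>n. (hnorm H (A (z n)))\<^sup>2)"
    using Az_sq[OF A] by (auto simp: sq_summable_def)
  have "(\<lambda>n. complex_of_real ((hnorm H (A (z n)))\<^sup>2)) sums of_real (\<Sum>n. (hnorm H (A (z n)))\<^sup>2)"
    by (rule sums_of_real[OF s])
  then show ?thesis using sums_unique2[OF kz_sums[OF A A]] by (simp only: hinner_self[OF HS Az[OF A]])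
qed

text \<open>The difference of the two kernels is sesquilinear in the operators, and on the diagonal its positivity
  is the bound for \<open>P\<^sub>t\<close>.\<close>

lemma B_dom: "psd M (\<lambda>A B. of_real (1\<^sup>2) * kz A B - hinner (LS t) (la t A u) (la t B u))"
proof -
  have t0: "0 \<le> t" using t by simp
  define Q where "Q A B = hinner H k (P t (ocomp H (hadj H H A) B) k)" for A B
  have Pc: "P t A k \<in> hcar H" if "A \<in> M" for A by (rule bop_car[OF M_bop[OF P_M[OF t0 that]] k])
  have AB: "ocomp H (hadj H H A) B \<in> M" if "A \<in> M" "B \<in> M" for A B by (intro M_comp M_adj that)
  have "psd M (\<lambda>A B. kz A B - Q A B)"
  proof (rule psd_sesquilinear[OF M_star])
    fix A B C c assume A: "A \<in> M" and B: "B \<in> M"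
    note Aa = M_bop[OF M_adj[OF A]]
    have "kz A (oscale H H c B) = c * kz A B"
      using sums_mult[OF kz_sums[OF A B], of c]
      by (intro sums_unique2[OF kz_sums[OF A M_scale[OF B]]]) (simp add: zc HS Az[OF A] Az[OF B])
    moreover have "ocomp H (hadj H H A) (oscale H H c B) = oscale H H c (ocomp H (hadj H H A) B)"
      by (rule bop_eqI[OF M_bop[OF AB[OF A M_scale[OF B]]] M_bop[OF M_scale[OF AB[OF A B]]]])
        (simp add: bop_scale[OF Aa] bop_car[OF M_bop[OF B]])
    ultimately show "kz A (oscale H H c B) - Q A (oscale H H c B) = c * (kz A B - Q A B)"
      using Pc[OF AB[OF A B]] k HS by (simp add: Q_def P_scale[OF t0 AB[OF A B]] right_diff_distrib)
    have "kz (oscale H H c A) B = cnj c * kz A B"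
      using sums_mult[OF kz_sums[OF A B], of "cnj c"]
      by (intro sums_unique2[OF kz_sums[OF M_scale[OF A] B]]) (simp add: zc HS Az[OF A] Az[OF B])
    moreover have "ocomp H (hadj H H (oscale H H c A)) B = oscale H H (cnj c) (ocomp H (hadj H H A) B)"
      unfolding hadj_oscale[OF H H M_bop[OF A]]
      by (rule bop_eqI[OF M_bop[OF M_comp[OF M_scale[OF M_adj[OF A]] B]] M_bop[OF M_scale[OF AB[OF A B]]]])
        (simp add: bop_car[OF M_bop[OF B]])
    ultimately show "kz (oscale H H c A) B - Q (oscale H H c A) B = cnj c * (kz A B - Q A B)"
      using Pc[OF AB[OF A B]] k HS by (simp add: Q_def P_scale[OF t0 AB[OF A B]] right_diff_distrib)
    assume C: "C \<in> M"
    have "kz A (oadd H H B C) = kz A B + kz A C"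
      using sums_add[OF kz_sums[OF A B] kz_sums[OF A C]]
      by (intro sums_unique2[OF kz_sums[OF A M_add[OF B C]]]) (simp add: zc HS Az[OF A] Az[OF B] Az[OF C])
    moreover have "ocomp H (hadj H H A) (oadd H H B C) = oadd H H (ocomp H (hadj H H A) B) (ocomp H (hadj H H A) C)"
      by (rule bop_eqI[OF M_bop[OF AB[OF A M_add[OF B C]]] M_bop[OF M_add[OF AB[OF A B] AB[OF A C]]]])
        (simp add: bop_add[OF Aa] bop_car[OF M_bop[OF B]] bop_car[OF M_bop[OF C]])
    ultimately show "kz A (oadd H H B C) - Q A (oadd H H B C) = kz A B - Q A B + (kz A C - Q A C)"
      using Pc[OF AB[OF A B]] Pc[OF AB[OF A C]] k HS by (simp add: Q_def P_add[OF t0 AB[OF A B] AB[OF A C]])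
    have "kz (oadd H H A B) C = kz A C + kz B C"
      using sums_add[OF kz_sums[OF A C] kz_sums[OF B C]]
      by (intro sums_unique2[OF kz_sums[OF M_add[OF A B] C]]) (simp add: zc HS Az[OF A] Az[OF B] Az[OF C])
    moreover have "ocomp H (hadj H H (oadd H H A B)) C = oadd H H (ocomp H (hadj H H A) C) (ocomp H (hadj H H B) C)"
      unfolding hadj_oadd[OF H H M_bop[OF A] M_bop[OF B]]
      by (rule bop_eqI[OF M_bop[OF M_comp[OF M_add[OF M_adj[OF A] M_adj[OF B]] C]] M_bop[OF M_add[OF AB[OF A C] AB[OF B C]]]])
        (simp add: bop_car[OF M_bop[OF C]])
    ultimately show "kz (oadd H H A B) C - Q (oadd H H A B) C = kz A C - Q A C + (kz B C - Q B C)"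
      using Pc[OF AB[OF A C]] Pc[OF AB[OF B C]] k HS by (simp add: Q_def P_add[OF t0 AB[OF A C] AB[OF B C]])
  next
    fix A assume A: "A \<in> M"
    have i: "Q A A = of_real ((hnorm (LS t) (la t A u))\<^sup>2)"
      unfolding Q_def la_inner[OF A A, symmetric] by (rule hinner_self[OF LSS la_car[OF A u_car]])
    have "(hnorm (LS t) (la t A u))\<^sup>2 \<le> (\<Sum>n. (hnorm H (A (z n)))\<^sup>2)"
      using bound[OF A] unfolding Q_def[symmetric] i by (simp add: norm_power)
    then show "Im (kz A A - Q A A) = 0 \<and> 0 \<le> Re (kz A A - Q A A)"
      unfolding i kz_self[OF A] by simp
  qed
  then show ?thesis by (subst psd_cong[where k'="\<lambda>A B. kz A B - Q A B"]) (simp_all add: la_inner Q_def)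
qed

definition B where "B = kext M kz (LS t) (\<lambda>A. la t A u)"

lemma B_bop: "B \<in> bop D (LS t)"
  unfolding B_def by (rule kext_bop[OF kz_psd LS_hilbert la_car[OF _ u_car] _ B_dom]) simp_all

lemma B_cl: "A \<in> M \<Longrightarrow> B (cl A) = la t A u"
  unfolding B_def by (rule kext_gen[OF kz_psd LS_hilbert la_car[OF _ u_car] _ B_dom]) simp_all

definition lam where "lam A = kext M kz D (\<lambda>C. cl (ocomp H A C))"

lemma
  assumes A: "A \<in> M"
  shows lam_bop: "lam A \<in> bop D D" and lam_cl: "C \<in> M \<Longrightarrow> lam A (cl C) = cl (ocomp H A C)"
proof -
  obtain r where r: "0 \<le> r" "\<And>x. x \<in> hcar H \<Longrightarrow> hnorm H (A x) \<le> r * hnorm H x"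
    using bop_bound[OF HS M_bop[OF A]] by blast
  have c: "cl (ocomp H A C) \<in> hcar D" if "C \<in> M" for C by (rule cl_car[OF M_comp[OF A that]])
  have d: "psd M (\<lambda>C C'. of_real (r\<^sup>2) * kz C C' - hinner D (cl (ocomp H A C)) (cl (ocomp H A C')))"
  proof (rule psd_sums[where k="\<lambda>n C C'. of_real (r\<^sup>2) * hinner H (C (z n)) (C' (z n)) - hinner H (A (C (z n))) (A (C' (z n)))"])
    show "psd M (\<lambda>C C'. of_real (r\<^sup>2) * hinner H (C (z n)) (C' (z n)) - hinner H (A (C (z n))) (A (C' (z n))))" for n
      by (rule psd_pullback[OF psd_bop_dominated[OF H H M_bop[OF A] r] Az])
    fix C C' assume C: "C \<in> M" "C' \<in> M"
    have "(\<lambda>n. hinner H (A (C (z n))) (A (C' (z n)))) sums kz (ocomp H A C) (ocomp H A C')"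
      using kz_sums[OF M_comp[OF A C(1)] M_comp[OF A C(2)]] by (simp add: zc)
    then show "(\<lambda>n. of_real (r\<^sup>2) * hinner H (C (z n)) (C' (z n)) - hinner H (A (C (z n))) (A (C' (z n))))
        sums (of_real (r\<^sup>2) * kz C C' - hinner D (cl (ocomp H A C)) (cl (ocomp H A C')))"
      unfolding cl_inner[OF M_comp[OF A C(1)] M_comp[OF A C(2)]] by (intro sums_diff sums_mult kz_sums C)
  qed
  show "lam A \<in> bop D D" unfolding lam_def by (rule kext_bop[OF kz_psd D_hilbert c r(1) d])
  show "lam A (cl C) = cl (ocomp H A C)" if "C \<in> M"
    unfolding lam_def by (rule kext_gen[OF kz_psd D_hilbert c r(1) d that])
qed

lemma J_lam:
  assumes A: "A \<in> M" and d: "d \<in> hcar D" shows "J i (lam A d) = A (J i d)"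
proof -
  have "ocomp D (J i) (lam A) = ocomp D A (J i)"
  proof (rule bop_total_eqI[OF D_hilbert H cl_total ocomp_bop[OF DS DS J_bop lam_bop[OF A]] ocomp_bop[OF DS HS M_bop[OF A] J_bop]])
    fix d assume "d \<in> cl ` M"
    then obtain C where C: "C \<in> M" "d = cl C" by auto
    show "ocomp D (J i) (lam A) d = ocomp D A (J i) d"
      using zc by (simp add: C cl_car lam_cl[OF A] J_cl M_comp[OF A])
  qed
  then have "ocomp D (J i) (lam A) d = ocomp D A (J i) d" by simp
  then show ?thesis using d by simp
qed

lemma B_lam:
  assumes A: "A \<in> M" and d: "d \<in> hcar D" shows "B (lam A d) = la t A (B d)"
proof -
  have "ocomp D B (lam A) = ocomp D (la t A) B"
  proof (rule bop_total_eqI[OF D_hilbert LS_hilbert cl_total ocomp_bop[OF DS DS B_bop lam_bop[OF A]] ocomp_bop[OF DS LSS la_bop[OF t A] B_bop]])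
    fix d assume "d \<in> cl ` M"
    then obtain C where C: "C \<in> M" "d = cl C" by auto
    show "ocomp D B (lam A) d = ocomp D (la t A) B d"
      by (simp add: C cl_car lam_cl[OF A] B_cl M_comp[OF A] la_comp[OF t A C(1) u_car])
  qed
  then have "ocomp D B (lam A) d = ocomp D (la t A) B d" by simp
  then show ?thesis using d by simp
qed

lemma lam_adj:
  assumes A: "A \<in> M" and d: "d \<in> hcar D" and e: "e \<in> hcar D"
  shows "hinner D (lam A d) e = hinner D d (lam (hadj H H A) e)"
proof -
  have "hinner D (lam A d) (oid D e) = hinner D d (lam (hadj H H A) e)"
  proof (rule total_sesq_eqI[OF D_hilbert D_hilbert D_hilbert cl_total cl_total lam_bop[OF A] oid_bop[OF DS] lam_bop[OF M_adj[OF A]] _ d e])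
    fix d d' assume "d \<in> cl ` M" "d' \<in> cl ` M"
    then obtain C C' where C: "C \<in> M" "C' \<in> M" "d = cl C" "d' = cl C'" by auto
    have "kz (ocomp H A C) C' = kz C (ocomp H (hadj H H A) C')"
      unfolding kz_def by (simp add: zc hadj_right[OF H H M_bop[OF A] Az[OF C(1)] Az[OF C(2)]])
    then show "hinner D (lam A d) (oid D d') = hinner D d (lam (hadj H H A) d')"
      by (simp add: C(3,4) lam_cl[OF A C(1)] lam_cl[OF M_adj[OF A] C(2)] cl_car C(1,2) cl_inner M_comp[OF A] M_comp[OF M_adj[OF A]])
  qed
  then show ?thesis using e by simp
qed

text \<open>\<open>J\<^sub>i\<close> and \<open>B\<close> respect the actions of \<open>M\<close>, and so does \<open>J\<^sub>i\<^sup>*\<close> because \<open>M\<close> is self-adjoint.\<close>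

lemma X_inter: "ocomp H B (hadj D H (J i)) \<in> inter t"
proof (rule interI[OF ocomp_bop[OF HS DS B_bop hadj_bop[OF D_hilbert H J_bop]]])
  fix A h assume A: "A \<in> M" and h: "h \<in> hcar H"
  note Ah = bop_car[OF M_bop[OF A] h]
  note Jh = hadj_car[OF D_hilbert H J_bop h]
  have "hadj D H (J i) (A h) = lam A (hadj D H (J i) h)"
  proof (rule hilbert_eqI[OF D_hilbert hadj_car[OF D_hilbert H J_bop Ah] bop_car[OF lam_bop[OF A] Jh]])
    fix d assume d: "d \<in> hcar D"
    have "hinner D d (hadj D H (J i) (A h)) = hinner H (J i d) (A h)"
      by (rule hadj_right[OF D_hilbert H J_bop d Ah])
    also have "\<dots> = hinner H (hadj H H A (J i d)) h"
      by (rule hadj_left[OF H H M_bop[OF A] h bop_car[OF J_bop d], symmetric])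
    also have "\<dots> = hinner H (J i (lam (hadj H H A) d)) h" unfolding J_lam[OF M_adj[OF A] d] ..
    also have "\<dots> = hinner D (lam (hadj H H A) d) (hadj D H (J i) h)"
      by (rule hadj_right[OF D_hilbert H J_bop bop_car[OF lam_bop[OF M_adj[OF A]] d] h, symmetric])
    also have "\<dots> = hinner D d (lam A (hadj D H (J i) h))"
      using lam_adj[OF M_adj[OF A] d Jh] unfolding hadj_hadj[OF H H M_bop[OF A]] .
    finally show "hinner D d (hadj D H (J i) (A h)) = hinner D d (lam A (hadj D H (J i) h))" .
  qed
  then show "ocomp H B (hadj D H (J i)) (A h) = la t A (ocomp H B (hadj D H (J i)) h)"
    using h Ah by (simp add: B_lam[OF A Jh])
qed

text \<open>The classes of elements of \<open>M\<close> form a subspace.\<close>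

lemma cl_approx:
  assumes d: "d \<in> hcar D"
  obtains A where "\<And>n::nat. A n \<in> M" "(\<lambda>n. hdist D (cl (A n)) d) \<longlonglongrightarrow> 0"
proof -
  have z0: "hzero D = cl (oscale H H 0 (oid H))"
  proof (rule total_eqI[OF D_hilbert cl_total])
    fix d assume "d \<in> cl ` M"
    then obtain C where C: "C \<in> M" "d = cl C" by auto
    have "kz C (oscale H H 0 (oid H)) = 0" unfolding kz_def using Az[OF C(1)] HS by (simp add: zero_op[OF H zc] del: oscale_apply)
    then show "hinner D d (hzero D) = hinner D d (cl (oscale H H 0 (oid H)))"
      using DS cl_car[OF C(1)] by (simp add: C cl_inner M_scale[OF M_oid])
  qed (use DS cl_car[OF M_scale[OF M_oid]] in auto)
  have add: "hadd D (cl A) (cl C) = cl (oadd H H A C)" if A: "A \<in> M" and C: "C \<in> M" for A C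
  proof (rule total_eqI[OF D_hilbert cl_total])
    fix d assume "d \<in> cl ` M"
    then obtain E where E: "E \<in> M" "d = cl E" by auto
    have "kz E (oadd H H A C) = kz E A + kz E C"
      using sums_add[OF kz_sums[OF E(1) A] kz_sums[OF E(1) C]]
      by (intro sums_unique2[OF kz_sums[OF E(1) M_add[OF A C]]]) (simp add: zc HS Az[OF E(1)] Az[OF A] Az[OF C])
    then show "hinner D d (hadd D (cl A) (cl C)) = hinner D d (cl (oadd H H A C))"
      using DS cl_car[OF E(1)] cl_car[OF A] cl_car[OF C] by (simp add: E cl_inner A C M_add[OF A C])
  qed (use DS cl_car[OF A] cl_car[OF C] cl_car[OF M_add[OF A C]] in auto)
  have scale: "hscale D c (cl A) = cl (oscale H H c A)" if A: "A \<in> M" for A c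
  proof (rule total_eqI[OF D_hilbert cl_total])
    fix d assume "d \<in> cl ` M"
    then obtain E where E: "E \<in> M" "d = cl E" by auto
    have "kz E (oscale H H c A) = c * kz E A"
      using sums_mult[OF kz_sums[OF E(1) A], of c]
      by (intro sums_unique2[OF kz_sums[OF E(1) M_scale[OF A]]]) (simp add: zc HS Az[OF E(1)] Az[OF A])
    then show "hinner D d (hscale D c (cl A)) = hinner D d (cl (oscale H H c A))"
      using DS cl_car[OF E(1)] cl_car[OF A] by (simp add: E cl_inner A M_scale[OF A])
  qed (use DS cl_car[OF A] cl_car[OF M_scale[OF A]] in auto)
  obtain v where v: "\<And>n. v n \<in> cl ` M" "(\<lambda>n. hdist D (v n) d) \<longlonglongrightarrow> 0"
  proof (rule total_approx[OF D_hilbert cl_total _ _ _ d])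
    show "hzero D \<in> cl ` M" unfolding z0 by (intro imageI M_scale M_oid)
    show "hadd D x y \<in> cl ` M" if xy: "x \<in> cl ` M" "y \<in> cl ` M" for x y
    proof -
      obtain A C where "A \<in> M" "C \<in> M" "x = cl A" "y = cl C" using xy by auto
      then show ?thesis by (simp add: add M_add)
    qed
    show "hscale D c x \<in> cl ` M" if x: "x \<in> cl ` M" for c x
    proof -
      obtain A where "A \<in> M" "x = cl A" using x by auto
      then show ?thesis by (simp add: scale M_scale)
    qed
  qed (rule that)
  have "\<forall>n. \<exists>A. A \<in> M \<and> v n = cl A" using v(1) by blast
  from choice[OF this] obtain A where "\<forall>n. A n \<in> M \<and> v n = cl (A n)" ..
  then show ?thesis using v(2) by (intro that[of A]) auto
qed

text \<open>The series \<open>\<Sum> \<langle>z\<^sub>i, J\<^sub>i d\<rangle>\<close> represents \<open>\<langle>[1], d\<rangle>\<close>: for \<open>d = [A]\<close> its tail is bounded by means of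
  \<open>\<bar>\<langle>x, y\<rangle>\<bar> \<le> (l \<parallel>x\<parallel>\<^sup>2 + \<parallel>y\<parallel>\<^sup>2 / l) / 2\<close>, and the bound survives the passage to limits since it involves the
  norm of \<open>d\<close> only.\<close>

lemma tail_bound:
  assumes d: "d \<in> hcar D" and l: "0 < l"
  shows "cmod (hinner D (cl (oid H)) d - (\<Sum>i<N. hinner H (z i) (J i d)))
    \<le> (l * (\<Sum>i. (hnorm H (z (i + N)))\<^sup>2) + (hnorm D d)\<^sup>2 / l) / 2" (is "?L d \<le> ?R d")
proof -
  have cl: "?L (cl A) \<le> ?R (cl A)" if A: "A \<in> M" for A
  proof -
    let ?f = "\<lambda>i. hinner H (z i) (A (z i))"
    have f: "?f sums hinner D (cl (oid H)) (cl A)"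
      using kz_sums[OF M_oid A] zc by (simp add: cl_inner[OF M_oid A])
    have sz: "summable (\<lambda>i. (hnorm H (z i))\<^sup>2)" and sA: "summable (\<lambda>i. (hnorm H (A (z i)))\<^sup>2)"
      using z Az_sq[OF A] by (auto simp: sq_summable_def)
    have szN: "summable (\<lambda>i. (hnorm H (z (i + N)))\<^sup>2)" and sAN: "summable (\<lambda>i. (hnorm H (A (z (i + N))))\<^sup>2)"
      by (rule summable_ignore_initial_segment[OF sz], rule summable_ignore_initial_segment[OF sA])
    have dN: "(\<Sum>i. (hnorm H (A (z (i + N))))\<^sup>2) \<le> (hnorm D (cl A))\<^sup>2"
    proof -
      have "(\<Sum>i. (hnorm H (A (z i)))\<^sup>2) = (\<Sum>i. (hnorm H (A (z (i + N))))\<^sup>2) + (\<Sum>i<N. (hnorm H (A (z i)))\<^sup>2)"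
        by (rule suminf_split_initial_segment[OF sA])
      moreover have "0 \<le> (\<Sum>i<N. (hnorm H (A (z i)))\<^sup>2)" by (intro sum_nonneg) simp
      moreover have "(hnorm D (cl A))\<^sup>2 = (\<Sum>i. (hnorm H (A (z i)))\<^sup>2)"
        by (simp add: hnorm_sq[OF DS cl_car[OF A]] cl_inner[OF A A] kz_self[OF A])
      ultimately show ?thesis by simp
    qed
    have le: "cmod (?f i) \<le> (l * (hnorm H (z i))\<^sup>2 + (hnorm H (A (z i)))\<^sup>2 / l) / 2" for i
    proof -
      have "cmod (?f i) \<le> hnorm H (z i) * hnorm H (A (z i))" by (rule hinner_Cauchy_Schwarz[OF HS zc Az[OF A]])
      also have "\<dots> \<le> (l * (hnorm H (z i))\<^sup>2 + (hnorm H (A (z i)))\<^sup>2 / l) / 2"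
      proof -
        have "0 \<le> (l * hnorm H (z i) - hnorm H (A (z i)))\<^sup>2 / l" using l by simp
        also have "\<dots> = l * (hnorm H (z i))\<^sup>2 + (hnorm H (A (z i)))\<^sup>2 / l - 2 * (hnorm H (z i) * hnorm H (A (z i)))"
          using l by (simp add: power2_diff field_simps power2_eq_square)
        finally show ?thesis by simp
      qed
      finally show ?thesis .
    qed
    have sR: "summable (\<lambda>i. (l * (hnorm H (z (i + N)))\<^sup>2 + (hnorm H (A (z (i + N))))\<^sup>2 / l) / 2)"
      by (intro summable_divide summable_add summable_mult szN sAN)
    have sf: "summable (\<lambda>i. cmod (?f (i + N)))"
      by (rule summable_comparison_test'[OF sR, of 0]) (use le in simp)
    have "hinner D (cl (oid H)) (cl A) - (\<Sum>i<N. ?f i) = (\<Sum>i. ?f (i + N))"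
      using suminf_split_initial_segment[OF sums_summable[OF f], of N] sums_unique[OF f] by simp
    then have "?L (cl A) = cmod (\<Sum>i. ?f (i + N))" by (simp add: J_cl[OF A])
    also have "\<dots> \<le> (\<Sum>i. cmod (?f (i + N)))" by (rule summable_norm[OF sf])
    also have "\<dots> \<le> (\<Sum>i. (l * (hnorm H (z (i + N)))\<^sup>2 + (hnorm H (A (z (i + N))))\<^sup>2 / l) / 2)"
      by (rule suminf_le[OF le sf sR])
    also have "\<dots> = (l * (\<Sum>i. (hnorm H (z (i + N)))\<^sup>2) + (\<Sum>i. (hnorm H (A (z (i + N))))\<^sup>2) / l) / 2"
      using szN sAN by (simp add: suminf_divide summable_add summable_mult summable_divide suminf_add[symmetric] suminf_mult)
    also have "\<dots> \<le> ?R (cl A)" using dN l by (intro divide_right_mono add_left_mono) auto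
    finally show ?thesis .
  qed
  obtain A where A: "\<And>n::nat. A n \<in> M" "(\<lambda>n. hdist D (cl (A n)) d) \<longlonglongrightarrow> 0"
    by (rule cl_approx[OF d], rule that)
  have in_lim: "(\<lambda>n. hinner D c (cl (A n))) \<longlonglongrightarrow> hinner D c d" if c: "c \<in> hcar D" for c
    by (rule hinner_tendsto[OF DS]) (use c d DS cl_car[OF A(1)] A(2) in auto)
  have "(\<lambda>n. hinner H (z i) (J i (cl (A n)))) \<longlonglongrightarrow> hinner H (z i) (J i d)" for i
    using in_lim[OF hadj_car[OF D_hilbert H J_bop[of i] zc[of i]]]
    by (simp add: hadj_left[OF D_hilbert H J_bop _ zc] cl_car[OF A(1)] d)
  then have "(\<lambda>n. ?L (cl (A n))) \<longlonglongrightarrow> ?L d"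
    by (intro tendsto_norm tendsto_diff in_lim cl_car[OF M_oid] tendsto_sum)
  moreover have "(\<lambda>n. ?R (cl (A n))) \<longlonglongrightarrow> ?R d"
    by (intro tendsto_intros hnorm_tendsto[OF DS]) (use d cl_car[OF A(1)] A(2) l in auto)
  ultimately show ?thesis by (rule LIMSEQ_le) (use cl[OF A(1)] in blast)
qed

text \<open>If \<open>w\<close> is orthogonal to the ranges of the operators \<open>B J\<^sub>i\<^sup>*\<close>, then \<open>J\<^sub>i B\<^sup>* w = 0\<close> for all \<open>i\<close>. Hence
  \<open>\<langle>[1], B\<^sup>* w\<rangle> = 0\<close>, where \<open>B [1]\<close> is the unit vector.\<close>

lemma unt_orthogonal:
  assumes w: "w \<in> hcar (LS t)" and o: "\<And>X h. X \<in> inter t \<Longrightarrow> h \<in> hcar H \<Longrightarrow> hinner (LS t) (X h) w = 0"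
  shows "hinner (LS t) u w = 0"
proof -
  define d where "d = hadj D (LS t) B w"
  have d: "d \<in> hcar D" unfolding d_def by (rule hadj_car[OF D_hilbert LS_hilbert B_bop w])
  have J0: "J i d = hzero H" for i
  proof (rule hilbert_eqI[OF H bop_car[OF J_bop d] hzero_car[OF HS]])
    fix h assume h: "h \<in> hcar H"
    note Jh = hadj_car[OF D_hilbert H J_bop h, of i]
    have "hinner H h (J i d) = hinner D (hadj D H (J i) h) d"
      by (rule hadj_left[OF D_hilbert H J_bop d h, symmetric])
    also have "\<dots> = hinner (LS t) (B (hadj D H (J i) h)) w"
      unfolding d_def by (rule hadj_right[OF D_hilbert LS_hilbert B_bop Jh w])
    also have "\<dots> = 0" using o[OF X_inter h, of i] h by simp
    finally show "hinner H h (J i d) = hinner H h (hzero H)" using h HS by simp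
  qed
  have "cmod (hinner D (cl (oid H)) d) \<le> 0 + e" if e: "0 < e" for e
  proof -
    \<comment> \<open>A large weight \<open>l\<close> makes the second term of the tail bound small, then a large \<open>N\<close> the first.\<close>
    define l where "l = ((hnorm D d)\<^sup>2 + 1) / e"
    have l: "0 < l" using e by (simp add: l_def add_nonneg_pos)
    have l2: "(hnorm D d)\<^sup>2 / l \<le> e"
    proof -
      have "(hnorm D d)\<^sup>2 \<le> e * l" using e by (simp add: l_def)
      then show ?thesis using l by (simp add: pos_divide_le_eq)
    qed
    have sz: "summable (\<lambda>i. (hnorm H (z i))\<^sup>2)" using z by (simp add: sq_summable_def)
    have el: "0 < e / l" using e l by simp
    obtain N where N: "\<And>n. n \<ge> N \<Longrightarrow> norm (\<Sum>i. (hnorm H (z (i + n)))\<^sup>2) < e / l"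
      using suminf_exist_split[OF el sz] by blast
    have "(\<Sum>i. (hnorm H (z (i + N)))\<^sup>2) < e / l"
      using N[of N] unfolding real_norm_def by linarith
    then have "l * (\<Sum>i. (hnorm H (z (i + N)))\<^sup>2) \<le> e"
      using l by (simp add: pos_less_divide_eq mult.commute)
    then show ?thesis using tail_bound[OF d l, of N] l2 J0 HS zc by simp
  qed
  then have "cmod (hinner D (cl (oid H)) d) \<le> 0" by (rule field_le_epsilon)
  then have "hinner D (cl (oid H)) d = 0" by simp
  moreover have "hinner D (cl (oid H)) d = hinner (LS t) (la t (oid H) u) w"
    unfolding d_def B_cl[OF M_oid, symmetric] by (rule hadj_right[OF D_hilbert LS_hilbert B_bop cl_car[OF M_oid] w])
  moreover have "la t (oid H) u = u"
    unfolding unt_def la_elt[OF t M_oid unt_partition[OF t] unt_gens[OF t k]]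
    unfolding lmul_oid[of "\<lambda>r. oid H", OF M_oid] ..
  ultimately show ?thesis by simp
qed

end

text \<open>Normality of \<open>P\<^sub>t\<close> supplies the sequence \<open>z\<close> that dominates the functional \<open>\<langle>k, P\<^sub>t(A\<^sup>* A) k\<rangle>\<close>.\<close>

lemma (in cp_data) unt_approximated:
  assumes t: "0 < t" and k: "k \<in> hcar H" and w: "w \<in> hcar (LS t)"
    and o: "\<And>X h. X \<in> inter t \<Longrightarrow> h \<in> hcar H \<Longrightarrow> hinner (LS t) (X h) w = 0"
  shows "hinner (LS t) (unt t k) w = 0"
proof -
  have t0: "0 \<le> t" using t by simp
  obtain z where z: "sq_summable H z"
    "\<And>A. A \<in> M \<Longrightarrow> cmod (hinner H k (P t (ocomp H (hadj H H A) A) k)) \<le> (\<Sum>n. (hnorm H (A (z n)))\<^sup>2)"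
    by (rule normal_map_bound[OF H M_star P_normal[OF t0] P_M[OF t0] P_scale[OF t0] k], assumption, assumption, rule that)
  interpret C: cyclic_space H M P z t k
    by unfold_locales (use z t k in auto)
  show ?thesis by (rule C.unt_orthogonal[OF w]) (rule o)
qed

section \<open>The dilation formula\<close>

text \<open>Two families of vectors with the same Gram matrix generate isomorphic spaces. A vector in the closed
  span of the first family and one of the same norm with the same coefficients against the second
  correspond to each other, hence so do the matrix elements of operators that agree on the families.\<close>

lemma gram_transfer:
  assumes G1: "hilbert_space G1" and G2: "hilbert_space G2"
    and a: "\<And>x. x \<in> I \<Longrightarrow> a x \<in> hcar G1" and b: "\<And>x. x \<in> I \<Longrightarrow> b x \<in> hcar G2"
    and gram: "\<And>x y. x \<in> I \<Longrightarrow> y \<in> I \<Longrightarrow> hinner G1 (a x) (a y) = hinner G2 (b x) (b y)"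
    and A: "A \<in> bop G1 G1" and B: "B \<in> bop G2 G2"
    and op: "\<And>x y. x \<in> I \<Longrightarrow> y \<in> I \<Longrightarrow> hinner G1 (a x) (A (a y)) = hinner G2 (b x) (B (b y))"
    and vec: "\<And>v v' x. (v, v') \<in> {(v1, v1'), (v2, v2')} \<Longrightarrow> x \<in> I \<Longrightarrow> hinner G1 (a x) v = hinner G2 (b x) v'"
    and car: "v1 \<in> hcar G1" "v2 \<in> hcar G1" "v1' \<in> hcar G2" "v2' \<in> hcar G2"
    and nrm: "hnorm G1 v1 = hnorm G2 v1'" "hnorm G1 v2 = hnorm G2 v2'"
    and appr: "\<And>v w. v \<in> {v1, v2} \<Longrightarrow> w \<in> hcar G1 \<Longrightarrow> (\<And>x. x \<in> I \<Longrightarrow> hinner G1 (a x) w = 0) \<Longrightarrow> hinner G1 v w = 0"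
  shows "hinner G1 v1 (A v2) = hinner G2 v1' (B v2')"
proof -
  note S1 = hilbert_semi[OF G1] and S2 = hilbert_semi[OF G2]
  define k where "k x y = hinner G1 (a x) (a y)" for x y
  have k: "psd I k" unfolding k_def[abs_def] by (rule psd_pullback[OF psd_hinner[OF G1] a])
  let ?Q = "kspace I k"
  note Q = kspace_hilbert[OF k]
  note SQ = hilbert_semi[OF Q]
  have d1: "psd I (\<lambda>x y. of_real (1\<^sup>2) * k x y - hinner G1 (a x) (a y))"
    using psd_zero by (subst psd_cong[where k'="\<lambda>x y. 0"]) (simp_all add: k_def)
  have d2: "psd I (\<lambda>x y. of_real (1\<^sup>2) * k x y - hinner G2 (b x) (b y))"
    using psd_zero by (subst psd_cong[where k'="\<lambda>x y. 0"]) (simp_all add: k_def gram)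
  have one: "(0::real) \<le> 1" by simp
  define p where "p = kext I k G1 a"
  define q where "q = kext I k G2 b"
  have p: "p \<in> bop ?Q G1" and pg: "\<And>x. x \<in> I \<Longrightarrow> p (kgen I k x) = a x"
    unfolding p_def by (rule kext_bop[OF k G1 a one d1], assumption) (rule kext_gen[OF k G1 a one d1])
  have q: "q \<in> bop ?Q G2" and qg: "\<And>x. x \<in> I \<Longrightarrow> q (kgen I k x) = b x"
    unfolding q_def by (rule kext_bop[OF k G2 b one d2], assumption) (rule kext_gen[OF k G2 b one d2])
  note gc = kgen_car[OF k] and tot = kgen_total[OF k]
  have piso: "hinner G1 (p u) (p v) = hinner ?Q u v" if "u \<in> hcar ?Q" "v \<in> hcar ?Q" for u v
  proof -
    have "hinner G1 (p u) (p v) = hinner ?Q u (oid ?Q v)"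
      by (rule total_sesq_eqI[OF Q Q G1 tot tot p p oid_bop[OF SQ] _ that]) (auto simp: pg gc kgen_inner[OF k] k_def)
    then show ?thesis using that by simp
  qed
  have qiso: "hinner G2 (q u) (q v) = hinner ?Q u v" if "u \<in> hcar ?Q" "v \<in> hcar ?Q" for u v
  proof -
    have "hinner G2 (q u) (q v) = hinner ?Q u (oid ?Q v)"
      by (rule total_sesq_eqI[OF Q Q G2 tot tot q q oid_bop[OF SQ] _ that]) (auto simp: qg gc kgen_inner[OF k] k_def gram)
    then show ?thesis using that by simp
  qed
  \<comment> \<open>Both closed spans are isometric images of \<open>Q\<close>. The point \<open>c = p\<^sup>* v = q\<^sup>* v'\<close> has the norm of \<open>v\<close>, because \<open>v\<close> is in the
  span; it has the norm of \<open>v'\<close> as well, hence \<open>v'\<close> is in the other span.\<close>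
  have lift: "\<exists>c\<in>hcar ?Q. p c = v \<and> q c = v'"
    if v: "v \<in> hcar G1" "v' \<in> hcar G2" "hnorm G1 v = hnorm G2 v'"
      and co: "\<And>x. x \<in> I \<Longrightarrow> hinner G1 (a x) v = hinner G2 (b x) v'"
      and ap: "\<And>w. w \<in> hcar G1 \<Longrightarrow> (\<And>x. x \<in> I \<Longrightarrow> hinner G1 (a x) w = 0) \<Longrightarrow> hinner G1 v w = 0" for v v'
  proof -
    define c where "c = hadj ?Q G1 p v"
    have c: "c \<in> hcar ?Q" unfolding c_def by (rule hadj_car[OF Q G1 p v(1)])
    note pc = bop_car[OF p c] and qc = bop_car[OF q c]
    have cq: "c = hadj ?Q G2 q v'"
    proof (rule total_eqI[OF Q tot c hadj_car[OF Q G2 q v(2)]])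
      fix d assume "d \<in> kgen I k ` I"
      then obtain x where x: "x \<in> I" "d = kgen I k x" by auto
      show "hinner ?Q d c = hinner ?Q d (hadj ?Q G2 q v')"
        unfolding x(2) c_def hadj_right[OF Q G1 p gc[OF x(1)] v(1)] hadj_right[OF Q G2 q gc[OF x(1)] v(2)] pg[OF x(1)] qg[OF x(1)]
        by (rule co[OF x(1)])
    qed
    let ?r = "hsub G1 v (p c)"
    have r: "?r \<in> hcar G1" using S1 v pc by simp
    have o: "hinner G1 (a x) ?r = 0" if x: "x \<in> I" for x
    proof -
      have "hinner G1 (a x) (p c) = hinner ?Q (kgen I k x) c" using piso[OF gc[OF x] c] pg[OF x] by simp
      also have "\<dots> = hinner G1 (a x) v" unfolding c_def hadj_right[OF Q G1 p gc[OF x] v(1)] pg[OF x] ..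
      finally show ?thesis using S1 v pc a[OF x] by simp
    qed
    have "hinner G1 v ?r = 0" by (rule ap[OF r o])
    moreover have "hinner G1 (p c) ?r = 0"
      by (rule total_image_orth[OF Q G1 tot p r _ c]) (auto simp: pg o)
    ultimately have "hinner G1 ?r ?r = 0"
      using hinner_add_left[OF S1 v(1) hscale_car[OF S1 pc] r, of "-1"] hinner_scale_left[OF S1 pc r, of "-1"]
      by (simp del: hinner_add_right hinner_scale_right hinner_add_left hinner_scale_left)
    then have pv: "v = p c" by (rule hilbert_eqI_sub[OF G1 v(1) pc])
    have n: "hinner G2 v' v' = hinner ?Q c c"
    proof -
      have "hinner G2 v' v' = hinner G1 v v" unfolding hinner_self[OF S1 v(1)] hinner_self[OF S2 v(2)] v(3) ..
      then show ?thesis using piso[OF c c] pv by simp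
    qed
    have m: "hinner G2 (q c) v' = hinner ?Q c c"
      using hadj_right[OF Q G2 q c v(2)] cq by simp
    have m': "hinner G2 v' (q c) = hinner ?Q c c"
      using hinner_commute[OF S2 qc v(2)] m hinner_commute[OF SQ c c] by simp
    have "hinner G2 (hsub G2 v' (q c)) (hsub G2 v' (q c)) = 0"
      using S2 v qc n m m' qiso[OF c c] by simp
    then have "v' = q c" by (rule hilbert_eqI_sub[OF G2 v(2) qc])
    with c pv show ?thesis by auto
  qed
  obtain c where c: "c \<in> hcar ?Q" "p c = v1" "q c = v1'"
    using lift[OF car(1,3) nrm(1)] vec[of v1 v1'] appr[of v1] by auto
  obtain e where e: "e \<in> hcar ?Q" "p e = v2" "q e = v2'"
    using lift[OF car(2,4) nrm(2)] vec[of v2 v2'] appr[of v2] by auto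
  let ?C = "ocomp ?Q (hadj ?Q G2 q) (ocomp ?Q B q)"
  have Bq: "ocomp ?Q B q \<in> bop ?Q G2" by (rule ocomp_bop[OF SQ S2 B q])
  have C: "?C \<in> bop ?Q ?Q" by (rule ocomp_bop[OF SQ S2 hadj_bop[OF Q G2 q] Bq])
  have Cx: "hinner ?Q x (?C y) = hinner G2 (q x) (B (q y))" if "x \<in> hcar ?Q" "y \<in> hcar ?Q" for x y
    using hadj_right[OF Q G2 q that(1) bop_car[OF B bop_car[OF q that(2)]]] that by simp
  have "hinner G1 (p c) (ocomp ?Q A p e) = hinner ?Q c (?C e)"
  proof (rule total_sesq_eqI[OF Q Q G1 tot tot p ocomp_bop[OF SQ S1 A p] C _ c(1) e(1)])
    fix d d' assume "d \<in> kgen I k ` I" "d' \<in> kgen I k ` I"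
    then obtain x y where x: "x \<in> I" "d = kgen I k x" and y: "y \<in> I" "d' = kgen I k y" by auto
    show "hinner G1 (p d) (ocomp ?Q A p d') = hinner ?Q d (?C d')"
      unfolding x(2) y(2) Cx[OF gc[OF x(1)] gc[OF y(1)]] using op[OF x(1) y(1)] gc[OF y(1)]
      by (simp add: pg qg x(1) y(1))
  qed
  then show ?thesis unfolding Cx[OF c(1) e(1)] using c e by simp
qed

locale dilation = cp_data H M P for H :: "'h hspace" and M P +
  fixes K :: "'k hspace" and u0 :: "'h \<Rightarrow> 'k" and V :: "real \<Rightarrow> 'h fpoint \<Rightarrow> 'k \<Rightarrow> 'k"
  assumes V: "minimal_isometric_dilation H (commutant H M) (cp_prodsys H M P) H (identity_rep H M P) V u0 K"
begin

abbreviation "E \<equiv> cp_prodsys H M P"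
abbreviation "N \<equiv> commutant H M"

lemma fibre_pos:
  assumes "0 < t"
  shows "ecar (pfib E t) = Inr ` inter t"
    and "einner (pfib E t) (Inr X) (Inr Y) = ocomp H (hadj H (LS t) X) Y"
    and "elact (pfib E t) R (Inr X) = Inr (ocomp H (ca t R) X)"
    and "eract (pfib E t) (Inr X) R = Inr (ocomp H X R)"
  using assms by (simp_all add: cp_prodsys_def cp_fibre_def corr_transport_def intertwiner_corr_def inter_def)

lemma fibre_0:
  "ecar (pfib E 0) = Inl ` N" "einner (pfib E 0) (Inl a) (Inl b) = ocomp H (hadj H H a) b"
  "elact (pfib E 0) a (Inl b) = Inl (ocomp H a b)"
  by (simp_all add: cp_prodsys_def cp_fibre_def corr_transport_def trivial_corr_def)

lemma pmul_eq: "pmul E t s \<xi> \<eta> =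
    (if t = 0 then elact (pfib E s) (projl \<xi>) \<eta>
     else if s = 0 then eract (pfib E t) \<xi> (projl \<eta>)
     else Inr (ocomp H (shift_tensor H M P t s (projr \<xi>)) (projr \<eta>)))"
  by (simp add: cp_prodsys_def)

lemma pmul_closed:
  assumes t: "0 \<le> t" and s: "0 \<le> s" and \<xi>: "\<xi> \<in> ecar (pfib E t)" and \<eta>: "\<eta> \<in> ecar (pfib E s)"
  shows "pmul E t s \<xi> \<eta> \<in> ecar (pfib E (t + s))"
proof (cases "t = 0")
  case True
  then obtain a where a: "a \<in> N" "\<xi> = Inl a" using \<xi> by (auto simp: fibre_0)
  show ?thesis
  proof (cases "s = 0")
    case s0: True
    then obtain b where b: "b \<in> N" "\<eta> = Inl b" using \<eta> by (auto simp: fibre_0)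
    show ?thesis using True s0 star_algebraD(3)[OF N_star a(1) b(1)] by (simp add: pmul_eq a b fibre_0)
  next
    case False
    then have s': "0 < s" using s by simp
    then obtain X where X: "X \<in> inter s" "\<eta> = Inr X" using \<eta> by (auto simp: fibre_pos)
    show ?thesis using True inter_ca[OF s' X(1) a(1)] by (simp add: pmul_eq a X fibre_pos[OF s'])
  qed
next
  case False
  then have t': "0 < t" using t by simp
  then obtain X where X: "X \<in> inter t" "\<xi> = Inr X" using \<xi> by (auto simp: fibre_pos)
  show ?thesis
  proof (cases "s = 0")
    case s0: True
    then obtain b where b: "b \<in> N" "\<eta> = Inl b" using \<eta> by (auto simp: fibre_0)
    show ?thesis using s0 t' inter_ract[OF X(1) b(1)] by (simp add: pmul_eq b X fibre_pos[OF t'])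
  next
    case False
    then have s': "0 < s" using s by simp
    then obtain Y where Y: "Y \<in> inter s" "\<eta> = Inr Y" using \<eta> by (auto simp: fibre_pos)
    have "0 < t + s" using t' s' by simp
    then show ?thesis using t' s' inter_mult[OF t' s' X(1) Y(1)] by (simp add: pmul_eq X Y fibre_pos)
  qed
qed

lemma K_hilbert: "hilbert_space K"
  and u0: "u0 \<in> bop H K"
  and u0_inner: "x \<in> hcar H \<Longrightarrow> y \<in> hcar H \<Longrightarrow> hinner K (u0 x) (u0 y) = hinner H x y"
  and V_cov: "covariant_rep H N E K V" and V_iso: "isometric_rep E K V" and V_coiso: "fully_coisometric_rep E K V"
  and V_compress: "0 \<le> t \<Longrightarrow> \<xi> \<in> ecar (pfib E t) \<Longrightarrow>
    ocomp H (hadj H K u0) (ocomp H (V t \<xi>) u0) = identity_rep H M P t \<xi>"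
  and V_invariant: "0 \<le> t \<Longrightarrow> \<xi> \<in> ecar (pfib E t) \<Longrightarrow> hadj K K (V t \<xi>) ` (u0 ` hcar H) \<subseteq> u0 ` hcar H"
  using V unfolding minimal_isometric_dilation_def by simp_all

sublocale rep: coisometric_representation H N E K V
proof
  show "hilbert_space H" by (rule H)
  show "star_algebra H N" by (rule N_star)
  show "hilbert_space K" by (rule K_hilbert)
  show "covariant_rep H N E K V" by (rule V_cov)
  show "isometric_rep E K V" by (rule V_iso)
  show "fully_coisometric_rep E K V" by (rule V_coiso)
  show "ecar (pfib E 0) = pzero E ` N" unfolding fibre_0 by (simp add: cp_prodsys_def)
  show "pmul E t s \<xi> \<eta> \<in> ecar (pfib E (t + s))"
    if "0 \<le> t" "0 \<le> s" "\<xi> \<in> ecar (pfib E t)" "\<eta> \<in> ecar (pfib E s)" for t s \<xi> \<eta>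
    by (rule pmul_closed[OF that])
  fix t \<xi> \<eta> assume t: "0 \<le> (t::real)" and \<xi>: "\<xi> \<in> ecar (pfib E t)" and \<eta>: "\<eta> \<in> ecar (pfib E t)"
  show "einner (pfib E t) \<xi> \<eta> \<in> N"
  proof (cases "t = 0")
    case True
    then show ?thesis using \<xi> \<eta> star_algebraD(3,6)[OF N_star] by (auto simp: fibre_0)
  next
    case False
    then have t': "0 < t" using t by simp
    then show ?thesis using \<xi> \<eta> inter_einner[OF t'] by (auto simp: fibre_pos)
  qed
qed

lemmas KS = hilbert_semi[OF K_hilbert]
lemmas u0_car = bop_car[OF u0]

abbreviation "ua \<equiv> hadj H K u0"

lemma ua_car: "y \<in> hcar K \<Longrightarrow> ua y \<in> hcar H"
  by (rule hadj_car[OF H K_hilbert u0])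

lemma ua_right: "h \<in> hcar H \<Longrightarrow> y \<in> hcar K \<Longrightarrow> hinner H h (ua y) = hinner K (u0 h) y"
  by (rule hadj_right[OF H K_hilbert u0])

lemma ua_u0: "h \<in> hcar H \<Longrightarrow> ua (u0 h) = h"
  by (rule hilbert_eqI[OF H]) (simp_all add: ua_car u0_car ua_right u0_inner)

lemma rho_eq: "rep.rho a = V 0 (Inl a)"
  unfolding rep.rho_def by (simp add: cp_prodsys_def)

text \<open>The adjoint of \<open>V\<^sub>0(a\<^sup>*)\<close> is \<open>\<rho>(a)\<close>, so \<open>u\<^sub>0 H\<close> is invariant under \<open>\<rho>(a)\<close>, whose compression to it is \<open>a\<close>.\<close>

lemma rho_u0:
  assumes a: "a \<in> N" and h: "h \<in> hcar H" shows "rep.rho a (u0 h) = u0 (a h)"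
proof -
  have aa: "hadj H H a \<in> N" by (rule star_algebraD(6)[OF N_star a])
  have ax: "Inl a \<in> ecar (pfib E 0)" "Inl (hadj H H a) \<in> ecar (pfib E 0)" using a aa by (auto simp: fibre_0)
  have "hadj K K (rep.rho (hadj H H a)) = rep.rho a"
    using rep.rho_hadj[OF aa] hadj_hadj[OF H H commutant_bop[OF a]] by simp
  moreover have "hadj K K (V 0 (Inl (hadj H H a))) (u0 h) \<in> u0 ` hcar H"
    using V_invariant[OF order_refl ax(2)] h by blast
  ultimately have "rep.rho a (u0 h) \<in> u0 ` hcar H" by (simp add: rho_eq)
  then obtain h' where h': "h' \<in> hcar H" "rep.rho a (u0 h) = u0 h'" by auto
  have "ocomp H ua (ocomp H (V 0 (Inl a)) u0) = a" using V_compress[OF order_refl ax(1)] by (simp add: identity_rep_def)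
  then have "ocomp H ua (ocomp H (V 0 (Inl a)) u0) h = a h" by simp
  then have "ua (rep.rho a (u0 h)) = a h" using h by (simp add: rho_eq)
  then show ?thesis using h' ua_u0 by simp
qed

lemma ua_rho:
  assumes a: "a \<in> N" and y: "y \<in> hcar K" shows "ua (rep.rho a y) = a (ua y)"
proof -
  have aa: "hadj H H a \<in> N" by (rule star_algebraD(6)[OF N_star a])
  note rb = rep.rho_bop[OF a] and ab = commutant_bop[OF a]
  show ?thesis
  proof (rule hilbert_eqI[OF H ua_car[OF bop_car[OF rb y]] bop_car[OF ab ua_car[OF y]]])
    fix d assume d: "d \<in> hcar H"
    have "hinner H d (ua (rep.rho a y)) = hinner K (u0 d) (rep.rho a y)" by (rule ua_right[OF d bop_car[OF rb y]])
    also have "\<dots> = hinner K (rep.rho (hadj H H a) (u0 d)) y"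
      unfolding rep.rho_hadj[OF a] by (rule hadj_left[OF K_hilbert K_hilbert rb y u0_car[OF d], symmetric])
    also have "\<dots> = hinner K (u0 (hadj H H a d)) y" unfolding rho_u0[OF aa d] ..
    also have "\<dots> = hinner H (hadj H H a d) (ua y)"
      by (rule ua_right[OF hadj_car[OF H H ab d] y, symmetric])
    also have "\<dots> = hinner H d (a (ua y))" by (rule hadj_left[OF H H ab ua_car[OF y] d])
    finally show "hinner H d (ua (rep.rho a y)) = hinner H d (a (ua y))" .
  qed
qed

lemma compress_bop: "S \<in> bop K K \<Longrightarrow> ocomp H ua (ocomp H S u0) \<in> bop H H"
  by (rule ocomp_bop[OF HS KS hadj_bop[OF H K_hilbert u0] ocomp_bop[OF HS KS _ u0]])

text \<open>The compression commutes with the commutant of \<open>M\<close>.\<close>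

lemma compress_M:
  assumes S: "S \<in> rep.R" shows "ocomp H ua (ocomp H S u0) \<in> M"
proof (rule von_neumannI[OF M compress_bop[OF rep.R_bop[OF S]]])
  fix a h assume a: "a \<in> N" and h: "h \<in> hcar H"
  note ah = bop_car[OF commutant_bop[OF a] h]
  have "ua (S (u0 (a h))) = ua (rep.rho a (S (u0 h)))"
    unfolding rho_u0[OF a h, symmetric] rep.R_commute[OF S a u0_car[OF h]] ..
  also have "\<dots> = a (ua (S (u0 h)))" by (rule ua_rho[OF a bop_car[OF rep.R_bop[OF S] u0_car[OF h]]])
  finally show "ocomp H ua (ocomp H S u0) (a h) = a (ocomp H ua (ocomp H S u0) h)" using h ah by simp
qed

lemma lift_R:
  assumes A: "A \<in> M" shows "ocomp K u0 (ocomp K A ua) \<in> rep.R"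
  unfolding rep.R_def
proof (rule commutantI)
  show "ocomp K u0 (ocomp K A ua) \<in> bop K K"
    by (rule ocomp_bop[OF KS HS u0 ocomp_bop[OF KS HS M_bop[OF A] hadj_bop[OF H K_hilbert u0]]])
  fix b y assume "b \<in> rep.rho ` N" and y: "y \<in> hcar K"
  then obtain a where a: "a \<in> N" "b = rep.rho a" by auto
  note Au = bop_car[OF M_bop[OF A] ua_car[OF y]]
  have "u0 (A (ua (rep.rho a y))) = u0 (a (A (ua y)))"
    unfolding ua_rho[OF a(1) y] using commutant_M[OF a(1) A ua_car[OF y]] by simp
  also have "\<dots> = rep.rho a (u0 (A (ua y)))" by (rule rho_u0[OF a(1) Au, symmetric])
  finally show "ocomp K u0 (ocomp K A ua) (b y) = b (ocomp K u0 (ocomp K A ua) y)"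
    using y bop_car[OF rep.rho_bop[OF a(1)] y] by (simp add: a)
qed

lemma compress_lift:
  assumes A: "A \<in> M" shows "ocomp H ua (ocomp H (ocomp K u0 (ocomp K A ua)) u0) = A"
  by (rule bop_eqI[OF compress_bop[OF rep.R_bop[OF lift_R[OF A]]] M_bop[OF A]])
    (simp add: u0_car ua_u0 bop_car[OF M_bop[OF A]])

text \<open>The vectors \<open>V\<^sub>t(X) u\<^sub>0 h\<close> and \<open>X h\<close> have the same Gram matrix \<open>\<langle>h, X\<^sup>* Y k\<rangle>\<close>. Under the resulting correspondence
  \<open>\<alpha>\<^sub>t(S)\<close> goes to the left action of \<open>u\<^sub>0\<^sup>* S u\<^sub>0\<close> and \<open>u\<^sub>0 k\<close> to \<open>\<iota>\<^sub>t k\<close>.\<close>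

lemma alpha_dilates:
  assumes t: "0 \<le> t" and S: "S \<in> rep.R"
  shows "P t (ocomp H ua (ocomp H S u0)) = ocomp H ua (ocomp H (rep.alpha t S) u0)"
proof (cases "t = 0")
  case True
  then show ?thesis using P_zero[OF compress_M[OF S]] rep.alpha_zero[OF S] by simp
next
  case False
  then have t': "0 < t" using t by simp
  let ?A = "ocomp H ua (ocomp H S u0)"
  note AM = compress_M[OF S] and Sb = rep.R_bop[OF S]
  note al = rep.alpha_bop[OF t S]
  have Xc: "Inr X \<in> ecar (pfib E t)" if "X \<in> inter t" for X using that by (simp add: fibre_pos[OF t'])
  let ?a = "\<lambda>(X, h). X h" and ?b = "\<lambda>(X, h). V t (Inr X) (u0 h)" and ?I = "inter t \<times> hcar H"
  have Vc: "V t (Inr X) (u0 h) \<in> hcar K" if "X \<in> inter t" "h \<in> hcar H" for X h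
    by (rule bop_car[OF rep.V_bop[OF t Xc[OF that(1)]] u0_car[OF that(2)]])
  have ein: "hinner K (V t (Inr X) (u0 h)) (V t (Inr Y) y) = hinner (LS t) (X h) (Y (ua y))"
    if X: "X \<in> inter t" and Y: "Y \<in> inter t" and h: "h \<in> hcar H" and y: "y \<in> hcar K" for X Y h y
  proof -
    let ?e = "ocomp H (hadj H (LS t) X) Y"
    have e: "?e \<in> N" by (rule inter_einner[OF t' X Y])
    have "hinner K (V t (Inr X) (u0 h)) (V t (Inr Y) y) = hinner K (u0 h) (rep.rho ?e y)"
      using rep.V_inner[OF t Xc[OF X] Xc[OF Y] u0_car[OF h] y] by (simp add: fibre_pos[OF t'])
    also have "\<dots> = hinner H h (?e (ua y))"
      unfolding ua_right[OF h bop_car[OF rep.rho_bop[OF e] y], symmetric] ua_rho[OF e y] ..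
    also have "\<dots> = hinner (LS t) (X h) (Y (ua y))"
      using ua_car[OF y] hadj_right[OF H LS_hilbert inter_bop[OF X] h bop_car[OF inter_bop[OF Y] ua_car[OF y]]] by simp
    finally show ?thesis .
  qed
  have unit: "hinner (LS t) (X h) (unt t k) = hinner K (V t (Inr X) (u0 h)) (u0 k)"
    if X: "X \<in> inter t" and h: "h \<in> hcar H" and k: "k \<in> hcar H" for X h k
  proof -
    have "ocomp H ua (ocomp H (V t (Inr X)) u0) = ocomp H (hadj H (LS t) (lim_iota H M P t)) X"
      using V_compress[OF t Xc[OF X]] t' by (simp add: identity_rep_def)
    then have "ocomp H ua (ocomp H (V t (Inr X)) u0) h = ocomp H (hadj H (LS t) (lim_iota H M P t)) X h" by simp
    then have e: "ua (V t (Inr X) (u0 h)) = hadj H (LS t) (lim_iota H M P t) (X h)" using h by simp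
    have "hinner H (ua (V t (Inr X) (u0 h))) k = hinner K (V t (Inr X) (u0 h)) (u0 k)"
      by (rule hadj_left[OF H K_hilbert u0 k Vc[OF X h]])
    moreover have "hinner H (hadj H (LS t) (lim_iota H M P t) (X h)) k = hinner (LS t) (X h) (unt t k)"
      using hadj_left[OF H LS_hilbert lim_iota_bop[OF t'] k bop_car[OF inter_bop[OF X] h]] by (simp add: lim_iota_apply[OF t' k])
    ultimately show ?thesis using e by simp
  qed
  have t0: "0 \<le> t" by (rule t)
  note PA = P_M[OF t0 AM]
  show ?thesis
  proof (rule bop_eqI[OF M_bop[OF PA] compress_bop[OF al]])
    fix k assume k: "k \<in> hcar H"
    note alk = bop_car[OF al u0_car[OF k]]
    have "P t ?A k = ua (rep.alpha t S (u0 k))"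
    proof (rule hilbert_eqI[OF H bop_car[OF M_bop[OF PA] k] ua_car[OF alk]])
      fix h assume h: "h \<in> hcar H"
      have "hinner H h (P t ?A k) = hinner (LS t) (unt t h) (la t ?A (unt t k))"
        by (rule unt_la[OF t' AM h k, symmetric])
      also have "\<dots> = hinner K (u0 h) (rep.alpha t S (u0 k))"
      proof (rule gram_transfer[OF LS_hilbert K_hilbert, where I="?I" and a="?a" and b="?b"
            and A="la t ?A" and B="rep.alpha t S" and ?v1.0="unt t h" and ?v2.0="unt t k"
            and ?v1'.0="u0 h" and ?v2'.0="u0 k"])
        show "?a x \<in> hcar (LS t)" if "x \<in> ?I" for x using that bop_car[OF inter_bop] by auto
        show "?b x \<in> hcar K" if "x \<in> ?I" for x using that Vc by auto
        show "hinner (LS t) (?a x) (?a y) = hinner K (?b x) (?b y)" if "x \<in> ?I" "y \<in> ?I" for x y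
          using that ein u0_car ua_u0 by auto
        show "la t ?A \<in> bop (LS t) (LS t)" by (rule la_bop[OF t' AM])
        show "rep.alpha t S \<in> bop K K" by (rule al)
        show "hinner (LS t) (?a x) (la t ?A (?a y)) = hinner K (?b x) (rep.alpha t S (?b y))"
          if xy: "x \<in> ?I" "y \<in> ?I" for x y
        proof -
          obtain X h Y k where e: "x = (X, h)" "y = (Y, k)" "X \<in> inter t" "Y \<in> inter t" "h \<in> hcar H" "k \<in> hcar H"
            using xy by auto
          have Sk: "S (u0 k) \<in> hcar K" by (rule bop_car[OF Sb u0_car[OF e(6)]])
          have "hinner K (?b x) (rep.alpha t S (?b y)) = hinner (LS t) (X h) (Y (ua (S (u0 k))))"
            using rep.alpha_V[OF t S Xc[OF e(4)] u0_car[OF e(6)]] ein[OF e(3,4,5) Sk] by (simp add: e(1,2))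
          also have "Y (ua (S (u0 k))) = la t ?A (Y k)"
            using inter_la[OF e(4) AM e(6)] e(6) by simp
          finally show ?thesis by (simp add: e(1,2))
        qed
        show "hinner (LS t) (?a x) v = hinner K (?b x) v'"
          if "(v, v') \<in> {(unt t h, u0 h), (unt t k, u0 k)}" "x \<in> ?I" for v v' x
          using that unit h k by auto
        show "unt t h \<in> hcar (LS t)" "unt t k \<in> hcar (LS t)" by (rule unt_car[OF t' h], rule unt_car[OF t' k])
        show "u0 h \<in> hcar K" "u0 k \<in> hcar K" by (rule u0_car[OF h], rule u0_car[OF k])
        show "hnorm (LS t) (unt t h) = hnorm K (u0 h)" "hnorm (LS t) (unt t k) = hnorm K (u0 k)"
          by (simp_all add: hnorm_def unt_inner[OF t'] u0_inner h k)
        show "hinner (LS t) v w = 0" if "v \<in> {unt t h, unt t k}" "w \<in> hcar (LS t)"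
          and o: "\<And>x. x \<in> ?I \<Longrightarrow> hinner (LS t) (?a x) w = 0" for v w
        proof -
          have "hinner (LS t) (X g) w = 0" if "X \<in> inter t" "g \<in> hcar H" for X g using o[of "(X, g)"] that by simp
          then show ?thesis using unt_approximated[OF t' h that(2)] unt_approximated[OF t' k that(2)] that(1) by blast
        qed
      qed
      also have "\<dots> = hinner H h (ua (rep.alpha t S (u0 k)))" by (rule ua_right[OF h alk, symmetric])
      finally show "hinner H h (P t ?A k) = hinner H h (ua (rep.alpha t S (u0 k)))" .
    qed
    then show "P t ?A k = ocomp H ua (ocomp H (rep.alpha t S) u0) k" using k by simp
  qed
qed

end

theorem theorem3p11:
  fixes H :: "'h hspace" and M :: "('h \<Rightarrow> 'h) set"
    and P :: "real \<Rightarrow> ('h \<Rightarrow> 'h) \<Rightarrow> 'h \<Rightarrow> 'h"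
    and K :: "'k hspace" and u0 :: "'h \<Rightarrow> 'k"
    and E :: "('h, 'h fpoint) prodsys"
    and T :: "real \<Rightarrow> 'h fpoint \<Rightarrow> 'h \<Rightarrow> 'h"
    and V :: "real \<Rightarrow> 'h fpoint \<Rightarrow> 'k \<Rightarrow> 'k"
    and \<rho> :: "('h \<Rightarrow> 'h) \<Rightarrow> 'k \<Rightarrow> 'k" and R :: "('k \<Rightarrow> 'k) set"
    and \<alpha> :: "real \<Rightarrow> ('k \<Rightarrow> 'k) \<Rightarrow> 'k \<Rightarrow> 'k"
  assumes H: "hilbert_space H"
    and M: "von_neumann_algebra H M"
    and P: "cp_semigroup H M P"
    and E: "E = cp_prodsys H M P"
    and T: "T = identity_rep H M P"
    and V: "minimal_isometric_dilation H (commutant H M) E H T V u0 K"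
    and \<rho>: "\<rho> = (\<lambda>a. V 0 (pzero E a))"
    and R: "R = commutant K (\<rho> ` commutant H M)"
    and \<alpha>: "\<And>t S. 0 \<le> t \<Longrightarrow> S \<in> R \<Longrightarrow>
        \<alpha> t S = ocomp K (rep_tilde E K V t)
          (ocomp K (rep_id_tensor E K V t S) (hadj (rep_space E K V t) K (rep_tilde E K V t)))"
  shows "(\<lambda>S. ocomp H (hadj H K u0) (ocomp H S u0)) ` R = M
    \<and> (\<forall>t\<ge>0. unital_normal_endomorphism K R (\<alpha> t))
    \<and> (\<forall>S\<in>R. \<alpha> 0 S = S)
    \<and> (\<forall>s\<ge>0. \<forall>t\<ge>0. \<forall>S\<in>R. \<alpha> (s + t) S = \<alpha> s (\<alpha> t S))
    \<and> (\<forall>t\<ge>0. \<forall>S\<in>R.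
         P t (ocomp H (hadj H K u0) (ocomp H S u0)) =
           ocomp H (hadj H K u0) (ocomp H (\<alpha> t S) u0))
    \<and> (\<forall>t\<ge>0. \<forall>A\<in>M.
         P t A =
           ocomp H (hadj H K u0) (ocomp H (\<alpha> t (ocomp K u0 (ocomp K A (hadj H K u0)))) u0))"
proof -
  interpret D: dilation H M P K u0 V
    using H M P V unfolding E T by unfold_locales
  have R': "R = D.rep.R" unfolding R \<rho> E D.rep.R_def D.rep.rho_def[abs_def] ..
  have \<alpha>': "\<alpha> t S = D.rep.alpha t S" if "0 \<le> t" "S \<in> R" for t S
    using \<alpha>[OF that] unfolding E D.rep.alpha_def .
  have aR: "\<alpha> t S \<in> R" if "0 \<le> t" "S \<in> R" for t S
    using D.rep.alpha_R[OF that(1)] that by (simp add: \<alpha>' R')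
  have 1: "(\<lambda>S. ocomp H (hadj H K u0) (ocomp H S u0)) ` R = M"
  proof (intro equalityI subsetI)
    fix A assume "A \<in> M"
    then show "A \<in> (\<lambda>S. ocomp H (hadj H K u0) (ocomp H S u0)) ` R"
      using D.lift_R D.compress_lift by (intro image_eqI[of _ _ "ocomp K u0 (ocomp K A (hadj H K u0))"]) (auto simp: R')
  qed (use D.compress_M in \<open>auto simp: R'\<close>)
  have 2: "unital_normal_endomorphism K R (\<alpha> t)" if t: "0 \<le> t" for t
  proof -
    note Rs = star_algebraD[OF D.rep.R_star_algebra, folded R']
    have "star_hom K R K (\<alpha> t)"
      using D.rep.alpha_star_hom[OF t] Rs
      unfolding star_hom_def op_linear_def R'[symmetric] by (simp add: \<alpha>'[OF t])
    moreover have "normal_map K R K (\<alpha> t)"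
    proof -
      have "topspace (subtopology (sigma_weak K) R) \<subseteq> R" by simp
      then have e: "D.rep.alpha t S = \<alpha> t S" if "S \<in> topspace (subtopology (sigma_weak K) R)" for S
        using \<alpha>'[OF t, of S] that by (metis subsetD)
      show ?thesis
        using D.rep.alpha_normal[OF t] unfolding normal_map_def R'[symmetric]
        by (rule continuous_map_eq[OF _ e])
    qed
    moreover have "\<alpha> t (oid K) = oid K" using D.rep.alpha_oid[OF t] by (simp add: \<alpha>'[OF t] Rs(2))
    ultimately show ?thesis unfolding unital_normal_endomorphism_def using aR[OF t] by simp
  qed
  have 3: "\<alpha> 0 S = S" if "S \<in> R" for S
    using D.rep.alpha_zero that by (simp add: \<alpha>' R')
  have 4: "\<alpha> (s + t) S = \<alpha> s (\<alpha> t S)" if "0 \<le> s" "0 \<le> t" "S \<in> R" for s t S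
  proof -
    have st: "0 \<le> s + t" using that by simp
    show ?thesis
      unfolding \<alpha>'[OF st that(3)] \<alpha>'[OF that(1) aR[OF that(2,3)]]
      unfolding \<alpha>'[OF that(2,3)]
      using D.rep.alpha_semigroup[OF that(1,2)] that(3) by (simp add: R')
  qed
  have 5: "P t (ocomp H (hadj H K u0) (ocomp H S u0)) = ocomp H (hadj H K u0) (ocomp H (\<alpha> t S) u0)"
    if "0 \<le> t" "S \<in> R" for t S
    using D.alpha_dilates[OF that(1)] that(2) unfolding \<alpha>'[OF that] by (simp add: R')
  have 6: "P t A = ocomp H (hadj H K u0) (ocomp H (\<alpha> t (ocomp K u0 (ocomp K A (hadj H K u0)))) u0)"
    if "0 \<le> t" "A \<in> M" for t A
    using 5[OF that(1), of "ocomp K u0 (ocomp K A (hadj H K u0))"] D.lift_R[OF that(2)] D.compress_lift[OF that(2)]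
    by (simp add: R')
  show ?thesis using 1 2 3 4 5 6 by blast
qed

end
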